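(* Fix real numbers $D,T>0$ and $u_0\in L^\infty[0,D]$. Let $a,b\in C^\infty([0,D])$ with $a$ bounded uniformly away from zero and infinity, and let $(\mathscr L\varphi)(x)=\tfrac12a^2(x)\varphi''(x)+b(x)\varphi'(x)$. Let $g:[0,T]\times[0,D]\times\mathbb R\to\mathbb R$ be measurable, and suppose there is a real number $L_g>0$ with $|g(t,x,u)-g(t,x,v)|\le L_g|u-v|$ for all $(t,x)\in[0,T]\times[0,D]$ and $u,v\in\mathbb R$. Let $u$ be the mild solution of $$\frac{\partial}{\partial t}u(t,x)=(\mathscr Lu)(t,x)+g(t,x,u(t,x))+\frac{\partial^2}{\partial t\,\partial x}W(t,x),\qquad (t,x)\in(0,T]\times(0,D),$$ (that is, the noise coefficient is $\sigma\equiv1$) with initial data $u_0$ and either homogeneous Dirichlet, homogeneous Neumann, or periodic boundary conditions on $[0,D]$, where $W$ is a two-parameter Brownian sheet. Let $G$ be the heat kernel of $\mathscr L$ on $[0,D]$ with the same boundary conditions, and set $$\mathcal G_T:=\sup_{x\in[0,D]}\int_0^T\int_0^D[G(t,x,y)]^2\,\mathrm dy\,\mathrm dt<\infty .$$ Then the law $\mathbb P$ of $u$, viewed as a Borel probability measure on $E=C([0,T]\times[0,D])$ with the norm $\|f\|_{\infty,T}=\max_{(t,x)}|f(t,x)|$, belongs to $T_2(C_\infty)$ with $$C_\infty:=2\,\mathcal G_T\,\mathrm e^{2L_g^2T^2}.$$ Explicitly, $\mathcal W_2(\mathbb P,\mathbb Q)\le\sqrt{2C_\infty\,\mathcal H(\mathbb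 Q\mid\mathbb P)}$ for every Borel probability measure $\mathbb Q$ on $E$.
   Context: **Probability space and noise.** $(\Omega,\mathcal F,\{\mathcal F_t\}_{t\in[0,T]},\mathbf P)$ is a filtered probability space. $W=\{W(t,x)\}_{t\in[0,T],x\in[0,D]}$ is a mean-zero Gaussian process with $\mathrm{Cov}[W(t,x),W(s,y)]=(s\wedge t)(x\wedge y)$ (Brownian sheet), so $\partial^2W/(\partial t\,\partial x)$ is space-time white noise. $\mathcal F_t$ is generated by $\{W(s,x):s\in[0,t],x\in[0,D]\}$, made right-continuous and augmented by the null sets; $\mathcal F_T=\mathcal F$. **Boundary conditions** (for all $t\in(0,T)$; prime denotes $\partial/\partial x$): Dirichlet: $u(t,0)=u(t,D)=0$; Neumann: $u'(t,0)=u'(t,D)=0$; periodic: $u(t,0)=u(t,D)$ and $u'(t,0)=u'(t,D)$. **Mild solution** (in the sense of Walsh): $u$ is a predictable random field with, for all $(t,x)$, almost surely, $$u(t,x)=\int_0^DG(t,x,y)u_0(y)\,\mathrm dy+\int_{(0,t)\times(0,D)}G(t-s,x,y)g(s,y,u(s,y))\,\mathrm dy\,\mathrm ds+\int_{(0,t)\times(0,D)}G(t-s,x,y)\,W(\mathrm ds\,\mathrm dy),$$ where $G(t,x,y)$ is the heat kernel (fundamental solution) of $\partial_t=\mathscr L$ on $[0,D]$ with the chosen boundary conditions. Standing assumptions (taken as well known): the equation has a unique predictable mild solution, with $\sup_{t\in[0,T],x\in[0,D]}\mathbb E|u(t,x)|^p<\infty$ for all $p\in[1,\infty)$, and its trajectories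 are continuous, so that its law is a Borel probability measure on $C([0,T]\times[0,D])$; also $\mathcal G_T<\infty$. **Transportation inequality.** For a metric space $(E,\rho)$ and $p\ge1$, $\mathcal W_p(\mathbb Q_1,\mathbb Q_2)=\inf_\pi[\int\rho(x,y)^p\,\pi(\mathrm dx\,\mathrm dy)]^{1/p}$, the infimum over all couplings $\pi$ of $\mathbb Q_1$ and $\mathbb Q_2$. Relative entropy: $\mathcal H(\mathbb Q_2\mid\mathbb Q_1)=\mathbb E^{\mathbb Q_2}[\log(\mathrm d\mathbb Q_2/\mathrm d\mathbb Q_1)]$ if $\mathbb Q_2\ll\mathbb Q_1$, and $=\infty$ otherwise. $\mathbb Q_1\in T_p(C)$ means $\mathcal W_p(\mathbb Q_1,\mathbb Q_2)\le\sqrt{2C\,\mathcal H(\mathbb Q_2\mid\mathbb Q_1)}$ for every Borel probability measure $\mathbb Q_2$ on $E$. *)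

theory Defs
  imports "HOL-Probability.Probability"
begin

definition metric_borel :: "'a metric \<Rightarrow> 'a measure" where
  "metric_borel E = sigma (mspace E) {U. openin (mtopology_of E) U}"

definition borel_prob :: "'a metric \<Rightarrow> 'a measure \<Rightarrow> bool" where
  "borel_prob E Q \<longleftrightarrow> prob_space Q \<and> sets Q = sets (metric_borel E)"

definition couplings :: "'a measure \<Rightarrow> 'a measure \<Rightarrow> ('a \<times> 'a) measure set" where
  "couplings Q\<^sub>1 Q\<^sub>2 =
     {\<pi>. sets \<pi> = sets (Q\<^sub>1 \<Otimes>\<^sub>M Q\<^sub>2) \<and> distr \<pi> Q\<^sub>1 fst = Q\<^sub>1 \<and> distr \<pi> Q\<^sub>2 snd = Q\<^sub>2}"

text \<open>The power function on \<open>[0,\<infinity>]\<close>, for exponents \<open>r > 0\<close>.\<close>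

definition ennreal_powr :: "ennreal \<Rightarrow> real \<Rightarrow> ennreal" where
  "ennreal_powr x r = (if x = \<infinity> then \<infinity> else ennreal (enn2real x powr r))"

definition wasserstein :: "real \<Rightarrow> 'a metric \<Rightarrow> 'a measure \<Rightarrow> 'a measure \<Rightarrow> ennreal" where
  "wasserstein p E Q\<^sub>1 Q\<^sub>2 =
     (INF \<pi>\<in>couplings Q\<^sub>1 Q\<^sub>2.
        ennreal_powr (\<integral>\<^sup>+ (x, y). ennreal (mdist E x y powr p) \<partial>\<pi>) (1 / p))"

text \<open>\<open>rel_entropy Q\<^sub>2 Q\<^sub>1\<close> is \<open>\<H>(Q\<^sub>2 | Q\<^sub>1)\<close>; the library's \<open>KL_divergence\<close> takes the reference measure
  first. The negative part of \<open>log (dQ\<^sub>2/dQ\<^sub>1)\<close> is always \<open>Q\<^sub>2\<close>-integrable, so non-integrability means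
  that the expectation is \<open>\<infinity>\<close>.\<close>

definition rel_entropy :: "'a measure \<Rightarrow> 'a measure \<Rightarrow> ennreal" where
  "rel_entropy Q\<^sub>2 Q\<^sub>1 =
     (if absolutely_continuous Q\<^sub>1 Q\<^sub>2 \<and> integrable Q\<^sub>2 (entropy_density (exp 1) Q\<^sub>1 Q\<^sub>2)
      then ennreal (KL_divergence (exp 1) Q\<^sub>1 Q\<^sub>2) else \<infinity>)"

definition transport_ineq :: "real \<Rightarrow> 'a metric \<Rightarrow> real \<Rightarrow> 'a measure set" where
  "transport_ineq p E C =
     {Q\<^sub>1. borel_prob E Q\<^sub>1 \<and>
        (\<forall>Q\<^sub>2. borel_prob E Q\<^sub>2 \<longrightarrow>
           wasserstein p E Q\<^sub>1 Q\<^sub>2 \<le> ennreal_powr (ennreal (2 * C) * rel_entropy Q\<^sub>2 Q\<^sub>1) (1 / 2))}"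

definition gaussian_rv :: "'w measure \<Rightarrow> ('w \<Rightarrow> real) \<Rightarrow> bool" where
  "gaussian_rv M X \<longleftrightarrow> X \<in> borel_measurable M \<and>
     (\<exists>\<mu>. (AE \<omega> in M. X \<omega> = \<mu>) \<or> (\<exists>\<sigma>>0. distributed M lborel X (normal_density \<mu> \<sigma>)))"

definition gaussian_process :: "'w measure \<Rightarrow> 'i set \<Rightarrow> ('i \<Rightarrow> 'w \<Rightarrow> real) \<Rightarrow> bool" where
  "gaussian_process M I X \<longleftrightarrow>
     (\<forall>S c. finite S \<and> S \<subseteq> I \<longrightarrow> gaussian_rv M (\<lambda>\<omega>. \<Sum>i\<in>S. c i * X i \<omega>))"

definition brownian_sheet ::
  "'w measure \<Rightarrow> real \<Rightarrow> real \<Rightarrow> (real \<Rightarrow> real \<Rightarrow> 'w \<Rightarrow> real) \<Rightarrow> bool" where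
  "brownian_sheet M T D W \<longleftrightarrow>
     gaussian_process M ({0..T} \<times> {0..D}) (\<lambda>(t, x). W t x) \<and>
     (\<forall>t\<in>{0..T}. \<forall>x\<in>{0..D}. prob_space.expectation M (W t x) = 0) \<and>
     (\<forall>t\<in>{0..T}. \<forall>x\<in>{0..D}. \<forall>s\<in>{0..T}. \<forall>y\<in>{0..D}.
        prob_space.expectation M (\<lambda>\<omega>. W t x \<omega> * W s y \<omega>) = min s t * min x y)"

definition augmented_history ::
  "'w measure \<Rightarrow> real \<Rightarrow> (real \<Rightarrow> real \<Rightarrow> 'w \<Rightarrow> real) \<Rightarrow> real \<Rightarrow> 'w set set" where
  "augmented_history M D W t = sigma_sets (space M)
     ({W s x -` B \<inter> space M | s x B. s \<in> {0..t} \<and> x \<in> {0..D} \<and> B \<in> sets borel} \<union>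
      {N. \<exists>A\<in>null_sets M. N \<subseteq> A})"

text \<open>The minimum keeps the time index in \<open>[0,T]\<close>, so that the right limit at \<open>T\<close> is the
  history up to \<open>T\<close> itself.\<close>

definition sheet_filtration ::
  "'w measure \<Rightarrow> real \<Rightarrow> real \<Rightarrow> (real \<Rightarrow> real \<Rightarrow> 'w \<Rightarrow> real) \<Rightarrow> real \<Rightarrow> 'w set set" where
  "sheet_filtration M T D W t = (\<Inter>r\<in>{t<..}. augmented_history M D W (min r T))"

definition predictable_algebra ::
  "'w measure \<Rightarrow> real \<Rightarrow> real \<Rightarrow> (real \<Rightarrow> 'w set set) \<Rightarrow> (real \<times> real \<times> 'w) measure" where
  "predictable_algebra M T D F = sigma ({0..T} \<times> {0..D} \<times> space M)
     ({{0} \<times> B \<times> A | B A. B \<in> sets borel \<and> B \<subseteq> {0..D} \<and> A \<in> F 0} \<union>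
      {{s<..t} \<times> B \<times> A | s t B A.
         0 \<le> s \<and> s \<le> t \<and> t \<le> T \<and> B \<in> sets borel \<and> B \<subseteq> {0..D} \<and> A \<in> F s})"

definition predictable_field ::
  "'w measure \<Rightarrow> real \<Rightarrow> real \<Rightarrow> (real \<Rightarrow> 'w set set) \<Rightarrow> (real \<Rightarrow> real \<Rightarrow> 'w \<Rightarrow> real) \<Rightarrow> bool" where
  "predictable_field M T D F u \<longleftrightarrow>
     (\<lambda>(t, x, \<omega>). u t x \<omega>) \<in> borel_measurable (predictable_algebra M T D F)"

text \<open>An entry \<open>(k, (a, b), (c, d))\<close> of a list stands for \<open>k\<close> times the indicator of the rectangle
  \<open>(a, b] \<times> (c, d]\<close>.\<close>

type_synonym rect_step = "(real \<times> (real \<times> real) \<times> (real \<times> real)) list"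

definition rect_step_in :: "real \<Rightarrow> real \<Rightarrow> rect_step \<Rightarrow> bool" where
  "rect_step_in T D xs \<longleftrightarrow>
     (\<forall>(k, (a, b), (c, d))\<in>set xs. 0 \<le> a \<and> a \<le> b \<and> b \<le> T \<and> 0 \<le> c \<and> c \<le> d \<and> d \<le> D)"

definition rect_step_fun :: "rect_step \<Rightarrow> real \<times> real \<Rightarrow> real" where
  "rect_step_fun xs z = (\<Sum>(k, (a, b), (c, d))\<leftarrow>xs. k * indicator ({a<..b} \<times> {c<..d}) z)"

definition rect_step_integral ::
  "(real \<Rightarrow> real \<Rightarrow> 'w \<Rightarrow> real) \<Rightarrow> rect_step \<Rightarrow> 'w \<Rightarrow> real" where
  "rect_step_integral W xs \<omega> =
     (\<Sum>(k, (a, b), (c, d))\<leftarrow>xs. k * (W b d \<omega> - W a d \<omega> - W b c \<omega> + W a c \<omega>))"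

text \<open>\<open>Z\<close> is (a version of) the Walsh integral \<open>\<integral> f(s,y) W(ds dy)\<close> over \<open>[0,T] \<times> [0,D]\<close> of a deterministic
  integrand \<open>f\<close>: the \<open>L\<^sup>2\<close> limit of the integrals of step functions that converge to \<open>f\<close> in \<open>L\<^sup>2\<close>.
  By the isometry on step functions \<open>Z\<close> is almost surely unique.\<close>

definition walsh_integral ::
  "'w measure \<Rightarrow> real \<Rightarrow> real \<Rightarrow> (real \<Rightarrow> real \<Rightarrow> 'w \<Rightarrow> real) \<Rightarrow> (real \<times> real \<Rightarrow> real) \<Rightarrow>
   ('w \<Rightarrow> real) \<Rightarrow> bool" where
  "walsh_integral M T D W f Z \<longleftrightarrow>
     set_borel_measurable lborel ({0..T} \<times> {0..D}) f \<and> Z \<in> borel_measurable M \<and>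
     (\<exists>xs. (\<forall>n. rect_step_in T D (xs n)) \<and>
        (\<lambda>n. \<integral>\<^sup>+z\<in>{0..T} \<times> {0..D}. ennreal ((f z - rect_step_fun (xs n) z)\<^sup>2) \<partial>lborel)
           \<longlonglongrightarrow> 0 \<and>
        (\<lambda>n. \<integral>\<^sup>+\<omega>. ennreal ((Z \<omega> - rect_step_integral W (xs n) \<omega>)\<^sup>2) \<partial>M) \<longlonglongrightarrow> 0)"

definition C_infinity_on :: "real set \<Rightarrow> (real \<Rightarrow> real) \<Rightarrow> bool" where
  "C_infinity_on S f \<longleftrightarrow>
     (\<exists>F :: nat \<Rightarrow> real \<Rightarrow> real. (\<forall>x\<in>S. F 0 x = f x) \<and>
        (\<forall>n. \<forall>x\<in>S. (F n has_real_derivative F (Suc n) x) (at x within S)))"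

datatype boundary_condition = Dirichlet | Neumann | Periodic

fun satisfies_bc ::
  "boundary_condition \<Rightarrow> real \<Rightarrow> (real \<Rightarrow> real) \<Rightarrow> (real \<Rightarrow> real) \<Rightarrow> bool" where
  "satisfies_bc Dirichlet D f f' \<longleftrightarrow> f 0 = 0 \<and> f D = 0"
| "satisfies_bc Neumann D f f' \<longleftrightarrow> f' 0 = 0 \<and> f' D = 0"
| "satisfies_bc Periodic D f f' \<longleftrightarrow> f 0 = f D \<and> f' 0 = f' D"

text \<open>Fundamental solution of \<open>\<partial>\<^sub>t = \<L>\<close> with \<open>\<L>\<phi> = a\<^sup>2\<phi>''/2 + b\<phi>'\<close> acting on \<open>x\<close>. The initial condition
  \<open>G(0+,x,\<cdot>) = \<delta>\<^sub>x\<close> is tested against continuous functions supported in the open interval. The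
  convergence has to be uniform in \<open>x\<close>: the pointwise limit does not see, for example, \<open>\<partial>\<^sub>z G(t,x,z)\<close>
  for a fixed interior \<open>z\<close>, which tends to \<open>0\<close> at every \<open>x\<close> when the coefficients are constant and
  \<open>b = 0\<close>, and so would not determine \<open>G\<close>.\<close>

definition heat_kernel ::
  "boundary_condition \<Rightarrow> real \<Rightarrow> (real \<Rightarrow> real) \<Rightarrow> (real \<Rightarrow> real) \<Rightarrow>
   (real \<Rightarrow> real \<Rightarrow> real \<Rightarrow> real) \<Rightarrow> bool" where
  "heat_kernel bc D a b G \<longleftrightarrow>
     (\<exists>Gt Gx Gxx.
        continuous_on ({0<..} \<times> {0..D} \<times> {0..D}) (\<lambda>(t, x, y). G t x y) \<and>
        continuous_on ({0<..} \<times> {0..D} \<times> {0..D}) (\<lambda>(t, x, y). Gt t x y) \<and>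
        continuous_on ({0<..} \<times> {0..D} \<times> {0..D}) (\<lambda>(t, x, y). Gx t x y) \<and>
        continuous_on ({0<..} \<times> {0..D} \<times> {0..D}) (\<lambda>(t, x, y). Gxx t x y) \<and>
        (\<forall>t>0. \<forall>x\<in>{0..D}. \<forall>y\<in>{0..D}.
           ((\<lambda>t. G t x y) has_real_derivative Gt t x y) (at t) \<and>
           ((\<lambda>x. G t x y) has_real_derivative Gx t x y) (at x within {0..D}) \<and>
           ((\<lambda>x. Gx t x y) has_real_derivative Gxx t x y) (at x within {0..D})) \<and>
        (\<forall>t>0. \<forall>x\<in>{0<..<D}. \<forall>y\<in>{0..D}.
           Gt t x y = (a x)\<^sup>2 / 2 * Gxx t x y + b x * Gx t x y) \<and>
        (\<forall>t>0. \<forall>y\<in>{0..D}. satisfies_bc bc D (\<lambda>x. G t x y) (\<lambda>x. Gx t x y))) \<and>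
     (\<forall>\<phi>. continuous_on {0..D} \<phi> \<and>
          (\<exists>c d. 0 < c \<and> d < D \<and> (\<forall>y\<in>{0..D} - {c..d}. \<phi> y = 0)) \<longrightarrow>
        uniform_limit {0..D} (\<lambda>t x. LINT y:{0..D}|lborel. G t x y * \<phi> y) \<phi> (at_right 0))"

definition kernel_energy :: "real \<Rightarrow> real \<Rightarrow> (real \<Rightarrow> real \<Rightarrow> real \<Rightarrow> real) \<Rightarrow> ennreal" where
  "kernel_energy T D G =
     (SUP x\<in>{0..D}. \<integral>\<^sup>+t\<in>{0..T}. (\<integral>\<^sup>+y\<in>{0..D}. ennreal ((G t x y)\<^sup>2) \<partial>lborel) \<partial>lborel)"

definition essentially_bounded_on :: "real set \<Rightarrow> (real \<Rightarrow> real) \<Rightarrow> bool" where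
  "essentially_bounded_on S f \<longleftrightarrow>
     f \<in> borel_measurable (lebesgue_on S) \<and> (\<exists>C. AE x in lebesgue_on S. \<bar>f x\<bar> \<le> C)"

text \<open>At \<open>t = 0\<close> the kernel is \<open>\<delta>\<^sub>x\<close> and the equation reads \<open>u(0,x) = u\<^sub>0(x)\<close>, which for \<open>u\<^sub>0 \<in> L\<^sup>\<infinity>\<close> makes sense
  for almost every \<open>x\<close> only. Integrability of the drift term is stated because the Bochner integral
  of a non-integrable function is \<open>0\<close>.\<close>

definition mild_solution ::
  "'w measure \<Rightarrow> real \<Rightarrow> real \<Rightarrow> (real \<Rightarrow> real \<Rightarrow> 'w \<Rightarrow> real) \<Rightarrow> (real \<Rightarrow> real \<Rightarrow> real \<Rightarrow> real) \<Rightarrow>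
   (real \<Rightarrow> real) \<Rightarrow> (real \<Rightarrow> real \<Rightarrow> real \<Rightarrow> real) \<Rightarrow> (real \<Rightarrow> real \<Rightarrow> 'w \<Rightarrow> real) \<Rightarrow> bool" where
  "mild_solution M T D W G u\<^sub>0 g u \<longleftrightarrow>
     predictable_field M T D (sheet_filtration M T D W) u \<and>
     (AE x in lebesgue_on {0..D}. AE \<omega> in M. u 0 x \<omega> = u\<^sub>0 x) \<and>
     (\<forall>t\<in>{0<..T}. \<forall>x\<in>{0..D}. \<exists>Z.
        walsh_integral M T D W
          (\<lambda>(s, y). indicator ({0<..<t} \<times> {0<..<D}) (s, y) * G (t - s) x y) Z \<and>
        (AE \<omega> in M.
           set_integrable lborel ({0<..<t} \<times> {0<..<D})
             (\<lambda>(s, y). G (t - s) x y * g s y (u s y \<omega>)) \<and>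
           u t x \<omega> =
             (LINT y:{0..D}|lebesgue. G t x y * u\<^sub>0 y) +
             (LINT z:{0<..<t} \<times> {0<..<D}|lborel.
                case z of (s, y) \<Rightarrow> G (t - s) x y * g s y (u s y \<omega>)) +
             Z \<omega>))"

definition moments_bounded ::
  "'w measure \<Rightarrow> real \<Rightarrow> real \<Rightarrow> (real \<Rightarrow> real \<Rightarrow> 'w \<Rightarrow> real) \<Rightarrow> bool" where
  "moments_bounded M T D u \<longleftrightarrow>
     (\<forall>p\<ge>1. (SUP (t, x)\<in>{0..T} \<times> {0..D}. \<integral>\<^sup>+\<omega>. ennreal (\<bar>u t x \<omega>\<bar> powr p) \<partial>M) < \<infinity>)"

definition continuous_trajectories ::
  "'w measure \<Rightarrow> real \<Rightarrow> real \<Rightarrow> (real \<Rightarrow> real \<Rightarrow> 'w \<Rightarrow> real) \<Rightarrow> bool" where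
  "continuous_trajectories M T D u \<longleftrightarrow>
     (\<forall>\<omega>\<in>space M. continuous_on ({0..T} \<times> {0..D}) (\<lambda>(t, x). u t x \<omega>))"

text \<open>The space \<open>C([0,T] \<times> [0,D])\<close> with the supremum distance; its elements are \<open>undefined\<close> off the
  rectangle.\<close>

definition path_space :: "real \<Rightarrow> real \<Rightarrow> (real \<times> real \<Rightarrow> real) metric" where
  "path_space T D = cfunspace (top_of_set ({0..T} \<times> {0..D})) euclidean_metric"

definition path_law ::
  "'w measure \<Rightarrow> real \<Rightarrow> real \<Rightarrow> (real \<Rightarrow> real \<Rightarrow> 'w \<Rightarrow> real) \<Rightarrow> (real \<times> real \<Rightarrow> real) measure" where
  "path_law M T D u =
     distr M (metric_borel (path_space T D)) (\<lambda>\<omega>. \<lambda>(t, x)\<in>{0..T} \<times> {0..D}. u t x \<omega>)"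

end

theory Submission
  imports Defs
begin

text \<open>
  The law of \<open>u\<close> is the image of the Gaussian noise \<open>W\<close>, so no stochastic calculus is needed. For a density on the
  noise space that depends on finitely many values of \<open>W\<close>, Knothe's triangular map transports the noise to the tilted
  noise, and it shifts \<open>W\<close> in finitely many Cameron-Martin directions: the mean square of the shift is at most twice the
  entropy. When \<open>W\<close> is shifted by \<open>\<integral>h\<close>, the stochastic convolution moves by \<open>\<integral>G h\<close>, and a Gronwall
  argument, which uses \<open>\<integral>|G(t,x,y)| dy \<le> 1\<close> from the maximum principle, bounds the supremum distance of the two
  solutions by \<open>sqrt (\<G>\<^sub>T \<integral>h\<^sup>2) exp (LT)\<close>. Hence the cost is at most \<open>2 \<G>\<^sub>T exp (2LT)\<close> times the entropy, and
  \<open>exp (2x) \<le> 2 exp (2x\<^sup>2)\<close> for \<open>x = LT\<close>. A general density is approximated in \<open>L\<^sup>1\<close> and in entropy by cylindrical ones; the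
  couplings are then corrected on a set of small mass, which is harmless because the second moments are finite.
\<close>

section \<open>Gaussian transport-entropy inequality\<close>

text \<open>The Cameron-Martin shift is not adapted: its coefficients depend on all the values of
  \<open>W\<close> that enter the density. This does no harm because the shifted solution is
  estimated path by path, where the shift is an ordinary integrand \<open>h\<close>. The obstacle is
  that the stochastic integral and the solution are known up to null sets only, so neither can be
  evaluated directly at a shifted noise. Since the sigma-algebra is generated by the sheet and the
  null sets, both are almost surely measurable functionals of the path of \<open>W\<close>. The
  shifted solution is this functional at the shifted path, and it inherits the mild equation because
  the law of the shifted path has a bounded density with respect to the law of \<open>W\<close>.
  Cylindrical densities are kept between two positive constants: the upper bound carries L2 limits
  over to the shifted noise, and both bounds keep the one-dimensional transport maps and the
  entropies under control. Finiteness of the second moment of the supremum norm is itself derived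
  from the transport bound.\<close>

lemma inverse_sequence_tendsto:
  fixes F :: "nat \<Rightarrow> real \<Rightarrow> real" and H :: "real \<Rightarrow> real"
  assumes mono: "\<And>k. mono (F k)" and sm: "strict_mono H"
    and lim: "\<And>y. (\<lambda>k. F k y) \<longlonglongrightarrow> H y"
    and p: "(\<lambda>k. F k (y k)) \<longlonglongrightarrow> H z"
  shows "y \<longlonglongrightarrow> z"
proof (rule LIMSEQ_I)
  fix r :: real assume r: "r > 0"
  \<comment> \<open>The levels \<open>m1\<close> and \<open>m2\<close> separate \<open>H z\<close>
    from the values of \<open>H\<close> at \<open>z - r/2\<close> and \<open>z + r/2\<close>.
    Pointwise convergence at these two points, with monotonicity of each \<open>F k\<close>, already
    traps \<open>y k\<close>.\<close>
  have "H (z - r/2) < H z" "H z < H (z + r/2)" using sm r by (auto simp: strict_mono_def)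
  then obtain m1 m2 where m: "H (z - r/2) < m1" "m1 < H z" "H z < m2" "m2 < H (z + r/2)"
    by (meson dense)
  have "eventually (\<lambda>k. F k (z - r/2) < m1) sequentially"
    using order_tendstoD(2)[OF lim m(1)] .
  moreover have "eventually (\<lambda>k. m1 < F k (y k)) sequentially" using order_tendstoD(1)[OF p m(2)] .
  moreover have "eventually (\<lambda>k. F k (y k) < m2) sequentially" using order_tendstoD(2)[OF p m(3)] .
  moreover have "eventually (\<lambda>k. m2 < F k (z + r/2)) sequentially" using order_tendstoD(1)[OF lim m(4)] .
  ultimately have "eventually (\<lambda>k. norm (y k - z) < r) sequentially"
  proof eventually_elim
    case (elim k)
    have "F k (z - r/2) < F k (y k)" "F k (y k) < F k (z + r/2)" using elim by linarith+
    then have "z - r/2 < y k" "y k < z + r/2" using monoD[OF mono[of k]] by (meson leD leI)+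
    then show ?case using r by (auto simp: abs_less_iff)
  qed
  then show "\<exists>no. \<forall>n\<ge>no. norm (y n - z) < r" by (simp add: eventually_sequentially)
qed

lemma power2_diff_le: "(a - b)\<^sup>2 \<le> 2 * a\<^sup>2 + 2 * (b::real)\<^sup>2"
proof -
  have "0 \<le> (a + b)\<^sup>2" by simp
  then show ?thesis unfolding power2_sum power2_diff by linarith
qed

section \<open>Densities relative to the standard normal law on the line\<close>

definition gauss_density :: "(real \<Rightarrow> real) \<Rightarrow> real measure" where
  "gauss_density f = density std_normal_distribution (\<lambda>x. ennreal (f x))"

text \<open>The two-sided bounds keep \<open>ln f\<close> bounded, give every interval positive
  mass, and compare the second moment under the density with that of the normal law. More general
  densities are reached later, by truncation and normalisation.\<close>

locale bounded_gauss_density =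
  fixes f :: "real \<Rightarrow> real" and c C :: real
  assumes f_meas [measurable]: "f \<in> borel_measurable borel"
    and c_pos: "0 < c" and f_ge: "\<And>x. c \<le> f x" and f_le: "\<And>x. f x \<le> C"
    and f_int: "(\<integral>x. f x \<partial>std_normal_distribution) = 1"
begin

lemma f_pos: "0 < f x" using c_pos f_ge[of x] by linarith

sublocale N: real_distribution std_normal_distribution by (rule real_dist_normal_dist)

lemma f_integrable: "integrable std_normal_distribution f"
  by (rule N.integrable_const_bound[where B=C]) (auto intro!: AE_I2 simp: f_le f_pos less_imp_le)

lemma real_distribution_gauss_density: "real_distribution (gauss_density f)"
proof -
  have "emeasure (gauss_density f) UNIV = (\<integral>\<^sup>+x. ennreal (f x) \<partial>std_normal_distribution)"
    unfolding gauss_density_def by (subst emeasure_density) (auto)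
  also have "\<dots> = 1"
    using f_integrable f_int f_pos by (subst nn_integral_eq_integral) (auto intro: less_imp_le)
  finally have "prob_space (gauss_density f)"
    by (intro prob_spaceI) (simp add: gauss_density_def)
  then show ?thesis by (auto simp: real_distribution_def real_distribution_axioms_def gauss_density_def)
qed

sublocale Q: real_distribution "gauss_density f" by (rule real_distribution_gauss_density)

lemma gauss_density_Ioc:
  assumes "a < b" shows "0 < measure (gauss_density f) {a<..b}"
proof -
  let ?g = "\<lambda>x. f x * std_normal_density x"
  have "emeasure (gauss_density f) {a<..b} = (\<integral>\<^sup>+x. ennreal (f x) * ennreal (std_normal_density x) * indicator {a<..b} x \<partial>lborel)"
    unfolding gauss_density_def
    by (subst emeasure_density) (auto simp: nn_integral_density mult_ac)
  moreover have "\<dots> \<noteq> 0"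
  proof
    assume "(\<integral>\<^sup>+x. ennreal (f x) * ennreal (std_normal_density x) * indicator {a<..b} x \<partial>lborel) = 0"
    then have "AE x in lborel. ennreal (f x) * ennreal (std_normal_density x) * indicator {a<..b} x = 0"
      by (subst (asm) nn_integral_0_iff_AE) auto
    moreover have "ennreal (f x) * ennreal (std_normal_density x) \<noteq> 0" for x
      using f_pos[of x] normal_density_pos[of 1 0 x] by (simp add: ennreal_eq_0_iff)
    ultimately have "AE x in lborel. x \<notin> {a<..b}"
      by (auto split: split_indicator_asm)
    then have "emeasure lborel {a<..b} = 0" by (subst (asm) AE_iff_measurable[where N="{a<..b}"]) auto
    with assms show False by simp
  qed
  ultimately show ?thesis by (metis Q.emeasure_eq_measure ennreal_0 zero_less_measure_iff)
qed

lemma strict_mono_cdf: "strict_mono (cdf (gauss_density f))"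
proof (rule strict_monoI)
  fix x y :: real assume "x < y"
  then show "cdf (gauss_density f) x < cdf (gauss_density f) y"
    using Q.cdf_diff_eq[of x y] gauss_density_Ioc[of x y] by simp
qed

lemma isCont_cdf_gauss: "isCont (cdf (gauss_density f)) x"
proof -
  have "emeasure (gauss_density f) {x} = (\<integral>\<^sup>+y. ennreal (f y) * ennreal (std_normal_density y) * indicator {x} y \<partial>lborel)"
    unfolding gauss_density_def
    by (subst emeasure_density, simp, simp, subst nn_integral_density) (auto simp: mult_ac)
  also have "\<dots> = 0" by (subst nn_integral_indicator_singleton) auto
  finally show ?thesis by (simp add: Q.isCont_cdf measure_def)
qed

lemma cdf_gauss_pos: "0 < cdf (gauss_density f) x"
  using strict_mono_cdf[unfolded strict_mono_def, rule_format, of "x - 1" x] Q.cdf_nonneg[of "x - 1"] by simp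

lemma cdf_gauss_less_1: "cdf (gauss_density f) x < 1"
  using strict_mono_cdf[unfolded strict_mono_def, rule_format, of x "x+1"] Q.cdf_bounded_prob[of "x + 1"] by simp

lemma cdf_gauss_surj:
  assumes "0 < p" "p < 1" shows "\<exists>y. cdf (gauss_density f) y = p"
proof -
  have "eventually (\<lambda>x. cdf (gauss_density f) x < p) at_bot" using order_tendstoD(2)[OF Q.cdf_lim_at_bot] assms by simp
  then obtain a where a: "cdf (gauss_density f) a < p" by (auto simp: eventually_at_bot_linorder)
  have "eventually (\<lambda>x. cdf (gauss_density f) x > p) at_top" using order_tendstoD(1)[OF Q.cdf_lim_at_top_prob] assms by simp
  then obtain b where b: "cdf (gauss_density f) b > p" by (auto simp: eventually_at_top_linorder)
  have "a \<le> b" using a b Q.cdf_nondecreasing[of b a] by linarith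
  then show ?thesis
    using IVT[of "cdf (gauss_density f)" a p b] a b isCont_cdf_gauss by auto
qed

end

section \<open>Monotone transport from the standard normal law\<close>

lemma bounded_gauss_density_1: "bounded_gauss_density (\<lambda>_. 1) 1 1"
proof -
  interpret N: real_distribution std_normal_distribution by (rule real_dist_normal_dist)
  show ?thesis by unfold_locales (auto simp: N.prob_space[simplified])
qed

lemma gauss_density_1: "gauss_density (\<lambda>_. 1) = std_normal_distribution"
  unfolding gauss_density_def by (simp add: density_1)

text \<open>The increasing rearrangement: the inverse distribution function of the density composed
  with the normal distribution function. The description is proper because the former is strictly
  increasing and attains every value strictly between 0 and 1.\<close>

definition gauss_transport :: "(real \<Rightarrow> real) \<Rightarrow> real \<Rightarrow> real" where
  "gauss_transport f x = (THE y. cdf (gauss_density f) y = cdf std_normal_distribution x)"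

context bounded_gauss_density begin

text \<open>The normal law is itself the density 1, so the facts on distribution functions serve
  both sides of the transport equation.\<close>

interpretation one: bounded_gauss_density "\<lambda>_. 1" 1 1 by (rule bounded_gauss_density_1)

lemma cdf_gauss_transport: "cdf (gauss_density f) (gauss_transport f x) = cdf std_normal_distribution x"
proof -
  obtain y where y: "cdf (gauss_density f) y = cdf std_normal_distribution x"
    using cdf_gauss_surj[of "cdf std_normal_distribution x"] one.cdf_gauss_pos one.cdf_gauss_less_1
    by (auto simp: gauss_density_1)
  show ?thesis unfolding gauss_transport_def
  proof (rule theI)
    show "cdf (gauss_density f) y = cdf std_normal_distribution x" by (rule y)
    show "z = y" if "cdf (gauss_density f) z = cdf std_normal_distribution x" for z
      using that y strict_mono_eq[OF strict_mono_cdf, of z y] by simp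
  qed
qed

text \<open>Sublevel sets of the map are expressed through distribution functions alone.
  Measurability, the law of the image and joint measurability in a parameter all rest on
  this.\<close>

lemma gauss_transport_le_iff: "gauss_transport f x \<le> y \<longleftrightarrow> cdf std_normal_distribution x \<le> cdf (gauss_density f) y"
  using strict_mono_less_eq[OF strict_mono_cdf, of "gauss_transport f x" y] by (simp add: cdf_gauss_transport)

lemma gauss_transport_measurable [measurable]: "gauss_transport f \<in> borel_measurable borel"
proof (rule borel_measurableI_le)
  fix y
  have "cdf std_normal_distribution \<in> borel_measurable borel"
    by (rule borel_measurable_mono) (simp add: mono_def N.cdf_nondecreasing)
  then show "{x\<in>space borel. gauss_transport f x \<le> y} \<in> sets borel"
    by (simp add: gauss_transport_le_iff)
qed

lemma distr_gauss_transport: "distr std_normal_distribution borel (gauss_transport f) = gauss_density f"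
proof (rule cdf_unique)
  have *: "gauss_transport f \<in> measurable std_normal_distribution borel" by simp
  show "real_distribution (distr std_normal_distribution borel (gauss_transport f))"
    by (rule N.real_distribution_distr[OF *])
  show "real_distribution (gauss_density f)" by (rule Q.real_distribution_axioms)
  show "cdf (distr std_normal_distribution borel (gauss_transport f)) = cdf (gauss_density f)"
  proof
    fix y
    \<comment> \<open>The point whose normal mass to the left equals the mass of the density to the
      left of \<open>y\<close>: the sublevel set of the map at \<open>y\<close> is the half line up
      to it.\<close>
    obtain x where x: "cdf std_normal_distribution x = cdf (gauss_density f) y"
      using one.cdf_gauss_surj[of "cdf (gauss_density f) y"] cdf_gauss_pos cdf_gauss_less_1
      by (auto simp: gauss_density_1)
    have "cdf (distr std_normal_distribution borel (gauss_transport f)) y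
        = measure std_normal_distribution {x. gauss_transport f x \<le> y}"
      unfolding cdf_def by (subst measure_distr[OF *]) (auto simp: vimage_def)
    also have "{z. gauss_transport f z \<le> y} = {..x}"
      using strict_mono_less_eq[OF one.strict_mono_cdf] by (auto simp: gauss_transport_le_iff x[symmetric] gauss_density_1)
    finally show "cdf (distr std_normal_distribution borel (gauss_transport f)) y = cdf (gauss_density f) y"
      using x by (simp add: cdf_def)
  qed
qed

lemma isCont_gauss_transport: "isCont (gauss_transport f) x"
proof (rule continuous_at_sequentiallyI)
  fix s assume s: "s \<longlonglongrightarrow> x"
  show "(\<lambda>n. gauss_transport f (s n)) \<longlonglongrightarrow> gauss_transport f x"
  \<comment> \<open>The convergence lemma for inverses with a constant sequence of distribution
    functions; continuity of the normal distribution function passes to the map.\<close>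
  proof (rule inverse_sequence_tendsto[where F="\<lambda>_. cdf (gauss_density f)" and H="cdf (gauss_density f)"])
    show "mono (cdf (gauss_density f))" by (simp add: mono_def Q.cdf_nondecreasing)
    show "(\<lambda>k. cdf (gauss_density f) (gauss_transport f (s k))) \<longlonglongrightarrow> cdf (gauss_density f) (gauss_transport f x)"
      using isCont_tendsto_compose[OF one.isCont_cdf_gauss s] by (simp add: cdf_gauss_transport gauss_density_1)
  qed (auto simp: strict_mono_cdf)
qed

lemma integrable_gauss_transport_sq:
  "integrable std_normal_distribution (\<lambda>x. (gauss_transport f x)\<^sup>2)"
proof -
  have i2: "integrable std_normal_distribution (\<lambda>x. x\<^sup>2)" by (rule integrable_std_normal_distribution_moment)
  have "integrable std_normal_distribution (\<lambda>x. f x * x\<^sup>2)"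
    by (rule Bochner_Integration.integrable_bound[OF integrable_mult_right[OF i2, of C]])
      (auto intro!: AE_I2 mult_right_mono simp: abs_mult f_le f_pos less_imp_le order_trans[OF f_le abs_ge_self])
  then have "integrable (gauss_density f) (\<lambda>x. x\<^sup>2)"
    unfolding gauss_density_def
    by (subst integrable_density) (auto intro!: less_imp_le f_pos)
  then show ?thesis
    unfolding distr_gauss_transport[symmetric] by (subst (asm) integrable_distr_eq) auto
qed

lemma integrable_gauss_transport_diff_sq:
  "integrable std_normal_distribution (\<lambda>x. (gauss_transport f x - x)\<^sup>2)"
proof (rule Bochner_Integration.integrable_bound)
  have i2: "integrable std_normal_distribution (\<lambda>x. x\<^sup>2)" by (rule integrable_std_normal_distribution_moment)
  show "integrable std_normal_distribution (\<lambda>x. 2 * (gauss_transport f x)\<^sup>2 + 2 * x\<^sup>2)"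
    using i2 integrable_gauss_transport_sq by simp
  show "AE x in std_normal_distribution. norm ((gauss_transport f x - x)\<^sup>2) \<le> norm (2 * (gauss_transport f x)\<^sup>2 + 2 * x\<^sup>2)"
    using power2_diff_le by (intro AE_I2) (simp add: order_trans[OF _ abs_ge_self])
qed simp

lemma integral_gauss_density:
  fixes h :: "real \<Rightarrow> real"
  assumes [measurable]: "h \<in> borel_measurable borel"
  shows "(\<integral>x. h x \<partial>gauss_density f) = (\<integral>x. f x * h x \<partial>std_normal_distribution)"
  unfolding gauss_density_def by (subst integral_density) (auto intro!: less_imp_le f_pos)

lemma integral_comp_gauss_transport:
  fixes h :: "real \<Rightarrow> real"
  assumes [measurable]: "h \<in> borel_measurable borel"
  shows "(\<integral>x. h (gauss_transport f x) \<partial>std_normal_distribution) = (\<integral>x. f x * h x \<partial>std_normal_distribution)"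
  using integral_distr[of "gauss_transport f" std_normal_distribution borel h]
  by (simp add: distr_gauss_transport integral_gauss_density)

lemma cdf_gauss_density_eq:
  "cdf (gauss_density f) y = (\<integral>x. f x * indicator {..y} x \<partial>std_normal_distribution)"
  using integral_gauss_density[of "indicator {..y}"] by (simp add: cdf_def)

lemma measure_gauss_density_Ioc:
  assumes "continuous_on UNIV f" "a \<le> b"
  shows "measure (gauss_density f) {a<..b} = integral {a..b} (\<lambda>x. f x * std_normal_density x)"
proof -
  have cont: "continuous_on {a..b} (\<lambda>x. f x * std_normal_density x)"
    unfolding normal_density_def using assms(1)
    by (intro continuous_intros continuous_on_subset[OF assms(1)]) auto
  have "measure (gauss_density f) {a<..b} = (\<integral>x. f x * indicator {a<..b} x \<partial>std_normal_distribution)"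
    using integral_gauss_density[of "indicator {a<..b}"] by simp
  also have "\<dots> = (\<integral>x. std_normal_density x * (f x * indicator {a<..b} x) \<partial>lborel)"
    by (subst integral_density) auto
  also have "\<dots> = (LINT x:{a..b}|lborel. f x * std_normal_density x)"
    unfolding set_lebesgue_integral_def
    by (rule integral_cong_AE) (auto intro!: AE_I'[of "{a}"] split: split_indicator simp: mult_ac)
  also have "\<dots> = integral {a..b} (\<lambda>x. f x * std_normal_density x)"
    by (rule set_borel_integral_eq_integral) (rule borel_integrable_atLeastAtMost'[OF cont])
  finally show ?thesis .
qed

lemma has_derivative_cdf_gauss:
  assumes "continuous_on UNIV f"
  shows "(cdf (gauss_density f) has_real_derivative f y * std_normal_density y) (at y)"
proof -
  let ?g = "\<lambda>x. f x * std_normal_density x"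
  have "continuous_on {y-1..y+1} ?g"
    unfolding normal_density_def
    by (intro continuous_intros continuous_on_subset[OF assms(1)]) auto
  then have "((\<lambda>x. integral {y-1..x} ?g) has_real_derivative ?g y) (at y within {y-1..y+1})"
    by (rule integral_has_real_derivative) auto
  then have "((\<lambda>x. cdf (gauss_density f) (y-1) + integral {y-1..x} ?g) has_real_derivative ?g y) (at y within {y-1..y+1})"
    by (auto intro!: derivative_eq_intros)
  then have "((\<lambda>x. cdf (gauss_density f) (y-1) + integral {y-1..x} ?g) has_real_derivative ?g y) (at y)"
    by (subst (asm) at_within_interior) auto
  then show ?thesis
  proof (rule DERIV_cong_ev[THEN iffD1, rotated -1])
    have "eventually (\<lambda>x. x \<in> {y-1<..}) (nhds y)" by (intro eventually_nhds_in_open) auto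
    then show "\<forall>\<^sub>F x in nhds y. cdf (gauss_density f) (y - 1) + integral {y - 1..x} ?g = cdf (gauss_density f) x"
    proof eventually_elim
      case (elim x)
      then show ?case
        using Q.cdf_diff_eq[of "y-1" x] measure_gauss_density_Ioc[OF assms, of "y-1" x] by simp
    qed
  qed auto
qed

end

section \<open>The transport-entropy bound in dimension one\<close>

lemma has_derivative_cdf_std_normal:
  "(cdf std_normal_distribution has_real_derivative std_normal_density y) (at y)"
  using bounded_gauss_density.has_derivative_cdf_gauss[OF bounded_gauss_density_1, of y] by (simp add: gauss_density_1)

context bounded_gauss_density begin

text \<open>Caratheodory's form of the derivative: the difference quotient of the map is that of the
  normal distribution function divided by the slope \<open>m\<close> at the image point. Continuity
  of the map then suffices to pass to the limit.\<close>

lemma has_derivative_gauss_transport: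
  assumes "continuous_on UNIV f"
  shows "(gauss_transport f has_real_derivative
           std_normal_density x / (f (gauss_transport f x) * std_normal_density (gauss_transport f x))) (at x)"
proof -
  let ?F = "cdf (gauss_density f)" and ?T = "gauss_transport f" and ?P = "cdf std_normal_distribution"
  define d where "d = f (?T x) * std_normal_density (?T x)"
  have d: "d \<noteq> 0" using f_pos[of "?T x"] normal_density_pos[of 1 0 "?T x"] by (simp add: d_def)
  obtain m where m: "\<And>y. ?F y - ?F (?T x) = m y * (y - ?T x)" "isCont m (?T x)" "m (?T x) = d"
    using has_derivative_cdf_gauss[OF assms, of "?T x"] unfolding CARAT_DERIV d_def by blast
  have "((\<lambda>z. m (?T z)) \<longlongrightarrow> d) (at x)"
    using isCont_tendsto_compose[OF m(2), of ?T "at x"] isCont_gauss_transport[of x] m(3) by (simp add: isCont_def)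
  moreover have "((\<lambda>z. (?P z - ?P x) / (z - x)) \<longlongrightarrow> std_normal_density x) (at x)"
    using has_derivative_cdf_std_normal[of x] by (simp add: has_field_derivative_iff)
  ultimately have lim: "((\<lambda>z. ((?P z - ?P x) / (z - x)) / m (?T z)) \<longlongrightarrow> std_normal_density x / d) (at x)"
    using d by (intro tendsto_divide)
  have "eventually (\<lambda>z. m (?T z) \<noteq> 0) (at x)"
    using \<open>((\<lambda>z. m (?T z)) \<longlongrightarrow> d) (at x)\<close> d by (rule tendsto_imp_eventually_ne)
  then have "eventually (\<lambda>z. ((?P z - ?P x) / (z - x)) / m (?T z) = (?T z - ?T x) / (z - x)) (at x)"
  proof eventually_elim
    case (elim z)
    then show ?case using m(1)[of "?T z"] by (simp add: cdf_gauss_transport)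
  qed
  with lim show ?thesis unfolding has_field_derivative_iff d_def by (blast intro: Lim_transform_eventually)
qed

text \<open>Talagrand's argument. The derivative \<open>d\<close> of the map T satisfies \<phi>(x) =
  f(T x) \<phi>(T x) d(x), where \<phi> is the normal density. Taking logarithms and using ln d
  \<le> d - 1 bounds (T x - x)^2/2 - ln f(T x), multiplied by \<phi>(x), by the derivative of (T x -
  x) \<phi>(x), whose integral over long intervals is a vanishing boundary term. Under the map the
  mean of ln f(T x) becomes the entropy.\<close>

lemma transport_entropy_continuous:
  assumes cont: "continuous_on UNIV f"
  shows "(\<integral>x. (gauss_transport f x - x)\<^sup>2 \<partial>std_normal_distribution)
           \<le> 2 * (\<integral>x. f x * ln (f x) \<partial>std_normal_distribution)"
proof -
  let ?T = "gauss_transport f" and ?\<phi> = std_normal_density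
  define d where "d x = ?\<phi> x / (f (?T x) * ?\<phi> (?T x))" for x
  have d_pos: "0 < d x" for x
    using f_pos[of "?T x"] normal_density_pos[of 1 0 "?T x"] normal_density_pos[of 1 0 x] by (simp add: d_def)
  \<comment> \<open>Half the squared displacement minus the pulled-back logarithm of the density;
    the claim is that its normal mean is not positive. \<open>B\<close> is the boundary term of the
    integration by parts.\<close>
  define v where "v x = (1/2 * (?T x - x)\<^sup>2 - ln (f (?T x)))" for x
  define B where "B x = (?T x - x) * ?\<phi> x" for x
  have T': "(?T has_real_derivative d x) (at x)" for x
    using has_derivative_gauss_transport[OF cont, of x] by (simp add: d_def)
  have phi': "(?\<phi> has_real_derivative - x * ?\<phi> x) (at x)" for x
  proof -
    have "((\<lambda>x. k * exp (- x\<^sup>2 / 2)) has_real_derivative - x * (k * exp (- x\<^sup>2 / 2))) (at x)" for k :: real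
      by (auto intro!: derivative_eq_intros simp: power2_eq_square)
    from this[of "1 / sqrt (2 * pi)"] show ?thesis unfolding std_normal_density_def .
  qed
  have B': "(B has_real_derivative (d x - 1) * ?\<phi> x - x * (?T x - x) * ?\<phi> x) (at x)" for x
    unfolding B_def by (auto intro!: derivative_eq_intros T' phi' simp: algebra_simps)
  have le: "v x * ?\<phi> x \<le> (d x - 1) * ?\<phi> x - x * (?T x - x) * ?\<phi> x" for x
  proof -
    have ephi: "?\<phi> x / ?\<phi> (?T x) = exp (((?T x)\<^sup>2 - x\<^sup>2) / 2)"
      by (simp add: std_normal_density_def exp_diff[symmetric] field_simps)
    have "f (?T x) = (?\<phi> x / ?\<phi> (?T x)) / d x"
      using d_pos[of x] f_pos[of "?T x"] normal_density_pos[of 1 0 "?T x"] normal_density_pos[of 1 0 x]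
      by (simp add: d_def field_simps)
    then have "f (?T x) = exp (((?T x)\<^sup>2 - x\<^sup>2) / 2) / d x" using ephi by simp
    then have "ln (f (?T x)) = ((?T x)\<^sup>2 - x\<^sup>2) / 2 - ln (d x)"
      using d_pos[of x] by (simp add: ln_div)
    moreover have "ln (d x) \<le> d x - 1" using ln_le_minus_one[OF d_pos] .
    ultimately have "v x \<le> (d x - 1) - x * (?T x - x)"
      unfolding v_def by (simp add: power2_eq_square algebra_simps add_divide_distrib diff_divide_distrib)
    then have "v x * ?\<phi> x \<le> ((d x - 1) - x * (?T x - x)) * ?\<phi> x"
      by (intro mult_right_mono) auto
    then show ?thesis by (simp add: algebra_simps)
  qed
  have cT: "continuous_on S ?T" for S by (simp add: continuous_at_imp_continuous_on isCont_gauss_transport)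
  have cf: "continuous_on S (\<lambda>x. f (?T x))" for S
    using continuous_on_compose2[OF cont cT] by auto
  have cv: "continuous_on S (\<lambda>x. v x * ?\<phi> x)" for S
    unfolding v_def std_normal_density_def
    by (intro continuous_intros cT cf) (use f_pos in \<open>auto simp: less_imp_neq[THEN not_sym]\<close>)
  have step: "integral {-R..R} (\<lambda>x. v x * ?\<phi> x) \<le> B R - B (-R)" if "R \<ge> 0" for R
  proof -
    have 1: "((\<lambda>x. (d x - 1) * ?\<phi> x - x * (?T x - x) * ?\<phi> x) has_integral (B R - B (-R))) {-R..R}"
      using that by (intro fundamental_theorem_of_calculus)
        (auto simp: has_real_derivative_iff_has_vector_derivative[symmetric] intro: has_field_derivative_at_within[OF B'])
    have 2: "((\<lambda>x. v x * ?\<phi> x) has_integral integral {-R..R} (\<lambda>x. v x * ?\<phi> x)) {-R..R}"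
      by (intro integrable_integral integrable_continuous_interval cv)
    show ?thesis by (rule has_integral_le[OF 2 1]) (rule le)
  qed
  have iT: "integrable std_normal_distribution (\<lambda>x. (?T x - x)\<^sup>2)" by (rule integrable_gauss_transport_diff_sq)
  have ln_bd: "\<bar>ln (f x)\<bar> \<le> \<bar>ln c\<bar> + \<bar>ln C\<bar>" for x
  proof -
    have "ln c \<le> ln (f x)" "ln (f x) \<le> ln C" using c_pos f_ge[of x] f_le[of x] f_pos[of x] by (auto intro!: ln_mono)
    then show ?thesis by linarith
  qed
  have iL: "integrable std_normal_distribution (\<lambda>x. ln (f (?T x)))"
    by (rule N.integrable_const_bound[where B="\<bar>ln c\<bar> + \<bar>ln C\<bar>"]) (auto simp: ln_bd)
  have iv: "integrable std_normal_distribution v" unfolding v_def using iT iL by simp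
  then have ivl: "integrable lborel (\<lambda>x. v x * ?\<phi> x)"
    unfolding v_def by (subst (asm) integrable_density) (auto simp: mult_ac)
  have "integrable std_normal_distribution (\<lambda>x. \<bar>?T x - x\<bar>)"
  proof (rule Bochner_Integration.integrable_bound)
    show "integrable std_normal_distribution (\<lambda>x. 1 + (?T x - x)\<^sup>2)" using iT by simp
    show "AE x in std_normal_distribution. norm \<bar>?T x - x\<bar> \<le> norm (1 + (?T x - x)\<^sup>2)"
    proof (rule AE_I2)
      fix x
      have "0 \<le> (\<bar>?T x - x\<bar> - 1)\<^sup>2" by simp
      then have "2 * \<bar>?T x - x\<bar> \<le> 1 + (?T x - x)\<^sup>2" by (simp add: power2_eq_square algebra_simps)
      then have "\<bar>?T x - x\<bar> \<le> 1 + (?T x - x)\<^sup>2" using abs_ge_zero[of "?T x - x"]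
        by (smt (verit))
      then show "norm \<bar>?T x - x\<bar> \<le> norm (1 + (?T x - x)\<^sup>2)" by simp
    qed
  qed simp
  then have iB: "integrable lborel (\<lambda>x. \<bar>B x\<bar>)"
    unfolding B_def by (subst (asm) integrable_density) (auto simp: mult_ac abs_mult)
  then have iB2: "integrable lborel (\<lambda>x. \<bar>B x\<bar> + \<bar>B (-x)\<bar>)"
    using lborel_integrable_real_affine[OF iB, of "-1" 0] by simp
  \<comment> \<open>\<open>B\<close> is integrable, so its absolute values at \<open>R\<close> and
    \<open>-R\<close> have a small sum for arbitrarily large \<open>R\<close>. The boundary terms
    thus vanish along a sequence, without a pointwise bound on the growth of the map.\<close>
  have ex: "\<exists>R. real n \<le> R \<and> \<bar>B R\<bar> + \<bar>B (-R)\<bar> < 1 / real (Suc n)" for n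
  proof (rule ccontr)
    assume "\<not> ?thesis"
    then have *: "\<And>R. real n \<le> R \<Longrightarrow> 1 / real (Suc n) \<le> \<bar>B R\<bar> + \<bar>B (-R)\<bar>" by force
    have "(\<integral>\<^sup>+x. ennreal (1 / real (Suc n)) * indicator {real n..} x \<partial>lborel) \<le> (\<integral>\<^sup>+x. ennreal (\<bar>B x\<bar> + \<bar>B (-x)\<bar>) \<partial>lborel)"
      using * by (intro nn_integral_mono) (auto split: split_indicator simp del: of_nat_Suc ennreal_plus intro!: ennreal_leI)
    also have "\<dots> < \<infinity>" using iB2 by (simp add: integrable_iff_bounded)
    also have "(\<integral>\<^sup>+x. ennreal (1 / real (Suc n)) * indicator {real n..} x \<partial>lborel) = \<infinity>"
    proof -
      have "ennreal m \<le> emeasure lborel {real n..}" if "0 \<le> m" for m :: real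
        using emeasure_mono[of "{real n..real n + m}" "{real n..}" lborel] that by simp
      then have "emeasure lborel {real n..} = \<infinity>"
        by (metis ennreal_le_of_nat_iff ennreal_of_nat_eq_real_of_nat infinity_ennreal_def of_nat_0_le_iff ennreal_SUP_of_nat_eq_top top.extremum_uniqueI SUP_least)
      then show ?thesis by (subst nn_integral_cmult_indicator) (auto simp: ennreal_mult_top simp del: of_nat_Suc)
    qed
    finally show False by simp
  qed
  then obtain R where R: "\<And>n. real n \<le> R n" "\<And>n. \<bar>B (R n)\<bar> + \<bar>B (- R n)\<bar> < 1 / real (Suc n)" by metis
  have R0: "0 \<le> R n" for n using R(1)[of n] by (meson of_nat_0_le_iff order_trans)
  have "(\<lambda>n. LINT x:{- R n..R n}|lborel. v x * ?\<phi> x) \<longlonglongrightarrow> (\<integral>x. v x * ?\<phi> x \<partial>lborel)"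
    unfolding set_lebesgue_integral_def
  proof (rule integral_dominated_convergence)
    show "integrable lborel (\<lambda>x. \<bar>v x * ?\<phi> x\<bar>)" using ivl by simp
    show "AE x in lborel. (\<lambda>i. indicator {- R i..R i} x *\<^sub>R (v x * ?\<phi> x)) \<longlonglongrightarrow> v x * ?\<phi> x"
    proof (rule AE_I2)
      fix x :: real
      have "eventually (\<lambda>i. \<bar>x\<bar> \<le> real i) sequentially"
        using eventually_ge_at_top[of "nat \<lceil>\<bar>x\<bar>\<rceil>"] by eventually_elim linarith
      then have "eventually (\<lambda>i. indicator {- R i..R i} x *\<^sub>R (v x * ?\<phi> x) = v x * ?\<phi> x) sequentially"
      proof eventually_elim
        case (elim i)
        then have "\<bar>x\<bar> \<le> R i" using R(1)[of i] by linarith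
        then show ?case by (auto split: split_indicator)
      qed
      then show "(\<lambda>i. indicator {- R i..R i} x *\<^sub>R (v x * ?\<phi> x)) \<longlonglongrightarrow> v x * ?\<phi> x" by (rule tendsto_eventually)
    qed
  qed (use ivl in \<open>auto simp: abs_mult split: split_indicator\<close>)
  moreover have "(LINT x:{- R n..R n}|lborel. v x * ?\<phi> x) \<le> 1 / real (Suc n)" for n
  proof -
    have "(LINT x:{- R n..R n}|lborel. v x * ?\<phi> x) = integral {- R n..R n} (\<lambda>x. v x * ?\<phi> x)"
      by (rule set_borel_integral_eq_integral) (rule borel_integrable_atLeastAtMost'[OF cv])
    then show ?thesis using step[OF R0[of n]] R(2)[of n] by linarith
  qed
  ultimately have "(\<integral>x. v x * ?\<phi> x \<partial>lborel) \<le> 0"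
    by (intro LIMSEQ_le[OF _ LIMSEQ_inverse_real_of_nat]) (auto simp: inverse_eq_divide)
  moreover have "(\<integral>x. v x * ?\<phi> x \<partial>lborel) = (\<integral>x. v x \<partial>std_normal_distribution)"
    unfolding v_def by (subst integral_density) (auto simp: mult_ac)
  moreover have "\<dots> = 1/2 * (\<integral>x. (?T x - x)\<^sup>2 \<partial>std_normal_distribution) - (\<integral>x. ln (f (?T x)) \<partial>std_normal_distribution)"
    unfolding v_def using iT iL by simp
  moreover have "(\<integral>x. ln (f (?T x)) \<partial>std_normal_distribution) = (\<integral>x. f x * ln (f x) \<partial>std_normal_distribution)"
    by (rule integral_comp_gauss_transport) simp
  ultimately show ?thesis by linarith
qed

text \<open>A measurable density is an almost everywhere limit of continuous functions, which are
  clipped to \<open>[c, C]\<close> and normalised. Their distribution functions converge at every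
  point, hence so do the maps; Fatou's lemma on the left meets dominated convergence of the
  entropies on the right.\<close>

lemma transport_entropy:
  "(\<integral>\<^sup>+x. ennreal ((gauss_transport f x - x)\<^sup>2) \<partial>std_normal_distribution)
     \<le> ennreal (2 * (\<integral>x. f x * ln (f x) \<partial>std_normal_distribution))"
proof -
  have cC: "c \<le> C" using f_ge[of 0] f_le[of 0] by linarith
  \<comment> \<open>\<open>measurable_on\<close> is by definition the approximation by continuous
    functions off a negligible set.\<close>
  have "f measurable_on UNIV" by (intro lebesgue_measurable_imp_measurable_on measurable_completion) auto
  then obtain Ng g where Ng: "negligible Ng" and g: "\<And>n. continuous_on UNIV (g n)"
    and glim: "\<And>x. x \<notin> Ng \<Longrightarrow> (\<lambda>n. g n x) \<longlonglongrightarrow> f x"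
    unfolding measurable_on_def by auto
  have g_meas [measurable]: "g n \<in> borel_measurable borel" for n
    using g by (rule borel_measurable_continuous_onI)
  have "AE x in lebesgue. x \<notin> Ng" using Ng by (simp add: negligible_iff_null_sets AE_not_in)
  then have "AE x in lborel. x \<notin> Ng" by (simp add: AE_completion_iff)
  then have aeN: "AE x in std_normal_distribution. x \<notin> Ng" by (subst AE_density) auto
  define h where "h n x = max c (min C (g n x))" for n x
  have h_meas [measurable]: "h n \<in> borel_measurable borel" for n unfolding h_def by measurable
  have h_bd: "c \<le> h n x" "h n x \<le> C" for n x using cC by (auto simp: h_def)
  have h_abs: "\<bar>h n x\<bar> \<le> C" for n x using h_bd[of n x] c_pos by linarith
  have hlim: "AE x in std_normal_distribution. (\<lambda>n. h n x) \<longlonglongrightarrow> f x"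
    using aeN
  proof eventually_elim
    case (elim x)
    then have "(\<lambda>n. h n x) \<longlonglongrightarrow> max c (min C (f x))"
      unfolding h_def by (intro tendsto_intros glim)
    then show ?case using f_ge[of x] f_le[of x] by (simp add: max_def min_def split: if_splits)
  qed
  define m where "m n = (\<integral>x. h n x \<partial>std_normal_distribution)" for n
  have hi: "integrable std_normal_distribution (h n)" for n
    by (rule N.integrable_const_bound[where B=C]) (auto simp: h_abs)
  have m_bd: "c \<le> m n" "m n \<le> C" for n
    using N.integral_ge_const[OF hi, of c n] N.integral_le_const[OF hi, of n C] h_bd by (auto simp: m_def)
  have "m \<longlonglongrightarrow> (\<integral>x. f x \<partial>std_normal_distribution)"
    unfolding m_def
    by (rule integral_dominated_convergence[where w="\<lambda>_. C"])
       (auto simp: h_abs hlim)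
  then have m_lim: "m \<longlonglongrightarrow> 1" by (simp only: f_int)
  define k where "k n x = h n x / m n" for n x
  have k_meas [measurable]: "k n \<in> borel_measurable borel" for n unfolding k_def by measurable
  have m_pos: "0 < m n" for n using m_bd(1)[of n] c_pos by linarith
  have C_pos: "0 < C" using cC c_pos by linarith
  \<comment> \<open>The normalising constant lies in \<open>[c, C]\<close> as well, which gives
    bounds uniform in \<open>n\<close>, as dominated convergence requires.\<close>
  have k_bd: "c / C \<le> k n x" "k n x \<le> C / c" for n x
    unfolding k_def using h_bd[of n x] m_bd[of n] c_pos m_pos[of n] C_pos by (auto intro!: frac_le)
  have kD: "bounded_gauss_density (k n) (c / C) (C / c)" for n
  proof
    show "(\<integral>x. k n x \<partial>std_normal_distribution) = 1" using m_pos[of n] by (simp add: k_def m_def[symmetric])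
  qed (use k_bd c_pos C_pos in auto)
  have klim: "AE x in std_normal_distribution. (\<lambda>n. k n x) \<longlonglongrightarrow> f x"
    using hlim
  proof eventually_elim
    case (elim x)
    have "(\<lambda>n. h n x / m n) \<longlonglongrightarrow> f x / 1" by (intro tendsto_divide elim m_lim) simp
    then show ?case by (simp add: k_def)
  qed
  have kpos: "0 < k n x" for n x using bounded_gauss_density.f_pos[OF kD] .
  have kcont: "continuous_on UNIV (k n)" for n
    unfolding k_def h_def using m_pos[of n] by (intro continuous_intros g) auto
  have cdf_lim: "(\<lambda>n. cdf (gauss_density (k n)) y) \<longlonglongrightarrow> cdf (gauss_density f) y" for y
    unfolding bounded_gauss_density.cdf_gauss_density_eq[OF kD] cdf_gauss_density_eq
  proof (rule integral_dominated_convergence[where w="\<lambda>_. C / c"])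
    show "AE x in std_normal_distribution. (\<lambda>n. k n x * indicator {..y} x) \<longlonglongrightarrow> f x * indicator {..y} x"
      using klim by eventually_elim (intro tendsto_intros)
    show "AE x in std_normal_distribution. norm (k n x * indicator {..y} x) \<le> C / c" for n
      using k_bd(2)[of n] kpos[of n] c_pos C_pos by (auto intro!: AE_I2 split: split_indicator simp: abs_of_pos)
  qed auto
  have Tlim: "(\<lambda>n. gauss_transport (k n) x) \<longlonglongrightarrow> gauss_transport f x" for x
  proof (rule inverse_sequence_tendsto[where F="\<lambda>n. cdf (gauss_density (k n))" and H="cdf (gauss_density f)"])
    show "mono (cdf (gauss_density (k n)))" for n
      using bounded_gauss_density.strict_mono_cdf[OF kD] by (rule strict_mono_mono)
    show "(\<lambda>n. cdf (gauss_density (k n)) (gauss_transport (k n) x)) \<longlonglongrightarrow> cdf (gauss_density f) (gauss_transport f x)"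
      by (simp add: bounded_gauss_density.cdf_gauss_transport[OF kD] cdf_gauss_transport)
  qed (auto simp: strict_mono_cdf cdf_lim)
  have ent_lim: "(\<lambda>n. \<integral>x. k n x * ln (k n x) \<partial>std_normal_distribution) \<longlonglongrightarrow> (\<integral>x. f x * ln (f x) \<partial>std_normal_distribution)"
  proof (rule integral_dominated_convergence[where w="\<lambda>_. C / c * ln (C / c)"])
    show "AE x in std_normal_distribution. (\<lambda>n. k n x * ln (k n x)) \<longlonglongrightarrow> f x * ln (f x)"
      using klim by eventually_elim (intro tendsto_intros, use f_pos in \<open>auto simp: less_imp_neq[THEN not_sym]\<close>)
    show "AE x in std_normal_distribution. norm (k n x * ln (k n x)) \<le> C / c * ln (C / c)" for n
    proof (rule AE_I2)
      fix x
      have "ln (c / C) \<le> ln (k n x)" using k_bd(1)[of n x] c_pos C_pos kpos[of n x] by simp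
      moreover have "ln (k n x) \<le> ln (C / c)" using k_bd(2)[of n x] c_pos C_pos kpos[of n x] by simp
      ultimately have "\<bar>ln (k n x)\<bar> \<le> ln (C / c)" using c_pos C_pos by (simp add: ln_div)
      then have "\<bar>k n x\<bar> * \<bar>ln (k n x)\<bar> \<le> C / c * ln (C / c)"
        using k_bd(2)[of n x] kpos[of n x] c_pos C_pos by (intro mult_mono) auto
      then show "norm (k n x * ln (k n x)) \<le> C / c * ln (C / c)" by (simp add: abs_mult)
    qed
  qed auto
  have step: "(\<integral>\<^sup>+x. ennreal ((gauss_transport (k n) x - x)\<^sup>2) \<partial>std_normal_distribution)
      \<le> ennreal (2 * (\<integral>x. k n x * ln (k n x) \<partial>std_normal_distribution))" for n
  proof -
    interpret k: bounded_gauss_density "k n" "c / C" "C / c" by (rule kD)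
    show ?thesis using k.integrable_gauss_transport_diff_sq k.transport_entropy_continuous[OF kcont]
      by (subst nn_integral_eq_integral) (auto intro: ennreal_leI)
  qed
  have "(\<integral>\<^sup>+x. ennreal ((gauss_transport f x - x)\<^sup>2) \<partial>std_normal_distribution)
      = (\<integral>\<^sup>+x. liminf (\<lambda>n. ennreal ((gauss_transport (k n) x - x)\<^sup>2)) \<partial>std_normal_distribution)"
    by (intro nn_integral_cong lim_imp_Liminf[symmetric] tendsto_ennrealI tendsto_intros Tlim) auto
  also have "\<dots> \<le> liminf (\<lambda>n. \<integral>\<^sup>+x. ennreal ((gauss_transport (k n) x - x)\<^sup>2) \<partial>std_normal_distribution)"
    using bounded_gauss_density.gauss_transport_measurable[OF kD] by (intro nn_integral_liminf) auto
  also have "\<dots> \<le> liminf (\<lambda>n. ennreal (2 * (\<integral>x. k n x * ln (k n x) \<partial>std_normal_distribution)))"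
    by (intro Liminf_mono always_eventually allI step)
  also have "\<dots> = ennreal (2 * (\<integral>x. f x * ln (f x) \<partial>std_normal_distribution))"
    by (intro lim_imp_Liminf tendsto_ennrealI tendsto_intros ent_lim) auto
  finally show ?thesis .
qed

end

text \<open>The map is defined implicitly for each parameter separately. Its sublevel sets compare
  two distribution functions, and that of the density depends measurably on the parameter, being the
  integral of a jointly measurable function.\<close>

lemma gauss_transport_measurable_param:
  assumes k [measurable]: "(\<lambda>(\<theta>, x). k \<theta> x) \<in> borel_measurable (M \<Otimes>\<^sub>M borel)"
    and D: "\<And>\<theta>. \<theta> \<in> space M \<Longrightarrow> bounded_gauss_density (k \<theta>) c C"
  shows "(\<lambda>(\<theta>, x). gauss_transport (k \<theta>) x) \<in> borel_measurable (M \<Otimes>\<^sub>M borel)"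
proof (rule borel_measurableI_le)
  fix y :: real
  interpret N: real_distribution std_normal_distribution by (rule real_dist_normal_dist)
  have 1 [measurable]: "cdf std_normal_distribution \<in> borel_measurable borel"
    by (rule borel_measurable_mono) (simp add: mono_def N.cdf_nondecreasing)
  have "(\<lambda>\<theta>. \<integral>x. k \<theta> x * indicator {..y} x \<partial>std_normal_distribution) \<in> borel_measurable M"
    by (rule N.borel_measurable_lebesgue_integral) measurable
  then have 2 [measurable]: "(\<lambda>\<theta>. cdf (gauss_density (k \<theta>)) y) \<in> borel_measurable M"
    by (subst measurable_cong[OF bounded_gauss_density.cdf_gauss_density_eq[OF D]]) auto
  have "{z \<in> space (M \<Otimes>\<^sub>M borel). (case z of (\<theta>, x) \<Rightarrow> gauss_transport (k \<theta>) x) \<le> y}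
     = {z \<in> space (M \<Otimes>\<^sub>M borel). cdf std_normal_distribution (snd z) \<le> cdf (gauss_density (k (fst z))) y}"
    using bounded_gauss_density.gauss_transport_le_iff[OF D] by (auto simp: space_pair_measure)
  also have "\<dots> \<in> sets (M \<Otimes>\<^sub>M borel)" by measurable
  finally show "{z \<in> space (M \<Otimes>\<^sub>M borel). (case z of (\<theta>, x) \<Rightarrow> gauss_transport (k \<theta>) x) \<le> y} \<in> sets (M \<Otimes>\<^sub>M borel)" .
qed

section \<open>Triangular transport on finite products of the normal law\<close>

abbreviation std_gaussian :: "nat \<Rightarrow> (nat \<Rightarrow> real) measure" where
  "std_gaussian n \<equiv> (\<Pi>\<^sub>M i\<in>{..<n}. std_normal_distribution)"

lemma sets_std_gaussian [measurable_cong]: "sets (std_gaussian n) = sets (\<Pi>\<^sub>M i\<in>{..<n}. borel)"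
  by (rule sets_PiM_cong) auto

interpretation std_normal: real_distribution std_normal_distribution by (rule real_dist_normal_dist)

interpretation std_gauss: product_prob_space "\<lambda>_::nat. std_normal_distribution" UNIV
  by unfold_locales

lemma prob_space_std_gaussian: "prob_space (std_gaussian n)"
  by (rule prob_space_PiM) (rule std_normal.prob_space_axioms)

lemma mult_ln_bound:
  fixes c x C :: real
  assumes "0 < c" "c \<le> x" "x \<le> C"
  shows "\<bar>x * ln x\<bar> \<le> C * (\<bar>ln c\<bar> + \<bar>ln C\<bar>)"
proof -
  have "0 < x" using assms by linarith
  then have "ln c \<le> ln x" "ln x \<le> ln C" using assms by auto
  then have "\<bar>ln x\<bar> \<le> \<bar>ln c\<bar> + \<bar>ln C\<bar>" by linarith
  then have "\<bar>x\<bar> * \<bar>ln x\<bar> \<le> C * (\<bar>ln c\<bar> + \<bar>ln C\<bar>)" using assms by (intro mult_mono) auto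
  then show ?thesis by (simp add: abs_mult)
qed

text \<open>Nonnegativity comes from h ln h \<ge> h - 1, which is ln (1/h) \<le> 1/h - 1 multiplied
  by h, and from the mean of h - 1 being zero.\<close>

lemma (in prob_space) entropy_bounded_nonneg:
  fixes h :: "'a \<Rightarrow> real"
  assumes [measurable]: "h \<in> borel_measurable M" and h: "0 < c" "\<And>x. c \<le> h x" "\<And>x. h x \<le> C"
    and 1: "expectation h = 1"
  shows "integrable M h" "integrable M (\<lambda>x. h x * ln (h x))" "0 \<le> expectation (\<lambda>x. h x * ln (h x))"
proof -
  have pos: "0 < h x" for x using h(1) h(2)[of x] by linarith
  have "\<bar>h x\<bar> \<le> C" for x using pos[of x] h(3)[of x] by linarith
  then show ih: "integrable M h" by (intro integrable_const_bound[where B=C]) auto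
  show ie: "integrable M (\<lambda>x. h x * ln (h x))"
    by (rule integrable_const_bound[where B="C * (\<bar>ln c\<bar> + \<bar>ln C\<bar>)"]) (use h in \<open>auto intro!: mult_ln_bound AE_I2\<close>)
  have "0 = expectation (\<lambda>x. h x - 1)" using ih 1 by (simp add: prob_space)
  also have "\<dots> \<le> expectation (\<lambda>x. h x * ln (h x))"
  proof (rule integral_mono)
    fix x
    have "ln (1 / h x) \<le> 1 / h x - 1" using ln_le_minus_one[of "1 / h x"] pos[of x] by simp
    then have "h x * (1 - 1 / h x) \<le> h x * ln (h x)" using pos[of x] by (intro mult_left_mono) (auto simp: ln_div)
    then show "h x - 1 \<le> h x * ln (h x)" using pos[of x] by (simp add: right_diff_distrib)
  qed (use ih ie in auto)
  finally show "0 \<le> expectation (\<lambda>x. h x * ln (h x))" .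
qed

text \<open>The transport map is triangular: the last coordinate is moved by the one-dimensional monotone map
  of the conditional density, evaluated at the image of the other coordinates, and entropy splits accordingly.\<close>

theorem gaussian_transport_entropy:
  fixes F :: "(nat \<Rightarrow> real) \<Rightarrow> real"
  assumes "F \<in> borel_measurable (\<Pi>\<^sub>M i\<in>{..<n}. borel)"
    and "0 < c" "\<And>x. c \<le> F x" "\<And>x. F x \<le> C" "(\<integral>x. F x \<partial>std_gaussian n) = 1"
  shows "\<exists>T. T \<in> measurable (\<Pi>\<^sub>M i\<in>{..<n}. borel) (\<Pi>\<^sub>M i\<in>{..<n}. borel) \<and>
    distr (std_gaussian n) (\<Pi>\<^sub>M i\<in>{..<n}. borel) T = density (std_gaussian n) (\<lambda>x. ennreal (F x)) \<and>
    (\<integral>\<^sup>+x. (\<Sum>i<n. ennreal ((T x i - x i)\<^sup>2)) \<partial>std_gaussian n) \<le> ennreal (2 * (\<integral>x. F x * ln (F x) \<partial>std_gaussian n))"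
  using assms
proof (induction n arbitrary: F)
  case 0
  \<comment> \<open>The product over no coordinates is a single point, where normalisation forces
    the density to be 1; the identity is the transport.\<close>
  have F1: "F (\<lambda>_. undefined) = 1" using 0(5) by (simp add: PiM_empty lebesgue_integral_count_space_finite)
  have "density (std_gaussian 0) (\<lambda>x. ennreal (F x)) = density (std_gaussian 0) (\<lambda>_. 1)"
    using 0(1) by (intro density_cong) (auto simp: PiM_empty F1)
  then have "density (std_gaussian 0) (\<lambda>x. ennreal (F x)) = std_gaussian 0" by (simp add: density_1)
  moreover have "distr (std_gaussian 0) (\<Pi>\<^sub>M i\<in>{..<0}. borel) (\<lambda>x. x) = std_gaussian 0"
    by (rule distr_id2) (rule sets_std_gaussian[symmetric])
  ultimately show ?case by (intro exI[of _ "\<lambda>x. x"]) auto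
next
  case (Suc n)
  note [measurable] = Suc.prems(1)
  let ?P = "\<lambda>n. (\<Pi>\<^sub>M i\<in>{..<n}. borel) :: (nat \<Rightarrow> real) measure" and ?g = std_normal_distribution
  interpret G: prob_space "std_gaussian n" by (rule prob_space_std_gaussian)
  have upd [measurable]: "(\<lambda>(x, y). x(n := y)) \<in> measurable (?P n \<Otimes>\<^sub>M borel) (?P (Suc n))"
    unfolding lessThan_Suc by (rule measurable_add_dim)
  have updx [measurable]: "(\<lambda>y. x(n := y)) \<in> measurable borel (?P (Suc n))" if "x \<in> space (?P n)" for x
    using measurable_compose[OF measurable_Pair1'[OF that] upd] by simp
  have Cc: "c \<le> C" using Suc.prems(3,4)[of undefined] by linarith
  then have Cpos: "0 < C" using Suc.prems(2) by linarith
  have Fpos: "0 < F x" for x using Suc.prems(2) Suc.prems(3)[of x] by linarith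
  have Fabs: "\<bar>F x\<bar> \<le> C" for x using Fpos[of x] Suc.prems(4)[of x] by linarith
  have sp_eq: "space (std_gaussian n) = space (?P n)" for n by (simp add: space_PiM)
  \<comment> \<open>The marginal density of the first \<open>n\<close> coordinates.\<close>
  define f1 where "f1 x = (\<integral>y. F (x(n := y)) \<partial>?g)" for x
  have f1_meas [measurable]: "f1 \<in> borel_measurable (?P n)"
    unfolding f1_def by (rule std_normal.borel_measurable_lebesgue_integral) measurable
  have Fi: "integrable ?g (\<lambda>y. F (x(n := y)))" if "x \<in> space (?P n)" for x
    using that by (intro std_normal.integrable_const_bound[where B=C]) (auto simp: Fabs)
  have f1_bd: "c \<le> f1 x" "f1 x \<le> C" if "x \<in> space (?P n)" for x
    using std_normal.integral_ge_const[OF Fi[OF that], of c] std_normal.integral_le_const[OF Fi[OF that], of C]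
      Suc.prems(3,4) by (auto simp: f1_def)
  have insert_nn: "(\<integral>\<^sup>+z. h z \<partial>std_gaussian (Suc n)) = (\<integral>\<^sup>+x. \<integral>\<^sup>+y. h (x(n := y)) \<partial>?g \<partial>std_gaussian n)"
    if "h \<in> borel_measurable (?P (Suc n))" for h
    unfolding lessThan_Suc using that
    by (intro std_gauss.product_nn_integral_insert) (auto simp: lessThan_Suc[symmetric] cong: measurable_cong_sets)
  have insert_int: "(\<integral>z. h z \<partial>std_gaussian (Suc n)) = (\<integral>x. \<integral>y. h (x(n := y)) \<partial>?g \<partial>std_gaussian n)"
    if "h \<in> borel_measurable (?P (Suc n))" "\<And>x. \<bar>h x\<bar> \<le> B" for h :: "(nat \<Rightarrow> real) \<Rightarrow> real" and B
    unfolding lessThan_Suc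
  proof (intro std_gauss.product_integral_insert)
    interpret G': prob_space "std_gaussian (Suc n)" by (rule prob_space_std_gaussian)
    show "integrable (Pi\<^sub>M (insert n {..<n}) (\<lambda>_. ?g)) h"
      unfolding lessThan_Suc[symmetric] using that by (intro G'.integrable_const_bound[where B=B]) auto
  qed auto
  have sx: "x \<in> space (std_gaussian n) \<Longrightarrow> x \<in> space (?P n)" for x by (simp add: space_PiM)
  \<comment> \<open>Off the product space \<open>f1\<close> need not respect the bounds, whereas the
    induction hypothesis asks for them at every function. Clipping changes nothing on the space
    itself.\<close>
  define f1' where "f1' x = max c (min C (f1 x))" for x
  have f1'_eq: "f1' x = f1 x" if "x \<in> space (?P n)" for x using f1_bd[OF that] by (simp add: f1'_def)
  have f1'_meas [measurable]: "f1' \<in> borel_measurable (?P n)" unfolding f1'_def by measurable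
  have f1'_bd: "c \<le> f1' x" "f1' x \<le> C" for x using Cc by (auto simp: f1'_def)
  have f1'_pos: "0 < f1' x" for x using f1'_bd(1)[of x] Suc.prems(2) by linarith
  have "(\<integral>x. f1' x \<partial>std_gaussian n) = (\<integral>x. f1 x \<partial>std_gaussian n)"
    by (rule Bochner_Integration.integral_cong) (auto simp: f1'_eq sx)
  also have "\<dots> = 1" using insert_int[of F C, OF Suc.prems(1) Fabs] Suc.prems(5) by (simp add: f1_def fun_upd_def)
  finally have f1'_1: "(\<integral>x. f1' x \<partial>std_gaussian n) = 1" .
  from Suc.IH[OF f1'_meas Suc.prems(2) f1'_bd this] obtain T where
    T [measurable]: "T \<in> measurable (?P n) (?P n)" and
    Td: "distr (std_gaussian n) (?P n) T = density (std_gaussian n) (\<lambda>x. ennreal (f1' x))" and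
    Tc: "(\<integral>\<^sup>+x. (\<Sum>i<n. ennreal ((T x i - x i)\<^sup>2)) \<partial>std_gaussian n) \<le> ennreal (2 * (\<integral>x. f1' x * ln (f1' x) \<partial>std_gaussian n))"
    by blast
  have Tsp: "T x \<in> space (?P n)" if "x \<in> space (?P n)" for x using measurable_space[OF T that] .
  have Tint: "(\<integral>\<^sup>+x. h (T x) \<partial>std_gaussian n) = (\<integral>\<^sup>+x. ennreal (f1' x) * h x \<partial>std_gaussian n)"
    if [measurable]: "h \<in> borel_measurable (?P n)" for h
  proof -
    have "(\<integral>\<^sup>+x. h (T x) \<partial>std_gaussian n) = (\<integral>\<^sup>+x. h x \<partial>distr (std_gaussian n) (?P n) T)"
      by (subst nn_integral_distr) auto
    also have "\<dots> = (\<integral>\<^sup>+x. ennreal (f1' x) * h x \<partial>std_gaussian n)"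
      unfolding Td by (subst nn_integral_density) auto
    finally show ?thesis .
  qed
  \<comment> \<open>The density of the last coordinate conditional on the others.\<close>
  define k where "k x y = F (x(n := y)) / f1' x" for x y
  have k_meas [measurable]: "(\<lambda>(x, y). k x y) \<in> borel_measurable (?P n \<Otimes>\<^sub>M borel)"
    unfolding k_def by measurable
  have kD: "bounded_gauss_density (k x) (c / C) (C / c)" if x: "x \<in> space (?P n)" for x
  proof
    show "k x \<in> borel_measurable borel" unfolding k_def using x by measurable
    show "(\<integral>y. k x y \<partial>?g) = 1" using f1'_pos[of x] f1'_eq[OF x] by (simp add: k_def f1_def[symmetric])
    show "c / C \<le> k x y" "k x y \<le> C / c" for y
      unfolding k_def using f1'_bd[of x] f1'_pos[of x] Suc.prems(2) Cpos Suc.prems(3,4) Fpos by (auto intro!: frac_le less_imp_le[OF Fpos])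
  qed (use Cpos Suc.prems(2) in auto)
  have tr_meas [measurable]: "(\<lambda>(x, y). gauss_transport (k x) y) \<in> borel_measurable (?P n \<Otimes>\<^sub>M borel)"
    by (rule gauss_transport_measurable_param[OF k_meas kD])
  \<comment> \<open>The restriction brings a point back to a function that is undefined from
    \<open>n\<close> on, as the smaller product space requires.\<close>
  define T' where "T' z = (T (restrict z {..<n}))(n := gauss_transport (k (T (restrict z {..<n}))) (z n))" for z
  have res [measurable]: "(\<lambda>z. restrict z {..<n}) \<in> measurable (?P (Suc n)) (?P n)"
    by (rule measurable_restrict_subset) auto
  have cn [measurable]: "(\<lambda>z. z n) \<in> borel_measurable (?P (Suc n))" by (rule measurable_component_singleton) auto
  have T'_meas: "T' \<in> measurable (?P (Suc n)) (?P (Suc n))"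
  proof -
    have "(\<lambda>z. (T (restrict z {..<n}), gauss_transport (k (T (restrict z {..<n}))) (z n))) \<in> measurable (?P (Suc n)) (?P n \<Otimes>\<^sub>M borel)"
      by measurable
    from measurable_compose[OF this upd] show ?thesis by (simp add: T'_def[abs_def])
  qed
  have T'_eq: "T' (x(n := y)) = (T x)(n := gauss_transport (k (T x)) y)" if "x \<in> space (?P n)" for x y
  proof -
    have "restrict (x(n := y)) {..<n} = x" using that by (auto simp: space_PiM PiE_def extensional_def restrict_def fun_eq_iff)
    then show ?thesis by (simp add: T'_def)
  qed
  show ?case
  proof (intro exI[of _ T'] conjI T'_meas)
    show "distr (std_gaussian (Suc n)) (?P (Suc n)) T' = density (std_gaussian (Suc n)) (\<lambda>x. ennreal (F x))"
    proof (rule measure_eqI)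
      show "sets (distr (std_gaussian (Suc n)) (?P (Suc n)) T') = sets (density (std_gaussian (Suc n)) (\<lambda>x. ennreal (F x)))"
        by (simp add: sets_std_gaussian)
      fix A assume "A \<in> sets (distr (std_gaussian (Suc n)) (?P (Suc n)) T')"
      then have A [measurable]: "A \<in> sets (?P (Suc n))" by simp
      have "emeasure (distr (std_gaussian (Suc n)) (?P (Suc n)) T') A = (\<integral>\<^sup>+z. indicator A z \<partial>distr (std_gaussian (Suc n)) (?P (Suc n)) T')"
        by simp
      also have "\<dots> = (\<integral>\<^sup>+z. indicator A (T' z) \<partial>std_gaussian (Suc n))"
        using T'_meas by (subst nn_integral_distr) auto
      also have "\<dots> = (\<integral>\<^sup>+x. \<integral>\<^sup>+y. indicator A (T' (x(n := y))) \<partial>?g \<partial>std_gaussian n)"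
        using T'_meas by (subst insert_nn) auto
      also have "\<dots> = (\<integral>\<^sup>+x. \<integral>\<^sup>+y. ennreal (k (T x) y) * indicator A ((T x)(n := y)) \<partial>?g \<partial>std_gaussian n)"
      proof (rule nn_integral_cong)
        fix x assume "x \<in> space (std_gaussian n)"
        then have x: "x \<in> space (?P n)" by (rule sx)
        then have Tx: "T x \<in> space (?P n)" by (rule Tsp)
        interpret k: bounded_gauss_density "k (T x)" "c / C" "C / c" by (rule kD[OF Tx])
        have [measurable]: "(\<lambda>y. indicator A ((T x)(n := y)) :: ennreal) \<in> borel_measurable borel"
          using Tx by measurable
        have "(\<integral>\<^sup>+y. indicator A (T' (x(n := y))) \<partial>?g) = (\<integral>\<^sup>+y. indicator A ((T x)(n := gauss_transport (k (T x)) y)) \<partial>?g)"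
          by (simp add: T'_eq[OF x])
        also have "\<dots> = (\<integral>\<^sup>+y. indicator A ((T x)(n := y)) \<partial>distr ?g borel (gauss_transport (k (T x))))"
          by (subst nn_integral_distr) auto
        also have "\<dots> = (\<integral>\<^sup>+y. ennreal (k (T x) y) * indicator A ((T x)(n := y)) \<partial>?g)"
          unfolding k.distr_gauss_transport unfolding gauss_density_def by (subst nn_integral_density) auto
        finally show "(\<integral>\<^sup>+y. indicator A (T' (x(n := y))) \<partial>?g) = (\<integral>\<^sup>+y. ennreal (k (T x) y) * indicator A ((T x)(n := y)) \<partial>?g)" .
      qed
      \<comment> \<open>The induction hypothesis replaces \<open>T x\<close> by a point with density
        \<open>f1'\<close>, and \<open>f1'\<close> times the conditional density is
        \<open>F\<close>.\<close>
      also have "\<dots> = (\<integral>\<^sup>+x. ennreal (f1' x) * (\<integral>\<^sup>+y. ennreal (k x y) * indicator A (x(n := y)) \<partial>?g) \<partial>std_gaussian n)"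
        by (rule Tint, rule std_normal.borel_measurable_nn_integral) measurable
      also have "\<dots> = (\<integral>\<^sup>+x. \<integral>\<^sup>+y. ennreal (F (x(n := y))) * indicator A (x(n := y)) \<partial>?g \<partial>std_gaussian n)"
      proof (rule nn_integral_cong)
        fix x assume "x \<in> space (std_gaussian n)"
        then have x: "x \<in> space (?P n)" by (rule sx)
        have m1: "(\<lambda>y. indicator A (x(n := y)) :: ennreal) \<in> borel_measurable borel"
          using x by measurable
        have m2: "k x \<in> borel_measurable borel" by (rule bounded_gauss_density.f_meas[OF kD[OF x]])
        have m: "(\<lambda>y. ennreal (k x y) * indicator A (x(n := y))) \<in> borel_measurable std_normal_distribution"
          using m1 measurable_compose[OF m2 measurable_ennreal] by simp
        show "ennreal (f1' x) * (\<integral>\<^sup>+y. ennreal (k x y) * indicator A (x(n := y)) \<partial>?g) = (\<integral>\<^sup>+y. ennreal (F (x(n := y))) * indicator A (x(n := y)) \<partial>?g)"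
          unfolding nn_integral_cmult[OF m, symmetric] using f1'_pos[of x] Fpos
          by (intro nn_integral_cong) (auto simp: k_def mult.assoc[symmetric] ennreal_mult[symmetric] less_imp_le)
      qed
      also have "\<dots> = (\<integral>\<^sup>+z. ennreal (F z) * indicator A z \<partial>std_gaussian (Suc n))"
        by (subst insert_nn) auto
      also have "\<dots> = emeasure (density (std_gaussian (Suc n)) (\<lambda>x. ennreal (F x))) A"
        by (subst emeasure_density) auto
      finally show "emeasure (distr (std_gaussian (Suc n)) (?P (Suc n)) T') A = emeasure (density (std_gaussian (Suc n)) (\<lambda>x. ennreal (F x))) A" .
    qed
    define E where "E x = (\<integral>y. k x y * ln (k x y) \<partial>?g)" for x
    have E_meas [measurable]: "E \<in> borel_measurable (?P n)"
      unfolding E_def by (rule std_normal.borel_measurable_lebesgue_integral) measurable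
    have Enn: "0 \<le> E x" if "x \<in> space (?P n)" for x
    proof -
      interpret k: bounded_gauss_density "k x" "c / C" "C / c" by (rule kD[OF that])
      show ?thesis unfolding E_def
        by (rule std_normal.entropy_bounded_nonneg(3)) (use k.f_ge k.f_le k.f_int k.c_pos in auto)
    qed
    \<comment> \<open>Chain rule for the entropy with the other coordinates fixed: ln F is the sum
      of ln f1' and ln k, and \<open>k\<close> has mean 1.\<close>
    have ent: "(\<integral>y. F (x(n := y)) * ln (F (x(n := y))) \<partial>?g) = f1' x * ln (f1' x) + f1' x * E x" if x: "x \<in> space (?P n)" for x
    proof -
      interpret k: bounded_gauss_density "k x" "c / C" "C / c" by (rule kD[OF x])
      have "(\<integral>y. F (x(n := y)) * ln (F (x(n := y))) \<partial>?g) = (\<integral>y. f1' x * ln (f1' x) * k x y + f1' x * (k x y * ln (k x y)) \<partial>?g)"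
      proof (rule Bochner_Integration.integral_cong[OF refl])
        fix y
        have F: "F (x(n := y)) = f1' x * k x y" using f1'_pos[of x] by (simp add: k_def)
        show "F (x(n := y)) * ln (F (x(n := y))) = f1' x * ln (f1' x) * k x y + f1' x * (k x y * ln (k x y))"
          unfolding F using f1'_pos[of x] k.f_pos[of y] by (simp add: ln_mult algebra_simps)
      qed
      also have "\<dots> = f1' x * ln (f1' x) + f1' x * E x"
        using k.f_int std_normal.entropy_bounded_nonneg(1,2)[of "k x" "c / C" "C / c"] k.f_ge k.f_le k.c_pos
        by (simp add: E_def)
      finally show ?thesis .
    qed
    have Eabs: "\<bar>f1' x * E x\<bar> \<le> 2 * (C * (\<bar>ln c\<bar> + \<bar>ln C\<bar>))" if x: "x \<in> space (?P n)" for x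
    proof -
      have "\<bar>\<integral>y. F (x(n := y)) * ln (F (x(n := y))) \<partial>?g\<bar> \<le> C * (\<bar>ln c\<bar> + \<bar>ln C\<bar>)"
      proof -
        have b: "\<bar>F (x(n := y)) * ln (F (x(n := y)))\<bar> \<le> C * (\<bar>ln c\<bar> + \<bar>ln C\<bar>)" for y
          by (rule mult_ln_bound[OF Suc.prems(2,3,4)])
        have i: "integrable ?g (\<lambda>y. F (x(n := y)) * ln (F (x(n := y))))"
          by (rule std_normal.integrable_const_bound[where B="C * (\<bar>ln c\<bar> + \<bar>ln C\<bar>)"]) (use b x in auto)
        have "\<bar>\<integral>y. F (x(n := y)) * ln (F (x(n := y))) \<partial>?g\<bar> \<le> (\<integral>y. \<bar>F (x(n := y)) * ln (F (x(n := y)))\<bar> \<partial>?g)"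
          by (rule integral_abs_bound)
        also have "\<dots> \<le> C * (\<bar>ln c\<bar> + \<bar>ln C\<bar>)"
          using i b by (intro std_normal.integral_le_const) auto
        finally show ?thesis .
      qed
      moreover have "\<bar>f1' x * ln (f1' x)\<bar> \<le> C * (\<bar>ln c\<bar> + \<bar>ln C\<bar>)" by (rule mult_ln_bound[OF Suc.prems(2) f1'_bd])
      ultimately show ?thesis using ent[OF x] by linarith
    qed
    have fEi: "integrable (std_gaussian n) (\<lambda>x. f1' x * E x)"
      using Eabs sx by (intro G.integrable_const_bound[where B="2 * (C * (\<bar>ln c\<bar> + \<bar>ln C\<bar>))"]) auto
    note f1e = G.entropy_bounded_nonneg[of f1' c C]
    have f1e': "integrable (std_gaussian n) (\<lambda>x. f1' x * ln (f1' x))" "0 \<le> (\<integral>x. f1' x * ln (f1' x) \<partial>std_gaussian n)"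
      using f1e(2,3) Suc.prems(2) f1'_bd f1'_1 by auto
    have total: "(\<integral>z. F z * ln (F z) \<partial>std_gaussian (Suc n)) = (\<integral>x. f1' x * ln (f1' x) \<partial>std_gaussian n) + (\<integral>x. f1' x * E x \<partial>std_gaussian n)"
    proof -
      have "(\<integral>z. F z * ln (F z) \<partial>std_gaussian (Suc n)) = (\<integral>x. \<integral>y. F (x(n := y)) * ln (F (x(n := y))) \<partial>?g \<partial>std_gaussian n)"
        by (rule insert_int[of "\<lambda>z. F z * ln (F z)" "C * (\<bar>ln c\<bar> + \<bar>ln C\<bar>)"]) (auto intro!: mult_ln_bound[OF Suc.prems(2,3,4)])
      also have "\<dots> = (\<integral>x. f1' x * ln (f1' x) + f1' x * E x \<partial>std_gaussian n)"
        by (rule Bochner_Integration.integral_cong) (auto simp: ent sx)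
      also have "\<dots> = (\<integral>x. f1' x * ln (f1' x) \<partial>std_gaussian n) + (\<integral>x. f1' x * E x \<partial>std_gaussian n)"
        using f1e'(1) fEi by simp
      finally show ?thesis .
    qed
    have Ti: "(\<lambda>z. T z i) \<in> borel_measurable (?P n)" if "i < n" for i
      using measurable_compose[OF T measurable_component_singleton[of i "{..<n}"]] that by simp
    have T'i: "(\<lambda>z. T' z i) \<in> borel_measurable (?P (Suc n))" if "i < Suc n" for i
      using measurable_compose[OF T'_meas measurable_component_singleton[of i "{..<Suc n}"]] that by simp
    have zi: "(\<lambda>z. z i) \<in> borel_measurable (?P m)" if "i < m" for i m
      using measurable_component_singleton[of i "{..<m}"] that by simp
    have "(\<integral>\<^sup>+z. (\<Sum>i<Suc n. ennreal ((T' z i - z i)\<^sup>2)) \<partial>std_gaussian (Suc n))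
       = (\<integral>\<^sup>+x. \<integral>\<^sup>+y. (\<Sum>i<Suc n. ennreal ((T' (x(n := y)) i - (x(n := y)) i)\<^sup>2)) \<partial>?g \<partial>std_gaussian n)"
      using T'i zi by (subst insert_nn) (auto intro!: borel_measurable_sum measurable_compose[OF _ measurable_ennreal] borel_measurable_power borel_measurable_diff)
    \<comment> \<open>Only the last coordinate meets the one-dimensional bound, for the conditional
      density at the image point. The entropies \<open>E (T x)\<close> are averaged below by the
      change of variables that \<open>T\<close> provides.\<close>
    also have "\<dots> \<le> (\<integral>\<^sup>+x. (\<Sum>i<n. ennreal ((T x i - x i)\<^sup>2)) + ennreal (2 * E (T x)) \<partial>std_gaussian n)"
    proof (rule nn_integral_mono)
      fix x assume "x \<in> space (std_gaussian n)"
      then have x: "x \<in> space (?P n)" by (rule sx)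
      then have Tx: "T x \<in> space (?P n)" by (rule Tsp)
      interpret k: bounded_gauss_density "k (T x)" "c / C" "C / c" by (rule kD[OF Tx])
      have "(\<integral>\<^sup>+y. (\<Sum>i<Suc n. ennreal ((T' (x(n := y)) i - (x(n := y)) i)\<^sup>2)) \<partial>?g)
          = (\<integral>\<^sup>+y. (\<Sum>i<n. ennreal ((T x i - x i)\<^sup>2)) + ennreal ((gauss_transport (k (T x)) y - y)\<^sup>2) \<partial>?g)"
        by (simp add: T'_eq[OF x])
      also have "\<dots> = (\<Sum>i<n. ennreal ((T x i - x i)\<^sup>2)) + (\<integral>\<^sup>+y. ennreal ((gauss_transport (k (T x)) y - y)\<^sup>2) \<partial>?g)"
        by (subst nn_integral_add) (auto simp: std_normal.emeasure_space_1[simplified])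
      also have "\<dots> \<le> (\<Sum>i<n. ennreal ((T x i - x i)\<^sup>2)) + ennreal (2 * E (T x))"
        unfolding E_def by (intro add_left_mono k.transport_entropy)
      finally show "(\<integral>\<^sup>+y. (\<Sum>i<Suc n. ennreal ((T' (x(n := y)) i - (x(n := y)) i)\<^sup>2)) \<partial>?g) \<le> (\<Sum>i<n. ennreal ((T x i - x i)\<^sup>2)) + ennreal (2 * E (T x))" .
    qed
    also have "\<dots> = (\<integral>\<^sup>+x. (\<Sum>i<n. ennreal ((T x i - x i)\<^sup>2)) \<partial>std_gaussian n) + (\<integral>\<^sup>+x. ennreal (2 * E (T x)) \<partial>std_gaussian n)"
      using Ti zi[unfolded measurable_cong_sets[OF sets_std_gaussian[symmetric] refl]] by (intro nn_integral_add) (auto intro!: borel_measurable_sum measurable_compose[OF _ measurable_ennreal] borel_measurable_power borel_measurable_diff)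
    also have "\<dots> \<le> ennreal (2 * (\<integral>x. f1' x * ln (f1' x) \<partial>std_gaussian n)) + (\<integral>\<^sup>+x. ennreal (2 * E (T x)) \<partial>std_gaussian n)"
      by (intro add_right_mono Tc)
    also have "(\<integral>\<^sup>+x. ennreal (2 * E (T x)) \<partial>std_gaussian n) = (\<integral>\<^sup>+x. ennreal (f1' x) * ennreal (2 * E x) \<partial>std_gaussian n)"
      by (rule Tint) measurable
    also have "\<dots> = (\<integral>\<^sup>+x. ennreal (2 * (f1' x * E x)) \<partial>std_gaussian n)"
      by (intro nn_integral_cong) (simp add: ennreal_mult[symmetric] Enn sx f1'_pos less_imp_le mult_ac)
    also have "\<dots> = ennreal (2 * (\<integral>x. f1' x * E x \<partial>std_gaussian n))"
      using fEi by (subst nn_integral_eq_integral) (auto intro!: AE_I2 mult_nonneg_nonneg simp: Enn sx f1'_pos less_imp_le)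
    also have "ennreal (2 * (\<integral>x. f1' x * ln (f1' x) \<partial>std_gaussian n)) + ennreal (2 * (\<integral>x. f1' x * E x \<partial>std_gaussian n))
       = ennreal (2 * (\<integral>z. F z * ln (F z) \<partial>std_gaussian (Suc n)))"
    proof (subst ennreal_plus[symmetric])
      show "0 \<le> 2 * (\<integral>x. f1' x * E x \<partial>std_gaussian n)"
        by (auto intro!: Bochner_Integration.integral_nonneg mult_nonneg_nonneg simp: Enn sx f1'_pos less_imp_le)
    qed (use f1e' in \<open>auto simp: total algebra_simps\<close>)
    finally show "(\<integral>\<^sup>+z. (\<Sum>i<Suc n. ennreal ((T' z i - z i)\<^sup>2)) \<partial>std_gaussian (Suc n)) \<le> ennreal (2 * (\<integral>z. F z * ln (F z) \<partial>std_gaussian (Suc n)))" .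
  qed
qed

section \<open>Characteristic functions\<close>

lemma (in prob_space) integrable_bounded_iexp:
  fixes Y :: "'a \<Rightarrow> real"
  assumes [measurable]: "X \<in> borel_measurable M" "Y \<in> borel_measurable M" and Y: "\<And>x. \<bar>Y x\<bar> \<le> B"
  shows "integrable M (\<lambda>x. complex_of_real (Y x) * iexp (X x))"
  by (rule integrable_const_bound[where B=B]) (use Y in \<open>auto simp: norm_mult\<close>)

text \<open>At t = 0 the hypothesis says that both weights have the same mass \<open>m\<close>.
  Division by it makes them probability densities, and the claim becomes Levy's uniqueness theorem.
  Mass zero is treated apart, since both sides then vanish.\<close>

lemma weighted_char_unique:
  fixes X :: "'a \<Rightarrow> real" and X' :: "'b \<Rightarrow> real"
  assumes M: "prob_space M" and N: "prob_space N"
    and [measurable]: "X \<in> borel_measurable M" "Y \<in> borel_measurable M" "X' \<in> borel_measurable N" "Y' \<in> borel_measurable N"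
    and Y: "\<And>x. 0 \<le> Y x" "\<And>x. Y x \<le> B" and Y': "\<And>x. 0 \<le> Y' x" "\<And>x. Y' x \<le> B"
    and eq: "\<And>t. (\<integral>x. complex_of_real (Y x) * iexp (t * X x) \<partial>M) = (\<integral>x. complex_of_real (Y' x) * iexp (t * X' x) \<partial>N)"
    and S: "S \<in> sets borel"
  shows "(\<integral>x. Y x * indicator S (X x) \<partial>M) = (\<integral>x. Y' x * indicator S (X' x) \<partial>N)"
proof -
  interpret M: prob_space M by fact
  interpret N: prob_space N by fact
  have iY: "integrable M Y" by (rule M.integrable_const_bound[where B=B]) (use Y in auto)
  have iY': "integrable N Y'" by (rule N.integrable_const_bound[where B=B]) (use Y' in auto)
  define m where "m = (\<integral>x. Y x \<partial>M)"
  have m': "m = (\<integral>x. Y' x \<partial>N)"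
    using eq[of 0] by (simp add: m_def of_real_eq_iff)
  have m0: "0 \<le> m" unfolding m_def by (rule Bochner_Integration.integral_nonneg) (use Y in auto)
  show ?thesis
  proof (cases "m = 0")
    case True
    have "AE x in M. Y x = 0" using iY Y True by (subst integral_nonneg_eq_0_iff_AE[symmetric]) (auto simp: m_def)
    then have "(\<integral>x. Y x * indicator S (X x) \<partial>M) = (\<integral>x. 0 \<partial>M)" using S by (intro integral_cong_AE) auto
    moreover have "AE x in N. Y' x = 0" using iY' Y' True by (subst integral_nonneg_eq_0_iff_AE[symmetric]) (auto simp: m')
    then have "(\<integral>x. Y' x * indicator S (X' x) \<partial>N) = (\<integral>x. 0 \<partial>N)" using S by (intro integral_cong_AE) auto
    ultimately show ?thesis by simp
  next
    case False
    with m0 have m: "0 < m" by simp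
    \<comment> \<open>Stated for an arbitrary space, so that it serves both sides of the
      claim.\<close>
    have aux: "real_distribution (distr (density K (\<lambda>x. ennreal (Z x / m))) borel V) \<and>
      (\<forall>t. char (distr (density K (\<lambda>x. ennreal (Z x / m))) borel V) t = (\<integral>x. complex_of_real (Z x) * iexp (t * V x) \<partial>K) / m) \<and>
      measure (distr (density K (\<lambda>x. ennreal (Z x / m))) borel V) S = (\<integral>x. Z x * indicator S (V x) \<partial>K) / m"
      if "prob_space K" and [measurable]: "V \<in> borel_measurable K" "Z \<in> borel_measurable K" and Z: "\<And>x. 0 \<le> Z x" "\<And>x. Z x \<le> B" "(\<integral>x. Z x \<partial>K) = m"
      for K :: "'c measure" and Z V
    proof -
      interpret K: prob_space K by fact
      have iZ: "integrable K Z" by (rule K.integrable_const_bound[where B=B]) (use Z in auto)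
      have D: "prob_space (density K (\<lambda>x. ennreal (Z x / m)))"
      proof (rule prob_spaceI)
        have "(\<integral>\<^sup>+x. ennreal (Z x / m) \<partial>K) = 1" using iZ Z m by (subst nn_integral_eq_integral) auto
        then show "emeasure (density K (\<lambda>x. ennreal (Z x / m))) (space (density K (\<lambda>x. ennreal (Z x / m)))) = 1"
          by (simp add: emeasure_density cong: nn_integral_cong)
      qed
      then interpret D: prob_space "density K (\<lambda>x. ennreal (Z x / m))" .
      have V: "V \<in> measurable (density K (\<lambda>x. ennreal (Z x / m))) borel" by simp
      show ?thesis
      proof (intro conjI allI)
        show "real_distribution (distr (density K (\<lambda>x. ennreal (Z x / m))) borel V)"
          by (rule D.real_distribution_distr[OF V])
        show "char (distr (density K (\<lambda>x. ennreal (Z x / m))) borel V) t = (\<integral>x. complex_of_real (Z x) * iexp (t * V x) \<partial>K) / m" for t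
        proof -
          have "char (distr (density K (\<lambda>x. ennreal (Z x / m))) borel V) t = (\<integral>x. iexp (t * V x) \<partial>density K (\<lambda>x. ennreal (Z x / m)))"
            unfolding char_def by (subst integral_distr[OF V]) auto
          also have "\<dots> = (\<integral>x. (Z x / m) *\<^sub>R iexp (t * V x) \<partial>K)"
            using Z m by (subst integral_density) auto
          also have "\<dots> = (\<integral>x. complex_of_real (Z x) * iexp (t * V x) / m \<partial>K)"
            by (simp add: scaleR_conv_of_real)
          finally show ?thesis by simp
        qed
        show "measure (distr (density K (\<lambda>x. ennreal (Z x / m))) borel V) S = (\<integral>x. Z x * indicator S (V x) \<partial>K) / m"
        proof -
          have "measure (distr (density K (\<lambda>x. ennreal (Z x / m))) borel V) S = (\<integral>x. indicator S x \<partial>(distr (density K (\<lambda>x. ennreal (Z x / m))) borel V))"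
            using S by simp
          also have "\<dots> = (\<integral>x. indicator S (V x) \<partial>(density K (\<lambda>x. ennreal (Z x / m))))"
            using S by (subst integral_distr[OF V]) auto
          also have "\<dots> = (\<integral>x. (Z x / m) *\<^sub>R indicator S (V x) \<partial>K)"
            using Z m S by (subst integral_density) auto
          also have "\<dots> = (\<integral>x. (Z x * indicator S (V x)) / m \<partial>K)" by simp
          finally show ?thesis by simp
        qed
      qed
    qed
    note a = aux[OF M, of X Y] and b = aux[OF N, of X' Y']
    have "distr (density M (\<lambda>x. ennreal (Y x / m))) borel X = distr (density N (\<lambda>x. ennreal (Y' x / m))) borel X'"
      by (rule Levy_uniqueness) (use a b eq Y Y' m_def m' in \<open>auto simp: fun_eq_iff\<close>)
    then have "(\<integral>x. Y x * indicator S (X x) \<partial>M) / m = (\<integral>x. Y' x * indicator S (X' x) \<partial>N) / m"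
      using a b Y Y' m_def m' by auto
    then show ?thesis using m by simp
  qed
qed

lemma iexp_cos: "complex_of_real (cos y) * iexp x = (iexp (x + y) + iexp (x - y)) / 2"
  unfolding cis_conv_exp[symmetric] by (simp add: complex_eq_iff cos_add cos_diff sin_add sin_diff)

lemma iexp_sin: "complex_of_real (sin y) * iexp x = (iexp (x + y) - iexp (x - y)) / (2 * \<i>)"
  unfolding cis_conv_exp[symmetric]
  by (subst nonzero_eq_divide_eq) (simp_all add: complex_eq_iff cos_add cos_diff sin_add sin_diff)

text \<open>All three terms keep the shape \<open>x + r * y\<close> with r = 0, 1, -1, so that one
  family of integrals indexed by \<open>r\<close> rewrites them at once.\<close>

lemma weighted_iexp_cos:
  "complex_of_real (P * (1 + cos y)) * iexp x = complex_of_real P * iexp (x + 0 * y)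
     + (complex_of_real P * iexp (x + 1 * y) + complex_of_real P * iexp (x + (-1) * y)) / 2"
proof -
  have "complex_of_real (P * (1 + cos y)) * iexp x = complex_of_real P * iexp x + complex_of_real P * (complex_of_real (cos y) * iexp x)"
    by (simp add: algebra_simps)
  then show ?thesis unfolding iexp_cos by (simp add: algebra_simps add_divide_distrib)
qed

lemma weighted_iexp_sin:
  "complex_of_real (P * (1 + sin y)) * iexp x = complex_of_real P * iexp (x + 0 * y)
     + (complex_of_real P * iexp (x + 1 * y) - complex_of_real P * iexp (x + (-1) * y)) / (2 * \<i>)"
proof -
  have "complex_of_real (P * (1 + sin y)) * iexp x = complex_of_real P * iexp x + complex_of_real P * (complex_of_real (sin y) * iexp x)"
    by (simp add: algebra_simps)
  then show ?thesis unfolding iexp_sin by (simp add: algebra_simps diff_divide_distrib)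
qed

text \<open>A form between characteristic functions and laws: the coordinates in \<open>A\<close>
  have been turned into indicators, those in \<open>B\<close> are still in the exponent. The
  induction moves one coordinate at a time. One-dimensional uniqueness requires nonnegative weights,
  while the remaining exponential is complex; it is therefore replaced by the weights 1 + cos and 1
  + sin, from which the weight 1 is subtracted at the end.\<close>

lemma char_unique_partial:
  fixes X :: "'i \<Rightarrow> 'a \<Rightarrow> real" and X' :: "'i \<Rightarrow> 'b \<Rightarrow> real"
  assumes M: "prob_space M" and N: "prob_space N"
    and X: "\<And>j. X j \<in> borel_measurable M" and X': "\<And>j. X' j \<in> borel_measurable N"
    and S: "\<And>j. S j \<in> sets borel" and "finite A"
  shows "finite B \<Longrightarrow> A \<inter> B = {} \<Longrightarrow>
    (\<And>a. (\<integral>x. iexp (\<Sum>j\<in>A \<union> B. a j * X j x) \<partial>M) = (\<integral>x. iexp (\<Sum>j\<in>A \<union> B. a j * X' j x) \<partial>N)) \<Longrightarrow>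
    (\<integral>x. complex_of_real (\<Prod>j\<in>A. indicator (S j) (X j x)) * iexp (\<Sum>j\<in>B. a j * X j x) \<partial>M) =
    (\<integral>x. complex_of_real (\<Prod>j\<in>A. indicator (S j) (X' j x)) * iexp (\<Sum>j\<in>B. a j * X' j x) \<partial>N)"
  using \<open>finite A\<close>
proof (induction A arbitrary: B a rule: finite_induct)
  case empty
  show ?case using empty(3)[of a] by simp
next
  case (insert k A)
  interpret M: prob_space M by fact
  interpret N: prob_space N by fact
  note [measurable] = X X' S
  let ?P = "\<lambda>x. (\<Prod>j\<in>A. indicator (S j) (X j x)) :: real" and ?P' = "\<lambda>x. (\<Prod>j\<in>A. indicator (S j) (X' j x)) :: real"
  let ?s = "\<lambda>x. (\<Sum>j\<in>B. a j * X j x)" and ?s' = "\<lambda>x. (\<Sum>j\<in>B. a j * X' j x)"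
  have P01: "0 \<le> ?P x" "?P x \<le> 1" for x by (auto intro!: prod_nonneg prod_le_1 simp: indicator_def)
  have P'01: "0 \<le> ?P' x" "?P' x \<le> 1" for x by (auto intro!: prod_nonneg prod_le_1 simp: indicator_def)
  have kB: "k \<notin> B" and AB: "A \<inter> B = {}" and fB: "finite B" using insert.prems by auto
  \<comment> \<open>The induction hypothesis with \<open>k\<close> moved into the exponent, for all
    coefficients \<open>t\<close> of \<open>k\<close> and all multiples \<open>r\<close> of the
    remaining sum.\<close>
  have IH: "(\<integral>x. complex_of_real (?P x) * iexp (t * X k x + r * ?s x) \<partial>M) = (\<integral>x. complex_of_real (?P' x) * iexp (t * X' k x + r * ?s' x) \<partial>N)" for t r
  proof -
    have u: "A \<union> insert k B = insert k A \<union> B" by auto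
    have "(\<integral>x. complex_of_real (?P x) * iexp (\<Sum>j\<in>insert k B. ((\<lambda>j. r * a j)(k := t)) j * X j x) \<partial>M) =
        (\<integral>x. complex_of_real (?P' x) * iexp (\<Sum>j\<in>insert k B. ((\<lambda>j. r * a j)(k := t)) j * X' j x) \<partial>N)"
      by (rule insert.IH) (use insert.prems insert.hyps AB fB in \<open>auto simp del: fun_upd_apply simp: u\<close>)
    moreover have "(\<Sum>j\<in>insert k B. ((\<lambda>j. r * a j)(k := t)) j * Z j) = t * Z k + r * (\<Sum>j\<in>B. a j * Z j)" for Z :: "'i \<Rightarrow> real"
    proof -
      have "(\<Sum>j\<in>B. ((\<lambda>j. r * a j)(k := t)) j * Z j) = (\<Sum>j\<in>B. r * (a j * Z j))"
        using kB by (intro sum.cong) (auto simp: mult_ac)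
      then show ?thesis using kB fB by (simp add: sum_distrib_left)
    qed
    ultimately show ?thesis by (simp only:)
  qed
  define Yc Yc' Ys Ys' where "Yc x = ?P x * (1 + cos (?s x))" and "Yc' y = ?P' y * (1 + cos (?s' y))"
    and "Ys x = ?P x * (1 + sin (?s x))" and "Ys' y = ?P' y * (1 + sin (?s' y))" for x y
  have Pi: "integrable M (\<lambda>x. complex_of_real (?P x) * iexp (t * X k x + r * ?s x))" for t r
    by (rule M.integrable_bounded_iexp[where B=1]) (use P01 in \<open>auto simp del: of_real_prod\<close>)
  have P'i: "integrable N (\<lambda>x. complex_of_real (?P' x) * iexp (t * X' k x + r * ?s' x))" for t r
    by (rule N.integrable_bounded_iexp[where B=1]) (use P'01 in \<open>auto simp del: of_real_prod\<close>)
  have Yc_bd: "0 \<le> ?P x * (1 + c)" "?P x * (1 + c) \<le> 2" if "\<bar>c\<bar> \<le> 1" for x c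
    using that P01[of x] mult_mono[of "?P x" 1 "1 + c" 2] by (auto intro!: mult_nonneg_nonneg)
  have Yc'_bd: "0 \<le> ?P' x * (1 + c)" "?P' x * (1 + c) \<le> 2" if "\<bar>c\<bar> \<le> 1" for x c
    using that P'01[of x] mult_mono[of "?P' x" 1 "1 + c" 2] by (auto intro!: mult_nonneg_nonneg)
  have [measurable]: "Yc \<in> borel_measurable M" "Ys \<in> borel_measurable M" "Yc' \<in> borel_measurable N" "Ys' \<in> borel_measurable N"
    unfolding Yc_def Ys_def Yc'_def Ys'_def by measurable
  have e0: "(\<integral>x. complex_of_real (?P x) * iexp (t * X k x) \<partial>M) = (\<integral>x. complex_of_real (?P' x) * iexp (t * X' k x) \<partial>N)" for t
    using IH[of t 0] by simp
  have ec: "(\<integral>x. complex_of_real (Yc x) * iexp (t * X k x) \<partial>M) = (\<integral>x. complex_of_real (Yc' x) * iexp (t * X' k x) \<partial>N)" for t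
  proof -
    show ?thesis unfolding Yc_def Yc'_def weighted_iexp_cos
      by (simp only: Bochner_Integration.integral_add Bochner_Integration.integrable_add Bochner_Integration.integrable_divide_zero integral_divide_zero Pi P'i IH)
  qed
  have es: "(\<integral>x. complex_of_real (Ys x) * iexp (t * X k x) \<partial>M) = (\<integral>x. complex_of_real (Ys' x) * iexp (t * X' k x) \<partial>N)" for t
  proof -
    show ?thesis unfolding Ys_def Ys'_def weighted_iexp_sin
      by (simp only: Bochner_Integration.integral_add Bochner_Integration.integrable_add Bochner_Integration.integral_diff Bochner_Integration.integrable_diff Bochner_Integration.integrable_divide_zero integral_divide_zero Pi P'i IH)
  qed
  let ?I = "\<lambda>x. indicator (S k) (X k x) :: real" and ?I' = "\<lambda>x. indicator (S k) (X' k x) :: real"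
  have r0: "(\<integral>x. ?P x * ?I x \<partial>M) = (\<integral>x. ?P' x * ?I' x \<partial>N)"
    by (rule weighted_char_unique[OF M N, where B=1]) (use P01 P'01 e0 in auto)
  have rc: "(\<integral>x. Yc x * ?I x \<partial>M) = (\<integral>x. Yc' x * ?I' x \<partial>N)"
    by (rule weighted_char_unique[OF M N, where B=2]) (use Yc_bd Yc'_bd ec in \<open>auto simp: Yc_def Yc'_def\<close>)
  have rs: "(\<integral>x. Ys x * ?I x \<partial>M) = (\<integral>x. Ys' x * ?I' x \<partial>N)"
    by (rule weighted_char_unique[OF M N, where B=2]) (use Yc_bd Yc'_bd es in \<open>auto simp: Ys_def Ys'_def\<close>)
  have ir: "integrable M (\<lambda>x. ?P x * ?I x)" "integrable M (\<lambda>x. Yc x * ?I x)" "integrable M (\<lambda>x. Ys x * ?I x)"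
    by (auto intro!: M.integrable_const_bound[where B=2] AE_I2 split: split_indicator
        simp: Yc_def Ys_def abs_of_nonneg Yc_bd order_trans[OF P01(2)] P01(1))
  have ir': "integrable N (\<lambda>x. ?P' x * ?I' x)" "integrable N (\<lambda>x. Yc' x * ?I' x)" "integrable N (\<lambda>x. Ys' x * ?I' x)"
    by (auto intro!: N.integrable_const_bound[where B=2] AE_I2 split: split_indicator
        simp: Yc'_def Ys'_def abs_of_nonneg Yc'_bd order_trans[OF P'01(2)] P'01(1))
  have prod: "(\<Prod>j\<in>insert k A. indicator (S j) (Z j)) = (indicator (S k) (Z k) :: real) * (\<Prod>j\<in>A. indicator (S j) (Z j))" for Z
    using insert.hyps by simp
  have iexp_eq: "iexp y = complex_of_real (cos y) + \<i> * complex_of_real (sin y)" for y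
    by (simp add: cis_conv_exp[symmetric] complex_eq_iff)
  have d: "complex_of_real (\<Prod>j\<in>insert k A. indicator (S j) (X j x)) * iexp (?s x)
     = (complex_of_real (Yc x * ?I x) - complex_of_real (?P x * ?I x)) + \<i> * (complex_of_real (Ys x * ?I x) - complex_of_real (?P x * ?I x))" for x
    unfolding prod iexp_eq Yc_def Ys_def of_real_mult of_real_add by (simp add: algebra_simps del: of_real_prod)
  have d': "complex_of_real (\<Prod>j\<in>insert k A. indicator (S j) (X' j x)) * iexp (?s' x)
     = (complex_of_real (Yc' x * ?I' x) - complex_of_real (?P' x * ?I' x)) + \<i> * (complex_of_real (Ys' x * ?I' x) - complex_of_real (?P' x * ?I' x))" for x
    unfolding prod iexp_eq Yc'_def Ys'_def of_real_mult of_real_add by (simp add: algebra_simps del: of_real_prod)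
  note ic = ir[THEN integrable_of_real[where 'a=complex]] and ic' = ir'[THEN integrable_of_real[where 'a=complex]]
  show ?case
    unfolding d d'
    by (simp only: Bochner_Integration.integral_add Bochner_Integration.integrable_add Bochner_Integration.integral_diff
        Bochner_Integration.integrable_diff integral_mult_right_zero integrable_mult_right ic ic' integral_complex_of_real r0 rc rs)
qed

text \<open>Once every coordinate has become an indicator, the two laws agree on measurable boxes,
  and these determine a law on a finite product.\<close>

proposition distr_PiM_eqI_char:
  fixes X :: "'i \<Rightarrow> 'a \<Rightarrow> real" and X' :: "'i \<Rightarrow> 'b \<Rightarrow> real"
  assumes M: "prob_space M" and N: "prob_space N" and J: "finite J"
    and X: "\<And>j. X j \<in> borel_measurable M" and X': "\<And>j. X' j \<in> borel_measurable N"
    and eq: "\<And>a. (\<integral>x. iexp (\<Sum>j\<in>J. a j * X j x) \<partial>M) = (\<integral>x. iexp (\<Sum>j\<in>J. a j * X' j x) \<partial>N)"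
  shows "distr M (\<Pi>\<^sub>M j\<in>J. borel) (\<lambda>x. \<lambda>j\<in>J. X j x) = distr N (\<Pi>\<^sub>M j\<in>J. borel) (\<lambda>x. \<lambda>j\<in>J. X' j x)"
proof -
  interpret M: prob_space M by fact
  interpret N: prob_space N by fact
  note [measurable] = X X'
  let ?P = "distr M (\<Pi>\<^sub>M j\<in>J. borel) (\<lambda>x. \<lambda>j\<in>J. X j x)" and ?Q = "distr N (\<Pi>\<^sub>M j\<in>J. borel) (\<lambda>x. \<lambda>j\<in>J. X' j x)"
  interpret P: prob_space ?P by (rule M.prob_space_distr) measurable
  interpret Q: prob_space ?Q by (rule N.prob_space_distr) measurable
  show ?thesis
  proof (rule measure_eqI_PiM_finite[OF J])
    fix A :: "'i \<Rightarrow> real set" assume A: "\<And>i. i \<in> J \<Longrightarrow> A i \<in> sets borel"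
    \<comment> \<open>The sets outside \<open>J\<close> are made empty so that every member of the
      family is measurable; the box does not see them.\<close>
    define S where "S j = (if j \<in> J then A j else {})" for j
    have S [measurable]: "S j \<in> sets borel" for j using A by (simp add: S_def)
    have E: "Pi\<^sub>E J A = Pi\<^sub>E J S" by (auto simp: S_def PiE_def Pi_def)
    have SE: "Pi\<^sub>E J S \<in> sets (\<Pi>\<^sub>M j\<in>J. borel)" using J by (intro sets_PiM_I_finite) auto
    have aux: "measure (distr K (\<Pi>\<^sub>M j\<in>J. borel) (\<lambda>x. \<lambda>j\<in>J. V j x)) (Pi\<^sub>E J S) = (\<integral>x. (\<Prod>j\<in>J. indicator (S j) (V j x)) \<partial>K)"
      if "prob_space K" and V[measurable]: "\<And>j. V j \<in> borel_measurable K" for K :: "'c measure" and V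
    proof -
      interpret K: prob_space K by fact
      have "measure (distr K (\<Pi>\<^sub>M j\<in>J. borel) (\<lambda>x. \<lambda>j\<in>J. V j x)) (Pi\<^sub>E J S)
          = measure K ((\<lambda>x. \<lambda>j\<in>J. V j x) -` Pi\<^sub>E J S \<inter> space K)"
        using SE by (intro measure_distr) auto
      also have "\<dots> = (\<integral>x. indicator ((\<lambda>x. \<lambda>j\<in>J. V j x) -` Pi\<^sub>E J S \<inter> space K) x \<partial>K)"
        by (subst Bochner_Integration.integral_indicator) (auto simp: Int_absorb2)
      also have "\<dots> = (\<integral>x. (\<Prod>j\<in>J. indicator (S j) (V j x)) \<partial>K)"
      proof (rule Bochner_Integration.integral_cong[OF refl])
        fix x assume "x \<in> space K"
        then show "indicator ((\<lambda>x. \<lambda>j\<in>J. V j x) -` Pi\<^sub>E J S \<inter> space K) x = (\<Prod>j\<in>J. indicator (S j) (V j x) :: real)"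
          using J by (cases "\<forall>j\<in>J. V j x \<in> S j") (auto simp: indicator_def PiE_def Pi_def prod_zero_iff)
      qed
      finally show ?thesis .
    qed
    have "complex_of_real (\<integral>x. (\<Prod>j\<in>J. indicator (S j) (X j x)) \<partial>M) = complex_of_real (\<integral>x. (\<Prod>j\<in>J. indicator (S j) (X' j x)) \<partial>N)"
      using char_unique_partial[OF M N X X' S J, of "{}"] eq by (simp del: of_real_prod add: integral_complex_of_real)
    then have "measure ?P (Pi\<^sub>E J S) = measure ?Q (Pi\<^sub>E J S)"
      by (simp only: of_real_eq_iff aux[OF M X] aux[OF N X'])
    then show "emeasure ?P (Pi\<^sub>E J A) = emeasure ?Q (Pi\<^sub>E J A)"
      by (simp add: E P.emeasure_eq_measure Q.emeasure_eq_measure)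
  next
    show "range (\<lambda>n::nat. \<Pi>\<^sub>E j\<in>J. UNIV) \<subseteq> prod_algebra J (\<lambda>_. borel :: real measure)"
      using J by (auto intro!: prod_algebraI_finite)
  qed (auto simp: space_PiM)
qed

text \<open>The definition of a Gaussian variable admits constants. A centred constant has variance
  zero and obeys the same formula, so later arguments need no case distinction.\<close>

lemma (in prob_space) gaussian_rv_centered:
  assumes X: "gaussian_rv M X" and E: "expectation X = 0"
  shows "integrable M (\<lambda>x. (X x)\<^sup>2)" "expectation (\<lambda>x. iexp (X x)) = complex_of_real (exp (- expectation (\<lambda>x. (X x)\<^sup>2) / 2))"
proof -
  have [measurable]: "X \<in> borel_measurable M" using X by (simp add: gaussian_rv_def)
  have "integrable M (\<lambda>x. (X x)\<^sup>2) \<and> expectation (\<lambda>x. iexp (X x)) = complex_of_real (exp (- expectation (\<lambda>x. (X x)\<^sup>2) / 2))"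
  proof -
    obtain \<mu> where "(AE \<omega> in M. X \<omega> = \<mu>) \<or> (\<exists>\<sigma>>0. distributed M lborel X (normal_density \<mu> \<sigma>))"
      using X by (auto simp: gaussian_rv_def)
    then show ?thesis
    proof
      assume ae: "AE \<omega> in M. X \<omega> = \<mu>"
      then have "expectation X = expectation (\<lambda>_. \<mu>)" by (intro integral_cong_AE) auto
      then have "\<mu> = 0" using E by (simp add: prob_space)
      with ae have ae: "AE \<omega> in M. X \<omega> = 0" by simp
      have "integrable M (\<lambda>x. (X x)\<^sup>2) \<longleftrightarrow> integrable M (\<lambda>_. 0 :: real)"
        using ae by (intro integrable_cong_AE) auto
      moreover have "expectation (\<lambda>x. (X x)\<^sup>2) = expectation (\<lambda>_. 0)" using ae by (intro integral_cong_AE) auto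
      moreover have "expectation (\<lambda>x. iexp (X x)) = expectation (\<lambda>_. 1)" using ae by (intro integral_cong_AE) auto
      ultimately show ?thesis by (simp add: prob_space)
    next
      assume "\<exists>\<sigma>>0. distributed M lborel X (normal_density \<mu> \<sigma>)"
      then obtain \<sigma> where s: "\<sigma> > 0" and D: "distributed M lborel X (normal_density \<mu> \<sigma>)" by auto
      have mu: "\<mu> = 0" using normal_distributed_expectation[OF s D] E by simp
      have var: "expectation (\<lambda>x. (X x)\<^sup>2) = \<sigma>\<^sup>2" using normal_distributed_variance[OF s D] by (simp add: E)
      have i: "integrable M (\<lambda>x. (X x)\<^sup>2)"
        using integrable_normal_moment[OF s, of \<mu> 2] distributed_integrable[OF D, of "\<lambda>x. x\<^sup>2"] by (simp add: mu normal_density_nonneg)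
      have "distributed M lborel (\<lambda>x. X x / \<sigma>) std_normal_density"
        using D s by (subst (asm) normal_standard_normal_convert) (auto simp: mu)
      from distributed_distr_eq_density[OF this]
      have d: "distr M lborel (\<lambda>x. X x / \<sigma>) = std_normal_distribution" .
      have "expectation (\<lambda>x. iexp (X x)) = (\<integral>x. iexp (\<sigma> * (X x / \<sigma>)) \<partial>M)" using s by simp
      also have "\<dots> = (\<integral>y. iexp (\<sigma> * y) \<partial>distr M lborel (\<lambda>x. X x / \<sigma>))"
        by (subst integral_distr) auto
      also have "\<dots> = char std_normal_distribution \<sigma>" unfolding d char_def ..
      finally show ?thesis using i var by (simp add: char_std_normal_distribution)
    qed
  qed
  then show "integrable M (\<lambda>x. (X x)\<^sup>2)" "expectation (\<lambda>x. iexp (X x)) = complex_of_real (exp (- expectation (\<lambda>x. (X x)\<^sup>2) / 2))" by auto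
qed

section \<open>Shifts of the Brownian sheet\<close>

text \<open>Gram-Schmidt for a form that may be degenerate, as the covariance of the sheet is at
  points on the axes. The residual of a new indicator is normalised if its square is positive. If
  the square is zero, semidefiniteness makes its product with every vector vanish, and the earlier
  system already represents the new point.\<close>

lemma gram_schmidt_form:
  fixes B :: "('i \<Rightarrow> real) \<Rightarrow> ('i \<Rightarrow> real) \<Rightarrow> real"
  assumes lin: "\<And>c d e r. B (\<lambda>p. c p + r * d p) e = B c e + r * B d e"
    and sym: "\<And>c d. B c d = B d c" and psd: "\<And>c. 0 \<le> B c c" and A: "finite A"
  shows "\<exists>(n::nat) c. (\<forall>i<n. \<forall>j<n. B (c i) (c j) = (if i = j then 1 else 0)) \<and>
    (\<forall>p\<in>A. \<forall>d. B (indicator {p}) d = (\<Sum>i<n. B (indicator {p}) (c i) * B (c i) d))"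
  using A
proof (induction A rule: finite_induct)
  case empty
  show ?case by (intro exI[of _ "0 :: nat"]) auto
next
  case (insert a A)
  then obtain n :: nat and c where on: "\<And>i j. i < n \<Longrightarrow> j < n \<Longrightarrow> B (c i) (c j) = (if i = j then 1 else 0)"
    and rep: "\<And>p d. p \<in> A \<Longrightarrow> B (indicator {p}) d = (\<Sum>i<n. B (indicator {p}) (c i) * B (c i) d)"
    by blast
  have B0: "B (\<lambda>_. 0) d = 0" for d using lin[of "\<lambda>_. 0" 1 "\<lambda>_. 0" d] by simp
  have scale: "B (\<lambda>p. r * f p) d = r * B f d" for r f d using lin[of "\<lambda>_. 0" r f d] B0 by simp
  have lsum: "B (\<lambda>p. f p + (\<Sum>i<m. \<beta> i * c i p)) d = B f d + (\<Sum>i<m. \<beta> i * B (c i) d)" for f m \<beta> d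
  proof (induction m)
    case (Suc m)
    have "B (\<lambda>p. f p + (\<Sum>i<Suc m. \<beta> i * c i p)) d = B (\<lambda>p. (f p + (\<Sum>i<m. \<beta> i * c i p)) + \<beta> m * c m p) d"
      by (simp add: add.assoc)
    also have "\<dots> = B f d + (\<Sum>i<Suc m. \<beta> i * B (c i) d)" unfolding lin Suc by simp
    finally show ?case .
  qed simp
  \<comment> \<open>The indicator of \<open>a\<close> minus its projection onto the system found so
    far.\<close>
  define r where "r p = indicator {a} p + (\<Sum>i<n. - B (indicator {a}) (c i) * c i p)" for p
  have Br: "B r d = B (indicator {a}) d - (\<Sum>i<n. B (indicator {a}) (c i) * B (c i) d)" for d
    unfolding r_def lsum by (simp add: sum_negf)
  have Brc: "B r (c j) = 0" if "j < n" for j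
  proof -
    have "(\<Sum>i<n. B (indicator {a}) (c i) * B (c i) (c j)) = (\<Sum>i<n. if i = j then B (indicator {a}) (c j) else 0)"
      using on that by (intro sum.cong) auto
    then show ?thesis unfolding Br using that by simp
  qed
  show ?case
  proof (cases "B r r = 0")
    case True
    have "B r d = 0" for d
    proof (rule ccontr)
      assume nz: "B r d \<noteq> 0"
      \<comment> \<open>Chosen so that the square of \<open>d + t r\<close> would be -1.\<close>
      define t where "t = - (B d d + 1) / (2 * B r d)"
      have "B (\<lambda>p. d p + t * r p) (\<lambda>p. d p + t * r p) = B d d + t * B r d + t * (B d r + t * B r r)"
        by (simp only: lin sym[of d "\<lambda>p. d p + t * r p"] sym[of r "\<lambda>p. d p + t * r p"])
      also have "\<dots> = B d d + 2 * t * B r d" using True by (simp add: sym[of d r])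
      also have "\<dots> = -1" using nz by (simp add: t_def field_simps)
      finally show False using psd[of "\<lambda>p. d p + t * r p"] by simp
    qed
    then have a: "B (indicator {a}) d = (\<Sum>i<n. B (indicator {a}) (c i) * B (c i) d)" for d using Br[of d] by simp
    show ?thesis
    proof (intro exI[of _ n] exI[of _ c] conjI allI impI ballI)
      show "B (c i) (c j) = (if i = j then 1 else 0)" if "i < n" "j < n" for i j by (rule on[OF that])
      show "B (indicator {p}) d = (\<Sum>i<n. B (indicator {p}) (c i) * B (c i) d)" if "p \<in> insert a A" for p d
      proof (cases "p = a")
        case True show ?thesis unfolding True by (rule a)
      next
        case False then show ?thesis using that by (intro rep) simp
      qed
    qed
  next
    case False
    with psd[of r] have pos: "0 < B r r" by simp
    define s where "s = sqrt (B r r)"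
    have s: "s > 0" "s * s = B r r" using pos by (auto simp: s_def)
    define c' where "c' = c(n := \<lambda>p. (1 / s) * r p)"
    have cn: "c' n = (\<lambda>p. (1 / s) * r p)" and ci: "i < n \<Longrightarrow> c' i = c i" for i by (auto simp: c'_def)
    have Bcn: "B (c' n) d = B r d / s" for d unfolding cn scale by simp
    have nn: "B (c' n) (c' n) = 1"
      using s pos Bcn[of "c' n"] Bcn[of r] sym[of r "c' n"] by (simp add: field_simps)
    have cn0: "B (c' n) (c j) = 0" if "j < n" for j using Bcn[of "c j"] Brc[OF that] by simp
    show ?thesis
    proof (intro exI[of _ "Suc n"] exI[of _ c'] conjI allI impI ballI)
      fix i j assume "i < Suc n" "j < Suc n"
      then show "B (c' i) (c' j) = (if i = j then 1 else 0)"
        using on nn cn0 sym ci by (auto simp: less_Suc_eq)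
    next
      fix p d assume p: "p \<in> insert a A"
      have S: "(\<Sum>i<Suc n. B (indicator {p}) (c' i) * B (c' i) d) =
        (\<Sum>i<n. B (indicator {p}) (c i) * B (c i) d) + B (indicator {p}) (c' n) * B (c' n) d" by (simp add: ci)
      show "B (indicator {p}) d = (\<Sum>i<Suc n. B (indicator {p}) (c' i) * B (c' i) d)"
      proof (cases "p = a")
        case True
        have "B (indicator {a}) (c' n) = B r (c' n) + (\<Sum>i<n. B (indicator {a}) (c i) * B (c i) (c' n))" using Br[of "c' n"] by simp
        also have "(\<Sum>i<n. B (indicator {a}) (c i) * B (c i) (c' n)) = 0" using cn0 sym by (intro sum.neutral) auto
        also have "B r (c' n) = s" using Bcn[of r] sym[of r "c' n"] s by (metis nonzero_mult_div_cancel_left less_irrefl)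
        finally have "B (indicator {a}) (c' n) * B (c' n) d = B r d" using Bcn[of d] s by simp
        then show ?thesis using True S Br[of d] by simp
      next
        case False
        with p have pA: "p \<in> A" by simp
        have "B (indicator {p}) (c' n) = (\<Sum>i<n. B (indicator {p}) (c i) * B (c i) (c' n))" by (rule rep[OF pA])
        also have "\<dots> = 0" using cn0 sym by (intro sum.neutral) auto
        finally show ?thesis using S rep[OF pA, of d] by simp
      qed
    qed
  qed
qed

section \<open>Linear combinations of values of the sheet\<close>

locale sheet = prob_space M for M :: "'w measure" +
  fixes T D :: real and W :: "real \<Rightarrow> real \<Rightarrow> 'w \<Rightarrow> real"
  assumes T_pos: "0 < T" and D_pos: "0 < D" and bs: "brownian_sheet M T D W"
begin

definition I :: "(real \<times> real) set" where "I = {0..T} \<times> {0..D}"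

definition Wp :: "real \<times> real \<Rightarrow> 'w \<Rightarrow> real" where "Wp p = W (fst p) (snd p)"

definition cov :: "real \<times> real \<Rightarrow> real \<times> real \<Rightarrow> real" where
  "cov p q = min (fst p) (fst q) * min (snd p) (snd q)"

text \<open>Finite combinations are jointly Gaussian by the definition of a Gaussian process. They
  are closed under the linear operations below, so their joint laws are determined by second
  moments.\<close>

definition sheet_lin :: "('w \<Rightarrow> real) \<Rightarrow> bool" where
  "sheet_lin X \<longleftrightarrow> (\<exists>S c. finite S \<and> S \<subseteq> I \<and> X = (\<lambda>\<omega>. \<Sum>p\<in>S. c p * Wp p \<omega>))"

lemma gaussian_sum: "finite S \<Longrightarrow> S \<subseteq> I \<Longrightarrow> gaussian_rv M (\<lambda>\<omega>. \<Sum>p\<in>S. c p * Wp p \<omega>)"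
  using bs by (auto simp: brownian_sheet_def gaussian_process_def I_def Wp_def[abs_def] case_prod_beta')

lemma E_Wp: "p \<in> I \<Longrightarrow> expectation (Wp p) = 0"
  using bs by (auto simp: brownian_sheet_def I_def Wp_def)

lemma E_Wp_Wp: "p \<in> I \<Longrightarrow> q \<in> I \<Longrightarrow> expectation (\<lambda>\<omega>. Wp p \<omega> * Wp q \<omega>) = cov p q"
  using bs by (auto simp: brownian_sheet_def I_def Wp_def cov_def min.commute)

lemma Wp_measurable: "p \<in> I \<Longrightarrow> Wp p \<in> borel_measurable M"
  using gaussian_sum[of "{p}" "\<lambda>_. 1"] by (simp add: gaussian_rv_def)

lemma Wp_sq_integrable: "p \<in> I \<Longrightarrow> integrable M (\<lambda>\<omega>. (Wp p \<omega>)\<^sup>2)"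
  using gaussian_sum[of "{p}" "\<lambda>_. 1"] E_Wp[of p] by (intro gaussian_rv_centered(1)) auto

lemma sq_integrable_mult:
  fixes X Y :: "'w \<Rightarrow> real"
  assumes [measurable]: "X \<in> borel_measurable M" "Y \<in> borel_measurable M"
    and i: "integrable M (\<lambda>\<omega>. (X \<omega>)\<^sup>2)" "integrable M (\<lambda>\<omega>. (Y \<omega>)\<^sup>2)"
  shows "integrable M (\<lambda>\<omega>. X \<omega> * Y \<omega>)"
proof (rule Bochner_Integration.integrable_bound)
  show "integrable M (\<lambda>\<omega>. (X \<omega>)\<^sup>2 + (Y \<omega>)\<^sup>2)" using i by simp
  show "AE \<omega> in M. norm (X \<omega> * Y \<omega>) \<le> norm ((X \<omega>)\<^sup>2 + (Y \<omega>)\<^sup>2)"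
  proof (rule AE_I2)
    fix \<omega>
    have "0 \<le> (\<bar>X \<omega>\<bar> - \<bar>Y \<omega>\<bar>)\<^sup>2" by simp
    then have "2 * (\<bar>X \<omega>\<bar> * \<bar>Y \<omega>\<bar>) \<le> (X \<omega>)\<^sup>2 + (Y \<omega>)\<^sup>2" unfolding power2_diff by simp
    moreover have "0 \<le> \<bar>X \<omega>\<bar> * \<bar>Y \<omega>\<bar>" by simp
    ultimately have "\<bar>X \<omega>\<bar> * \<bar>Y \<omega>\<bar> \<le> (X \<omega>)\<^sup>2 + (Y \<omega>)\<^sup>2" by linarith
    then show "norm (X \<omega> * Y \<omega>) \<le> norm ((X \<omega>)\<^sup>2 + (Y \<omega>)\<^sup>2)" by (simp add: abs_mult)
  qed
qed simp

lemma sheet_lin_Wp: "p \<in> I \<Longrightarrow> sheet_lin (Wp p)"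
  unfolding sheet_lin_def by (intro exI[of _ "{p}"] exI[of _ "\<lambda>_. 1"]) auto

lemma sheet_lin_scale: "sheet_lin X \<Longrightarrow> sheet_lin (\<lambda>\<omega>. r * X \<omega>)"
proof -
  assume "sheet_lin X"
  then obtain S c where "finite S" "S \<subseteq> I" "X = (\<lambda>\<omega>. \<Sum>p\<in>S. c p * Wp p \<omega>)" by (auto simp: sheet_lin_def)
  then show ?thesis unfolding sheet_lin_def
    by (intro exI[of _ S] exI[of _ "\<lambda>p. r * c p"]) (auto simp: sum_distrib_left mult.assoc)
qed

lemma sheet_lin_add: "sheet_lin X \<Longrightarrow> sheet_lin Y \<Longrightarrow> sheet_lin (\<lambda>\<omega>. X \<omega> + Y \<omega>)"
proof -
  assume "sheet_lin X" "sheet_lin Y"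
  then obtain S c S' d where a: "finite S" "S \<subseteq> I" "X = (\<lambda>\<omega>. \<Sum>p\<in>S. c p * Wp p \<omega>)"
    and b: "finite S'" "S' \<subseteq> I" "Y = (\<lambda>\<omega>. \<Sum>p\<in>S'. d p * Wp p \<omega>)" by (auto simp: sheet_lin_def)
  have "(\<Sum>p\<in>S. c p * Wp p \<omega>) = (\<Sum>p\<in>S\<union>S'. (if p \<in> S then c p else 0) * Wp p \<omega>)" for \<omega>
    using a(1) b(1) by (intro sum.mono_neutral_cong_left) auto
  moreover have "(\<Sum>p\<in>S'. d p * Wp p \<omega>) = (\<Sum>p\<in>S\<union>S'. (if p \<in> S' then d p else 0) * Wp p \<omega>)" for \<omega>
    using a(1) b(1) by (intro sum.mono_neutral_cong_left) auto
  ultimately show ?thesis unfolding sheet_lin_def using a b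
    by (intro exI[of _ "S \<union> S'"] exI[of _ "\<lambda>p. (if p \<in> S then c p else 0) + (if p \<in> S' then d p else 0)"])
      (auto simp: sum.distrib distrib_right)
qed

lemma sheet_lin_0: "sheet_lin (\<lambda>_. 0)"
  unfolding sheet_lin_def by (intro exI[of _ "{}"]) auto

lemma sheet_lin_sum: "(\<And>i. i \<in> A \<Longrightarrow> sheet_lin (X i)) \<Longrightarrow> sheet_lin (\<lambda>\<omega>. \<Sum>i\<in>A. r i * X i \<omega>)"
  by (induction A rule: infinite_finite_induct) (auto simp: sheet_lin_0 intro!: sheet_lin_add sheet_lin_scale)

lemma sheet_lin_gaussian:
  assumes "sheet_lin X"
  shows "X \<in> borel_measurable M" "integrable M (\<lambda>\<omega>. (X \<omega>)\<^sup>2)"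
    "expectation (\<lambda>\<omega>. iexp (X \<omega>)) = complex_of_real (exp (- expectation (\<lambda>\<omega>. (X \<omega>)\<^sup>2) / 2))"
proof -
  obtain S c where S: "finite S" "S \<subseteq> I" "X = (\<lambda>\<omega>. \<Sum>p\<in>S. c p * Wp p \<omega>)" using assms by (auto simp: sheet_lin_def)
  have g: "gaussian_rv M X" unfolding S(3) by (rule gaussian_sum[OF S(1,2)])
  have "integrable M (Wp p)" if "p \<in> S" for p
    using that S by (intro square_integrable_imp_integrable[OF Wp_measurable Wp_sq_integrable]) auto
  then have "expectation X = (\<Sum>p\<in>S. c p * expectation (Wp p))"
    unfolding S(3) by (subst Bochner_Integration.integral_sum) auto
  also have "\<dots> = 0" using E_Wp S by (intro sum.neutral) auto
  finally have E: "expectation X = 0" .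
  show "X \<in> borel_measurable M" using g by (simp add: gaussian_rv_def)
  show "integrable M (\<lambda>\<omega>. (X \<omega>)\<^sup>2)"
    "expectation (\<lambda>\<omega>. iexp (X \<omega>)) = complex_of_real (exp (- expectation (\<lambda>\<omega>. (X \<omega>)\<^sup>2) / 2))"
    using gaussian_rv_centered[OF g E] by auto
qed

lemma sheet_lin_mult_integrable: "sheet_lin X \<Longrightarrow> sheet_lin Y \<Longrightarrow> integrable M (\<lambda>\<omega>. X \<omega> * Y \<omega>)"
  by (intro sq_integrable_mult sheet_lin_gaussian)

lemma sheet_lin_E_sum_mult:
  assumes "\<And>i. i \<in> A \<Longrightarrow> sheet_lin (X i)" "sheet_lin Y"
  shows "expectation (\<lambda>\<omega>. (\<Sum>i\<in>A. r i * X i \<omega>) * Y \<omega>) = (\<Sum>i\<in>A. r i * expectation (\<lambda>\<omega>. X i \<omega> * Y \<omega>))"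
proof -
  have "expectation (\<lambda>\<omega>. (\<Sum>i\<in>A. r i * X i \<omega>) * Y \<omega>) = expectation (\<lambda>\<omega>. \<Sum>i\<in>A. r i * (X i \<omega> * Y \<omega>))"
    by (simp add: sum_distrib_right mult.assoc)
  also have "\<dots> = (\<Sum>i\<in>A. expectation (\<lambda>\<omega>. r i * (X i \<omega> * Y \<omega>)))"
    using assms by (intro Bochner_Integration.integral_sum integrable_mult_right sheet_lin_mult_integrable)
  finally show ?thesis by simp
qed

text \<open>Variances of orthogonal variables add, so the Gaussian exponentials multiply. This is
  independence in the form that uniqueness by characteristic functions can use.\<close>

lemma sheet_lin_iexp_orthogonal:
  assumes X: "sheet_lin X" and Y: "sheet_lin Y" and o: "expectation (\<lambda>\<omega>. X \<omega> * Y \<omega>) = 0"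
  shows "expectation (\<lambda>\<omega>. iexp (X \<omega> + Y \<omega>)) = expectation (\<lambda>\<omega>. iexp (X \<omega>)) * expectation (\<lambda>\<omega>. iexp (Y \<omega>))"
proof -
  have "expectation (\<lambda>\<omega>. (X \<omega> + Y \<omega>)\<^sup>2) = expectation (\<lambda>\<omega>. (X \<omega>)\<^sup>2 + (Y \<omega>)\<^sup>2 + 2 * (X \<omega> * Y \<omega>))"
    by (simp add: power2_sum mult.assoc)
  also have "\<dots> = expectation (\<lambda>\<omega>. (X \<omega>)\<^sup>2) + expectation (\<lambda>\<omega>. (Y \<omega>)\<^sup>2)"
    using X Y o by (simp add: sheet_lin_gaussian(2) sheet_lin_mult_integrable)
  finally show ?thesis
    using sheet_lin_gaussian(3)[OF sheet_lin_add[OF X Y]] sheet_lin_gaussian(3)[OF X] sheet_lin_gaussian(3)[OF Y]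
    by (simp add: exp_add[symmetric] of_real_mult[symmetric] add_divide_distrib diff_divide_distrib del: of_real_mult)
qed

definition rect :: "real \<times> real \<Rightarrow> (real \<times> real) set" where "rect p = {0<..fst p} \<times> {0<..snd p}"

lemma rect_sets [measurable]: "rect p \<in> sets borel"
  unfolding rect_def borel_prod[symmetric] by measurable

lemma rect_subset: "p \<in> I \<Longrightarrow> rect p \<subseteq> I" by (auto simp: rect_def I_def)

lemma rect_Int: "rect p \<inter> rect q = rect (min (fst p) (fst q), min (snd p) (snd q))"
  by (auto simp: rect_def)

lemma emeasure_rect: "0 \<le> fst p \<Longrightarrow> 0 \<le> snd p \<Longrightarrow> emeasure lborel (rect p) = ennreal (fst p * snd p)"
  unfolding rect_def lborel_prod[symmetric] by (subst lborel.emeasure_pair_measure_Times) (auto simp: ennreal_mult)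

text \<open>The isometry behind white noise: the covariance at two points is the L2 product of the
  indicators of their rectangles, so \<open>Wp p\<close> plays the part of the Wiener integral of
  \<open>indicator (rect p)\<close>.\<close>

lemma integral_rect_rect:
  assumes "p \<in> I" "q \<in> I"
  shows "integrable lborel (\<lambda>z. indicator (rect p) z * indicator (rect q) z :: real)"
    "(\<integral>z. indicator (rect p) z * indicator (rect q) z \<partial>lborel) = cov p q"
proof -
  have nn: "0 \<le> min (fst p) (fst q)" "0 \<le> min (snd p) (snd q)" using assms by (auto simp: I_def)
  have e: "indicator (rect p) z * indicator (rect q) z = (indicator (rect p \<inter> rect q) z :: real)" for z
    by (auto split: split_indicator)
  have em: "emeasure lborel (rect p \<inter> rect q) = ennreal (cov p q)"
    unfolding rect_Int using nn by (subst emeasure_rect) (auto simp: cov_def)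
  show "integrable lborel (\<lambda>z. indicator (rect p) z * indicator (rect q) z :: real)"
    unfolding e by (rule integrable_real_indicator) (auto simp: em)
  have "0 \<le> cov p q" using nn by (simp add: cov_def)
  then show "(\<integral>z. indicator (rect p) z * indicator (rect q) z \<partial>lborel) = cov p q"
    unfolding e by (simp add: measure_def em)
qed

end

lemma char_std_gaussian:
  "(\<integral>x. iexp (\<Sum>i<n. a i * x i) \<partial>std_gaussian n) = complex_of_real (exp (- (\<Sum>i<n. (a i)\<^sup>2) / 2))"
proof -
  have "(\<integral>x. iexp (\<Sum>i<n. a i * x i) \<partial>std_gaussian n) = (\<integral>x. (\<Prod>i<n. iexp (a i * x i)) \<partial>std_gaussian n)"
    by (simp add: sum_distrib_left exp_sum)
  also have "\<dots> = (\<Prod>i<n. \<integral>y. iexp (a i * y) \<partial>std_normal_distribution)"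
    by (rule std_gauss.product_integral_prod)
      (auto intro!: std_normal.integrable_iexp)
  also have "\<dots> = (\<Prod>i<n. complex_of_real (exp (- (a i)\<^sup>2 / 2)))"
    using char_std_normal_distribution by (simp add: char_def fun_eq_iff)
  also have "\<dots> = complex_of_real (exp (- (\<Sum>i<n. (a i)\<^sup>2) / 2))"
    unfolding of_real_prod[symmetric] exp_sum[OF finite_lessThan, symmetric]
    by (simp only: sum_negf sum_divide_distrib[symmetric])
  finally show ?thesis .
qed

text \<open>To be supplied by Gram-Schmidt. \<open>ortho\<close> makes the combinations with
  coefficients \<open>c i\<close> orthonormal, and \<open>rep\<close> recovers the covariance on
  \<open>S\<close> from the projections onto them, which says that they span the values of the sheet
  on \<open>S\<close>.\<close>

locale sheet_system = sheet +
  fixes S :: "(real \<times> real) set" and n :: nat and c :: "nat \<Rightarrow> real \<times> real \<Rightarrow> real"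
  assumes S: "finite S" "S \<subseteq> I"
    and ortho: "\<And>i j. i < n \<Longrightarrow> j < n \<Longrightarrow> (\<Sum>p\<in>S. \<Sum>q\<in>S. c i p * c j q * cov p q) = (if i = j then 1 else 0)"
    and rep: "\<And>p q. p \<in> S \<Longrightarrow> q \<in> S \<Longrightarrow> cov p q = (\<Sum>i<n. (\<Sum>r\<in>S. c i r * cov p r) * (\<Sum>r\<in>S. c i r * cov r q))"
begin

text \<open>\<open>xi\<close> are independent standard normal variables that span the values of \<open>W\<close> on \<open>S\<close>, \<open>e i\<close> is the integrand
  of which \<open>xi i\<close> is the Wiener integral, \<open>ee i\<close> its primitive, and \<open>Y\<close> is the part of the sheet independent of \<open>xi\<close>.\<close>

definition xi :: "nat \<Rightarrow> 'a \<Rightarrow> real" where "xi i \<omega> = (\<Sum>p\<in>S. c i p * Wp p \<omega>)"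

definition e :: "nat \<Rightarrow> real \<times> real \<Rightarrow> real" where "e i z = (\<Sum>p\<in>S. c i p * indicator (rect p) z)"

definition ee :: "nat \<Rightarrow> real \<times> real \<Rightarrow> real" where "ee i q = (\<Sum>p\<in>S. c i p * cov p q)"

definition Y :: "real \<times> real \<Rightarrow> 'a \<Rightarrow> real" where "Y q \<omega> = Wp q \<omega> - (\<Sum>i<n. ee i q * xi i \<omega>)"

lemma cov_sym: "cov p q = cov q p" by (simp add: cov_def min.commute)

lemma sheet_lin_xi: "sheet_lin (xi i)"
  unfolding xi_def[abs_def] using S by (intro sheet_lin_sum sheet_lin_Wp) auto

lemma sheet_lin_Y: "q \<in> I \<Longrightarrow> sheet_lin (Y q)"
proof -
  assume q: "q \<in> I"
  have "Y q = (\<lambda>\<omega>. Wp q \<omega> + (-1) * (\<Sum>i<n. ee i q * xi i \<omega>))" by (auto simp: Y_def)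
  then show ?thesis using q by (simp only:) (intro sheet_lin_add sheet_lin_scale sheet_lin_Wp sheet_lin_sum sheet_lin_xi)
qed

lemma E_xi_Wp: "q \<in> I \<Longrightarrow> expectation (\<lambda>\<omega>. xi i \<omega> * Wp q \<omega>) = ee i q"
proof -
  assume q: "q \<in> I"
  have "expectation (\<lambda>\<omega>. xi i \<omega> * Wp q \<omega>) = (\<Sum>p\<in>S. c i p * expectation (\<lambda>\<omega>. Wp p \<omega> * Wp q \<omega>))"
    unfolding xi_def using S q by (intro sheet_lin_E_sum_mult sheet_lin_Wp) auto
  also have "\<dots> = ee i q" unfolding ee_def using S q by (intro sum.cong) (auto simp: E_Wp_Wp)
  finally show ?thesis .
qed

lemma E_xi_xi:
  assumes "i < n" "j < n" shows "expectation (\<lambda>\<omega>. xi i \<omega> * xi j \<omega>) = (if i = j then 1 else 0)"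
proof -
  have "expectation (\<lambda>\<omega>. xi i \<omega> * xi j \<omega>) = (\<Sum>p\<in>S. c i p * expectation (\<lambda>\<omega>. Wp p \<omega> * xi j \<omega>))"
    unfolding xi_def[of i] using S by (intro sheet_lin_E_sum_mult sheet_lin_Wp sheet_lin_xi) auto
  also have "\<dots> = (\<Sum>p\<in>S. c i p * ee j p)"
    using S by (intro sum.cong refl) (subst mult.commute[of "Wp _ _"], subst E_xi_Wp, auto)
  also have "\<dots> = (\<Sum>p\<in>S. \<Sum>q\<in>S. c i p * c j q * cov p q)"
    unfolding ee_def by (simp add: sum_distrib_left mult.assoc cov_sym)
  finally show ?thesis using ortho[OF assms] by simp
qed

lemma E_xi_Y:
  assumes q: "q \<in> I" and j: "j < n" shows "expectation (\<lambda>\<omega>. xi j \<omega> * Y q \<omega>) = 0"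
proof -
  have "expectation (\<lambda>\<omega>. xi j \<omega> * Y q \<omega>) = expectation (\<lambda>\<omega>. xi j \<omega> * Wp q \<omega> - (\<Sum>i<n. ee i q * xi i \<omega>) * xi j \<omega>)"
    by (simp add: Y_def algebra_simps)
  also have "\<dots> = expectation (\<lambda>\<omega>. xi j \<omega> * Wp q \<omega>) - expectation (\<lambda>\<omega>. (\<Sum>i<n. ee i q * xi i \<omega>) * xi j \<omega>)"
    using q by (intro Bochner_Integration.integral_diff sheet_lin_mult_integrable sheet_lin_sum sheet_lin_xi sheet_lin_Wp)
  also have "expectation (\<lambda>\<omega>. (\<Sum>i<n. ee i q * xi i \<omega>) * xi j \<omega>) = (\<Sum>i<n. ee i q * expectation (\<lambda>\<omega>. xi i \<omega> * xi j \<omega>))"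
    by (intro sheet_lin_E_sum_mult sheet_lin_xi)
  also have "\<dots> = (\<Sum>i<n. if i = j then ee j q else 0)" using j by (intro sum.cong) (auto simp: E_xi_xi)
  also have "\<dots> = ee j q" using j by simp
  finally show ?thesis using E_xi_Wp[OF q, of j] by simp
qed

text \<open>The variance of the residual \<open>Y p\<close> is \<open>cov p p\<close> minus the sum
  of the squares of \<open>ee i p\<close>, and by \<open>rep\<close> this is zero at points of
  \<open>S\<close>.\<close>

lemma Wp_eq_xi: assumes p: "p \<in> S" shows "AE \<omega> in M. Wp p \<omega> = (\<Sum>i<n. ee i p * xi i \<omega>)"
proof -
  have pI: "p \<in> I" using p S by auto
  have "expectation (\<lambda>\<omega>. (Y p \<omega>)\<^sup>2) = expectation (\<lambda>\<omega>. Wp p \<omega> * Y p \<omega> - (\<Sum>i<n. ee i p * xi i \<omega>) * Y p \<omega>)"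
    by (simp add: Y_def power2_eq_square algebra_simps)
  also have "\<dots> = expectation (\<lambda>\<omega>. Wp p \<omega> * Y p \<omega>) - expectation (\<lambda>\<omega>. (\<Sum>i<n. ee i p * xi i \<omega>) * Y p \<omega>)"
    using pI by (intro Bochner_Integration.integral_diff sheet_lin_mult_integrable sheet_lin_sum sheet_lin_xi sheet_lin_Wp sheet_lin_Y)
  also have "expectation (\<lambda>\<omega>. (\<Sum>i<n. ee i p * xi i \<omega>) * Y p \<omega>) = (\<Sum>i<n. ee i p * expectation (\<lambda>\<omega>. xi i \<omega> * Y p \<omega>))"
    using pI by (intro sheet_lin_E_sum_mult sheet_lin_xi sheet_lin_Y)
  also have "\<dots> = 0" using pI by (intro sum.neutral) (auto simp: E_xi_Y)
  also have "expectation (\<lambda>\<omega>. Wp p \<omega> * Y p \<omega>) = expectation (\<lambda>\<omega>. Wp p \<omega> * Wp p \<omega> - (\<Sum>i<n. ee i p * xi i \<omega>) * Wp p \<omega>)"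
    by (simp add: Y_def algebra_simps)
  also have "\<dots> = expectation (\<lambda>\<omega>. Wp p \<omega> * Wp p \<omega>) - expectation (\<lambda>\<omega>. (\<Sum>i<n. ee i p * xi i \<omega>) * Wp p \<omega>)"
    using pI by (intro Bochner_Integration.integral_diff sheet_lin_mult_integrable sheet_lin_sum sheet_lin_xi sheet_lin_Wp)
  also have "expectation (\<lambda>\<omega>. (\<Sum>i<n. ee i p * xi i \<omega>) * Wp p \<omega>) = (\<Sum>i<n. ee i p * expectation (\<lambda>\<omega>. xi i \<omega> * Wp p \<omega>))"
    using pI by (intro sheet_lin_E_sum_mult sheet_lin_xi sheet_lin_Wp)
  also have "\<dots> = (\<Sum>i<n. ee i p * ee i p)" using pI by (simp add: E_xi_Wp)
  also have "\<dots> = cov p p" unfolding rep[OF p p] ee_def by (simp add: cov_sym)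
  finally have "expectation (\<lambda>\<omega>. (Y p \<omega>)\<^sup>2) = 0" using E_Wp_Wp[OF pI pI] by simp
  then have "AE \<omega> in M. (Y p \<omega>)\<^sup>2 = 0"
    using sheet_lin_gaussian(2)[OF sheet_lin_Y[OF pI]] by (subst integral_nonneg_eq_0_iff_AE[symmetric]) auto
  then show ?thesis by eventually_elim (simp add: Y_def)
qed

lemma e_measurable [measurable]: "e i \<in> borel_measurable borel" unfolding e_def[abs_def] by measurable

lemma e_bounded: "\<bar>e i z\<bar> \<le> (\<Sum>p\<in>S. \<bar>c i p\<bar>)"
  unfolding e_def by (rule order_trans[OF sum_abs]) (auto intro!: sum_mono split: split_indicator)

lemma e_zero: "z \<notin> I \<Longrightarrow> e i z = 0"
  unfolding e_def using rect_subset S by (intro sum.neutral) (auto split: split_indicator)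

lemma integral_e_rect:
  assumes "q \<in> I" shows "(\<integral>z. e i z * indicator (rect q) z \<partial>lborel) = ee i q"
proof -
  have "(\<integral>z. e i z * indicator (rect q) z \<partial>lborel) = (\<integral>z. (\<Sum>p\<in>S. c i p * (indicator (rect p) z * indicator (rect q) z)) \<partial>lborel)"
    by (simp add: e_def sum_distrib_right mult.assoc)
  also have "\<dots> = (\<Sum>p\<in>S. c i p * cov p q)"
    using assms S by (subst Bochner_Integration.integral_sum) (auto simp: integral_rect_rect subset_eq intro!: integrable_mult_right)
  finally show ?thesis by (simp add: ee_def)
qed

text \<open>By the isometry the integrands have the same Gram matrix as the variables
  \<open>xi\<close>.\<close>

lemma integral_e_e:
  assumes "i < n" "j < n" shows "(\<integral>z. e i z * e j z \<partial>lborel) = (if i = j then 1 else 0)"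
proof -
  have int: "integrable lborel (\<lambda>z. c i p * (c j q * (indicator (rect p) z * indicator (rect q) z)))" if "p \<in> S" "q \<in> S" for p q
    using that S by (intro integrable_mult_right integral_rect_rect) auto
  have "(\<integral>z. e i z * e j z \<partial>lborel) = (\<integral>z. (\<Sum>p\<in>S. \<Sum>q\<in>S. c i p * (c j q * (indicator (rect p) z * indicator (rect q) z))) \<partial>lborel)"
    unfolding e_def sum_product by (simp add: mult_ac)
  also have "\<dots> = (\<Sum>p\<in>S. \<Sum>q\<in>S. \<integral>z. c i p * (c j q * (indicator (rect p) z * indicator (rect q) z)) \<partial>lborel)"
    using int by (subst Bochner_Integration.integral_sum) (auto intro!: sum.cong Bochner_Integration.integral_sum Bochner_Integration.integrable_sum)
  also have "\<dots> = (\<Sum>p\<in>S. \<Sum>q\<in>S. c i p * c j q * cov p q)"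
    using S by (intro sum.cong refl) (auto simp: integral_rect_rect subset_eq)
  finally show ?thesis using ortho[OF assms] by simp
qed

definition xiv :: "'a \<Rightarrow> nat \<Rightarrow> real" where "xiv \<omega> = (\<lambda>i\<in>{..<n}. xi i \<omega>)"

lemma xi_measurable [measurable]: "xi i \<in> borel_measurable M" by (rule sheet_lin_gaussian(1)[OF sheet_lin_xi])

lemma xiv_measurable [measurable]: "xiv \<in> measurable M (\<Pi>\<^sub>M i\<in>{..<n}. borel)"
  unfolding xiv_def[abs_def] by measurable

lemma distr_xiv: "distr M (\<Pi>\<^sub>M i\<in>{..<n}. borel) xiv = std_gaussian n"
proof -
  let ?Z = "\<lambda>i (x::nat \<Rightarrow> real). if i < n then x i else 0"
  have "distr M (\<Pi>\<^sub>M i\<in>{..<n}. borel) (\<lambda>\<omega>. \<lambda>i\<in>{..<n}. xi i \<omega>) = distr (std_gaussian n) (\<Pi>\<^sub>M i\<in>{..<n}. borel) (\<lambda>x. \<lambda>i\<in>{..<n}. ?Z i x)"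
  proof (rule distr_PiM_eqI_char)
    show "prob_space M" by unfold_locales
    show "prob_space (std_gaussian n)" by (rule prob_space_std_gaussian)
    show "?Z i \<in> borel_measurable (std_gaussian n)" for i
      by (cases "i < n") (auto cong: measurable_cong_sets intro: measurable_component_singleton)
    fix a :: "nat \<Rightarrow> real"
    let ?X = "\<lambda>\<omega>. \<Sum>i<n. a i * xi i \<omega>"
    have sl: "sheet_lin ?X" by (intro sheet_lin_sum sheet_lin_xi)
    have "expectation (\<lambda>\<omega>. (?X \<omega>)\<^sup>2) = expectation (\<lambda>\<omega>. (\<Sum>i<n. a i * xi i \<omega>) * ?X \<omega>)" by (simp add: power2_eq_square)
    also have "\<dots> = (\<Sum>i<n. a i * expectation (\<lambda>\<omega>. xi i \<omega> * ?X \<omega>))" by (intro sheet_lin_E_sum_mult sheet_lin_xi sl)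
    also have "\<dots> = (\<Sum>i<n. a i * a i)"
    proof (intro sum.cong refl)
      fix i assume i: "i \<in> {..<n}"
      have "expectation (\<lambda>\<omega>. xi i \<omega> * ?X \<omega>) = expectation (\<lambda>\<omega>. ?X \<omega> * xi i \<omega>)" by (simp add: mult.commute)
      also have "\<dots> = (\<Sum>j<n. a j * expectation (\<lambda>\<omega>. xi j \<omega> * xi i \<omega>))" by (intro sheet_lin_E_sum_mult sheet_lin_xi)
      also have "\<dots> = (\<Sum>j<n. if j = i then a i else 0)" using i by (intro sum.cong) (auto simp: E_xi_xi)
      finally show "a i * expectation (\<lambda>\<omega>. xi i \<omega> * ?X \<omega>) = a i * a i" using i by simp
    qed
    finally have "expectation (\<lambda>\<omega>. (?X \<omega>)\<^sup>2) = (\<Sum>i<n. (a i)\<^sup>2)" by (simp add: power2_eq_square)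
    moreover have "(\<Sum>i<n. a i * ?Z i x) = (\<Sum>i<n. a i * x i)" for x by (intro sum.cong) auto
    ultimately show "expectation (\<lambda>\<omega>. iexp (\<Sum>i<n. a i * xi i \<omega>)) = (\<integral>x. iexp (\<Sum>i<n. a i * ?Z i x) \<partial>std_gaussian n)"
      using sheet_lin_gaussian(3)[OF sl] char_std_gaussian[of n a] by (simp only:)
  qed simp_all
  also have "\<dots> = distr (std_gaussian n) (\<Pi>\<^sub>M i\<in>{..<n}. borel) (\<lambda>x. x)"
    by (rule distr_cong) (auto simp: space_PiM PiE_def extensional_def fun_eq_iff)
  also have "\<dots> = std_gaussian n" by (rule distr_id2) (rule sets_std_gaussian[symmetric])
  finally show ?thesis unfolding xiv_def[abs_def] .
qed

text \<open>Independence of \<open>xi\<close> and \<open>Y\<close>, expressed by evaluating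
  \<open>Y\<close> at an independent copy of the sample point. The two blocks are uncorrelated, so
  the characteristic function of the pair factors, as it does on the product space.\<close>

lemma joint_law:
  assumes R: "finite R" "R \<subseteq> I" and H: "H \<in> borel_measurable ((\<Pi>\<^sub>M i\<in>{..<n}. borel) \<Otimes>\<^sub>M (\<Pi>\<^sub>M q\<in>R. borel))"
  shows "(\<integral>\<^sup>+\<omega>. H (xiv \<omega>, \<lambda>q\<in>R. Y q \<omega>) \<partial>M) = (\<integral>\<^sup>+\<omega>'. \<integral>\<^sup>+\<omega>. H (xiv \<omega>, \<lambda>q\<in>R. Y q \<omega>') \<partial>M \<partial>M)"
proof -
  interpret P: pair_prob_space M M ..
  define Z :: "nat + real \<times> real \<Rightarrow> 'a \<Rightarrow> real" where
    "Z j \<omega> = (case j of Inl i \<Rightarrow> xi i \<omega> | Inr q \<Rightarrow> if q \<in> R then Y q \<omega> else 0)" for j \<omega>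
  \<comment> \<open>The second component of the product drives \<open>xi\<close> and the first
    drives \<open>Y\<close>, in the order of the iterated integrals of the claim.\<close>
  define Z' :: "nat + real \<times> real \<Rightarrow> 'a \<times> 'a \<Rightarrow> real" where
    "Z' j \<omega> = (case j of Inl i \<Rightarrow> xi i (snd \<omega>) | Inr q \<Rightarrow> if q \<in> R then Y q (fst \<omega>) else 0)" for j \<omega>
  let ?J = "{..<n} <+> R"
  have Ym [measurable]: "Y q \<in> borel_measurable M" if "q \<in> R" for q using that R by (intro sheet_lin_gaussian(1) sheet_lin_Y) auto
  have Zm [measurable]: "Z j \<in> borel_measurable M" for j
  proof (cases j)
    case (Inr q) then show ?thesis unfolding Z_def[abs_def] using Ym[of q] by (cases "q \<in> R") auto
  qed (auto simp: Z_def[abs_def])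
  have Z'm [measurable]: "Z' j \<in> borel_measurable (M \<Otimes>\<^sub>M M)" for j
  proof (cases j)
    case (Inr q) then show ?thesis unfolding Z'_def[abs_def] using measurable_compose[OF measurable_fst Ym[of q]] by (cases "q \<in> R") auto
  qed (auto simp: Z'_def[abs_def])
  have split: "(\<Sum>j\<in>?J. f j) = (\<Sum>i<n. f (Inl i)) + (\<Sum>q\<in>R. f (Inr q))" for f :: "nat + real \<times> real \<Rightarrow> real"
    using R(1) by (simp add: sum.Plus)
  have "distr M (\<Pi>\<^sub>M j\<in>?J. borel) (\<lambda>\<omega>. \<lambda>j\<in>?J. Z j \<omega>) = distr (M \<Otimes>\<^sub>M M) (\<Pi>\<^sub>M j\<in>?J. borel) (\<lambda>\<omega>. \<lambda>j\<in>?J. Z' j \<omega>)"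
  proof (rule distr_PiM_eqI_char)
    show "prob_space M" by unfold_locales
    show "prob_space (M \<Otimes>\<^sub>M M)" by unfold_locales
    show "finite ?J" using R by (intro finite_Plus) auto
    fix a :: "nat + real \<times> real \<Rightarrow> real"
    let ?X = "\<lambda>\<omega>. \<Sum>i<n. a (Inl i) * xi i \<omega>" and ?Y = "\<lambda>\<omega>. \<Sum>q\<in>R. a (Inr q) * Y q \<omega>"
    have sX: "sheet_lin ?X" by (intro sheet_lin_sum sheet_lin_xi)
    have sY: "sheet_lin ?Y" using R by (intro sheet_lin_sum sheet_lin_Y) auto
    note [measurable] = sheet_lin_gaussian(1)[OF sX] sheet_lin_gaussian(1)[OF sY]
    have "expectation (\<lambda>\<omega>. ?X \<omega> * ?Y \<omega>) = (\<Sum>i<n. a (Inl i) * expectation (\<lambda>\<omega>. xi i \<omega> * ?Y \<omega>))"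
      by (intro sheet_lin_E_sum_mult sheet_lin_xi sY)
    also have "\<dots> = 0"
    proof (intro sum.neutral ballI)
      fix i assume i: "i \<in> {..<n}"
      have "expectation (\<lambda>\<omega>. xi i \<omega> * ?Y \<omega>) = expectation (\<lambda>\<omega>. ?Y \<omega> * xi i \<omega>)" by (simp add: mult.commute)
      also have "\<dots> = (\<Sum>q\<in>R. a (Inr q) * expectation (\<lambda>\<omega>. Y q \<omega> * xi i \<omega>))"
        using R by (intro sheet_lin_E_sum_mult sheet_lin_xi sheet_lin_Y) auto
      also have "\<dots> = 0" using R i E_xi_Y by (intro sum.neutral) (auto simp: mult.commute)
      finally show "a (Inl i) * expectation (\<lambda>\<omega>. xi i \<omega> * ?Y \<omega>) = 0" by simp
    qed
    finally have o: "expectation (\<lambda>\<omega>. ?X \<omega> * ?Y \<omega>) = 0" .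
    have Zs: "(\<Sum>j\<in>?J. a j * Z j \<omega>) = ?X \<omega> + ?Y \<omega>" for \<omega> unfolding split by (simp add: Z_def)
    have Zs': "(\<Sum>j\<in>?J. a j * Z' j \<omega>) = ?X (snd \<omega>) + ?Y (fst \<omega>)" for \<omega> unfolding split by (simp add: Z'_def)
    have [measurable]: "(\<lambda>\<omega>. iexp (?X (snd \<omega>) + ?Y (fst \<omega>))) \<in> borel_measurable (M \<Otimes>\<^sub>M M)" by measurable
    have int: "integrable (M \<Otimes>\<^sub>M M) (\<lambda>\<omega>. iexp (?X (snd \<omega>) + ?Y (fst \<omega>)))"
      by (rule P.integrable_const_bound[where B=1]) (auto simp del: of_real_add of_real_sum)
    have "(\<integral>\<omega>. iexp (?X (snd \<omega>) + ?Y (fst \<omega>)) \<partial>(M \<Otimes>\<^sub>M M)) = (\<integral>\<omega>1. \<integral>\<omega>2. iexp (?X \<omega>2 + ?Y \<omega>1) \<partial>M \<partial>M)"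
      using P.integral_fst'[OF int] by (simp only: fst_conv snd_conv)
    also have "\<dots> = (\<integral>\<omega>1. (\<integral>\<omega>2. iexp (?X \<omega>2) \<partial>M) * iexp (?Y \<omega>1) \<partial>M)"
      by (simp add: distrib_left exp_add del: of_real_sum)
    also have "\<dots> = (\<integral>\<omega>2. iexp (?X \<omega>2) \<partial>M) * (\<integral>\<omega>1. iexp (?Y \<omega>1) \<partial>M)" by (simp del: of_real_sum)
    finally have "(\<integral>\<omega>. iexp (?X (snd \<omega>) + ?Y (fst \<omega>)) \<partial>(M \<Otimes>\<^sub>M M)) = (\<integral>\<omega>2. iexp (?X \<omega>2) \<partial>M) * (\<integral>\<omega>1. iexp (?Y \<omega>1) \<partial>M)" .
    then show "expectation (\<lambda>\<omega>. iexp (\<Sum>j\<in>?J. a j * Z j \<omega>)) = (\<integral>\<omega>. iexp (\<Sum>j\<in>?J. a j * Z' j \<omega>) \<partial>(M \<Otimes>\<^sub>M M))"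
      unfolding Zs Zs' using sheet_lin_iexp_orthogonal[OF sX sY o] by (simp only:)
  qed (auto simp: Zm Z'm)
  note law = this
  let ?K = "(\<Pi>\<^sub>M i\<in>{..<n}. borel) \<Otimes>\<^sub>M (\<Pi>\<^sub>M q\<in>R. borel) :: ((nat \<Rightarrow> real) \<times> (real \<times> real \<Rightarrow> real)) measure"
  define \<phi> where "\<phi> z = ((\<lambda>i\<in>{..<n}. z (Inl i)), (\<lambda>q\<in>R. z (Inr q)))" for z :: "nat + real \<times> real \<Rightarrow> real"
  have \<phi> [measurable]: "\<phi> \<in> measurable (\<Pi>\<^sub>M j\<in>?J. borel) ?K"
    unfolding \<phi>_def[abs_def]
    by (intro measurable_Pair measurable_restrict measurable_component_singleton) auto
  note [measurable] = H
  have m1: "(\<lambda>\<omega>. \<lambda>j\<in>?J. Z j \<omega>) \<in> measurable M (\<Pi>\<^sub>M j\<in>?J. borel)" by (intro measurable_restrict Zm)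
  have m2: "(\<lambda>\<omega>. \<lambda>j\<in>?J. Z' j \<omega>) \<in> measurable (M \<Otimes>\<^sub>M M) (\<Pi>\<^sub>M j\<in>?J. borel)" by (intro measurable_restrict Z'm)
  have e1: "\<phi> (\<lambda>j\<in>?J. Z j \<omega>) = (xiv \<omega>, \<lambda>q\<in>R. Y q \<omega>)" for \<omega>
    by (auto simp: \<phi>_def Z_def xiv_def restrict_def fun_eq_iff)
  have e2: "\<phi> (\<lambda>j\<in>?J. Z' j \<omega>) = (xiv (snd \<omega>), \<lambda>q\<in>R. Y q (fst \<omega>))" for \<omega>
    by (auto simp: \<phi>_def Z'_def xiv_def restrict_def fun_eq_iff)
  have "(\<integral>\<^sup>+\<omega>. H (xiv \<omega>, \<lambda>q\<in>R. Y q \<omega>) \<partial>M) = (\<integral>\<^sup>+z. H (\<phi> z) \<partial>distr M (\<Pi>\<^sub>M j\<in>?J. borel) (\<lambda>\<omega>. \<lambda>j\<in>?J. Z j \<omega>))"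
    by (subst nn_integral_distr[OF m1]) (auto simp: e1)
  also have "\<dots> = (\<integral>\<^sup>+\<omega>. H (\<phi> (\<lambda>j\<in>?J. Z' j \<omega>)) \<partial>(M \<Otimes>\<^sub>M M))"
    unfolding law by (subst nn_integral_distr[OF m2]) auto
  also have "\<dots> = (\<integral>\<^sup>+\<omega>1. \<integral>\<^sup>+\<omega>2. H (\<phi> (\<lambda>j\<in>?J. Z' j (\<omega>1, \<omega>2))) \<partial>M \<partial>M)"
    using measurable_compose[OF m2 measurable_compose[OF \<phi> H]] by (intro nn_integral_fst[symmetric]) auto
  finally show ?thesis unfolding e2 by simp
qed

text \<open>The sheet is \<open>Y\<close> plus the sum of \<open>xi i\<close> times
  \<open>ee i\<close>. Moving \<open>xi\<close> to its image under the transport leaves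
  \<open>Y\<close> alone and shifts the sheet by a combination of the \<open>ee i\<close>, with the
  displacements \<open>d i\<close> as coefficients. As the density depends on \<open>xi\<close> only
  and \<open>Y\<close> is independent of it, the shifted sheet has the tilted law.\<close>

lemma shift_law:
  assumes Fm [measurable]: "F \<in> borel_measurable (\<Pi>\<^sub>M i\<in>{..<n}. borel)" and c0: "0 < c0" and F: "\<And>x. c0 \<le> F x" "\<And>x. F x \<le> C0"
    and F1: "expectation (\<lambda>\<omega>. F (xiv \<omega>)) = 1"
  shows "\<exists>d. (\<forall>i<n. d i \<in> borel_measurable M) \<and>
    distr M (\<Pi>\<^sub>M q\<in>I. borel) (\<lambda>\<omega>. \<lambda>q\<in>I. Wp q \<omega> + (\<Sum>i<n. d i \<omega> * ee i q)) =
    distr (density M (\<lambda>\<omega>. ennreal (F (xiv \<omega>)))) (\<Pi>\<^sub>M q\<in>I. borel) (\<lambda>\<omega>. \<lambda>q\<in>I. Wp q \<omega>) \<and>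
    (\<integral>\<^sup>+\<omega>. (\<Sum>i<n. ennreal ((d i \<omega>)\<^sup>2)) \<partial>M) \<le> ennreal (2 * expectation (\<lambda>\<omega>. F (xiv \<omega>) * ln (F (xiv \<omega>))))"
proof -
  let ?P = "(\<Pi>\<^sub>M i\<in>{..<n}. borel) :: (nat \<Rightarrow> real) measure"
  have int_eq: "(\<integral>x. h x \<partial>std_gaussian n) = expectation (\<lambda>\<omega>. h (xiv \<omega>))" if [measurable]: "h \<in> borel_measurable ?P" for h :: "_ \<Rightarrow> real"
    unfolding distr_xiv[symmetric] by (subst integral_distr) auto
  have nn_eq: "(\<integral>\<^sup>+x. h x \<partial>std_gaussian n) = (\<integral>\<^sup>+\<omega>. h (xiv \<omega>) \<partial>M)" if [measurable]: "h \<in> borel_measurable ?P" for h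
    unfolding distr_xiv[symmetric] by (subst nn_integral_distr) auto
  have "(\<integral>x. F x \<partial>std_gaussian n) = 1" using int_eq[OF Fm] F1 by simp
  from gaussian_transport_entropy[OF Fm c0 F this] obtain T where T [measurable]: "T \<in> measurable ?P ?P"
    and Td: "distr (std_gaussian n) ?P T = density (std_gaussian n) (\<lambda>x. ennreal (F x))"
    and Tc: "(\<integral>\<^sup>+x. (\<Sum>i<n. ennreal ((T x i - x i)\<^sup>2)) \<partial>std_gaussian n) \<le> ennreal (2 * (\<integral>x. F x * ln (F x) \<partial>std_gaussian n))"
    by blast
  define d where "d i \<omega> = T (xiv \<omega>) i - xi i \<omega>" for i \<omega>
  have comp [measurable]: "(\<lambda>x. x i) \<in> borel_measurable ?P" if "i < n" for i using that by (intro measurable_component_singleton) auto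
  have Ti: "(\<lambda>x. T x i) \<in> borel_measurable ?P" if "i < n" for i using measurable_compose[OF T comp[OF that]] .
  have dm: "d i \<in> borel_measurable M" if "i < n" for i
    unfolding d_def[abs_def] using measurable_compose[OF xiv_measurable Ti[OF that]] by simp
  have Tint: "(\<integral>\<^sup>+\<omega>. h (T (xiv \<omega>)) \<partial>M) = (\<integral>\<^sup>+\<omega>. ennreal (F (xiv \<omega>)) * h (xiv \<omega>) \<partial>M)"
    if [measurable]: "h \<in> borel_measurable ?P" for h
  proof -
    have "(\<integral>\<^sup>+\<omega>. h (T (xiv \<omega>)) \<partial>M) = (\<integral>\<^sup>+x. h x \<partial>distr (std_gaussian n) ?P T)"
      by (subst nn_integral_distr) (auto simp: nn_eq)
    also have "\<dots> = (\<integral>\<^sup>+x. ennreal (F x) * h x \<partial>std_gaussian n)"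
      unfolding Td by (subst nn_integral_density) auto
    finally show ?thesis by (simp add: nn_eq)
  qed
  have Wm [measurable]: "(\<lambda>\<omega>. \<lambda>q\<in>I. Wp q \<omega>) \<in> measurable M (\<Pi>\<^sub>M q\<in>I. borel)"
    by (intro measurable_restrict Wp_measurable)
  have W'm [measurable]: "(\<lambda>\<omega>. \<lambda>q\<in>I. Wp q \<omega> + (\<Sum>i<n. d i \<omega> * ee i q)) \<in> measurable M (\<Pi>\<^sub>M q\<in>I. borel)"
    by (intro measurable_restrict borel_measurable_add borel_measurable_sum borel_measurable_times Wp_measurable dm) auto
  have cost: "(\<integral>\<^sup>+\<omega>. (\<Sum>i<n. ennreal ((d i \<omega>)\<^sup>2)) \<partial>M) \<le> ennreal (2 * expectation (\<lambda>\<omega>. F (xiv \<omega>) * ln (F (xiv \<omega>))))"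
  proof -
    have "(\<integral>\<^sup>+\<omega>. (\<Sum>i<n. ennreal ((d i \<omega>)\<^sup>2)) \<partial>M) = (\<integral>\<^sup>+\<omega>. (\<Sum>i<n. ennreal ((T (xiv \<omega>) i - xiv \<omega> i)\<^sup>2)) \<partial>M)"
      by (simp add: d_def xiv_def)
    also have "\<dots> = (\<integral>\<^sup>+x. (\<Sum>i<n. ennreal ((T x i - x i)\<^sup>2)) \<partial>std_gaussian n)"
      using Ti comp by (intro nn_eq[symmetric]) (auto intro!: borel_measurable_sum measurable_compose[OF _ measurable_ennreal] borel_measurable_power borel_measurable_diff)
    finally show ?thesis using Tc int_eq[of "\<lambda>x. F x * ln (F x)"] by simp
  qed
  have law: "distr M (\<Pi>\<^sub>M q\<in>I. borel) (\<lambda>\<omega>. \<lambda>q\<in>I. Wp q \<omega> + (\<Sum>i<n. d i \<omega> * ee i q)) =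
    distr (density M (\<lambda>\<omega>. ennreal (F (xiv \<omega>)))) (\<Pi>\<^sub>M q\<in>I. borel) (\<lambda>\<omega>. \<lambda>q\<in>I. Wp q \<omega>)" (is "?L = ?R")
  proof (rule measure_eqI_PiM_infinite)
    fix A :: "real \<times> real \<Rightarrow> real set" and J assume J: "finite J" "J \<subseteq> I" and A: "\<And>i. i \<in> J \<Longrightarrow> A i \<in> sets borel"
    let ?E = "prod_emb I (\<lambda>_. borel) J (Pi\<^sub>E J A)" and ?Q = "\<Pi>\<^sub>M q\<in>J. borel :: real measure"
    have A': "Pi\<^sub>E J A \<in> sets ?Q" using J A by (intro sets_PiM_I_finite) auto
    have E: "?E \<in> sets (\<Pi>\<^sub>M q\<in>I. borel)" using J A' by (intro sets_PiM_I) (auto intro: A)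
    \<comment> \<open>The indicator of the cylinder as a function of coordinates and residual; both
      laws are expressed by it.\<close>
    define \<Psi> :: "(nat \<Rightarrow> real) \<times> (real \<times> real \<Rightarrow> real) \<Rightarrow> ennreal" where
      "\<Psi> z = indicator (Pi\<^sub>E J A) (\<lambda>q\<in>J. snd z q + (\<Sum>i<n. fst z i * ee i q))" for z
    have \<Psi>m [measurable]: "\<Psi> \<in> borel_measurable (?P \<Otimes>\<^sub>M ?Q)"
    proof -
      have "(\<lambda>z. \<lambda>q\<in>J. snd z q + (\<Sum>i<n. fst z i * ee i q)) \<in> measurable (?P \<Otimes>\<^sub>M ?Q) ?Q"
        by (intro measurable_restrict borel_measurable_add borel_measurable_sum borel_measurable_times
            measurable_compose[OF measurable_fst comp] measurable_compose[OF measurable_snd measurable_component_singleton]) auto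
      from measurable_compose[OF this borel_measurable_indicator[OF A']] show ?thesis by (simp add: \<Psi>_def[abs_def])
    qed
    have ind: "indicator ?E (\<lambda>q\<in>I. f q) = (indicator (Pi\<^sub>E J A) (\<lambda>q\<in>J. f q) :: ennreal)" for f :: "real \<times> real \<Rightarrow> real"
      using J by (auto simp: indicator_def prod_emb_def PiE_def Pi_def space_PiM extensional_def)
    have W_eq: "Wp q \<omega> = Y q \<omega> + (\<Sum>i<n. xiv \<omega> i * ee i q)" for q \<omega> by (simp add: Y_def xiv_def mult.commute)
    have W'_eq: "Wp q \<omega> + (\<Sum>i<n. d i \<omega> * ee i q) = Y q \<omega> + (\<Sum>i<n. T (xiv \<omega>) i * ee i q)" for q \<omega>
      by (simp add: Y_def d_def left_diff_distrib sum_subtractf mult.commute[of "xi _ _"])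
    have Ym: "(\<lambda>\<omega>. \<lambda>q\<in>J. Y q \<omega>) \<in> measurable M ?Q"
      using J by (intro measurable_restrict sheet_lin_gaussian(1) sheet_lin_Y) auto
    have Ysp: "(\<lambda>q\<in>J. Y q \<omega>) \<in> space ?Q" for \<omega> by (simp add: space_PiM)
    have res: "(\<lambda>q\<in>J. snd (a, \<lambda>q\<in>J. Y q \<omega>) q + b q) = (\<lambda>q\<in>J. Y q \<omega> + b q)" for a :: "nat \<Rightarrow> real" and \<omega> b by (auto simp: restrict_def)
    have "emeasure ?L ?E = (\<integral>\<^sup>+z. indicator ?E z \<partial>?L)" using E by simp
    also have "\<dots> = (\<integral>\<^sup>+\<omega>. indicator ?E (\<lambda>q\<in>I. Wp q \<omega> + (\<Sum>i<n. d i \<omega> * ee i q)) \<partial>M)"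
      using E by (subst nn_integral_distr[OF W'm]) auto
    also have "\<dots> = (\<integral>\<^sup>+\<omega>. \<Psi> (T (xiv \<omega>), \<lambda>q\<in>J. Y q \<omega>) \<partial>M)"
      unfolding ind W'_eq \<Psi>_def res by simp
    also have "\<dots> = (\<integral>\<^sup>+\<omega>. (\<lambda>z. \<Psi> (T (fst z), snd z)) (xiv \<omega>, \<lambda>q\<in>J. Y q \<omega>) \<partial>M)" by simp
    also have "\<dots> = (\<integral>\<^sup>+\<omega>'. \<integral>\<^sup>+\<omega>. (\<lambda>z. \<Psi> (T (fst z), snd z)) (xiv \<omega>, \<lambda>q\<in>J. Y q \<omega>') \<partial>M \<partial>M)"
      by (rule joint_law[OF J]) measurable
    \<comment> \<open>With the residual frozen at an independent copy, the transport acts on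
      \<open>xi\<close> alone and produces the factor \<open>F\<close>.\<close>
    also have "\<dots> = (\<integral>\<^sup>+\<omega>'. \<integral>\<^sup>+\<omega>. ennreal (F (xiv \<omega>)) * \<Psi> (xiv \<omega>, \<lambda>q\<in>J. Y q \<omega>') \<partial>M \<partial>M)"
    proof (rule nn_integral_cong)
      fix \<omega>'
      have "(\<lambda>x. \<Psi> (x, \<lambda>q\<in>J. Y q \<omega>')) \<in> borel_measurable ?P" using Ysp by measurable
      from Tint[OF this] show "(\<integral>\<^sup>+\<omega>. (\<lambda>z. \<Psi> (T (fst z), snd z)) (xiv \<omega>, \<lambda>q\<in>J. Y q \<omega>') \<partial>M) = (\<integral>\<^sup>+\<omega>. ennreal (F (xiv \<omega>)) * \<Psi> (xiv \<omega>, \<lambda>q\<in>J. Y q \<omega>') \<partial>M)"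
        by simp
    qed
    also have "\<dots> = (\<integral>\<^sup>+\<omega>'. \<integral>\<^sup>+\<omega>. (\<lambda>z. ennreal (F (fst z)) * \<Psi> z) (xiv \<omega>, \<lambda>q\<in>J. Y q \<omega>') \<partial>M \<partial>M)" by simp
    also have "\<dots> = (\<integral>\<^sup>+\<omega>. (\<lambda>z. ennreal (F (fst z)) * \<Psi> z) (xiv \<omega>, \<lambda>q\<in>J. Y q \<omega>) \<partial>M)"
      by (rule joint_law[OF J, symmetric]) measurable
    also have "\<dots> = (\<integral>\<^sup>+\<omega>. ennreal (F (xiv \<omega>)) * indicator ?E (\<lambda>q\<in>I. Wp q \<omega>) \<partial>M)"
      unfolding ind W_eq \<Psi>_def res by simp
    also have "\<dots> = (\<integral>\<^sup>+\<omega>. indicator ?E (\<lambda>q\<in>I. Wp q \<omega>) \<partial>density M (\<lambda>\<omega>. ennreal (F (xiv \<omega>))))"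
      using E Wm by (subst nn_integral_density) auto
    also have "\<dots> = (\<integral>\<^sup>+z. indicator ?E z \<partial>?R)"
      using E Wm by (subst nn_integral_distr) auto
    also have "\<dots> = emeasure ?R ?E" using E by simp
    finally show "emeasure ?L ?E = emeasure ?R ?E" .
  next
    interpret L: prob_space ?L by (rule prob_space_distr[OF W'm])
    show "finite_measure ?L" by unfold_locales
  qed auto
  show ?thesis using dm law cost by blast
qed

end

section \<open>Densities that depend on finitely many values of the sheet\<close>

context sheet begin

text \<open>The density is rewritten in orthonormal coordinates, which is possible up to a null set.
  The functions \<open>e i\<close> are bounded, vanish off the rectangle and are orthonormal in L2,
  so the sum of the squares of the \<open>d i\<close> is the squared L2 norm of the shift density,
  the quantity that enters the stability estimate.\<close>

theorem cylinder_shift: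
  assumes S: "finite S" "S \<subseteq> I" and Fm [measurable]: "F \<in> borel_measurable (\<Pi>\<^sub>M p\<in>S. borel)"
    and c0: "0 < c0" and F: "\<And>x. c0 \<le> F x" "\<And>x. F x \<le> C0"
    and F1: "expectation (\<lambda>\<omega>. F (\<lambda>p\<in>S. Wp p \<omega>)) = 1"
  shows "\<exists>(n::nat) e d B. (\<forall>i. e i \<in> borel_measurable borel) \<and> (\<forall>i<n. \<forall>z. \<bar>e i z\<bar> \<le> B) \<and> (\<forall>i. \<forall>z. z \<notin> I \<longrightarrow> e i z = 0) \<and>
    (\<forall>i<n. \<forall>j<n. (\<integral>z. e i z * e j z \<partial>lborel) = (if i = j then 1 else 0)) \<and>
    (\<forall>i<n. d i \<in> borel_measurable M) \<and>
    distr M (\<Pi>\<^sub>M q\<in>I. borel) (\<lambda>\<omega>. \<lambda>q\<in>I. Wp q \<omega> + (\<Sum>i<n. d i \<omega> * (\<integral>z. e i z * indicator (rect q) z \<partial>lborel))) =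
    distr (density M (\<lambda>\<omega>. ennreal (F (\<lambda>p\<in>S. Wp p \<omega>)))) (\<Pi>\<^sub>M q\<in>I. borel) (\<lambda>\<omega>. \<lambda>q\<in>I. Wp q \<omega>) \<and>
    (\<integral>\<^sup>+\<omega>. (\<Sum>i<n. ennreal ((d i \<omega>)\<^sup>2)) \<partial>M)
      \<le> ennreal (2 * expectation (\<lambda>\<omega>. F (\<lambda>p\<in>S. Wp p \<omega>) * ln (F (\<lambda>p\<in>S. Wp p \<omega>))))"
proof -
  define B where "B c d = (\<Sum>p\<in>S. \<Sum>q\<in>S. c p * d q * cov p q)" for c d
  have Bsym: "B c d = B d c" for c d
    unfolding B_def by (subst sum.swap) (simp add: cov_def min.commute mult_ac)
  have Blin: "B (\<lambda>p. c p + r * d p) f = B c f + r * B d f" for c d f r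
    unfolding B_def by (simp add: sum_distrib_left sum.distrib[symmetric] algebra_simps)
  \<comment> \<open>\<open>B c c\<close> is the second moment of a combination of values of the
    sheet.\<close>
  have Bpsd: "0 \<le> B c c" for c
  proof -
    have "expectation (\<lambda>\<omega>. (\<Sum>p\<in>S. c p * Wp p \<omega>) * (\<Sum>p\<in>S. c p * Wp p \<omega>)) = (\<Sum>p\<in>S. c p * expectation (\<lambda>\<omega>. Wp p \<omega> * (\<Sum>p\<in>S. c p * Wp p \<omega>)))"
      using S by (intro sheet_lin_E_sum_mult sheet_lin_Wp sheet_lin_sum) auto
    also have "\<dots> = (\<Sum>p\<in>S. c p * (\<Sum>q\<in>S. c q * cov p q))"
    proof (intro sum.cong refl arg_cong[where f="\<lambda>x. _ * x"])
      fix p assume p: "p \<in> S"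
      have "expectation (\<lambda>\<omega>. Wp p \<omega> * (\<Sum>p\<in>S. c p * Wp p \<omega>)) = expectation (\<lambda>\<omega>. (\<Sum>p\<in>S. c p * Wp p \<omega>) * Wp p \<omega>)" by (simp add: mult.commute)
      also have "\<dots> = (\<Sum>q\<in>S. c q * expectation (\<lambda>\<omega>. Wp q \<omega> * Wp p \<omega>))"
        using S p by (intro sheet_lin_E_sum_mult sheet_lin_Wp) auto
      also have "\<dots> = (\<Sum>q\<in>S. c q * cov p q)"
        by (intro sum.cong refl) (simp add: E_Wp_Wp[OF subsetD[OF S(2)] subsetD[OF S(2) p]], simp add: cov_def min.commute)
      finally show "expectation (\<lambda>\<omega>. Wp p \<omega> * (\<Sum>p\<in>S. c p * Wp p \<omega>)) = (\<Sum>q\<in>S. c q * cov p q)" .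
    qed
    also have "\<dots> = B c c" unfolding B_def by (simp add: sum_distrib_left mult.assoc)
    finally have "B c c = expectation (\<lambda>\<omega>. (\<Sum>p\<in>S. c p * Wp p \<omega>) * (\<Sum>p\<in>S. c p * Wp p \<omega>))" by (rule sym)
    also have "0 \<le> \<dots>" by (rule Bochner_Integration.integral_nonneg) (rule zero_le_square)
    finally show ?thesis .
  qed
  obtain n :: nat and c where on: "\<And>i j. i < n \<Longrightarrow> j < n \<Longrightarrow> B (c i) (c j) = (if i = j then 1 else 0)"
    and rep: "\<And>p d. p \<in> S \<Longrightarrow> B (indicator {p}) d = (\<Sum>i<n. B (indicator {p}) (c i) * B (c i) d)"
    using gram_schmidt_form[of B S, OF Blin Bsym Bpsd S(1)] by meson
  have Bi: "B (indicator {p}) d = (\<Sum>q\<in>S. d q * cov p q)" if p: "p \<in> S" for p d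
  proof -
    have "B (indicator {p}) d = (\<Sum>r\<in>S. if r = p then (\<Sum>q\<in>S. d q * cov p q) else 0)"
      unfolding B_def by (intro sum.cong) (auto simp: indicator_def)
    then show ?thesis using S p by simp
  qed
  interpret sys: sheet_system M T D W S n c
  proof
    show "(\<Sum>p\<in>S. \<Sum>q\<in>S. c i p * c j q * cov p q) = (if i = j then 1 else 0)" if "i < n" "j < n" for i j
      using on[OF that] by (simp add: B_def)
    show "cov p q = (\<Sum>i<n. (\<Sum>r\<in>S. c i r * cov p r) * (\<Sum>r\<in>S. c i r * cov r q))" if p: "p \<in> S" and q: "q \<in> S" for p q
    proof -
      have "cov p q = B (indicator {p}) (indicator {q})"
        unfolding Bi[OF p] using S q by (simp add: indicator_def if_distrib[of "\<lambda>x. x * _"] cong: if_cong)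
      also have "\<dots> = (\<Sum>i<n. B (indicator {p}) (c i) * B (c i) (indicator {q}))" by (rule rep[OF p])
      also have "\<dots> = (\<Sum>i<n. (\<Sum>r\<in>S. c i r * cov p r) * (\<Sum>r\<in>S. c i r * cov r q))"
        using Bi[OF p] Bi[OF q] Bsym by (simp add: cov_def min.commute)
      finally show ?thesis .
    qed
  qed (use S in auto)
  \<comment> \<open>\<open>F\<close> as a function of the coordinates: on \<open>S\<close> the sheet
    is almost surely its expansion in the \<open>xi i\<close>.\<close>
  define G where "G x = F (\<lambda>p\<in>S. \<Sum>i<n. sys.ee i p * x i)" for x
  have Gm [measurable]: "G \<in> borel_measurable (\<Pi>\<^sub>M i\<in>{..<n}. borel)"
  proof -
    have "(\<lambda>x. \<lambda>p\<in>S. \<Sum>i<n. sys.ee i p * x i) \<in> measurable (\<Pi>\<^sub>M i\<in>{..<n}. borel) (\<Pi>\<^sub>M p\<in>S. borel)"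
      by (intro measurable_restrict borel_measurable_sum borel_measurable_times measurable_component_singleton) auto
    from measurable_compose[OF this Fm] show ?thesis by (simp add: G_def[abs_def])
  qed
  have "AE \<omega> in M. \<forall>p\<in>S. Wp p \<omega> = (\<Sum>i<n. sys.ee i p * sys.xi i \<omega>)"
    using S sys.Wp_eq_xi by (intro AE_finite_allI) auto
  then have ae: "AE \<omega> in M. F (\<lambda>p\<in>S. Wp p \<omega>) = G (sys.xiv \<omega>)"
  proof eventually_elim
    case (elim \<omega>)
    then have "(\<lambda>p\<in>S. Wp p \<omega>) = (\<lambda>p\<in>S. \<Sum>i<n. sys.ee i p * sys.xiv \<omega> i)" by (auto simp: sys.xiv_def restrict_def)
    then show ?case by (simp add: G_def)
  qed
  have Wm [measurable]: "(\<lambda>\<omega>. \<lambda>q\<in>I. Wp q \<omega>) \<in> measurable M (\<Pi>\<^sub>M q\<in>I. borel)"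
    by (intro measurable_restrict Wp_measurable)
  have FWm [measurable]: "(\<lambda>\<omega>. F (\<lambda>p\<in>S. Wp p \<omega>)) \<in> borel_measurable M"
    using S by (intro measurable_compose[OF _ Fm] measurable_restrict Wp_measurable) auto
  have "expectation (\<lambda>\<omega>. G (sys.xiv \<omega>)) = expectation (\<lambda>\<omega>. F (\<lambda>p\<in>S. Wp p \<omega>))"
    using ae by (intro integral_cong_AE) auto
  then have G1: "expectation (\<lambda>\<omega>. G (sys.xiv \<omega>)) = 1" using F1 by simp
  have Gb: "c0 \<le> G x" "G x \<le> C0" for x using F by (auto simp: G_def)
  from sys.shift_law[OF Gm c0 Gb G1] obtain d where dm: "\<And>i. i < n \<Longrightarrow> d i \<in> borel_measurable M"
    and law: "distr M (\<Pi>\<^sub>M q\<in>I. borel) (\<lambda>\<omega>. \<lambda>q\<in>I. Wp q \<omega> + (\<Sum>i<n. d i \<omega> * sys.ee i q)) =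
      distr (density M (\<lambda>\<omega>. ennreal (G (sys.xiv \<omega>)))) (\<Pi>\<^sub>M q\<in>I. borel) (\<lambda>\<omega>. \<lambda>q\<in>I. Wp q \<omega>)"
    and cost: "(\<integral>\<^sup>+\<omega>. (\<Sum>i<n. ennreal ((d i \<omega>)\<^sup>2)) \<partial>M) \<le> ennreal (2 * expectation (\<lambda>\<omega>. G (sys.xiv \<omega>) * ln (G (sys.xiv \<omega>))))"
    by blast
  have dens: "density M (\<lambda>\<omega>. ennreal (G (sys.xiv \<omega>))) = density M (\<lambda>\<omega>. ennreal (F (\<lambda>p\<in>S. Wp p \<omega>)))"
    using ae by (intro density_cong) (auto elim: eventually_mono)
  have ent: "expectation (\<lambda>\<omega>. G (sys.xiv \<omega>) * ln (G (sys.xiv \<omega>))) = expectation (\<lambda>\<omega>. F (\<lambda>p\<in>S. Wp p \<omega>) * ln (F (\<lambda>p\<in>S. Wp p \<omega>)))"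
    using ae by (intro integral_cong_AE) (auto elim: eventually_mono)
  have W': "(\<lambda>\<omega>. \<lambda>q\<in>I. Wp q \<omega> + (\<Sum>i<n. d i \<omega> * (\<integral>z. sys.e i z * indicator (rect q) z \<partial>lborel))) = (\<lambda>\<omega>. \<lambda>q\<in>I. Wp q \<omega> + (\<Sum>i<n. d i \<omega> * sys.ee i q))"
    by (auto simp: fun_eq_iff restrict_def sys.integral_e_rect)
  have bd: "\<bar>sys.e i z\<bar> \<le> (\<Sum>j<n. \<Sum>p\<in>S. \<bar>c j p\<bar>)" if "i < n" for i z
    by (rule order_trans[OF sys.e_bounded]) (use that in \<open>auto intro!: member_le_sum sum_nonneg\<close>)
  show ?thesis
    by (intro exI[of _ n] exI[of _ sys.e] exI[of _ d] exI[of _ "\<Sum>j<n. \<Sum>p\<in>S. \<bar>c j p\<bar>"] conjI)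
      (use bd dm law cost in \<open>auto simp: W' dens ent sys.e_zero sys.integral_e_e\<close>)
qed

end

section \<open>The path space\<close>

lemma sets_Collect_ball_countable:
  assumes X: "countable X" and P: "\<And>i. i \<in> X \<Longrightarrow> {x \<in> space M. P i x} \<in> sets M"
  shows "{x \<in> space M. \<forall>i\<in>X. P i x} \<in> sets M"
proof -
  have "{x \<in> space M. \<forall>i\<in>X. P i x} = space M - (\<Union>i\<in>X. space M - {x \<in> space M. P i x})" by auto
  also have "\<dots> \<in> sets M" using P by (intro sets.Diff sets.countable_UN'[OF X]) auto
  finally show ?thesis .
qed

lemma sets_Collect_bex_countable:
  assumes X: "countable X" and P: "\<And>i. i \<in> X \<Longrightarrow> {x \<in> space M. P i x} \<in> sets M"
  shows "{x \<in> space M. \<exists>i\<in>X. P i x} \<in> sets M"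
proof -
  have "{x \<in> space M. \<exists>i\<in>X. P i x} = (\<Union>i\<in>X. {x \<in> space M. P i x})" by auto
  also have "\<dots> \<in> sets M" using P by (intro sets.countable_UN'[OF X]) auto
  finally show ?thesis .
qed

locale path_domain =
  fixes T D :: real
  assumes T_pos: "0 < T" and D_pos: "0 < D"
begin

definition R :: "(real \<times> real) set" where "R = {0..T} \<times> {0..D}"

abbreviation E :: "(real \<times> real \<Rightarrow> real) metric" where "E \<equiv> path_space T D"

abbreviation N :: "(real \<times> real \<Rightarrow> real) measure" where "N \<equiv> metric_borel E"

lemma compact_R: "compact R" unfolding R_def by (intro compact_Times) auto

lemma R_nonempty: "R \<noteq> {}" using T_pos D_pos by (auto simp: R_def)

lemma mspace_E: "mspace E = {p. p \<in> extensional R \<and> continuous_on R p}"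
proof -
  have "compactin (top_of_set R) (topspace (top_of_set R))" using compact_R by simp
  from compactin_mspace_cfunspace[OF this, of euclidean_metric] show ?thesis
    unfolding path_space_def R_def[symmetric] by auto
qed

lemma mdist_le_iff: "p \<in> mspace E \<Longrightarrow> q \<in> mspace E \<Longrightarrow> mdist E p q \<le> a \<longleftrightarrow> (\<forall>z\<in>R. \<bar>p z - q z\<bar> \<le> a)"
  unfolding path_space_def R_def[symmetric]
  by (subst cfunspace_mdist_le) (use R_nonempty in \<open>auto simp: dist_real_def\<close>)

lemma mdist_ge: "p \<in> mspace E \<Longrightarrow> q \<in> mspace E \<Longrightarrow> z \<in> R \<Longrightarrow> \<bar>p z - q z\<bar> \<le> mdist E p q"
  using mdist_le_iff[of p q "mdist E p q"] by auto

lemma N_subset: "{U. openin (mtopology_of E) U} \<subseteq> Pow (mspace E)"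
  using openin_subset[of "mtopology_of E"] by auto

lemma space_N: "space N = mspace E"
  unfolding metric_borel_def by (rule space_measure_of[OF N_subset])

lemma sets_N: "sets N = sigma_sets (mspace E) {U. openin (mtopology_of E) U}"
  unfolding metric_borel_def by (rule sets_measure_of[OF N_subset])

lemma eval_measurable: "z \<in> R \<Longrightarrow> (\<lambda>p. p z) \<in> borel_measurable N"
proof (rule borel_measurableI)
  fix S :: "real set" assume S: "open S" and z: "z \<in> R"
  have "openin (mtopology_of E) ((\<lambda>p. p z) -` S \<inter> mspace E)"
    unfolding mtopology_of_def
  proof (subst Metric_space.openin_mtopology[OF Metric_space_mspace_mdist], intro conjI allI impI)
    fix p assume p: "p \<in> (\<lambda>p. p z) -` S \<inter> mspace E"
    then obtain e where e: "e > 0" "ball (p z) e \<subseteq> S" using S by (auto simp: open_contains_ball)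
    have "Metric_space.mball (mspace E) (mdist E) p e \<subseteq> (\<lambda>p. p z) -` S \<inter> mspace E"
    proof
      fix q assume "q \<in> Metric_space.mball (mspace E) (mdist E) p e"
      then have q: "q \<in> mspace E" "mdist E p q < e" by (auto simp: Metric_space.in_mball[OF Metric_space_mspace_mdist])
      then have "\<bar>p z - q z\<bar> < e" using mdist_ge[of p q z] p z by auto
      then show "q \<in> (\<lambda>p. p z) -` S \<inter> mspace E" using e q by (auto simp: ball_def dist_real_def)
    qed
    with e show "\<exists>r>0. Metric_space.mball (mspace E) (mdist E) p r \<subseteq> (\<lambda>p. p z) -` S \<inter> mspace E" by auto
  qed auto
  then show "(\<lambda>p. p z) -` S \<inter> space N \<in> sets N" unfolding space_N sets_N by (intro sigma_sets.Basic) auto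
qed

text \<open>A dense set of interior points. There the time is positive, so the mild equation is
  available, and countability allows the exceptional null sets of all its points to be
  united.\<close>

definition Q :: "(real \<times> real) set" where
  "Q = (SOME Q. countable Q \<and> Q \<subseteq> {0<..<T} \<times> {0<..<D} \<and> closure Q = R)"

lemma Q: "countable Q" "Q \<subseteq> {0<..<T} \<times> {0<..<D}" "closure Q = R"
proof -
  have "\<exists>Q. countable Q \<and> Q \<subseteq> {0<..<T} \<times> {0<..<D} \<and> closure Q = R"
  proof -
    obtain A :: "(real \<times> real) set" where A: "countable A" "\<And>X. open X \<Longrightarrow> X \<noteq> {} \<Longrightarrow> \<exists>d\<in>A. d \<in> X"
      using countable_dense_setE by blast
    let ?B = "{0<..<T} \<times> {0<..<D}"
    have oB: "open ?B" by (intro open_Times) auto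
    have "?B \<subseteq> closure (A \<inter> ?B)"
    proof
      fix x assume x: "x \<in> ?B"
      show "x \<in> closure (A \<inter> ?B)" unfolding closure_approachable
      proof (intro allI impI)
        fix e :: real assume e: "e > 0"
        have "open (ball x e \<inter> ?B)" using oB by auto
        moreover have "ball x e \<inter> ?B \<noteq> {}" using x e centre_in_ball[of x e] by blast
        ultimately obtain d where "d \<in> A" "d \<in> ball x e \<inter> ?B" using A(2)[of "ball x e \<inter> ?B"] by blast
        then show "\<exists>y\<in>A \<inter> ?B. dist y x < e" by (auto simp: dist_commute)
      qed
    qed
    then have "closure ?B \<subseteq> closure (A \<inter> ?B)" by (metis closure_closure closure_mono)
    moreover have "closure (A \<inter> ?B) \<subseteq> closure ?B" by (intro closure_mono) auto
    moreover have "closure ?B = R" using T_pos D_pos by (simp add: closure_Times R_def)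
    ultimately show ?thesis using A by (intro exI[of _ "A \<inter> ?B"]) auto
  qed
  from someI_ex[OF this] show "countable Q" "Q \<subseteq> {0<..<T} \<times> {0<..<D}" "closure Q = R"
    unfolding Q_def by auto
qed

lemma Q_subset: "Q \<subseteq> R" using Q(2) by (auto simp: R_def)

lemma mspace_cont: "p \<in> mspace E \<Longrightarrow> continuous_on R p" by (simp add: mspace_E)

lemma le_on_Q_imp:
  fixes f :: "real \<times> real \<Rightarrow> real"
  assumes "continuous_on R f" "\<And>q. q \<in> Q \<Longrightarrow> f q \<le> a" "z \<in> R" shows "f z \<le> a"
  using continuous_le_on_closure[of Q f z a] assms Q(3) by simp

text \<open>Continuity reduces the supremum distance to countably many evaluations, on which its
  measurability rests.\<close>

lemma mdist_le_iff_Q: "p \<in> mspace E \<Longrightarrow> q \<in> mspace E \<Longrightarrow> mdist E p q \<le> a \<longleftrightarrow> (\<forall>z\<in>Q. \<bar>p z - q z\<bar> \<le> a)"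
proof
  assume pq: "p \<in> mspace E" "q \<in> mspace E"
  show "\<forall>z\<in>Q. \<bar>p z - q z\<bar> \<le> a" if "mdist E p q \<le> a" using that Q_subset by (auto simp: mdist_le_iff[OF pq])
  assume *: "\<forall>z\<in>Q. \<bar>p z - q z\<bar> \<le> a"
  show "mdist E p q \<le> a" unfolding mdist_le_iff[OF pq]
  proof
    fix z assume z: "z \<in> R"
    show "\<bar>p z - q z\<bar> \<le> a"
    proof (rule le_on_Q_imp[where f="\<lambda>z. \<bar>p z - q z\<bar>"])
      show "continuous_on R (\<lambda>z. \<bar>p z - q z\<bar>)"
        by (intro continuous_on_rabs continuous_on_diff mspace_cont pq)
    qed (use z * in auto)
  qed
qed

text \<open>Measurability is meant for the product of the two Borel algebras, the space on which
  couplings live.\<close>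

lemma mdist_measurable: "(\<lambda>(p, q). mdist E p q) \<in> borel_measurable (N \<Otimes>\<^sub>M N)"
proof (rule borel_measurableI_le)
  fix a
  have [measurable]: "(\<lambda>p. p z) \<in> borel_measurable N" if "z \<in> Q" for z using that Q_subset by (intro eval_measurable) auto
  have "{x \<in> space (N \<Otimes>\<^sub>M N). (case x of (p, q) \<Rightarrow> mdist E p q) \<le> a} = {x \<in> space (N \<Otimes>\<^sub>M N). \<forall>z\<in>Q. \<bar>fst x z - snd x z\<bar> \<le> a}"
    by (auto simp: space_pair_measure space_N mdist_le_iff_Q)
  also have "\<dots> \<in> sets (N \<Otimes>\<^sub>M N)"
  proof (rule sets_Collect_ball_countable[OF Q(1)])
    fix z assume "z \<in> Q"
    then have [measurable]: "(\<lambda>p. p z) \<in> borel_measurable N" using Q_subset by (intro eval_measurable) auto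
    show "{x \<in> space (N \<Otimes>\<^sub>M N). \<bar>fst x z - snd x z\<bar> \<le> a} \<in> sets (N \<Otimes>\<^sub>M N)"
      using measurable_compose[OF measurable_fst \<open>(\<lambda>p. p z) \<in> borel_measurable N\<close>] measurable_compose[OF measurable_snd \<open>(\<lambda>p. p z) \<in> borel_measurable N\<close>]
      by measurable
  qed
  finally show "{x \<in> space (N \<Otimes>\<^sub>M N). (case x of (p, q) \<Rightarrow> mdist E p q) \<le> a} \<in> sets (N \<Otimes>\<^sub>M N)" .
qed

text \<open>The Borel sets are generated by the evaluations at the points of the countable dense set: every open set
  is a union of countably many sets of paths with prescribed rational values, up to an error, near a finite net.\<close>

lemma measurable_path_borelI:
  assumes f: "\<And>\<omega>. \<omega> \<in> space A \<Longrightarrow> f \<omega> \<in> mspace E"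
    and fm: "\<And>q. q \<in> Q \<Longrightarrow> (\<lambda>\<omega>. f \<omega> q) \<in> borel_measurable A"
  shows "f \<in> measurable A N"
  unfolding metric_borel_def
proof (rule measurable_measure_of[OF N_subset])
  show "f \<in> space A \<rightarrow> mspace E" using f by auto
  fix U assume "U \<in> {U. openin (mtopology_of E) U}"
  then have U: "openin (mtopology_of E) U" by simp
  \<comment> \<open>An index consists of a list of net points with rational target values, the
    number \<open>m\<close> for the radius 1/(m+1) of the net balls, and \<open>k\<close> for the
    tolerance 1/(k+1).\<close>
  define B where "B = (\<lambda>(l, m::nat, k::nat). {p \<in> mspace E. \<forall>x\<in>set l. \<forall>q\<in>Q. dist q (fst x) < 1 / real (Suc m) \<longrightarrow> \<bar>p q - snd x\<bar> \<le> 1 / real (Suc k)})"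
  define J where "J = lists (Q \<times> (\<rat> :: real set)) \<times> (UNIV :: nat set) \<times> (UNIV :: nat set)"
  have cJ: "countable J" unfolding J_def using Q(1) countable_rat by (intro countable_SIGMA countable_lists) auto
  have "U = (\<Union>j\<in>{j\<in>J. B j \<subseteq> U}. B j)"
  proof (intro equalityI subsetI)
    fix p assume pU: "p \<in> U"
    then have p: "p \<in> mspace E" using U openin_subset by fastforce
    obtain r where r: "r > 0" "Metric_space.mball (mspace E) (mdist E) p r \<subseteq> U"
      using U pU unfolding mtopology_of_def by (auto simp: Metric_space.openin_mtopology[OF Metric_space_mspace_mdist])
    obtain k where k: "1 / real (Suc k) < r / 3" using r by (metis nat_approx_posE divide_pos_pos zero_less_numeral)
    define kk where "kk = 1 / real (Suc k)"
    have kk: "kk > 0" "kk < r / 3" using k by (simp_all add: kk_def)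
    have "uniformly_continuous_on R p" using compact_uniformly_continuous[OF mspace_cont[OF p] compact_R] .
    then obtain d where d: "d > 0" "\<And>x y. x \<in> R \<Longrightarrow> y \<in> R \<Longrightarrow> dist y x < d \<Longrightarrow> dist (p y) (p x) < kk / 2"
      unfolding uniformly_continuous_on_def using half_gt_zero[OF kk(1)] by meson
    obtain m where m: "1 / real (Suc m) < d" using d nat_approx_posE by blast
    let ?m = "1 / real (Suc m)"
    have "R \<subseteq> (\<Union>q\<in>Q. ball q ?m)"
    proof
      fix z assume "z \<in> R"
      then have "z \<in> closure Q" using Q(3) by simp
      then obtain q where "q \<in> Q" "dist q z < ?m" unfolding closure_approachable by (metis of_nat_0_less_iff zero_less_Suc zero_less_divide_1_iff)
      then show "z \<in> (\<Union>q\<in>Q. ball q ?m)" by auto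
    qed
    then obtain F where F: "F \<subseteq> Q" "finite F" "R \<subseteq> (\<Union>q\<in>F. ball q ?m)"
      using compactE_image[OF compact_R, of Q "\<lambda>q. ball q ?m"] by blast
    obtain l where l: "set l = F" using finite_list[OF F(2)] by blast
    have "\<exists>y\<in>\<rat>. \<bar>p q - y\<bar> < kk / 2" for q
    proof -
      have "p q - kk / 2 < p q + kk / 2" using kk by simp
      then obtain y where "y \<in> \<rat>" "p q - kk / 2 < y" "y < p q + kk / 2" using Rats_dense_in_real by blast
      then show ?thesis by (intro bexI[of _ y]) (linarith, simp)
    qed
    \<comment> \<open>Half of the tolerance goes to the rational rounding, the other half to the
      oscillation of \<open>p\<close> within a net ball.\<close>
    then obtain v where v: "\<And>q. v q \<in> \<rat>" "\<And>q. \<bar>p q - v q\<bar> < kk / 2" by metis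
    define j where "j = (map (\<lambda>q. (q, v q)) l, m, k)"
    have jJ: "j \<in> J" unfolding j_def J_def using l F v by auto
    have pB: "p \<in> B j"
    proof -
      have "\<bar>p q - v a\<bar> \<le> kk" if a: "a \<in> set l" and q: "q \<in> Q" and dd: "dist q a < ?m" for a q
      proof -
        have "q \<in> R" "a \<in> R" using a q Q_subset F(1) l by auto
        then have "dist (p q) (p a) < kk / 2" using dd m by (intro d(2)) auto
        then show ?thesis using v(2)[of a] unfolding dist_real_def by linarith
      qed
      then show ?thesis using p by (auto simp: B_def j_def kk_def simp del: of_nat_Suc)
    qed
    have "B j \<subseteq> U"
    proof
      fix g assume g: "g \<in> B j"
      then have gE: "g \<in> mspace E" by (auto simp: B_def j_def)
      have "mdist E p g \<le> 2 * kk" unfolding mdist_le_iff_Q[OF p gE]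
      proof
        fix q assume q: "q \<in> Q"
        then obtain a where a: "a \<in> F" "dist a q < ?m" using F(3) Q_subset by fastforce
        have "\<bar>g q - v a\<bar> \<le> kk" using g a q l by (auto simp: B_def j_def kk_def dist_commute simp del: of_nat_Suc)
        moreover have "q \<in> R" "a \<in> R" using a q Q_subset F(1) by auto
        then have "dist (p q) (p a) < kk / 2" using a m by (intro d(2)) (auto simp: dist_commute)
        ultimately show "\<bar>p q - g q\<bar> \<le> 2 * kk" using v(2)[of a] kk(1) unfolding dist_real_def by linarith
      qed
      then have "mdist E p g < r" using kk by linarith
      then show "g \<in> U" using r(2) p gE by (auto simp: Metric_space.in_mball[OF Metric_space_mspace_mdist])
    qed
    then show "p \<in> (\<Union>j\<in>{j\<in>J. B j \<subseteq> U}. B j)" using jJ pB by blast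
  qed blast
  then have "f -` U \<inter> space A = (\<Union>j\<in>{j\<in>J. B j \<subseteq> U}. f -` B j \<inter> space A)" by blast
  also have "\<dots> \<in> sets A"
  proof -
    have "countable {j \<in> J. B j \<subseteq> U}" using cJ by (rule countable_subset[rotated]) auto
    moreover have "f -` B j \<inter> space A \<in> sets A" for j
    proof -
      obtain l m k where j: "j = (l, m, k)" by (cases j)
      have "f -` B j \<inter> space A = {\<omega> \<in> space A. \<forall>q\<in>Q. \<forall>x\<in>set l. dist q (fst x) < 1 / real (Suc m) \<longrightarrow> \<bar>f \<omega> q - snd x\<bar> \<le> 1 / real (Suc k)}"
        using f by (auto simp: B_def j)
      also have "\<dots> \<in> sets A"
      proof (rule sets_Collect_ball_countable[OF Q(1)])
        fix q assume "q \<in> Q"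
        note [measurable] = fm[OF this]
        show "{\<omega> \<in> space A. \<forall>x\<in>set l. dist q (fst x) < 1 / real (Suc m) \<longrightarrow> \<bar>f \<omega> q - snd x\<bar> \<le> 1 / real (Suc k)} \<in> sets A"
          by measurable
      qed
      finally show ?thesis .
    qed
    ultimately show ?thesis by (intro sets.countable_UN') auto
  qed
  finally show "f -` U \<inter> space A \<in> sets A" .
qed

text \<open>Continuity of the paths makes evaluation jointly measurable: \<open>p z < a\<close>
  holds exactly if some rational number less than \<open>a\<close> bounds \<open>p\<close> at all
  points of \<open>Q\<close> close to \<open>z\<close>, and this is a countable condition on the
  pair.\<close>

lemma joint_eval_measurable: "(\<lambda>(z, p). p z) \<in> borel_measurable (restrict_space borel R \<Otimes>\<^sub>M N)"
proof (rule borel_measurableI_less)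
  fix a :: real
  let ?P = "restrict_space borel R \<Otimes>\<^sub>M N"
  have sp: "x \<in> space ?P \<longleftrightarrow> fst x \<in> R \<and> snd x \<in> mspace E" for x
    by (cases x) (auto simp: space_pair_measure space_N space_restrict_space)
  have "{x \<in> space ?P. (case x of (z, p) \<Rightarrow> p z) < a} =
    {x \<in> space ?P. \<exists>b\<in>\<rat> \<inter> {..<a}. \<exists>m::nat. \<forall>q\<in>Q. dist q (fst x) < 1 / real (Suc m) \<longrightarrow> snd x q \<le> b}"
  proof (intro Collect_cong conj_cong refl)
    fix x assume x: "x \<in> space ?P"
    obtain z p where xzp: "x = (z, p)" by (cases x)
    have z: "z \<in> R" and p: "p \<in> mspace E" using x by (auto simp: sp xzp)
    have c: "continuous_on R p" using p by (rule mspace_cont)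
    have "p z < a \<longleftrightarrow> (\<exists>b\<in>\<rat> \<inter> {..<a}. \<exists>m::nat. \<forall>q\<in>Q. dist q z < 1 / real (Suc m) \<longrightarrow> p q \<le> b)"
    proof
      assume "p z < a"
      then obtain b where b: "b \<in> \<rat>" "p z < b" "b < a" using Rats_dense_in_real by blast
      have "b - p z > 0" using b by simp
      then obtain d where d: "d > 0" "\<And>y. y \<in> R \<Longrightarrow> dist y z < d \<Longrightarrow> dist (p y) (p z) < b - p z"
        using c z unfolding continuous_on_iff by meson
      obtain m where m: "1 / real (Suc m) < d" using d nat_approx_posE by blast
      have "p q \<le> b" if "q \<in> Q" "dist q z < 1 / real (Suc m)" for q
      proof -
        have "dist (p q) (p z) < b - p z" using d(2)[of q] that m Q_subset by auto
        then show ?thesis by (simp add: dist_real_def)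
      qed
      then show "\<exists>b\<in>\<rat> \<inter> {..<a}. \<exists>m::nat. \<forall>q\<in>Q. dist q z < 1 / real (Suc m) \<longrightarrow> p q \<le> b" using b by blast
    next
      assume "\<exists>b\<in>\<rat> \<inter> {..<a}. \<exists>m::nat. \<forall>q\<in>Q. dist q z < 1 / real (Suc m) \<longrightarrow> p q \<le> b"
      then obtain b and m :: nat where b: "b < a" and bm: "\<And>q. q \<in> Q \<Longrightarrow> dist q z < 1 / real (Suc m) \<Longrightarrow> p q \<le> b" by auto
      show "p z < a"
      proof (rule ccontr)
        assume "\<not> p z < a"
        then have "p z - b > 0" using b by simp
        then obtain d where d: "d > 0" "\<And>y. y \<in> R \<Longrightarrow> dist y z < d \<Longrightarrow> dist (p y) (p z) < p z - b"
          using c z unfolding continuous_on_iff by meson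
        have "z \<in> closure Q" using z Q(3) by simp
        moreover have "min d (1 / real (Suc m)) > 0" using d by simp
        ultimately obtain q where q: "q \<in> Q" "dist q z < min d (1 / real (Suc m))" unfolding closure_approachable by blast
        then have "p q \<le> b" using bm by simp
        moreover have "dist (p q) (p z) < p z - b" using q Q_subset by (intro d(2)) auto
        ultimately show False by (simp add: dist_real_def)
      qed
    qed
    then show "((case x of (z, p) \<Rightarrow> p z) < a) = (\<exists>b\<in>\<rat> \<inter> {..<a}. \<exists>m::nat. \<forall>q\<in>Q. dist q (fst x) < 1 / real (Suc m) \<longrightarrow> snd x q \<le> b)"
      by (simp add: xzp)
  qed
  also have "\<dots> \<in> sets ?P"
  proof (rule sets_Collect_bex_countable)
    show "countable (\<rat> \<inter> {..<a} :: real set)" using countable_rat by auto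
    fix b
    have "{x \<in> space ?P. \<forall>q\<in>Q. dist q (fst x) < 1 / real (Suc m) \<longrightarrow> snd x q \<le> b} \<in> sets ?P" for m :: nat
    proof (rule sets_Collect_ball_countable[OF Q(1)])
      fix q assume "q \<in> Q"
      then have "(\<lambda>p. p q) \<in> borel_measurable N" using Q_subset by (intro eval_measurable) auto
      from measurable_compose[OF measurable_snd this] have 1: "(\<lambda>x. snd x q) \<in> borel_measurable ?P" .
      have "(\<lambda>z. dist q z) \<in> borel_measurable (restrict_space borel R)" by (intro measurable_restrict_space1) auto
      from measurable_compose[OF measurable_fst this] have 2: "(\<lambda>x. dist q (fst x)) \<in> borel_measurable ?P" .
      show "{x \<in> space ?P. dist q (fst x) < 1 / real (Suc m) \<longrightarrow> snd x q \<le> b} \<in> sets ?P"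
        using 1 2 by measurable
    qed
    then show "{x \<in> space ?P. \<exists>m::nat. \<forall>q\<in>Q. dist q (fst x) < 1 / real (Suc m) \<longrightarrow> snd x q \<le> b} \<in> sets ?P"
      by (intro sets.sets_Collect_countable_Ex) auto
  qed
  finally show "{x \<in> space ?P. (case x of (z, p) \<Rightarrow> p z) < a} \<in> sets ?P" .
qed

definition p0 :: "real \<times> real \<Rightarrow> real" where "p0 = (\<lambda>z\<in>R. 0)"

lemma p0_mspace: "p0 \<in> mspace E"
  unfolding mspace_E p0_def by (auto intro: continuous_on_eq[of _ "\<lambda>_. 0"])

text \<open>Glues functions chosen separately at each point of \<open>Q\<close> into one measurable
  path-valued map. Uniform continuity on \<open>Q\<close> is a countable condition and characterises
  traces of continuous paths; where it fails, the zero path is taken.\<close>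

lemma path_extension:
  assumes U: "\<And>q. q \<in> Q \<Longrightarrow> U q \<in> borel_measurable K"
  shows "\<exists>V \<in> measurable K N. \<forall>\<kappa>\<in>space K. (\<exists>p\<in>mspace E. \<forall>q\<in>Q. p q = U q \<kappa>) \<longrightarrow> (\<forall>q\<in>Q. V \<kappa> q = U q \<kappa>)"
proof -
  define good where "good \<kappa> \<longleftrightarrow> (\<forall>k::nat. \<exists>m::nat. \<forall>q\<in>Q. \<forall>q'\<in>Q. dist q q' < 1 / real (Suc m) \<longrightarrow> \<bar>U q \<kappa> - U q' \<kappa>\<bar> \<le> 1 / real (Suc k))" for \<kappa>
  have good_ex: "\<exists>p. p \<in> mspace E \<and> (\<forall>q\<in>Q. p q = U q \<kappa>)" if g: "good \<kappa>" for \<kappa>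
  proof -
    have "uniformly_continuous_on Q (\<lambda>q. U q \<kappa>)"
      unfolding uniformly_continuous_on_def
    proof (intro allI impI)
      fix e :: real assume "e > 0"
      then obtain k where k: "1 / real (Suc k) < e" using nat_approx_posE by blast
      from g obtain m :: nat where "\<forall>q\<in>Q. \<forall>q'\<in>Q. dist q q' < 1 / real (Suc m) \<longrightarrow> \<bar>U q \<kappa> - U q' \<kappa>\<bar> \<le> 1 / real (Suc k)"
        unfolding good_def by blast
      then show "\<exists>d>0. \<forall>x\<in>Q. \<forall>x'\<in>Q. dist x' x < d \<longrightarrow> dist (U x' \<kappa>) (U x \<kappa>) < e"
        using k by (intro exI[of _ "1 / real (Suc m)"]) (force simp: dist_real_def)
    qed
    then obtain h where h: "uniformly_continuous_on (closure Q) h" "\<And>q. q \<in> Q \<Longrightarrow> U q \<kappa> = h q"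
      using uniformly_continuous_on_extension_on_closure by metis
    have "continuous_on R h" using uniformly_continuous_imp_continuous[OF h(1)] Q(3) by simp
    then have "continuous_on R (restrict h R)" by (rule continuous_on_eq) auto
    then show ?thesis using h(2) Q_subset by (intro exI[of _ "restrict h R"]) (auto simp: mspace_E)
  qed
  have ex_good: "good \<kappa>" if p: "p \<in> mspace E" "\<forall>q\<in>Q. p q = U q \<kappa>" for p \<kappa>
    unfolding good_def
  proof
    fix k :: nat
    have "uniformly_continuous_on R p" using compact_uniformly_continuous[OF mspace_cont[OF p(1)] compact_R] .
    moreover have "1 / real (Suc k) > 0" by simp
    ultimately obtain d where d: "d > 0" "\<And>x y. x \<in> R \<Longrightarrow> y \<in> R \<Longrightarrow> dist y x < d \<Longrightarrow> dist (p y) (p x) < 1 / real (Suc k)"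
      unfolding uniformly_continuous_on_def by meson
    obtain m where m: "1 / real (Suc m) < d" using d nat_approx_posE by blast
    have "\<bar>U q \<kappa> - U q' \<kappa>\<bar> \<le> 1 / real (Suc k)" if "q \<in> Q" "q' \<in> Q" "dist q q' < 1 / real (Suc m)" for q q'
    proof -
      have "dist (p q) (p q') < 1 / real (Suc k)" using that m Q_subset by (intro d(2)) auto
      then show ?thesis using p(2) that by (simp add: dist_real_def)
    qed
    then show "\<exists>m::nat. \<forall>q\<in>Q. \<forall>q'\<in>Q. dist q q' < 1 / real (Suc m) \<longrightarrow> \<bar>U q \<kappa> - U q' \<kappa>\<bar> \<le> 1 / real (Suc k)" by blast
  qed
  have good_m: "{\<kappa> \<in> space K. good \<kappa>} \<in> sets K"
    unfolding good_def
  proof (intro sets.sets_Collect_countable_All sets.sets_Collect_countable_Ex)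
    fix k m :: nat
    show "{\<kappa> \<in> space K. \<forall>q\<in>Q. \<forall>q'\<in>Q. dist q q' < 1 / real (Suc m) \<longrightarrow> \<bar>U q \<kappa> - U q' \<kappa>\<bar> \<le> 1 / real (Suc k)} \<in> sets K"
    proof (intro sets_Collect_ball_countable[OF Q(1)])
      fix q q' assume "q \<in> Q" "q' \<in> Q"
      note [measurable] = U[OF \<open>q \<in> Q\<close>] U[OF \<open>q' \<in> Q\<close>]
      show "{\<kappa> \<in> space K. dist q q' < 1 / real (Suc m) \<longrightarrow> \<bar>U q \<kappa> - U q' \<kappa>\<bar> \<le> 1 / real (Suc k)} \<in> sets K"
        by measurable
    qed
  qed
  define V where "V \<kappa> = (if good \<kappa> then SOME p. p \<in> mspace E \<and> (\<forall>q\<in>Q. p q = U q \<kappa>) else p0)" for \<kappa>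
  have V1: "V \<kappa> \<in> mspace E" and V2: "good \<kappa> \<Longrightarrow> q \<in> Q \<Longrightarrow> V \<kappa> q = U q \<kappa>" for \<kappa> q
    using someI_ex[OF good_ex, of \<kappa>] p0_mspace by (auto simp: V_def)
  have "V \<in> measurable K N"
  proof (rule measurable_path_borelI[OF V1])
    fix q assume q: "q \<in> Q"
    have "(\<lambda>\<kappa>. if good \<kappa> then U q \<kappa> else 0) \<in> borel_measurable K"
      using U[OF q] good_m by (intro measurable_If) auto
    moreover have "V \<kappa> q = (if good \<kappa> then U q \<kappa> else 0)" for \<kappa> using V2[of \<kappa> q] q Q_subset by (auto simp: V_def p0_def)
    ultimately show "(\<lambda>\<kappa>. V \<kappa> q) \<in> borel_measurable K" by simp
  qed
  then show ?thesis using ex_good V2 by (intro bexI[of _ V]) blast+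
qed

end

section \<open>Maximum principle and bounds on the heat kernel\<close>

text \<open>End points are included, where derivatives are one-sided. If \<open>c\<close> were
  positive, \<open>f'\<close> would have the sign of y - x near \<open>x\<close>, and the mean value
  theorem would give values above \<open>f x\<close> on whichever side is available.\<close>

lemma second_derivative_at_max:
  fixes f f' :: "real \<Rightarrow> real"
  assumes D: "0 < D" and x: "x \<in> {0..D}" and max: "\<And>y. y \<in> {0..D} \<Longrightarrow> f y \<le> f x"
    and f: "\<And>y. y \<in> {0..D} \<Longrightarrow> (f has_real_derivative f' y) (at y within {0..D})"
    and f': "(f' has_real_derivative c) (at x within {0..D})" and 0: "f' x = 0"
  shows "c \<le> 0"
proof (rule ccontr)
  assume "\<not> c \<le> 0"
  then have c: "c > 0" by simp
  have "((\<lambda>y. (f' y - f' x) / (y - x)) \<longlongrightarrow> c) (at x within {0..D})"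
    using f' by (simp add: has_field_derivative_iff)
  from order_tendstoD(1)[OF this c] have "\<forall>\<^sub>F y in at x within {0..D}. 0 < f' y / (y - x)" using 0 by simp
  then obtain d where d: "d > 0" "\<And>y. y \<in> {0..D} \<Longrightarrow> y \<noteq> x \<Longrightarrow> dist y x < d \<Longrightarrow> 0 < f' y / (y - x)"
    unfolding eventually_at by auto
  have cont: "continuous_on {u..v} f" if "{u..v} \<subseteq> {0..D}" for u v
    using that f by (intro continuous_on_subset[OF _ that]) (metis DERIV_continuous_on)
  have diff: "(f has_real_derivative f' y) (at y)" if "0 < y" "y < D" for y
    using f[of y] that by (simp add: at_within_Icc_at)
  show False
  proof (cases "x < D")
    case True
    define y where "y = min (x + d / 2) D"
    have y: "x < y" "y \<le> D" "y - x < d" using True d by (auto simp: y_def)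
    obtain z where z: "x < z" "z < y" "f y - f x = (y - x) * f' z"
    proof -
      have "\<exists>l z. x < z \<and> z < y \<and> DERIV f z :> l \<and> f y - f x = (y - x) * l"
      proof (rule MVT)
        show "continuous_on {x..y} f" using x y by (intro cont) auto
        show "f differentiable (at z)" if "x < z" "z < y" for z
          using diff[of z] x y that by (auto simp: real_differentiable_def)
      qed (use y in auto)
      then obtain l z where lz: "x < z" "z < y" "DERIV f z :> l" "f y - f x = (y - x) * l" by blast
      moreover have "l = f' z" using DERIV_unique[OF lz(3) diff] lz x y by auto
      ultimately show ?thesis using that by blast
    qed
    have "0 < f' z / (z - x)" using z y x by (intro d(2)) (auto simp: dist_real_def)
    then have "0 < f' z" using z by (simp add: zero_less_divide_iff)
    then have "f x < f y" using z y by (smt (verit) mult_pos_pos)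
    then show False using max[of y] x y by auto
  next
    case False
    then have xD: "x = D" using x by simp
    define y where "y = max (x - d / 2) 0"
    have y: "y < x" "0 \<le> y" "x - y < d" using xD D d by (auto simp: y_def)
    obtain z where z: "y < z" "z < x" "f x - f y = (x - y) * f' z"
    proof -
      have "\<exists>l z. y < z \<and> z < x \<and> DERIV f z :> l \<and> f x - f y = (x - y) * l"
      proof (rule MVT)
        show "continuous_on {y..x} f" using x y by (intro cont) auto
        show "f differentiable (at z)" if "y < z" "z < x" for z
          using diff[of z] x y that by (auto simp: real_differentiable_def)
      qed (use y in auto)
      then obtain l z where lz: "y < z" "z < x" "DERIV f z :> l" "f x - f y = (x - y) * l" by blast
      moreover have "l = f' z" using DERIV_unique[OF lz(3) diff] lz x y by auto
      ultimately show ?thesis using that by blast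
    qed
    have "0 < f' z / (z - x)" using z y x by (intro d(2)) (auto simp: dist_real_def)
    then have "f' z < 0" using z by (simp add: zero_less_divide_iff)
    then have "f x < f y" using z y by (smt (verit) mult_pos_neg)
    then show False using max[of y] x y by auto
  qed
qed

lemma derivative_at_left_end:
  fixes f :: "real \<Rightarrow> real"
  assumes "0 < D" "\<And>y. y \<in> {0..D} \<Longrightarrow> f y \<le> f 0" "(f has_real_derivative l) (at 0 within {0..D})"
  shows "l \<le> 0"
proof (rule tendsto_upperbound)
  show "((\<lambda>y. (f y - f 0) / (y - 0)) \<longlongrightarrow> l) (at 0 within {0..D})"
    using assms(3) by (simp add: has_field_derivative_iff)
  show "\<forall>\<^sub>F y in at 0 within {0..D}. (f y - f 0) / (y - 0) \<le> 0"
    unfolding eventually_at using assms by (intro exI[of _ 1]) (auto simp: divide_le_0_iff)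
  show "at 0 within {0..D} \<noteq> bot" using assms(1) by (simp add: at_within_Icc_at_right)
qed

lemma derivative_at_right_end:
  fixes f :: "real \<Rightarrow> real"
  assumes "a < D" "\<And>y. y \<in> {a..D} \<Longrightarrow> f y \<le> f D" "(f has_real_derivative l) (at D within {a..D})"
  shows "0 \<le> l"
proof (rule tendsto_lowerbound)
  show "((\<lambda>y. (f y - f D) / (y - D)) \<longlongrightarrow> l) (at D within {a..D})"
    using assms(3) by (simp add: has_field_derivative_iff)
  show "\<forall>\<^sub>F y in at D within {a..D}. 0 \<le> (f y - f D) / (y - D)"
    unfolding eventually_at using assms by (intro exI[of _ 1]) (auto simp: zero_le_divide_iff)
  show "at D within {a..D} \<noteq> bot" using assms(1) by (simp add: at_within_Icc_at_left)
qed

text \<open>At a positive maximum of \<open>v - \<epsilon>t\<close> the spatial derivative vanishes and the second one is not positive, also on the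
  boundary, where the equation persists by continuity of the derivatives up to the boundary.\<close>

lemma parabolic_maximum_principle:
  fixes v vt vx vxx :: "real \<Rightarrow> real \<Rightarrow> real"
  assumes D: "0 < D" and cv: "continuous_on ({0<..} \<times> {0..D}) (\<lambda>(t, x). v t x)"
    and cvt: "\<And>t. t > 0 \<Longrightarrow> continuous_on {0..D} (vt t)" and cvx: "\<And>t. t > 0 \<Longrightarrow> continuous_on {0..D} (vx t)"
    and cvxx: "\<And>t. t > 0 \<Longrightarrow> continuous_on {0..D} (vxx t)"
    and dt: "\<And>t x. t > 0 \<Longrightarrow> x \<in> {0..D} \<Longrightarrow> ((\<lambda>t. v t x) has_real_derivative vt t x) (at t)"
    and dx: "\<And>t x. t > 0 \<Longrightarrow> x \<in> {0..D} \<Longrightarrow> (v t has_real_derivative vx t x) (at x within {0..D})"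
    and dxx: "\<And>t x. t > 0 \<Longrightarrow> x \<in> {0..D} \<Longrightarrow> (vx t has_real_derivative vxx t x) (at x within {0..D})"
    and pde: "\<And>t x. t > 0 \<Longrightarrow> x \<in> {0<..<D} \<Longrightarrow> vt t x = (a x)\<^sup>2 / 2 * vxx t x + b x * vx t x"
    and ca: "continuous_on {0..D} a" and cb: "continuous_on {0..D} b"
    and bc: "\<And>t. t > 0 \<Longrightarrow> satisfies_bc bc D (v t) (vx t)"
    and init: "uniform_limit {0..D} v \<phi> (at_right 0)" and m: "\<And>x. x \<in> {0..D} \<Longrightarrow> \<phi> x \<le> m" "0 \<le> m"
    and t0: "t0 > 0" and x0: "x0 \<in> {0..D}"
  shows "v t0 x0 \<le> m"
proof (rule ccontr)
  assume "\<not> v t0 x0 \<le> m"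
  then have gt: "v t0 x0 - m > 0" by simp
  \<comment> \<open>The slope in time is so small that \<open>v - e t\<close> still exceeds
    \<open>m + e / 2\<close> at the given point; the margin \<open>e / 2\<close> is reserved for the
    error in the initial condition.\<close>
  define e where "e = (v t0 x0 - m) / (2 * (t0 + 1))"
  have e: "e > 0" using gt t0 by (simp add: e_def)
  have e2: "e * (2 * (t0 + 1)) = v t0 x0 - m" using t0 by (simp add: e_def)
  have "0 < e * t0" using e t0 by simp
  with e2 e have w0: "v t0 x0 - e * t0 > m + e / 2" by (simp add: algebra_simps)
  have "\<forall>\<^sub>F t in at_right 0. \<forall>x\<in>{0..D}. dist (v t x) (\<phi> x) < e / 2"
    using init e unfolding uniform_limit_iff by (meson half_gt_zero)
  then obtain tau where tau: "tau > 0" "\<And>t x. 0 < t \<Longrightarrow> t < tau \<Longrightarrow> x \<in> {0..D} \<Longrightarrow> dist (v t x) (\<phi> x) < e / 2"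
    unfolding eventually_at_right_field by blast
  \<comment> \<open>A start time before \<open>t0\<close> at which \<open>v\<close> is within
    \<open>e / 2\<close> of the initial function. It excludes a maximum on the initial side of the
    rectangle.\<close>
  define s where "s = min (tau / 2) (t0 / 2)"
  have s: "0 < s" "s < tau" "s < t0" using tau t0 by (auto simp: s_def)
  have vs: "v s x \<le> m + e / 2" if "x \<in> {0..D}" for x
    using tau(2)[OF s(1,2) that] m(1)[OF that] unfolding dist_real_def by linarith
  let ?K = "{s..t0} \<times> {0..D}"
  let ?w = "\<lambda>z. v (fst z) (snd z) - e * fst z"
  have "continuous_on ?K ?w"
  proof -
    have "continuous_on ?K (\<lambda>z. (case z of (t, x) \<Rightarrow> v t x) - e * fst z)"
      using s by (intro continuous_intros continuous_on_subset[OF cv]) auto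
    then show ?thesis by (simp add: case_prod_beta')
  qed
  moreover have "compact ?K" by (intro compact_Times) auto
  moreover have "(t0, x0) \<in> ?K" using s x0 by auto
  ultimately obtain z where z: "z \<in> ?K" "\<And>y. y \<in> ?K \<Longrightarrow> ?w y \<le> ?w z"
    using continuous_attains_sup[of ?K ?w] by blast
  obtain t x where zt: "z = (t, x)" by (cases z)
  have x: "x \<in> {0..D}" and t: "s \<le> t" "t \<le> t0" using z zt by auto
  have wz: "v t x - e * t > m + e / 2" using z(2)[of "(t0, x0)"] w0 s x0 zt by auto
  have "t \<noteq> s" using vs[OF x] wz e s by (smt (verit) mult_pos_pos)
  then have ts: "s < t" using t by simp
  then have tp: "t > 0" using s by simp
  \<comment> \<open>The maximum may sit at the final time, so only the derivative from the left is
    used.\<close>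
  have "((\<lambda>r. v r x - e * r) has_real_derivative vt t x - e) (at t within {s..t})"
    using dt[OF tp x] by (auto intro!: derivative_eq_intros dest: has_field_derivative_at_within)
  then have "0 \<le> vt t x - e"
    by (rule derivative_at_right_end[OF ts, rotated]) (use z(2)[of "(r, x)" for r] zt t x in auto)
  then have vt: "vt t x > 0" using e by simp
  have mx: "v t y \<le> v t x" if "y \<in> {0..D}" for y using z(2)[of "(t, y)"] that t zt by auto
  have "0 < e * t" using e tp by simp
  then have vpos: "v t x > 0" using wz m(2) e by linarith
  have "vx t x = 0"
  proof (cases "x \<in> {0<..<D}")
    case True
    then have i: "(v t has_real_derivative vx t x) (at x)" using dx[OF tp x] by (simp add: at_within_Icc_at)
    show ?thesis
    proof (rule DERIV_local_max[OF i])
      show "0 < min x (D - x)" using True by auto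
      show "\<forall>y. \<bar>x - y\<bar> < min x (D - x) \<longrightarrow> v t y \<le> v t x" by (intro allI impI mx) (auto simp: abs_if split: if_splits)
    qed
  next
    case False
    then have x0D: "x = 0 \<or> x = D" using x by auto
    show ?thesis
    proof (cases bc)
      \<comment> \<open>The value at the maximum is positive because \<open>m\<close> is
        nonnegative, so it is not attained where \<open>v\<close> vanishes.\<close>
      case Dirichlet then show ?thesis using bc[OF tp] x0D vpos by auto
    next
      case Neumann then show ?thesis using bc[OF tp] x0D by auto
    next
      case Periodic
      then have per: "v t 0 = v t D" "vx t 0 = vx t D" using bc[OF tp] by auto
      \<comment> \<open>The two ends share one value, so both are maxima. The derivatives there have
        opposite signs, and periodicity makes them equal, hence zero.\<close>
      have "vx t 0 \<le> 0" using x0D per mx D by (intro derivative_at_left_end[OF D _ dx[OF tp]]) auto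
      moreover have "0 \<le> vx t D" using x0D per mx D by (intro derivative_at_right_end[OF D _ dx[OF tp]]) auto
      ultimately show ?thesis using per x0D by auto
    qed
  qed
  moreover have "vxx t x \<le> 0"
    by (rule second_derivative_at_max[OF D x mx dx[OF tp] dxx[OF tp x] \<open>vx t x = 0\<close>]) auto
  moreover have "vt t x = (a x)\<^sup>2 / 2 * vxx t x + b x * vx t x"
  proof -
    have cl: "closure {0<..<D} = {0..D}" using D by simp
    have "continuous_on (closure {0<..<D}) (\<lambda>x. vt t x - ((a x)\<^sup>2 / 2 * vxx t x + b x * vx t x))"
      unfolding cl using tp by (intro continuous_intros cvt cvx cvxx ca cb) auto
    then have "vt t x - ((a x)\<^sup>2 / 2 * vxx t x + b x * vx t x) = 0"
      by (rule continuous_constant_on_closure) (use pde[OF tp] x cl in auto)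
    then show ?thesis by simp
  qed
  ultimately have "vt t x = (a x)\<^sup>2 / 2 * vxx t x" "(a x)\<^sup>2 / 2 * vxx t x \<le> 0" by (auto intro!: mult_nonneg_nonpos)
  then have "vt t x \<le> 0" by linarith
  with vt show False by simp
qed

lemma C_infinity_on_imp_continuous:
  assumes "C_infinity_on S f" shows "continuous_on S f"
proof -
  obtain F :: "nat \<Rightarrow> real \<Rightarrow> real" where F: "\<And>x. x \<in> S \<Longrightarrow> F 0 x = f x" "\<And>n x. x \<in> S \<Longrightarrow> (F n has_real_derivative F (Suc n) x) (at x within S)"
    using assms unfolding C_infinity_on_def by blast
  have "continuous_on S (F 0)" using F(2)[of _ 0] by (rule DERIV_continuous_on)
  then show ?thesis using F(1) by (rule continuous_on_eq)
qed

section \<open>Consequences for the heat kernel\<close>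

locale heat_kernel_setup =
  fixes bc D a b G
  assumes D: "0 < D" and hk: "heat_kernel bc D a b G" and Ca: "C_infinity_on {0..D} a" and Cb: "C_infinity_on {0..D} b"
begin

lemma G_cont: "continuous_on ({0<..} \<times> {0..D} \<times> {0..D}) (\<lambda>(t, x, y). G t x y)"
  using hk by (auto simp: heat_kernel_def)

lemma G_cont_y: "t > 0 \<Longrightarrow> x \<in> {0..D} \<Longrightarrow> continuous_on {0..D} (\<lambda>y. G t x y)"
  by (rule continuous_on_compose2[OF G_cont, of "{0..D}" "\<lambda>y. (t, x, y)", simplified]) (auto intro!: continuous_intros)

text \<open>The integral of the kernel against \<open>\<phi>\<close> satisfies the equation and the
  boundary condition, by differentiation under the integral, and has initial value
  \<open>\<phi>\<close>. The maximum principle then applies with the bound 1.\<close>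

lemma G_test_le:
  assumes \<phi>: "continuous_on {0..D} \<phi>" and supp: "0 < c" "d < D" "\<And>y. y \<in> {0..D} - {c..d} \<Longrightarrow> \<phi> y = 0"
    and m: "\<And>y. y \<in> {0..D} \<Longrightarrow> \<phi> y \<le> 1" and t: "t > 0" and x: "x \<in> {0..D}"
  shows "integral {0..D} (\<lambda>y. G t x y * \<phi> y) \<le> 1"
proof -
  obtain Gt Gx Gxx where
    cGt: "continuous_on ({0<..} \<times> {0..D} \<times> {0..D}) (\<lambda>(t, x, y). Gt t x y)" and
    cGx: "continuous_on ({0<..} \<times> {0..D} \<times> {0..D}) (\<lambda>(t, x, y). Gx t x y)" and
    cGxx: "continuous_on ({0<..} \<times> {0..D} \<times> {0..D}) (\<lambda>(t, x, y). Gxx t x y)" and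
    der0: "\<forall>t>0. \<forall>x\<in>{0..D}. \<forall>y\<in>{0..D}.
           ((\<lambda>t. G t x y) has_real_derivative Gt t x y) (at t) \<and>
           ((\<lambda>x. G t x y) has_real_derivative Gx t x y) (at x within {0..D}) \<and>
           ((\<lambda>x. Gx t x y) has_real_derivative Gxx t x y) (at x within {0..D})" and
    pde0: "\<forall>t>0. \<forall>x\<in>{0<..<D}. \<forall>y\<in>{0..D}. Gt t x y = (a x)\<^sup>2 / 2 * Gxx t x y + b x * Gx t x y" and
    bc0: "\<forall>t>0. \<forall>y\<in>{0..D}. satisfies_bc bc D (\<lambda>x. G t x y) (\<lambda>x. Gx t x y)"
    using hk unfolding heat_kernel_def by (elim conjE exE) (rule that; assumption)
  have der: "((\<lambda>t. G t x y) has_real_derivative Gt t x y) (at t)"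
    "((\<lambda>x. G t x y) has_real_derivative Gx t x y) (at x within {0..D})"
    "((\<lambda>x. Gx t x y) has_real_derivative Gxx t x y) (at x within {0..D})"
    if "t > 0" "x \<in> {0..D}" "y \<in> {0..D}" for t x y using der0 that by auto
  have pde: "Gt t x y = (a x)\<^sup>2 / 2 * Gxx t x y + b x * Gx t x y" if "t > 0" "x \<in> {0<..<D}" "y \<in> {0..D}" for t x y
    using pde0 that by blast
  have bc: "satisfies_bc bc D (\<lambda>x. G t x y) (\<lambda>x. Gx t x y)" if "t > 0" "y \<in> {0..D}" for t y using bc0 that by blast
  \<comment> \<open>One operation for the kernel and its derivatives, so that continuity and
    integrability are proved once for all of them.\<close>
  define J where "J H t x = integral {0..D} (\<lambda>y. H t x y * \<phi> y)" for H :: "real \<Rightarrow> real \<Rightarrow> real \<Rightarrow> real" and t x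
  have cH: "continuous_on (({0<..} \<times> {0..D}) \<times> cbox 0 D) (\<lambda>(z, y). (case z of (t, x) \<Rightarrow> H t x y) * \<phi> y)"
    if "continuous_on ({0<..} \<times> {0..D} \<times> {0..D}) (\<lambda>(t, x, y). H t x y)" for H :: "real \<Rightarrow> real \<Rightarrow> real \<Rightarrow> real"
  proof -
    have "continuous_on (({0<..} \<times> {0..D}) \<times> {0..D}) (\<lambda>w. (case (fst (fst w), snd (fst w), snd w) of (t, x, y) \<Rightarrow> H t x y) * \<phi> (snd w))"
      by (intro continuous_on_mult continuous_on_compose2[OF that] continuous_on_compose2[OF \<phi>] continuous_intros) auto
    then show ?thesis by (simp add: case_prod_beta')
  qed
  have cJ: "continuous_on ({0<..} \<times> {0..D}) (\<lambda>(t, x). J H t x)"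
    if "continuous_on ({0<..} \<times> {0..D} \<times> {0..D}) (\<lambda>(t, x, y). H t x y)" for H
  proof -
    have "continuous_on ({0<..} \<times> {0..D}) (\<lambda>z. integral (cbox 0 D) (\<lambda>y. (case z of (t, x) \<Rightarrow> H t x y) * \<phi> y))"
      by (rule integral_continuous_on_param) (rule cH[OF that])
    then show ?thesis unfolding J_def by (simp add: case_prod_beta')
  qed
  have cJx: "continuous_on {0..D} (J H t)"
    if "continuous_on ({0<..} \<times> {0..D} \<times> {0..D}) (\<lambda>(t, x, y). H t x y)" "t > 0" for H t
    by (rule continuous_on_compose2[OF cJ[OF that(1)], of "{0..D}" "\<lambda>x. (t, x)", simplified]) (use that in \<open>auto intro!: continuous_intros\<close>)
  have intg: "(\<lambda>y. H t x y * \<phi> y) integrable_on {0..D}"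
    if "continuous_on ({0<..} \<times> {0..D} \<times> {0..D}) (\<lambda>(t, x, y). H t x y)" "t > 0" "x \<in> {0..D}" for H t x
  proof -
    have "continuous_on {0..D} (\<lambda>y. H t x y)"
      by (rule continuous_on_compose2[OF that(1), of "{0..D}" "\<lambda>y. (t, x, y)", simplified]) (use that in \<open>auto intro!: continuous_intros\<close>)
    then show ?thesis using \<phi> by (intro integrable_continuous_interval continuous_intros)
  qed
  have djt: "((\<lambda>t. J G t x) has_real_derivative J Gt t x) (at t)" if t: "t > 0" and x: "x \<in> {0..D}" for t x
  proof -
    have "((\<lambda>t. integral (cbox 0 D) (\<lambda>y. G t x y * \<phi> y)) has_field_derivative integral (cbox 0 D) (\<lambda>y. Gt t x y * \<phi> y)) (at t within {0<..})"
    proof (rule leibniz_rule_field_derivative)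
      show "((\<lambda>t. G t x y * \<phi> y) has_real_derivative Gt r x y * \<phi> y) (at r within {0<..})" if "r \<in> {0<..}" "y \<in> cbox 0 D" for r y
        using der[of r x y] that x by (auto intro!: derivative_eq_intros dest: has_field_derivative_at_within)
      show "(\<lambda>y. G r x y * \<phi> y) integrable_on cbox 0 D" if "r \<in> {0<..}" for r using intg[OF G_cont, of r x] that x by simp
      have "continuous_on ({0<..} \<times> {0..D}) (\<lambda>w. (case (fst w, x, snd w) of (t, x, y) \<Rightarrow> Gt t x y) * \<phi> (snd w))"
        using x by (intro continuous_on_mult continuous_on_compose2[OF cGt] continuous_on_compose2[OF \<phi>] continuous_intros) auto
      then show "continuous_on ({0<..} \<times> cbox 0 D) (\<lambda>(r, y). Gt r x y * \<phi> y)" by (simp add: case_prod_beta')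
    qed (use t in auto)
    moreover have "at t within {0<..} = at t" using t by (intro at_within_open) auto
    ultimately show ?thesis unfolding J_def by simp
  qed
  have djx: "(J H t has_real_derivative J H' t x) (at x within {0..D})"
    if t: "t > 0" and x: "x \<in> {0..D}" and cH: "continuous_on ({0<..} \<times> {0..D} \<times> {0..D}) (\<lambda>(t, x, y). H t x y)"
      and cH': "continuous_on ({0<..} \<times> {0..D} \<times> {0..D}) (\<lambda>(t, x, y). H' t x y)"
      and dd: "\<And>x y. x \<in> {0..D} \<Longrightarrow> y \<in> {0..D} \<Longrightarrow> ((\<lambda>x. H t x y) has_real_derivative H' t x y) (at x within {0..D})" for t x H H'
  proof -
    have "((\<lambda>x. integral (cbox 0 D) (\<lambda>y. H t x y * \<phi> y)) has_field_derivative integral (cbox 0 D) (\<lambda>y. H' t x y * \<phi> y)) (at x within {0..D})"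
    proof (rule leibniz_rule_field_derivative)
      show "((\<lambda>x. H t x y * \<phi> y) has_real_derivative H' t r y * \<phi> y) (at r within {0..D})" if "r \<in> {0..D}" "y \<in> cbox 0 D" for r y
        using dd[of r y] that by (auto intro!: derivative_eq_intros)
      show "(\<lambda>y. H t r y * \<phi> y) integrable_on cbox 0 D" if "r \<in> {0..D}" for r using intg[OF cH t that] by simp
      have "continuous_on ({0..D} \<times> {0..D}) (\<lambda>w. (case (t, fst w, snd w) of (t, x, y) \<Rightarrow> H' t x y) * \<phi> (snd w))"
        using t by (intro continuous_on_mult continuous_on_compose2[OF cH'] continuous_on_compose2[OF \<phi>] continuous_intros) auto
      then show "continuous_on ({0..D} \<times> cbox 0 D) (\<lambda>(r, y). H' t r y * \<phi> y)" by (simp add: case_prod_beta')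
    qed (use x in auto)
    then show ?thesis unfolding J_def by simp
  qed
  have lin: "J (\<lambda>t x y. \<alpha> * H t x y + \<beta> * H' t x y) t x = \<alpha> * J H t x + \<beta> * J H' t x"
    if "continuous_on ({0<..} \<times> {0..D} \<times> {0..D}) (\<lambda>(t, x, y). H t x y)" "continuous_on ({0<..} \<times> {0..D} \<times> {0..D}) (\<lambda>(t, x, y). H' t x y)"
      "t > 0" "x \<in> {0..D}" for H H' \<alpha> \<beta> t x
  proof -
    have "J (\<lambda>t x y. \<alpha> * H t x y + \<beta> * H' t x y) t x = integral {0..D} (\<lambda>y. \<alpha> * (H t x y * \<phi> y) + \<beta> * (H' t x y * \<phi> y))"
      unfolding J_def by (simp add: algebra_simps)
    also have "\<dots> = \<alpha> * J H t x + \<beta> * J H' t x"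
      unfolding J_def using intg[OF that(1,3,4)] intg[OF that(2,3,4)]
      by (subst integral_add) (auto intro: integrable_on_mult_right)
    finally show ?thesis .
  qed
  have "J G t x \<le> 1"
  proof (rule parabolic_maximum_principle[where v="J G" and ?t0.0=t and ?x0.0=x and vt="J Gt" and vx="J Gx" and vxx="J Gxx" and a=a and b=b and bc=bc and \<phi>=\<phi>, OF D])
    show "J Gt t x = (a x)\<^sup>2 / 2 * J Gxx t x + b x * J Gx t x" if "t > 0" "x \<in> {0<..<D}" for t x
    proof -
      have "J Gt t x = J (\<lambda>t x' y. (a x)\<^sup>2 / 2 * Gxx t x' y + b x * Gx t x' y) t x"
        unfolding J_def using pde[OF that] by (intro integral_cong) auto
      also have "\<dots> = (a x)\<^sup>2 / 2 * J Gxx t x + b x * J Gx t x"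
        using that by (intro lin cGxx cGx) auto
      finally show ?thesis .
    qed
    show "satisfies_bc bc D (J G t) (J Gx t)" if t: "t > 0" for t
    proof -
      have J0: "J H t r = 0" if "\<And>y. y \<in> {0..D} \<Longrightarrow> H t r y = 0" for H r
      proof -
        have "J H t r = integral {0..D} (\<lambda>y. 0)" unfolding J_def by (rule integral_cong) (simp add: that)
        then show ?thesis by simp
      qed
      have Jc: "J H t 0 = J H t D" if "\<And>y. y \<in> {0..D} \<Longrightarrow> H t 0 y = H t D y" for H
        unfolding J_def by (rule integral_cong) (simp add: that)
      show ?thesis
        using bc[OF t] by (cases bc) (auto intro!: J0 Jc)
    qed
    have "uniform_limit {0..D} (\<lambda>t x. LINT y:{0..D}|lborel. G t x y * \<phi> y) \<phi> (at_right 0)"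
      using hk \<phi> supp unfolding heat_kernel_def by blast
    then show "uniform_limit {0..D} (J G) \<phi> (at_right 0)"
    proof (rule uniform_limit_cong[THEN iffD1, rotated 2])
      show "\<forall>\<^sub>F t in at_right 0. \<forall>x\<in>{0..D}. (LINT y:{0..D}|lborel. G t x y * \<phi> y) = J G t x"
        unfolding eventually_at_right_field
      proof (intro exI[of _ 1] conjI allI impI ballI)
        fix t x assume "0 < (t::real)" "x \<in> {0..D}"
        then have "continuous_on {0..D} (\<lambda>y. G t x y * \<phi> y)" using G_cont_y \<phi> by (intro continuous_intros)
        then show "(LINT y:{0..D}|lborel. G t x y * \<phi> y) = J G t x"
          unfolding J_def by (intro set_borel_integral_eq_integral borel_integrable_atLeastAtMost')
      qed simp
    qed simp
  qed (use cJ[OF G_cont] cJx[OF cGt] cJx[OF cGx] cJx[OF cGxx] djt djx[OF _ _ G_cont cGx] djx[OF _ _ cGx cGxx] der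
      C_infinity_on_imp_continuous[OF Ca] C_infinity_on_imp_continuous[OF Cb] m t x in auto)
  then show ?thesis by (simp add: J_def)
qed

text \<open>For fixed \<open>t\<close> and \<open>x\<close> the kernel is tested against
  approximations of its own sign, which bounds its total variation without knowing that it is
  nonnegative. The test functions are cut off near both ends because the initial condition speaks
  only about functions supported inside.\<close>

lemma G_abs_integral_le:
  assumes t: "t > 0" and x: "x \<in> {0..D}"
  shows "integrable lborel (\<lambda>y. indicator {0..D} y * \<bar>G t x y\<bar>)" "(\<integral>y. indicator {0..D} y * \<bar>G t x y\<bar> \<partial>lborel) \<le> 1"
proof -
  define g where "g y = G t x y" for y
  have cg: "continuous_on {0..D} g" using G_cont_y[OF t x] by (simp add: g_def)
  \<comment> \<open>Zero within distance 1/(n+1) of the ends and one beyond distance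
    2/(n+1).\<close>
  define cut where "cut n y = min 1 (max 0 (real (Suc n) * min y (D - y) - 1))" for n y
  \<comment> \<open>The second factor is a continuous substitute for the sign of \<open>g\<close>,
    with the denominator kept away from zero.\<close>
  define \<phi> where "\<phi> n y = cut n y * (g y / (\<bar>g y\<bar> + 1 / real (Suc n)))" for n y
  have pos: "0 < \<bar>g y\<bar> + 1 / real (Suc n)" for n y by (simp add: add_nonneg_pos)
  have cut01: "0 \<le> cut n y" "cut n y \<le> 1" for n y by (auto simp: cut_def)
  have q: "\<bar>g y / (\<bar>g y\<bar> + 1 / real (Suc n))\<bar> \<le> 1" for n y
    using pos[of y n] by (simp add: abs_divide divide_le_eq_1)
  have \<phi>1: "\<bar>\<phi> n y\<bar> \<le> 1" for n y
    using mult_mono[OF cut01(2)[of n y] q[of y n]] cut01(1)[of n y] by (simp add: \<phi>_def abs_mult)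
  have c\<phi>: "continuous_on {0..D} (\<phi> n)" for n
    unfolding \<phi>_def cut_def using pos by (intro continuous_intros cg) (auto simp: less_imp_neq[THEN not_sym])
  have supp: "\<phi> n y = 0" if "y \<in> {0..D} - {1 / real (Suc n)..D - 1 / real (Suc n)}" for n y
  proof -
    have "min y (D - y) < 1 / real (Suc n)" using that by auto
    then have "real (Suc n) * min y (D - y) < 1" by (simp add: field_simps)
    then show ?thesis by (simp add: \<phi>_def cut_def del: of_nat_Suc)
  qed
  have le: "integral {0..D} (\<lambda>y. g y * \<phi> n y) \<le> 1" for n
    unfolding g_def by (rule G_test_le[OF c\<phi> _ _ supp]) (use \<phi>1[of n] t x in \<open>auto simp: abs_le_iff\<close>)
  have "set_integrable lborel {0..D} (\<lambda>y. \<bar>g y\<bar>)" using cg by (intro borel_integrable_atLeastAtMost' continuous_intros)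
  then have ig: "integrable lborel (\<lambda>y. indicator {0..D} y * \<bar>g y\<bar>)" by (simp add: set_integrable_def)
  then show "integrable lborel (\<lambda>y. indicator {0..D} y * \<bar>G t x y\<bar>)" by (simp add: g_def)
  have "set_integrable lborel {0..D} (\<lambda>y. g y * \<phi> n y)" for n
    using cg c\<phi> by (intro borel_integrable_atLeastAtMost' continuous_intros)
  then have i\<phi>: "integrable lborel (\<lambda>y. indicator {0..D} y * (g y * \<phi> n y))" for n by (simp add: set_integrable_def)
  have val: "(\<integral>y. indicator {0..D} y * (g y * \<phi> n y) \<partial>lborel) \<le> 1" for n
  proof -
    have "(LINT y:{0..D}|lborel. g y * \<phi> n y) = integral {0..D} (\<lambda>y. g y * \<phi> n y)"
      by (rule set_borel_integral_eq_integral) (use cg c\<phi> in \<open>intro borel_integrable_atLeastAtMost' continuous_intros\<close>)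
    then show ?thesis using le[of n] by (simp add: set_lebesgue_integral_def)
  qed
  have "(\<lambda>n. \<integral>y. indicator {0..D} y * (g y * \<phi> n y) \<partial>lborel) \<longlonglongrightarrow> (\<integral>y. indicator {0..D} y * \<bar>g y\<bar> \<partial>lborel)"
  proof (rule integral_dominated_convergence[OF _ _ ig])
    show "AE y in lborel. (\<lambda>n. indicator {0..D} y * (g y * \<phi> n y)) \<longlonglongrightarrow> indicator {0..D} y * \<bar>g y\<bar>"
    proof (rule AE_I'[of "{0, D}"])
      show "{y \<in> space lborel. \<not> (\<lambda>n. indicator {0..D} y * (g y * \<phi> n y)) \<longlonglongrightarrow> indicator {0..D} y * \<bar>g y\<bar>} \<subseteq> {0, D}"
      proof (rule subsetI, rule ccontr)
        fix y assume y: "y \<in> {y \<in> space lborel. \<not> (\<lambda>n. indicator {0..D} y * (g y * \<phi> n y)) \<longlonglongrightarrow> indicator {0..D} y * \<bar>g y\<bar>}" "y \<notin> {0, D}"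
        then have yI: "0 < y" "y < D" by (auto split: split_indicator_asm)
        have "filterlim (\<lambda>n. real (Suc n)) at_top sequentially" by (rule filterlim_compose[OF filterlim_real_sequentially filterlim_Suc])
        then have "\<forall>\<^sub>F n in sequentially. 2 / min y (D - y) \<le> real (Suc n)" by (simp add: filterlim_at_top)
        then have ev: "\<forall>\<^sub>F n in sequentially. cut n y = 1"
        proof eventually_elim
          case (elim n)
          then have "2 \<le> real (Suc n) * min y (D - y)" using yI by (simp add: divide_le_eq)
          then show ?case by (simp add: cut_def del: of_nat_Suc)
        qed
        have "(\<lambda>n. g y * (1 * (g y / (\<bar>g y\<bar> + 1 / real (Suc n))))) \<longlonglongrightarrow> \<bar>g y\<bar>"
        proof (cases "g y = 0")
          case False
          have "(\<lambda>n. g y * (1 * (g y / (\<bar>g y\<bar> + 1 / real (Suc n))))) \<longlonglongrightarrow> g y * (1 * (g y / (\<bar>g y\<bar> + 0)))"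
            using False by (intro tendsto_intros LIMSEQ_inverse_real_of_nat[unfolded inverse_eq_divide]) auto
          moreover have "g y * (1 * (g y / (\<bar>g y\<bar> + 0))) = \<bar>g y\<bar>" using False by (auto simp: abs_if)
          ultimately show ?thesis by simp
        qed simp
        then have "(\<lambda>n. g y * \<phi> n y) \<longlonglongrightarrow> \<bar>g y\<bar>"
          by (rule Lim_transform_eventually) (use ev in eventually_elim, simp add: \<phi>_def)
        then show False using y yI by (auto intro!: tendsto_mult)
      qed
      show "{0, D} \<in> null_sets lborel" by (intro finite_imp_null_set_lborel) auto
    qed
    show "AE y in lborel. norm (indicator {0..D} y * (g y * \<phi> n y)) \<le> indicator {0..D} y * \<bar>g y\<bar>" for n
      using \<phi>1[of n] by (auto intro!: AE_I2 mult_left_le split: split_indicator simp: abs_mult)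
  qed (use ig i\<phi> in auto)
  then show "(\<integral>y. indicator {0..D} y * \<bar>G t x y\<bar> \<partial>lborel) \<le> 1"
    unfolding g_def[symmetric] by (rule LIMSEQ_le_const2) (use val in auto)
qed

text \<open>Positivity matters for measures of infinite entropy, where the bound is the constant
  times infinity and \<open>0 * \<infinity>\<close> would be 0. It follows from the initial
  condition: for small times the integral of \<open>G\<close> against a bump is close to the
  positive value of the bump at the midpoint.\<close>

lemma G_energy_pos:
  assumes T: "T > 0" shows "kernel_energy T D G > 0"
proof (rule ccontr)
  assume "\<not> kernel_energy T D G > 0"
  then have 0: "kernel_energy T D G = 0" by simp
  define \<phi> where "\<phi> y = max 0 (min (y - D/4) (3*D/4 - y))" for y
  have c\<phi>: "continuous_on {0..D} \<phi>" unfolding \<phi>_def by (intro continuous_intros)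
  have s\<phi>: "\<phi> y = 0" if "y \<in> {0..D} - {D/4..3*D/4}" for y using that by (auto simp: \<phi>_def max_def min_def)
  have \<phi>D: "\<phi> (D/2) > 0" using D by (simp add: \<phi>_def)
  have lim: "uniform_limit {0..D} (\<lambda>t x. LINT y:{0..D}|lborel. G t x y * \<phi> y) \<phi> (at_right 0)"
  proof -
    have "\<exists>c d. 0 < c \<and> d < D \<and> (\<forall>y\<in>{0..D} - {c..d}. \<phi> y = 0)" using s\<phi> D by (intro exI[of _ "D/4"] exI[of _ "3*D/4"]) auto
    then show ?thesis using hk c\<phi> unfolding heat_kernel_def by blast
  qed
  define c where "c = \<phi> (D/2) / 2"
  have c: "c > 0" using \<phi>D by (simp add: c_def)
  \<comment> \<open>The weight in Young's inequality, chosen so that the error term D * D^2 / (4 s)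
    equals c / 2 while the integral to be bounded exceeds c.\<close>
  define s where "s = D ^ 3 / (2 * c)"
  have s: "s > 0" using D c by (simp add: s_def)
  have "\<forall>\<^sub>F t in at_right 0. \<forall>x\<in>{0..D}. dist (LINT y:{0..D}|lborel. G t x y * \<phi> y) (\<phi> x) < c"
    using lim c unfolding uniform_limit_iff by blast
  then obtain r where r: "r > 0" "\<And>t x. 0 < t \<Longrightarrow> t < r \<Longrightarrow> x \<in> {0..D} \<Longrightarrow> dist (LINT y:{0..D}|lborel. G t x y * \<phi> y) (\<phi> x) < c"
    unfolding eventually_at_right_field by blast
  have low: "ennreal (c / (2 * s)) \<le> (\<integral>\<^sup>+y\<in>{0..D}. ennreal ((G t (D/2) y)\<^sup>2) \<partial>lborel)" if t: "0 < t" "t < r" for t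
  proof -
    let ?G = "\<lambda>y. G t (D/2) y"
    have cG: "continuous_on {0..D} ?G" using t D by (intro G_cont_y) auto
    have "dist (LINT y:{0..D}|lborel. ?G y * \<phi> y) (\<phi> (D/2)) < c" using r(2)[OF t, of "D/2"] D by simp
    then have 1: "c < (LINT y:{0..D}|lborel. ?G y * \<phi> y)" unfolding dist_real_def c_def by linarith
    have i: "set_integrable lborel {0..D} (\<lambda>y. ?G y * \<phi> y)" "set_integrable lborel {0..D} (\<lambda>y. (?G y)\<^sup>2)"
      "set_integrable lborel {0..D} (\<lambda>y. s * (?G y)\<^sup>2 + D\<^sup>2 / (4 * s))"
      using cG c\<phi> by (auto intro!: borel_integrable_atLeastAtMost' continuous_intros)
    have "(LINT y:{0..D}|lborel. ?G y * \<phi> y) \<le> (LINT y:{0..D}|lborel. s * (?G y)\<^sup>2 + D\<^sup>2 / (4 * s))"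
    proof (rule set_integral_mono[OF i(1) i(3)])
      fix y assume y: "y \<in> {0..D}"
      have "0 \<le> (2 * s * ?G y - \<phi> y)\<^sup>2" by simp
      then have "4 * s * (?G y * \<phi> y) \<le> 4 * s * (s * (?G y)\<^sup>2) + (\<phi> y)\<^sup>2"
        unfolding power2_diff by (simp add: power2_eq_square algebra_simps)
      moreover have "(\<phi> y)\<^sup>2 \<le> D\<^sup>2" using y D by (intro power_mono) (auto simp: \<phi>_def)
      ultimately have "4 * s * (?G y * \<phi> y) \<le> 4 * s * (s * (?G y)\<^sup>2 + D\<^sup>2 / (4 * s))"
        using s by (simp add: distrib_left)
      then show "?G y * \<phi> y \<le> s * (?G y)\<^sup>2 + D\<^sup>2 / (4 * s)" using s by (subst (asm) mult_le_cancel_left_pos) auto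
    qed
    also have "\<dots> = (LINT y:{0..D}|lborel. s * (?G y)\<^sup>2) + (LINT y:{0..D}|lborel. D\<^sup>2 / (4 * s))"
      using cG by (intro set_integral_add(2) borel_integrable_atLeastAtMost' continuous_intros)
    also have "(LINT y:{0..D}|lborel. D\<^sup>2 / (4 * s)) = D * (D\<^sup>2 / (4 * s))"
      using D by (simp add: set_lebesgue_integral_def)
    also have "(LINT y:{0..D}|lborel. s * (?G y)\<^sup>2) = s * (LINT y:{0..D}|lborel. (?G y)\<^sup>2)" by simp
    also have "D * (D\<^sup>2 / (4 * s)) = c / 2" using D c by (simp add: s_def field_simps power2_eq_square power3_eq_cube)
    finally have "c / 2 \<le> s * (LINT y:{0..D}|lborel. (?G y)\<^sup>2)" using 1 by simp
    then have "c / (2 * s) \<le> (LINT y:{0..D}|lborel. (?G y)\<^sup>2)" using s by (simp add: field_simps)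
    then have "ennreal (c / (2 * s)) \<le> ennreal (LINT y:{0..D}|lborel. (?G y)\<^sup>2)" by (rule ennreal_leI)
    also have "\<dots> = (\<integral>\<^sup>+y. ennreal (indicator {0..D} y *\<^sub>R (?G y)\<^sup>2) \<partial>lborel)"
      using i(2) unfolding set_lebesgue_integral_def set_integrable_def by (intro nn_integral_eq_integral[symmetric]) auto
    also have "\<dots> = (\<integral>\<^sup>+y\<in>{0..D}. ennreal ((?G y)\<^sup>2) \<partial>lborel)"
      by (intro nn_integral_cong) (auto split: split_indicator)
    finally show ?thesis .
  qed
  define q where "q = min r T"
  have q: "q > 0" "q \<le> r" "q \<le> T" using r T by (auto simp: q_def)
  have "0 < ennreal (c / (2 * s)) * ennreal q" using c s q by (simp add: ennreal_mult[symmetric])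
  also have "\<dots> = (\<integral>\<^sup>+t. ennreal (c / (2 * s)) * indicator {0<..<q} t \<partial>lborel)"
    using q by (simp add: nn_integral_cmult_indicator)
  also have "\<dots> \<le> (\<integral>\<^sup>+t\<in>{0..T}. (\<integral>\<^sup>+y\<in>{0..D}. ennreal ((G t (D/2) y)\<^sup>2) \<partial>lborel) \<partial>lborel)"
    using low q by (intro nn_integral_mono) (auto split: split_indicator)
  also have "\<dots> \<le> kernel_energy T D G"
    unfolding kernel_energy_def using D by (intro SUP_upper2[of "D/2"]) auto
  finally show False using 0 by simp
qed

end

section \<open>Correcting the marginal of a coupling\<close>

lemma nn_integral_uniform_if:
  assumes "0 \<le> k" "k \<le> (1::real)"
  shows "(\<integral>\<^sup>+s. (if s \<le> k then A else B) \<partial>uniform_measure lborel {0..1}) = ennreal k * A + ennreal (1 - k) * B"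
proof -
  have "(\<integral>\<^sup>+s. (if s \<le> k then A else B) \<partial>uniform_measure lborel {0..1})
      = (\<integral>\<^sup>+s. (if s \<le> k then A else B) * indicator {0..1} s \<partial>lborel)"
    by (subst nn_integral_uniform_measure) (auto simp: divide_ennreal_def)
  also have "\<dots> = (\<integral>\<^sup>+s. A * indicator {0..k} s + B * indicator {k<..1} s \<partial>lborel)"
    using assms by (intro nn_integral_cong) (auto split: split_indicator)
  also have "\<dots> = A * ennreal k + B * ennreal (1 - k)"
    using assms by (subst nn_integral_add) (auto simp: nn_integral_cmult_indicator)
  finally show ?thesis by (simp add: mult.commute)
qed

text \<open>The second marginal of a coupling is corrected by keeping the common mass of the two densities and redrawing
  the rest independently.\<close>

lemma coupling_correction:
  fixes f fn :: "'a \<Rightarrow> real" and c :: "'a \<times> 'a \<Rightarrow> ennreal" and a :: "'a \<Rightarrow> ennreal"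
  assumes M: "prob_space M" and P: "prob_space P"
    and X: "X \<in> measurable M P" and Y: "Y \<in> measurable M P"
    and lX: "distr M P X = P" and lY: "distr M P Y = density P (\<lambda>x. ennreal (fn x))"
    and f [measurable]: "f \<in> borel_measurable P" and fn [measurable]: "fn \<in> borel_measurable P"
    and f0: "\<And>x. 0 \<le> f x" and fn0: "\<And>x. 0 \<le> fn x"
    and Q: "prob_space Q" "Q = density P (\<lambda>x. ennreal (f x))"
    and c [measurable]: "c \<in> borel_measurable (P \<Otimes>\<^sub>M P)" and a [measurable]: "a \<in> borel_measurable P"
    and ca: "\<And>x y. x \<in> space P \<Longrightarrow> y \<in> space P \<Longrightarrow> c (x, y) \<le> 2 * a x + 2 * a y"
  shows "\<exists>\<pi>\<in>couplings P Q. (\<integral>\<^sup>+z. c z \<partial>\<pi>) \<le> (\<integral>\<^sup>+\<omega>. c (X \<omega>, Y \<omega>) \<partial>M) + 4 * R * (\<integral>\<^sup>+x. ennreal \<bar>f x - fn x\<bar> \<partial>P)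
     + 2 * (\<integral>\<^sup>+x. a x * indicator {x. R < a x} x \<partial>P) + 2 * (\<integral>\<^sup>+x. a x * indicator {x. R < a x} x \<partial>Q)"
proof -
  interpret M: prob_space M by fact
  interpret P: prob_space P by fact
  interpret Q: prob_space Q by fact
  note [measurable] = X Y
  define h where "h x = min (f x) (fn x)" for x
  have h [measurable]: "h \<in> borel_measurable P" unfolding h_def by measurable
  have h0: "0 \<le> h x" "h x \<le> f x" "h x \<le> fn x" for x using f0 fn0 by (auto simp: h_def)
  \<comment> \<open>The probability of keeping a value of \<open>Y\<close>. The kept part then has
    density \<open>h\<close>, the common mass of the two densities.\<close>
  define k where "k x = (if fn x = 0 then 0 else h x / fn x)" for x
  have k [measurable]: "k \<in> borel_measurable P" unfolding k_def by measurable
  have k01: "0 \<le> k x" "k x \<le> 1" for x using h0[of x] fn0[of x] by (auto simp: k_def divide_le_eq_1)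
  have kfn: "k x * fn x = h x" for x using h0[of x] by (auto simp: k_def)
  have kfn': "fn x * k x = h x" for x using kfn[of x] by (simp add: mult.commute)
  have lYi: "(\<integral>\<^sup>+\<omega>. g (Y \<omega>) \<partial>M) = (\<integral>\<^sup>+x. ennreal (fn x) * g x \<partial>P)" if [measurable]: "g \<in> borel_measurable P" for g
  proof -
    have "(\<integral>\<^sup>+\<omega>. g (Y \<omega>) \<partial>M) = (\<integral>\<^sup>+x. g x \<partial>distr M P Y)" by (subst nn_integral_distr) auto
    then show ?thesis unfolding lY by (subst (asm) nn_integral_density) auto
  qed
  have lXi: "(\<integral>\<^sup>+\<omega>. g (X \<omega>) \<partial>M) = (\<integral>\<^sup>+x. g x \<partial>P)" if [measurable]: "g \<in> borel_measurable P" for g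
    by (subst lX[symmetric], subst nn_integral_distr) auto
  have Qi: "(\<integral>\<^sup>+x. g x \<partial>Q) = (\<integral>\<^sup>+x. ennreal (f x) * g x \<partial>P)" if [measurable]: "g \<in> borel_measurable P" for g
    unfolding Q(2) by (subst nn_integral_density) auto
  have f1: "(\<integral>\<^sup>+x. ennreal (f x) \<partial>P) = 1"
    using Q.emeasure_space_1 Qi[of "\<lambda>_. 1"] by simp
  have fn1: "(\<integral>\<^sup>+x. ennreal (fn x) \<partial>P) = 1" using lYi[of "\<lambda>_. 1"] M.emeasure_space_1 by simp
  define m where "m = (\<integral>\<^sup>+x. ennreal (f x - h x) \<partial>P)"
  have hm: "(\<integral>\<^sup>+x. ennreal (h x) \<partial>P) + m = 1"
    unfolding m_def f1[symmetric] using h0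
    by (subst nn_integral_add[symmetric]) (auto intro!: nn_integral_cong simp: ennreal_plus[symmetric] simp del: ennreal_plus)
  have hn: "(\<integral>\<^sup>+x. ennreal (h x) \<partial>P) + (\<integral>\<^sup>+x. ennreal (fn x - h x) \<partial>P) = 1"
    unfolding fn1[symmetric] using h0
    by (subst nn_integral_add[symmetric]) (auto intro!: nn_integral_cong simp: ennreal_plus[symmetric] simp del: ennreal_plus)
  have hfin: "(\<integral>\<^sup>+x. ennreal (h x) \<partial>P) < top" using hm by (metis ennreal_add_eq_top ennreal_one_neq_top top.not_eq_extremum)
  \<comment> \<open>Both densities have total mass 1, so what is removed from one equals what is
    missing from the other.\<close>
  have m': "(\<integral>\<^sup>+x. ennreal (fn x - h x) \<partial>P) = m" using hm hn hfin by (metis ennreal_add_left_cancel less_irrefl infinity_ennreal_def)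
  have mfin: "m < top" using hm by (metis ennreal_add_eq_top ennreal_one_neq_top top.not_eq_extremum)
  have m1k: "(\<integral>\<^sup>+\<omega>. ennreal (1 - k (Y \<omega>)) \<partial>M) = m"
  proof -
    have "(\<integral>\<^sup>+\<omega>. ennreal (1 - k (Y \<omega>)) \<partial>M) = (\<integral>\<^sup>+x. ennreal (fn x) * ennreal (1 - k x) \<partial>P)"
      by (rule lYi) measurable
    also have "\<dots> = (\<integral>\<^sup>+x. ennreal (fn x - h x) \<partial>P)"
      using k01 fn0 by (intro nn_integral_cong) (simp add: ennreal_mult[symmetric] right_diff_distrib kfn')
    finally show ?thesis using m' by simp
  qed
  have m_le: "m \<le> (\<integral>\<^sup>+x. ennreal \<bar>f x - fn x\<bar> \<partial>P)"
    unfolding m_def by (intro nn_integral_mono ennreal_leI) (auto simp: h_def min_def)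
  \<comment> \<open>The law of the redrawn values, namely the normalised excess of \<open>f\<close>.
    When nothing is missing any probability measure will do, and \<open>P\<close> is taken.\<close>
  define \<rho> where "\<rho> = (if m = 0 then P else density P (\<lambda>x. ennreal (f x - h x) / m))"
  have \<rho>s [measurable_cong]: "sets \<rho> = sets P" by (simp add: \<rho>_def)
  have \<rho>i: "m * (\<integral>\<^sup>+x. g x \<partial>\<rho>) = (\<integral>\<^sup>+x. ennreal (f x - h x) * g x \<partial>P)" if [measurable]: "g \<in> borel_measurable P" for g
  proof (cases "m = 0")
    case True
    then have "AE x in P. ennreal (f x - h x) = 0" unfolding m_def by (subst (asm) nn_integral_0_iff_AE) auto
    then have "(\<integral>\<^sup>+x. ennreal (f x - h x) * g x \<partial>P) = (\<integral>\<^sup>+x. 0 \<partial>P)" by (intro nn_integral_cong_AE) auto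
    then show ?thesis using True by simp
  next
    case False
    have "(\<integral>\<^sup>+x. g x \<partial>\<rho>) = (\<integral>\<^sup>+x. ennreal (f x - h x) / m * g x \<partial>P)" using False by (simp add: \<rho>_def nn_integral_density)
    then have "m * (\<integral>\<^sup>+x. g x \<partial>\<rho>) = (\<integral>\<^sup>+x. m * (ennreal (f x - h x) / m * g x) \<partial>P)" by (simp add: nn_integral_cmult)
    also have "\<dots> = (\<integral>\<^sup>+x. ennreal (f x - h x) * g x \<partial>P)"
    proof (rule nn_integral_cong)
      fix x
      have "m * (ennreal (f x - h x) / m) = ennreal (f x - h x) * m / m" by (simp add: ennreal_times_divide mult.commute)
      also have "\<dots> = ennreal (f x - h x)" using False mfin by (intro ennreal_mult_divide_eq) auto
      finally show "m * (ennreal (f x - h x) / m * g x) = ennreal (f x - h x) * g x" by (simp add: mult.assoc[symmetric])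
    qed
    finally show ?thesis .
  qed
  have \<rho>p: "prob_space \<rho>"
  proof (cases "m = 0")
    case True then show ?thesis by (simp add: \<rho>_def P.prob_space_axioms)
  next
    case False
    have "(\<integral>\<^sup>+x. ennreal (f x - h x) / m \<partial>P) = m / m" by (simp add: nn_integral_divide m_def)
    also have "\<dots> = 1" using False mfin by simp
    finally show ?thesis using False by (intro prob_spaceI) (simp add: \<rho>_def emeasure_density cong: nn_integral_cong)
  qed
  interpret R: prob_space \<rho> by (rule \<rho>p)
  \<comment> \<open>An independent uniform variable decides between keeping and redrawing.\<close>
  define L where "L = uniform_measure lborel {0..1::real}"
  have Ls [measurable_cong]: "sets L = sets borel" by (simp add: L_def)
  have Lp: "prob_space L" unfolding L_def by (rule prob_space_uniform_measure) auto
  interpret L: prob_space L by (rule Lp)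
  interpret LR: pair_prob_space L \<rho> ..
  have LRp: "prob_space (L \<Otimes>\<^sub>M \<rho>)" by unfold_locales
  define S where "S = M \<Otimes>\<^sub>M (L \<Otimes>\<^sub>M \<rho>)"
  have Ss [measurable_cong]: "sets S = sets (M \<Otimes>\<^sub>M (borel \<Otimes>\<^sub>M P))"
    unfolding S_def by (intro sets_pair_measure_cong Ls \<rho>s refl)
  define V where "V z = (X (fst z), if fst (snd z) \<le> k (Y (fst z)) then Y (fst z) else snd (snd z))" for z
  have V [measurable]: "V \<in> measurable S (P \<Otimes>\<^sub>M P)" unfolding V_def[abs_def] by measurable
  have Si: "(\<integral>\<^sup>+z. g (V z) \<partial>S) = (\<integral>\<^sup>+\<omega>. ennreal (k (Y \<omega>)) * g (X \<omega>, Y \<omega>) + ennreal (1 - k (Y \<omega>)) * (\<integral>\<^sup>+r. g (X \<omega>, r) \<partial>\<rho>) \<partial>M)"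
    if [measurable]: "g \<in> borel_measurable (P \<Otimes>\<^sub>M P)" for g
  proof -
    have gV: "(\<lambda>z. g (V z)) \<in> borel_measurable (M \<Otimes>\<^sub>M (L \<Otimes>\<^sub>M \<rho>))" unfolding S_def[symmetric] by measurable
    have "(\<integral>\<^sup>+z. g (V z) \<partial>S) = (\<integral>\<^sup>+\<omega>. \<integral>\<^sup>+y. g (V (\<omega>, y)) \<partial>(L \<Otimes>\<^sub>M \<rho>) \<partial>M)"
      unfolding S_def by (rule sigma_finite_measure.nn_integral_fst[OF prob_space_imp_sigma_finite[OF LRp] gV, symmetric])
    also have "\<dots> = (\<integral>\<^sup>+\<omega>. \<integral>\<^sup>+s. \<integral>\<^sup>+r. g (V (\<omega>, (s, r))) \<partial>\<rho> \<partial>L \<partial>M)"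
      using gV by (intro nn_integral_cong R.nn_integral_fst[symmetric]) measurable
    also have "\<dots> = (\<integral>\<^sup>+\<omega>. ennreal (k (Y \<omega>)) * g (X \<omega>, Y \<omega>) + ennreal (1 - k (Y \<omega>)) * (\<integral>\<^sup>+r. g (X \<omega>, r) \<partial>\<rho>) \<partial>M)"
    proof (rule nn_integral_cong)
      fix \<omega>
      have "(\<integral>\<^sup>+s. \<integral>\<^sup>+r. g (V (\<omega>, (s, r))) \<partial>\<rho> \<partial>L) = (\<integral>\<^sup>+s. (if s \<le> k (Y \<omega>) then g (X \<omega>, Y \<omega>) else \<integral>\<^sup>+r. g (X \<omega>, r) \<partial>\<rho>) \<partial>L)"
        by (intro nn_integral_cong) (auto simp: V_def R.emeasure_space_1)
      then show "(\<integral>\<^sup>+s. \<integral>\<^sup>+r. g (V (\<omega>, (s, r))) \<partial>\<rho> \<partial>L) = ennreal (k (Y \<omega>)) * g (X \<omega>, Y \<omega>) + ennreal (1 - k (Y \<omega>)) * (\<integral>\<^sup>+r. g (X \<omega>, r) \<partial>\<rho>)"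
        unfolding L_def using nn_integral_uniform_if[OF k01] by simp
    qed
    finally show ?thesis .
  qed
  have kk: "ennreal (k x) + ennreal (1 - k x) = 1" for x using k01[of x] by (simp add: ennreal_plus[symmetric] del: ennreal_plus)
  define \<pi> where "\<pi> = distr S (P \<Otimes>\<^sub>M P) V"
  have sQ: "sets Q = sets P" by (simp add: Q(2))
  have spQ: "space Q = space P" using sQ by (rule sets_eq_imp_space_eq)
  have \<pi>i: "(\<integral>\<^sup>+z. g z \<partial>\<pi>) = (\<integral>\<^sup>+z. g (V z) \<partial>S)" if "g \<in> borel_measurable (P \<Otimes>\<^sub>M P)" for g
    unfolding \<pi>_def using that by (subst nn_integral_distr) auto
  have "\<pi> \<in> couplings P Q"
    unfolding couplings_def
  proof (intro CollectI conjI)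
    show "sets \<pi> = sets (P \<Otimes>\<^sub>M Q)" unfolding \<pi>_def using sQ by (simp cong: sets_pair_measure_cong)
    show "distr \<pi> P fst = P"
    proof (rule measure_eqI)
      fix A assume "A \<in> sets (distr \<pi> P fst)"
      then have A [measurable]: "A \<in> sets P" by simp
      have "emeasure (distr \<pi> P fst) A = (\<integral>\<^sup>+z. indicator A (fst z) \<partial>\<pi>)"
        by (subst nn_integral_indicator[symmetric], simp, subst nn_integral_distr) (auto simp: \<pi>_def)
      also have "\<dots> = (\<integral>\<^sup>+\<omega>. ennreal (k (Y \<omega>)) * indicator A (X \<omega>) + ennreal (1 - k (Y \<omega>)) * (\<integral>\<^sup>+r. indicator A (X \<omega>) \<partial>\<rho>) \<partial>M)"
        by (subst \<pi>i, simp, subst Si) auto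
      also have "\<dots> = (\<integral>\<^sup>+\<omega>. indicator A (X \<omega>) \<partial>M)"
        by (simp add: R.emeasure_space_1 distrib_right[symmetric] kk)
      also have "\<dots> = emeasure P A" by (subst lXi) auto
      finally show "emeasure (distr \<pi> P fst) A = emeasure P A" .
    qed simp
    show "distr \<pi> Q snd = Q"
    proof (rule measure_eqI)
      fix A assume "A \<in> sets (distr \<pi> Q snd)"
      then have A [measurable]: "A \<in> sets P" by (simp add: sQ)
      have sndm: "snd \<in> measurable \<pi> Q" unfolding measurable_cong_sets[OF refl sQ] by (simp add: \<pi>_def)
      have "emeasure (distr \<pi> Q snd) A = (\<integral>\<^sup>+z. indicator A (snd z) \<partial>\<pi>)"
        using A sQ by (subst nn_integral_indicator[symmetric], simp, subst nn_integral_distr[OF sndm]) auto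
      also have "\<dots> = (\<integral>\<^sup>+\<omega>. ennreal (k (Y \<omega>)) * indicator A (Y \<omega>) + ennreal (1 - k (Y \<omega>)) * (\<integral>\<^sup>+r. indicator A r \<partial>\<rho>) \<partial>M)"
        by (subst \<pi>i, simp, subst Si) auto
      also have "\<dots> = (\<integral>\<^sup>+\<omega>. ennreal (k (Y \<omega>)) * indicator A (Y \<omega>) \<partial>M) + (\<integral>\<^sup>+\<omega>. ennreal (1 - k (Y \<omega>)) \<partial>M) * (\<integral>\<^sup>+r. indicator A r \<partial>\<rho>)"
        by (simp add: nn_integral_add nn_integral_multc)
      also have "\<dots> = (\<integral>\<^sup>+x. ennreal (fn x) * (ennreal (k x) * indicator A x) \<partial>P) + (\<integral>\<^sup>+x. ennreal (f x - h x) * indicator A x \<partial>P)"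
        unfolding m1k by (subst \<rho>i, simp, subst lYi) auto
      also have "\<dots> = (\<integral>\<^sup>+x. ennreal (f x) * indicator A x \<partial>P)"
      proof (subst nn_integral_add[symmetric])
        show "(\<integral>\<^sup>+x. ennreal (fn x) * (ennreal (k x) * indicator A x) + ennreal (f x - h x) * indicator A x \<partial>P) = (\<integral>\<^sup>+x. ennreal (f x) * indicator A x \<partial>P)"
        proof (rule nn_integral_cong)
          fix x
          have "ennreal (fn x) * ennreal (k x) + ennreal (f x - h x) = ennreal (f x)"
            using h0[of x] k01[of x] fn0[of x] by (simp add: ennreal_mult[symmetric] kfn' ennreal_plus[symmetric] del: ennreal_plus)
          then show "ennreal (fn x) * (ennreal (k x) * indicator A x) + ennreal (f x - h x) * indicator A x = ennreal (f x) * indicator A x"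
            by (metis mult.assoc distrib_right)
        qed
      qed auto
      also have "\<dots> = emeasure Q A" unfolding Q(2) by (subst emeasure_density) auto
      finally show "emeasure (distr \<pi> Q snd) A = emeasure Q A" .
    qed simp
  qed
  moreover have "(\<integral>\<^sup>+z. c z \<partial>\<pi>) \<le> (\<integral>\<^sup>+\<omega>. c (X \<omega>, Y \<omega>) \<partial>M) + 4 * R * (\<integral>\<^sup>+x. ennreal \<bar>f x - fn x\<bar> \<partial>P)
     + 2 * (\<integral>\<^sup>+x. a x * indicator {x. R < a x} x \<partial>P) + 2 * (\<integral>\<^sup>+x. a x * indicator {x. R < a x} x \<partial>Q)"
  proof -
    let ?t = "\<lambda>x. a x * indicator {x. R < a x} x"
    \<comment> \<open>Truncation at level \<open>R\<close>: on the part of mass \<open>m\<close>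
      that is redrawn, the bounded part costs a multiple of \<open>R * m\<close>, and the excess is
      integrated against the marginals \<open>P\<close> and \<open>Q\<close>.\<close>
    have aR: "a x \<le> R + ?t x" for x by (auto split: split_indicator simp: add_increasing)
    have [measurable]: "?t \<in> borel_measurable P" by measurable
    have "(\<integral>\<^sup>+z. c z \<partial>\<pi>) = (\<integral>\<^sup>+\<omega>. ennreal (k (Y \<omega>)) * c (X \<omega>, Y \<omega>) + ennreal (1 - k (Y \<omega>)) * (\<integral>\<^sup>+r. c (X \<omega>, r) \<partial>\<rho>) \<partial>M)"
      by (subst \<pi>i, simp, subst Si) auto
    also have "\<dots> \<le> (\<integral>\<^sup>+\<omega>. c (X \<omega>, Y \<omega>) + (2 * (ennreal (1 - k (Y \<omega>)) * a (X \<omega>)) + ennreal (1 - k (Y \<omega>)) * (2 * (\<integral>\<^sup>+r. a r \<partial>\<rho>))) \<partial>M)"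
    proof (rule nn_integral_mono)
      fix \<omega> assume w: "\<omega> \<in> space M"
      have Xs: "X \<omega> \<in> space P" using measurable_space[OF X w] .
      have "(\<integral>\<^sup>+r. c (X \<omega>, r) \<partial>\<rho>) \<le> (\<integral>\<^sup>+r. 2 * a (X \<omega>) + 2 * a r \<partial>\<rho>)"
        using Xs ca sets_eq_imp_space_eq[OF \<rho>s] by (intro nn_integral_mono) auto
      also have "\<dots> = 2 * a (X \<omega>) + 2 * (\<integral>\<^sup>+r. a r \<partial>\<rho>)"
        by (subst nn_integral_add) (auto simp: nn_integral_cmult R.emeasure_space_1)
      finally have 1: "(\<integral>\<^sup>+r. c (X \<omega>, r) \<partial>\<rho>) \<le> 2 * a (X \<omega>) + 2 * (\<integral>\<^sup>+r. a r \<partial>\<rho>)" .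
      have "ennreal (k (Y \<omega>)) * c (X \<omega>, Y \<omega>) \<le> 1 * c (X \<omega>, Y \<omega>)" using k01[of "Y \<omega>"] by (intro mult_right_mono) auto
      then show "ennreal (k (Y \<omega>)) * c (X \<omega>, Y \<omega>) + ennreal (1 - k (Y \<omega>)) * (\<integral>\<^sup>+r. c (X \<omega>, r) \<partial>\<rho>)
         \<le> c (X \<omega>, Y \<omega>) + (2 * (ennreal (1 - k (Y \<omega>)) * a (X \<omega>)) + ennreal (1 - k (Y \<omega>)) * (2 * (\<integral>\<^sup>+r. a r \<partial>\<rho>)))"
        using mult_left_mono[OF 1, of "ennreal (1 - k (Y \<omega>))"] by (auto intro!: add_mono simp: distrib_left mult.left_commute)
    qed
    also have "\<dots> = (\<integral>\<^sup>+\<omega>. c (X \<omega>, Y \<omega>) \<partial>M) + (2 * (\<integral>\<^sup>+\<omega>. ennreal (1 - k (Y \<omega>)) * a (X \<omega>) \<partial>M) + m * (2 * (\<integral>\<^sup>+r. a r \<partial>\<rho>)))"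
      by (simp add: nn_integral_add nn_integral_cmult nn_integral_multc m1k)
    also have "m * (2 * (\<integral>\<^sup>+r. a r \<partial>\<rho>)) = 2 * (\<integral>\<^sup>+x. ennreal (f x - h x) * a x \<partial>P)"
      using \<rho>i[OF a] by (metis mult.left_commute)
    finally have 0: "(\<integral>\<^sup>+z. c z \<partial>\<pi>) \<le> (\<integral>\<^sup>+\<omega>. c (X \<omega>, Y \<omega>) \<partial>M) + (2 * (\<integral>\<^sup>+\<omega>. ennreal (1 - k (Y \<omega>)) * a (X \<omega>) \<partial>M) + 2 * (\<integral>\<^sup>+x. ennreal (f x - h x) * a x \<partial>P))" .
    have "(\<integral>\<^sup>+x. ennreal (f x - h x) * a x \<partial>P) \<le> (\<integral>\<^sup>+x. R * ennreal (f x - h x) + ennreal (f x) * ?t x \<partial>P)"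
    proof (rule nn_integral_mono)
      fix x
      have "ennreal (f x - h x) * a x \<le> ennreal (f x - h x) * R + ennreal (f x - h x) * ?t x"
        using mult_left_mono[OF aR[of x], of "ennreal (f x - h x)"] by (simp add: distrib_left)
      also have "\<dots> \<le> R * ennreal (f x - h x) + ennreal (f x) * ?t x"
        using h0[of x] by (intro add_mono mult_right_mono ennreal_leI) (auto simp: mult.commute)
      finally show "ennreal (f x - h x) * a x \<le> R * ennreal (f x - h x) + ennreal (f x) * ?t x" .
    qed
    also have "\<dots> = R * m + (\<integral>\<^sup>+x. ?t x \<partial>Q)"
      by (subst Qi, simp, subst nn_integral_add) (auto simp: nn_integral_cmult m_def)
    finally have 1: "(\<integral>\<^sup>+x. ennreal (f x - h x) * a x \<partial>P) \<le> R * m + (\<integral>\<^sup>+x. ?t x \<partial>Q)" .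
    have "(\<integral>\<^sup>+\<omega>. ennreal (1 - k (Y \<omega>)) * a (X \<omega>) \<partial>M) \<le> (\<integral>\<^sup>+\<omega>. R * ennreal (1 - k (Y \<omega>)) + ?t (X \<omega>) \<partial>M)"
    proof (rule nn_integral_mono)
      fix \<omega>
      have "ennreal (1 - k (Y \<omega>)) * a (X \<omega>) \<le> ennreal (1 - k (Y \<omega>)) * R + ennreal (1 - k (Y \<omega>)) * ?t (X \<omega>)"
        using mult_left_mono[OF aR[of "X \<omega>"], of "ennreal (1 - k (Y \<omega>))"] by (simp add: distrib_left)
      also have "\<dots> \<le> ennreal (1 - k (Y \<omega>)) * R + 1 * ?t (X \<omega>)"
        using k01[of "Y \<omega>"] by (intro add_mono mult_right_mono order_refl) auto
      finally show "ennreal (1 - k (Y \<omega>)) * a (X \<omega>) \<le> R * ennreal (1 - k (Y \<omega>)) + ?t (X \<omega>)" by (simp add: mult.commute[of R])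
    qed
    also have "\<dots> = R * m + (\<integral>\<^sup>+x. ?t x \<partial>P)"
      using lXi[of ?t] by (subst nn_integral_add) (auto simp: nn_integral_cmult m1k)
    finally have 2: "(\<integral>\<^sup>+\<omega>. ennreal (1 - k (Y \<omega>)) * a (X \<omega>) \<partial>M) \<le> R * m + (\<integral>\<^sup>+x. ?t x \<partial>P)" .
    note 0
    also have "(\<integral>\<^sup>+\<omega>. c (X \<omega>, Y \<omega>) \<partial>M) + (2 * (\<integral>\<^sup>+\<omega>. ennreal (1 - k (Y \<omega>)) * a (X \<omega>) \<partial>M) + 2 * (\<integral>\<^sup>+x. ennreal (f x - h x) * a x \<partial>P))
       \<le> (\<integral>\<^sup>+\<omega>. c (X \<omega>, Y \<omega>) \<partial>M) + (2 * (R * m + (\<integral>\<^sup>+x. ?t x \<partial>P)) + 2 * (R * m + (\<integral>\<^sup>+x. ?t x \<partial>Q)))"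
      by (intro add_mono mult_left_mono order_refl 1 2) auto
    also have "\<dots> = (\<integral>\<^sup>+\<omega>. c (X \<omega>, Y \<omega>) \<partial>M) + 4 * R * m + 2 * (\<integral>\<^sup>+x. ?t x \<partial>P) + 2 * (\<integral>\<^sup>+x. ?t x \<partial>Q)"
    proof -
      have "2 * (R * m) + 2 * (R * m) = 4 * R * m" by (simp add: mult.assoc distrib_right[symmetric])
      then show ?thesis by (simp add: distrib_left ac_simps)
    qed
    also have "\<dots> \<le> (\<integral>\<^sup>+\<omega>. c (X \<omega>, Y \<omega>) \<partial>M) + 4 * R * (\<integral>\<^sup>+x. ennreal \<bar>f x - fn x\<bar> \<partial>P) + 2 * (\<integral>\<^sup>+x. ?t x \<partial>P) + 2 * (\<integral>\<^sup>+x. ?t x \<partial>Q)"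
      using m_le by (intro add_mono mult_left_mono order_refl) auto
    finally show ?thesis .
  qed
  ultimately show ?thesis by blast
qed

section \<open>Approximation by cylindrical densities\<close>

text \<open>The derivative ln z + 1 is at most 1 + ln K in absolute value on
  \<open>[1/K, K]\<close>. This turns closeness in L1 into closeness of entropies.\<close>

lemma xlnx_lipschitz:
  fixes x y K :: real
  assumes "1 \<le> K" "1 / K \<le> x" "x \<le> K" "1 / K \<le> y" "y \<le> K"
  shows "\<bar>x * ln x - y * ln y\<bar> \<le> (1 + ln K) * \<bar>x - y\<bar>"
proof -
  have le: "\<bar>x * ln x - y * ln y\<bar> \<le> (1 + ln K) * \<bar>x - y\<bar>" if xy: "x < y" "1 / K \<le> x" "y \<le> K" for x y :: real
  proof -
    have K: "0 < 1 / K" using assms by simp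
    then have x: "0 < x" using xy by linarith
    have d: "((\<lambda>x. x * ln x) has_real_derivative ln z + 1) (at z)" if "0 < z" for z :: real
      using that by (auto intro!: derivative_eq_intros)
    have "\<exists>z. x < z \<and> z < y \<and> y * ln y - x * ln x = (y - x) * (ln z + 1)"
      by (rule MVT2[OF xy(1)]) (use d x in auto)
    then obtain z where z: "x < z" "z < y" "y * ln y - x * ln x = (y - x) * (ln z + 1)" by blast
    have zp: "0 < z" using x z by linarith
    have "ln (1 / K) \<le> ln z" using zp K z xy by (subst ln_le_cancel_iff) linarith+
    moreover have "ln z \<le> ln K" using zp assms(1) z xy by (subst ln_le_cancel_iff) linarith+
    ultimately have "\<bar>ln z + 1\<bar> \<le> 1 + ln K" using assms by (simp add: ln_div)
    then have "(y - x) * \<bar>ln z + 1\<bar> \<le> (y - x) * (1 + ln K)" using xy by (intro mult_left_mono) auto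
    then show ?thesis using z(3) xy by (simp add: abs_minus_commute[of "x * ln x"] abs_minus_commute[of x] abs_mult mult.commute)
  qed
  consider "x < y" | "y < x" | "x = y" by linarith
  then show ?thesis
  proof cases
    case 1 then show ?thesis using le[of x y] assms by auto
  next
    case 2 then show ?thesis using le[of y x] assms by (auto simp: abs_minus_commute)
  qed auto
qed

lemma xlnx_small: "0 < x \<Longrightarrow> x \<le> 1 \<Longrightarrow> \<bar>x * ln x\<bar> \<le> (1::real)"
proof -
  assume x: "0 < x" "x \<le> 1"
  have "ln (1 / x) \<le> 1 / x - 1" using ln_le_minus_one[of "1 / x"] x by simp
  then have "x * ln (1 / x) \<le> x * (1 / x - 1)" using x by (intro mult_left_mono) auto
  then have "- (x * ln x) \<le> 1 - x" using x by (simp add: ln_div right_diff_distrib)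
  moreover have "x * ln x \<le> 0" using x by (intro mult_nonneg_nonpos) auto
  ultimately show ?thesis using x by linarith
qed

text \<open>With \<open>gen\<close>, every random variable is almost surely a functional of the path
  \<open>w\<close>, and cylindrical variables are dense in L1.\<close>

locale sheet_generated = sheet +
  assumes gen: "sets M = sheet_filtration M T D W T"
begin

definition K :: "(real \<times> real \<Rightarrow> real) measure" where "K = (\<Pi>\<^sub>M q\<in>I. borel)"

definition w :: "'a \<Rightarrow> real \<times> real \<Rightarrow> real" where "w \<omega> = (\<lambda>q\<in>I. Wp q \<omega>)"

lemma w_measurable [measurable]: "w \<in> measurable M K"
  unfolding w_def[abs_def] K_def by (intro measurable_restrict Wp_measurable)

definition gens :: "'a set set" where
  "gens = {W s x -` B \<inter> space M | s x B. s \<in> {0..T} \<and> x \<in> {0..D} \<and> B \<in> sets borel} \<union> {N. \<exists>A\<in>null_sets M. N \<subseteq> A}"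

lemma sets_eq: "sets M = sigma_sets (space M) gens"
proof -
  have "sheet_filtration M T D W T = augmented_history M D W T"
    unfolding sheet_filtration_def using gt_ex[of T] by (auto simp: min_def)
  then show ?thesis unfolding gen augmented_history_def gens_def .
qed

text \<open>Complements and arbitrary countable unions, without disjointness, are the steps of this
  induction; both properties proved by it below are stable under them.\<close>

lemma sets_induct [consumes 1, case_names point null compl union]:
  assumes "A \<in> sets M"
    and "\<And>q B. q \<in> I \<Longrightarrow> B \<in> sets borel \<Longrightarrow> P (Wp q -` B \<inter> space M)"
    and "\<And>N. N \<in> null_sets M \<Longrightarrow> P N"
    and compl: "\<And>A. A \<in> sets M \<Longrightarrow> P A \<Longrightarrow> P (space M - A)"
    and union: "\<And>A. (\<And>i::nat. A i \<in> sets M) \<Longrightarrow> (\<And>i. P (A i)) \<Longrightarrow> P (\<Union>i. A i)"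
  shows "P A"
  using assms(1) unfolding sets_eq
proof (induction rule: sigma_sets.induct)
  case (Basic A)
  then consider s x B where "A = W s x -` B \<inter> space M" "s \<in> {0..T}" "x \<in> {0..D}" "B \<in> sets borel"
    | N where "N \<in> null_sets M" "A \<subseteq> N" unfolding gens_def by auto
  then show ?case
  proof cases
    case 1 then show ?thesis using assms(2)[of "(s, x)" B] by (auto simp: I_def Wp_def)
  next
    case 2
    \<comment> \<open>Subsets of null sets are among the generators, so they are measurable and
      hence null sets themselves.\<close>
    have "A \<in> sets M" unfolding sets_eq using Basic by (rule sigma_sets.Basic)
    with 2 have "A \<in> null_sets M" by (meson null_sets_subset)
    then show ?thesis by (rule assms(3))
  qed
next
  case Empty show ?case by (rule assms(3)) simp
next
  case (Compl A) then show ?case using compl[of A] by (simp add: sets_eq)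
next
  case (Union A) then show ?case using union[of A] by (simp add: sets_eq)
qed

lemma factor_set: "A \<in> sets M \<Longrightarrow> \<exists>B\<in>sets K. AE \<omega> in M. \<omega> \<in> A \<longleftrightarrow> w \<omega> \<in> B"
proof (induction rule: sets_induct)
  case (point q B)
  have c: "(\<lambda>\<kappa>. \<kappa> q) \<in> borel_measurable K" unfolding K_def using point by (intro measurable_component_singleton)
  have "(\<lambda>\<kappa>. \<kappa> q) -` B \<inter> space K \<in> sets K" by (rule measurable_sets[OF c point(2)])
  moreover have "\<omega> \<in> Wp q -` B \<inter> space M \<longleftrightarrow> w \<omega> \<in> (\<lambda>\<kappa>. \<kappa> q) -` B \<inter> space K" if "\<omega> \<in> space M" for \<omega>
    using that point measurable_space[OF w_measurable that] by (auto simp: w_def)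
  ultimately show ?case by (intro bexI) (auto intro!: AE_I2)
next
  case (null N)
  then show ?case by (intro bexI[of _ "{}"]) (auto dest: AE_not_in)
next
  case (compl A)
  then obtain B where B: "B \<in> sets K" "AE \<omega> in M. \<omega> \<in> A \<longleftrightarrow> w \<omega> \<in> B" by blast
  have "AE \<omega> in M. \<omega> \<in> space M - A \<longleftrightarrow> w \<omega> \<in> space K - B"
    using B(2) AE_space by eventually_elim (use measurable_space[OF w_measurable] in auto)
  then show ?case using B by (intro bexI[of _ "space K - B"]) auto
next
  case (union A)
  then obtain B where B: "\<And>i. B i \<in> sets K" "\<And>i. AE \<omega> in M. \<omega> \<in> A i \<longleftrightarrow> w \<omega> \<in> B i" by metis
  have "AE \<omega> in M. \<forall>i. \<omega> \<in> A i \<longleftrightarrow> w \<omega> \<in> B i" using B(2) by (simp add: AE_all_countable)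
  then have "AE \<omega> in M. \<omega> \<in> (\<Union>i. A i) \<longleftrightarrow> w \<omega> \<in> (\<Union>i. B i)" by eventually_elim auto
  then show ?case using B(1) by (intro bexI[of _ "\<Union>i. B i"]) auto
qed

text \<open>The Doob-Dynkin factorisation up to null sets. The sublevel sets are factored first, and
  the function is recovered as the infimum of the rational levels whose set contains the
  path.\<close>

lemma factor_fun:
  fixes X :: "'a \<Rightarrow> real"
  assumes [measurable]: "X \<in> borel_measurable M"
  shows "\<exists>U\<in>borel_measurable K. AE \<omega> in M. X \<omega> = U (w \<omega>)"
proof -
  have "\<exists>B\<in>sets K. AE \<omega> in M. \<omega> \<in> {\<omega> \<in> space M. X \<omega> < r} \<longleftrightarrow> w \<omega> \<in> B" for r by (rule factor_set) measurable
  then have "\<forall>r. \<exists>B. B \<in> sets K \<and> (AE \<omega> in M. \<omega> \<in> {\<omega> \<in> space M. X \<omega> < r} \<longleftrightarrow> w \<omega> \<in> B)" by blast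
  from choice[OF this] obtain B where BB: "\<forall>r. B r \<in> sets K \<and> (AE \<omega> in M. \<omega> \<in> {\<omega> \<in> space M. X \<omega> < r} \<longleftrightarrow> w \<omega> \<in> B r)" by (rule exE)
  then have B [measurable]: "\<And>r. B r \<in> sets K" and ae: "\<And>r. AE \<omega> in M. \<omega> \<in> {\<omega> \<in> space M. X \<omega> < r} \<longleftrightarrow> w \<omega> \<in> B r" by blast+
  \<comment> \<open>The infimum may be infinite off an almost sure set of paths; it is taken in the
    extended reals, and the conversion makes the function total.\<close>
  define U where "U \<kappa> = real_of_ereal (INF r\<in>\<rat>. if \<kappa> \<in> B r then ereal r else \<infinity>)" for \<kappa>
  have [measurable]: "U \<in> borel_measurable K"
    unfolding U_def[abs_def]
    by (intro borel_measurable_real_of_ereal borel_measurable_INF countable_rat measurable_If_set) auto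
  have "AE \<omega> in M. \<forall>r\<in>\<rat>. \<omega> \<in> {\<omega> \<in> space M. X \<omega> < r} \<longleftrightarrow> w \<omega> \<in> B r"
    using ae countable_rat by (subst AE_ball_countable) auto
  then have "AE \<omega> in M. X \<omega> = U (w \<omega>)"
    using AE_space
  proof eventually_elim
    case (elim \<omega>)
    have "(INF r\<in>\<rat>. if w \<omega> \<in> B r then ereal r else \<infinity>) = (INF r\<in>\<rat>. if X \<omega> < r then ereal r else \<infinity>)"
      using elim by (intro INF_cong) auto
    also have "\<dots> = ereal (X \<omega>)"
    proof (rule antisym)
      show "ereal (X \<omega>) \<le> (INF r\<in>\<rat>. if X \<omega> < r then ereal r else \<infinity>)" by (intro INF_greatest) auto
      show "(INF r\<in>\<rat>. if X \<omega> < r then ereal r else \<infinity>) \<le> ereal (X \<omega>)"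
      proof (rule ereal_le_real)
        fix z assume "ereal (X \<omega>) \<le> ereal z"
        show "(INF r\<in>\<rat>. if X \<omega> < r then ereal r else \<infinity>) \<le> ereal z"
        proof (rule dense_ge)
          fix y assume y: "ereal z < y"
          then obtain z' where z': "ereal z < ereal z'" "ereal z' \<le> y" by (metis ereal_dense2 less_imp_le)
          then obtain r where r: "r \<in> \<rat>" "z < r" "r < z'" using Rats_dense_in_real[of z z'] by auto
          have "(INF r\<in>\<rat>. if X \<omega> < r then ereal r else \<infinity>) \<le> (if X \<omega> < r then ereal r else \<infinity>)" using r by (intro INF_lower)
          also have "\<dots> \<le> y" using r z' \<open>ereal (X \<omega>) \<le> ereal z\<close> by (auto intro: order_trans[of _ "ereal z'"])
          finally show "(INF r\<in>\<rat>. if X \<omega> < r then ereal r else \<infinity>) \<le> y" .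
        qed
      qed
    qed
    finally show ?case by (simp add: U_def)
  qed
  then show ?thesis by (intro bexI[of _ U]) auto
qed

section \<open>Density of the cylindrical variables in L1\<close>

definition cyl :: "('a \<Rightarrow> real) \<Rightarrow> bool" where
  "cyl F \<longleftrightarrow> (\<exists>S g. finite S \<and> S \<subseteq> I \<and> g \<in> borel_measurable (\<Pi>\<^sub>M p\<in>S. borel) \<and> F = (\<lambda>\<omega>. g (\<lambda>p\<in>S. Wp p \<omega>)))"

lemma cyl_comp2:
  assumes "cyl F" "cyl F'" and h: "(\<lambda>(x, y). h x y) \<in> borel_measurable (borel \<Otimes>\<^sub>M borel)"
  shows "cyl (\<lambda>\<omega>. h (F \<omega>) (F' \<omega>))"
proof -
  obtain S g where S: "finite S" "S \<subseteq> I" and g: "g \<in> borel_measurable (\<Pi>\<^sub>M p\<in>S. borel)" and F: "F = (\<lambda>\<omega>. g (\<lambda>p\<in>S. Wp p \<omega>))"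
    using assms(1) unfolding cyl_def by blast
  obtain S' g' where S': "finite S'" "S' \<subseteq> I" and g': "g' \<in> borel_measurable (\<Pi>\<^sub>M p\<in>S'. borel)" and F': "F' = (\<lambda>\<omega>. g' (\<lambda>p\<in>S'. Wp p \<omega>))"
    using assms(2) unfolding cyl_def by blast
  let ?S = "S \<union> S'"
  have 1: "(\<lambda>x. g (restrict x S)) \<in> borel_measurable (\<Pi>\<^sub>M p\<in>?S. borel)"
    by (intro measurable_compose[OF measurable_restrict_subset g]) auto
  have 2: "(\<lambda>x. g' (restrict x S')) \<in> borel_measurable (\<Pi>\<^sub>M p\<in>?S. borel)"
    by (intro measurable_compose[OF measurable_restrict_subset g']) auto
  have m: "(\<lambda>x. h (g (restrict x S)) (g' (restrict x S'))) \<in> borel_measurable (\<Pi>\<^sub>M p\<in>?S. borel)"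
    using measurable_compose[OF measurable_Pair[OF 1 2] h] by simp
  have r: "restrict (\<lambda>p\<in>?S. Wp p \<omega>) S = (\<lambda>p\<in>S. Wp p \<omega>)" "restrict (\<lambda>p\<in>?S. Wp p \<omega>) S' = (\<lambda>p\<in>S'. Wp p \<omega>)" for \<omega>
    by (auto simp: restrict_def)
  show ?thesis unfolding cyl_def
    using S S' m by (intro exI[of _ ?S] exI[of _ "\<lambda>x. h (g (restrict x S)) (g' (restrict x S'))"]) (auto simp: F F' r)
qed

lemma cyl_const: "cyl (\<lambda>_. r)"
  unfolding cyl_def by (intro exI[of _ "{}"] exI[of _ "\<lambda>_. r"]) auto

text \<open>Membership in the L1 closure of the cylindrical variables; the aim is that every
  integrable variable belongs to it.\<close>

definition apx :: "('a \<Rightarrow> real) \<Rightarrow> bool" where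
  "apx X \<longleftrightarrow> integrable M X \<and> (\<forall>e>0. \<exists>F. cyl F \<and> integrable M F \<and> expectation (\<lambda>\<omega>. \<bar>X \<omega> - F \<omega>\<bar>) < e)"

lemma apx_limit:
  assumes X: "integrable M X" and Y: "\<And>n. apx (Y n)" and lim: "(\<lambda>n. expectation (\<lambda>\<omega>. \<bar>X \<omega> - Y n \<omega>\<bar>)) \<longlonglongrightarrow> 0"
  shows "apx X"
  unfolding apx_def
proof (intro conjI allI impI X)
  fix e :: real assume e: "e > 0"
  have "\<forall>\<^sub>F n in sequentially. expectation (\<lambda>\<omega>. \<bar>X \<omega> - Y n \<omega>\<bar>) < e / 2" using order_tendstoD(2)[OF lim, of "e/2"] e by simp
  then obtain n where n: "expectation (\<lambda>\<omega>. \<bar>X \<omega> - Y n \<omega>\<bar>) < e / 2" by (meson eventually_sequentially order_refl)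
  have Yi: "integrable M (Y n)" using Y by (simp add: apx_def)
  obtain F where F: "cyl F" "integrable M F" "expectation (\<lambda>\<omega>. \<bar>Y n \<omega> - F \<omega>\<bar>) < e / 2"
    using Y[of n] e unfolding apx_def by (meson half_gt_zero)
  have "expectation (\<lambda>\<omega>. \<bar>X \<omega> - F \<omega>\<bar>) \<le> expectation (\<lambda>\<omega>. \<bar>X \<omega> - Y n \<omega>\<bar> + \<bar>Y n \<omega> - F \<omega>\<bar>)"
    using X Yi F(2) by (intro integral_mono) auto
  also have "\<dots> = expectation (\<lambda>\<omega>. \<bar>X \<omega> - Y n \<omega>\<bar>) + expectation (\<lambda>\<omega>. \<bar>Y n \<omega> - F \<omega>\<bar>)"
    using X Yi F(2) by simp
  finally show "\<exists>F. cyl F \<and> integrable M F \<and> expectation (\<lambda>\<omega>. \<bar>X \<omega> - F \<omega>\<bar>) < e" using F n by (intro exI[of _ F]) auto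
qed

text \<open>A Lipschitz function of two variables preserves approximation in L1. Complements, finite
  unions as maxima, scalar multiples and sums are all instances.\<close>

lemma apx_comp2:
  assumes X: "apx X" and Y: "apx Y" and h: "(\<lambda>(x, y). h x y) \<in> borel_measurable (borel \<Otimes>\<^sub>M borel)"
    and L: "\<And>x y x' y'. \<bar>h x y - h x' y'\<bar> \<le> L * (\<bar>x - x'\<bar> + \<bar>y - y'\<bar>)" and L0: "0 < L"
  shows "apx (\<lambda>\<omega>. h (X \<omega>) (Y \<omega>))"
proof -
  have int: "integrable M (\<lambda>\<omega>. h (X \<omega>) (Y \<omega>))" if X: "integrable M X" and Y: "integrable M Y" for X Y
  proof (rule Bochner_Integration.integrable_bound)
    show "integrable M (\<lambda>\<omega>. \<bar>h 0 0\<bar> + L * (\<bar>X \<omega>\<bar> + \<bar>Y \<omega>\<bar>))" using X Y by simp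
    show "(\<lambda>\<omega>. h (X \<omega>) (Y \<omega>)) \<in> borel_measurable M"
      using measurable_compose[OF measurable_Pair[of X M borel Y borel] h] X Y by simp
    show "AE \<omega> in M. norm (h (X \<omega>) (Y \<omega>)) \<le> norm (\<bar>h 0 0\<bar> + L * (\<bar>X \<omega>\<bar> + \<bar>Y \<omega>\<bar>))"
    proof (rule AE_I2)
      fix \<omega>
      have "\<bar>h (X \<omega>) (Y \<omega>)\<bar> \<le> \<bar>h 0 0\<bar> + L * (\<bar>X \<omega>\<bar> + \<bar>Y \<omega>\<bar>)" using L[of "X \<omega>" "Y \<omega>" 0 0] by simp
      then show "norm (h (X \<omega>) (Y \<omega>)) \<le> norm (\<bar>h 0 0\<bar> + L * (\<bar>X \<omega>\<bar> + \<bar>Y \<omega>\<bar>))" by simp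
    qed
  qed
  have Xi: "integrable M X" and Yi: "integrable M Y" using X Y by (auto simp: apx_def)
  show ?thesis unfolding apx_def
  proof (intro conjI allI impI int Xi Yi)
    fix e :: real assume e: "e > 0"
    then have "e / (2 * L) > 0" using L0 by simp
    then obtain F F' where F: "cyl F" "integrable M F" "expectation (\<lambda>\<omega>. \<bar>X \<omega> - F \<omega>\<bar>) < e / (2 * L)"
      and F': "cyl F'" "integrable M F'" "expectation (\<lambda>\<omega>. \<bar>Y \<omega> - F' \<omega>\<bar>) < e / (2 * L)"
      using X Y unfolding apx_def by meson
    have "expectation (\<lambda>\<omega>. \<bar>h (X \<omega>) (Y \<omega>) - h (F \<omega>) (F' \<omega>)\<bar>) \<le> expectation (\<lambda>\<omega>. L * (\<bar>X \<omega> - F \<omega>\<bar> + \<bar>Y \<omega> - F' \<omega>\<bar>))"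
      using Xi Yi F(2) F'(2) int[OF Xi Yi] int[OF F(2) F'(2)] L by (intro integral_mono) auto
    also have "\<dots> = L * (expectation (\<lambda>\<omega>. \<bar>X \<omega> - F \<omega>\<bar>) + expectation (\<lambda>\<omega>. \<bar>Y \<omega> - F' \<omega>\<bar>))"
      using Xi Yi F(2) F'(2) by simp
    also have "\<dots> < L * (e / (2 * L) + e / (2 * L))" using F F' L0 by (intro mult_strict_left_mono add_strict_mono)
    also have "\<dots> = e" using L0 by simp
    finally show "\<exists>F. cyl F \<and> integrable M F \<and> expectation (\<lambda>\<omega>. \<bar>h (X \<omega>) (Y \<omega>) - F \<omega>\<bar>) < e"
      using cyl_comp2[OF F(1) F'(1) h] int[OF F(2) F'(2)] by (intro exI[of _ "\<lambda>\<omega>. h (F \<omega>) (F' \<omega>)"]) auto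
  qed
qed

lemma apx_cyl: "cyl F \<Longrightarrow> integrable M F \<Longrightarrow> apx F"
  unfolding apx_def by (auto intro!: exI[of _ F])

lemma apx_indicator: "A \<in> sets M \<Longrightarrow> apx (indicator A)"
proof (induction rule: sets_induct)
  case (point q B)
  have "cyl (\<lambda>\<omega>. indicator B (Wp q \<omega>))"
    unfolding cyl_def using point measurable_compose[OF measurable_component_singleton[of q "{q}" "\<lambda>_. borel"] borel_measurable_indicator[of B borel]]
    by (intro exI[of _ "{q}"] exI[of _ "\<lambda>x. indicator B (x q)"]) auto
  moreover have "integrable M (\<lambda>\<omega>. indicator B (Wp q \<omega>) :: real)"
    using point Wp_measurable[of q] by (intro integrable_const_bound[where B=1]) auto
  ultimately have a: "apx (\<lambda>\<omega>. indicator B (Wp q \<omega>))" by (rule apx_cyl)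
  have A: "Wp q -` B \<inter> space M \<in> sets M" using measurable_sets[OF Wp_measurable] point by auto
  show ?case
  proof (rule apx_limit[OF _ a])
    show "integrable M (indicator (Wp q -` B \<inter> space M) :: 'a \<Rightarrow> real)" using A by (intro integrable_real_indicator) (auto simp: emeasure_eq_measure)
    have "expectation (\<lambda>\<omega>. \<bar>indicator (Wp q -` B \<inter> space M) \<omega> - indicator B (Wp q \<omega>)\<bar>) = expectation (\<lambda>\<omega>. 0 :: real)"
      by (intro Bochner_Integration.integral_cong) (auto split: split_indicator)
    then show "(\<lambda>n. expectation (\<lambda>\<omega>. \<bar>indicator (Wp q -` B \<inter> space M) \<omega> - indicator B (Wp q \<omega>)\<bar>)) \<longlonglongrightarrow> (0::real)" by simp
  qed
next
  case (null N)
  show ?case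
  proof (rule apx_limit[of _ "\<lambda>_ _. 0"])
    show "integrable M (indicator N :: 'a \<Rightarrow> real)" using null by (intro integrable_real_indicator) auto
    show "apx (\<lambda>_. 0)" by (intro apx_cyl cyl_const) simp
    have "expectation (\<lambda>\<omega>. \<bar>indicator N \<omega> - 0\<bar>) = (measure M N :: real)" using null by (simp add: Int_absorb2 sets.sets_into_space)
    then show "(\<lambda>n. expectation (\<lambda>\<omega>. \<bar>indicator N \<omega> - 0\<bar>)) \<longlonglongrightarrow> (0::real)" using null by (simp add: measure_def null_setsD1)
  qed
next
  case (compl A)
  have a: "apx (\<lambda>\<omega>. 1 - indicator A \<omega>)"
    by (rule apx_comp2[OF compl(2) compl(2), of "\<lambda>x _. 1 - x" 1]) auto
  show ?case
  proof (rule apx_limit[OF _ a])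
    show "integrable M (indicator (space M - A) :: 'a \<Rightarrow> real)" using compl by (intro integrable_real_indicator) (auto simp: emeasure_eq_measure)
    have "expectation (\<lambda>\<omega>. \<bar>indicator (space M - A) \<omega> - (1 - indicator A \<omega>)\<bar>) = expectation (\<lambda>\<omega>. 0 :: real)"
      by (intro Bochner_Integration.integral_cong) (auto split: split_indicator)
    then show "(\<lambda>n. expectation (\<lambda>\<omega>. \<bar>indicator (space M - A) \<omega> - (1 - indicator A \<omega>)\<bar>)) \<longlonglongrightarrow> (0::real)" by simp
  qed
next
  case (union A)
  \<comment> \<open>Finite unions come by induction; the countable union is then their limit in
    L1.\<close>
  have fin: "apx (indicator (\<Union>i<n. A i))" for n
  proof (induction n)
    case 0
    have "(indicator (\<Union>i<0. A i) :: 'a \<Rightarrow> real) = (\<lambda>_. 0)" by auto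
    then show ?case using apx_cyl[OF cyl_const[of 0]] by simp
  next
    case (Suc n)
    have "apx (\<lambda>\<omega>. max (indicator (\<Union>i<n. A i) \<omega>) (indicator (A n) \<omega>))"
      by (rule apx_comp2[OF Suc union(2)[of n], of "\<lambda>x y. max x y" 1]) (auto simp: max_def abs_if)
    moreover have "(\<lambda>\<omega>. max (indicator (\<Union>i<n. A i) \<omega>) (indicator (A n) \<omega>)) = (indicator (\<Union>i<Suc n. A i) :: 'a \<Rightarrow> real)"
      by (auto simp: fun_eq_iff indicator_def lessThan_Suc)
    ultimately show ?case by simp
  qed
  show ?case
  proof (rule apx_limit[OF _ fin])
    show "integrable M (indicator (\<Union>i. A i) :: 'a \<Rightarrow> real)" using union by (intro integrable_real_indicator) (auto simp: emeasure_eq_measure)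
    have "(\<lambda>n. expectation (\<lambda>\<omega>. \<bar>indicator (\<Union>i. A i) \<omega> - indicator (\<Union>i<n. A i) \<omega>\<bar>)) \<longlonglongrightarrow> expectation (\<lambda>\<omega>. 0 :: real)"
    proof (rule integral_dominated_convergence[where w="\<lambda>_. 1"])
      show "AE \<omega> in M. (\<lambda>n. \<bar>indicator (\<Union>i. A i) \<omega> - indicator (\<Union>i<n. A i) \<omega>\<bar> :: real) \<longlonglongrightarrow> 0"
      proof (rule AE_I2)
        fix \<omega>
        have "\<forall>\<^sub>F n in sequentially. \<bar>indicator (\<Union>i. A i) \<omega> - indicator (\<Union>i<n. A i) \<omega>\<bar> = (0::real)"
        proof (cases "\<omega> \<in> (\<Union>i. A i)")
          case True
          then obtain i where "\<omega> \<in> A i" by auto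
          then show ?thesis unfolding eventually_sequentially by (intro exI[of _ "Suc i"]) (auto simp: indicator_def)
        next
          case False
          then show ?thesis by (auto simp: indicator_def)
        qed
        then show "(\<lambda>n. \<bar>indicator (\<Union>i. A i) \<omega> - indicator (\<Union>i<n. A i) \<omega>\<bar> :: real) \<longlonglongrightarrow> 0" by (rule tendsto_eventually)
      qed
    qed (use union in \<open>auto split: split_indicator\<close>)
    then show "(\<lambda>n. expectation (\<lambda>\<omega>. \<bar>indicator (\<Union>i. A i) \<omega> - indicator (\<Union>i<n. A i) \<omega>\<bar>)) \<longlonglongrightarrow> (0::real)" by simp
  qed
qed

lemma apx_integrable: "integrable M X \<Longrightarrow> apx X"
proof (induction X rule: integrable_induct)
  case (base A c)
  have "apx (\<lambda>\<omega>. c * indicator A \<omega>)"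
    by (rule apx_comp2[OF apx_indicator[OF base(1)] apx_indicator[OF base(1)], of "\<lambda>x _. c * x" "\<bar>c\<bar> + 1"])
      (auto simp: right_diff_distrib[symmetric] abs_mult intro!: mult_mono)
  then show ?case by (simp add: mult.commute)
next
  case (add f g)
  show ?case by (rule apx_comp2[OF add(3) add(4), of "\<lambda>x y. x + y" 1]) auto
next
  case (lim f s)
  note L = lim
  show ?case
  proof (rule apx_limit[OF L(4) L(5)])
    note [measurable] = borel_measurable_integrable[OF L(1)] borel_measurable_integrable[OF L(4)]
    have "(\<lambda>n. expectation (\<lambda>\<omega>. \<bar>f \<omega> - s n \<omega>\<bar>)) \<longlonglongrightarrow> expectation (\<lambda>\<omega>. 0 :: real)"
    proof (rule integral_dominated_convergence[where w="\<lambda>\<omega>. 3 * \<bar>f \<omega>\<bar>"])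
      show "AE \<omega> in M. (\<lambda>n. \<bar>f \<omega> - s n \<omega>\<bar>) \<longlonglongrightarrow> 0"
      proof (rule AE_I2)
        fix \<omega> assume "\<omega> \<in> space M"
        then have "(\<lambda>n. \<bar>f \<omega> - s n \<omega>\<bar>) \<longlonglongrightarrow> \<bar>f \<omega> - f \<omega>\<bar>" using L(2) by (intro tendsto_intros)
        then show "(\<lambda>n. \<bar>f \<omega> - s n \<omega>\<bar>) \<longlonglongrightarrow> 0" by simp
      qed
      show "AE \<omega> in M. norm \<bar>f \<omega> - s n \<omega>\<bar> \<le> 3 * \<bar>f \<omega>\<bar>" for n
      proof (rule AE_I2)
        fix \<omega> assume "\<omega> \<in> space M"
        then have "\<bar>s n \<omega>\<bar> \<le> 2 * \<bar>f \<omega>\<bar>" using L(3)[of \<omega> n] by simp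
        then show "norm \<bar>f \<omega> - s n \<omega>\<bar> \<le> 3 * \<bar>f \<omega>\<bar>" by simp
      qed
    qed (use L(4) in auto)
    then show "(\<lambda>n. expectation (\<lambda>\<omega>. \<bar>f \<omega> - s n \<omega>\<bar>)) \<longlonglongrightarrow> 0" by simp
  qed
qed

text \<open>Clipping an approximant to \<open>[c, C]\<close> cannot increase its distance to a
  variable with values in that interval.\<close>

lemma bounded_cyl_approx:
  fixes X :: "'a \<Rightarrow> real"
  assumes X: "X \<in> borel_measurable M" "\<And>\<omega>. c \<le> X \<omega>" "\<And>\<omega>. X \<omega> \<le> C" and e: "e > 0"
  shows "\<exists>S g. finite S \<and> S \<subseteq> I \<and> g \<in> borel_measurable (\<Pi>\<^sub>M p\<in>S. borel) \<and> (\<forall>x. c \<le> g x) \<and> (\<forall>x. g x \<le> C) \<and>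
    expectation (\<lambda>\<omega>. \<bar>X \<omega> - g (\<lambda>p\<in>S. Wp p \<omega>)\<bar>) < e"
proof -
  have cC: "c \<le> C" using X(2,3)[of undefined] by linarith
  have Xi: "integrable M X"
    by (rule integrable_const_bound[where B="\<bar>c\<bar> + \<bar>C\<bar>"]) (use X(1) in \<open>auto intro!: AE_I2\<close>, use X(2,3) in \<open>smt (verit)\<close>)
  from apx_integrable[OF Xi] e obtain F where F: "cyl F" "integrable M F" "expectation (\<lambda>\<omega>. \<bar>X \<omega> - F \<omega>\<bar>) < e"
    unfolding apx_def by blast
  then obtain S g where S: "finite S" "S \<subseteq> I" and g [measurable]: "g \<in> borel_measurable (\<Pi>\<^sub>M p\<in>S. borel)" and Fg: "F = (\<lambda>\<omega>. g (\<lambda>p\<in>S. Wp p \<omega>))"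
    unfolding cyl_def by blast
  let ?g = "\<lambda>x. max c (min C (g x))"
  have gF: "?g (\<lambda>p\<in>S. Wp p \<omega>) = max c (min C (F \<omega>))" for \<omega> by (simp add: Fg)
  have Fm: "F \<in> borel_measurable M" using F(2) by auto
  have "expectation (\<lambda>\<omega>. \<bar>X \<omega> - ?g (\<lambda>p\<in>S. Wp p \<omega>)\<bar>) \<le> expectation (\<lambda>\<omega>. \<bar>X \<omega> - F \<omega>\<bar>)"
    unfolding gF
  proof (rule integral_mono')
    show "integrable M (\<lambda>\<omega>. \<bar>X \<omega> - F \<omega>\<bar>)" using Xi F(2) by simp
    show "\<bar>X \<omega> - max c (min C (F \<omega>))\<bar> \<le> \<bar>X \<omega> - F \<omega>\<bar>" for \<omega>
      using X(2)[of \<omega>] X(3)[of \<omega>] by (auto simp: max_def min_def)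
  qed simp
  with F(3) S cC show ?thesis by (intro exI[of _ S] exI[of _ ?g]) auto
qed

section \<open>Approximation of densities in L1 and in entropy\<close>

lemma lim_xlnx_inverse: "(\<lambda>k. 1 / real (Suc k) * ln (1 / real (Suc k))) \<longlonglongrightarrow> 0"
proof -
  have "(\<lambda>n. ln (real n) / real n) \<longlonglongrightarrow> 0" using lim_ln_over_n by simp
  from LIMSEQ_Suc[OF this] have "(\<lambda>k. - (ln (real (Suc k)) / real (Suc k))) \<longlonglongrightarrow> - 0" by (intro tendsto_minus)
  then show ?thesis by (simp add: ln_div field_simps del: of_nat_Suc)
qed

text \<open>Truncation to \<open>[1/(k+1), k+1]\<close> changes the density and its entropy little,
  by dominated convergence. On that interval x ln x is Lipschitz, so an L1 approximation by a
  cylindrical variable also approximates the entropy. The total mass is corrected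
  afterwards.\<close>

lemma density_approx_unnormalized:
  fixes \<rho> :: "'a \<Rightarrow> real"
  assumes rm [measurable]: "\<rho> \<in> borel_measurable M" and r0: "\<And>\<omega>. 0 \<le> \<rho> \<omega>" and ri: "integrable M \<rho>"
    and ei: "integrable M (\<lambda>\<omega>. \<rho> \<omega> * ln (\<rho> \<omega>))" and d: "d > 0"
  shows "\<exists>S g c C. finite S \<and> S \<subseteq> I \<and> g \<in> borel_measurable (\<Pi>\<^sub>M p\<in>S. borel) \<and> 0 < c \<and> (\<forall>x. c \<le> g x) \<and> (\<forall>x. g x \<le> C) \<and>
    expectation (\<lambda>\<omega>. \<bar>\<rho> \<omega> - g (\<lambda>p\<in>S. Wp p \<omega>)\<bar>) < d \<and>
    \<bar>expectation (\<lambda>\<omega>. g (\<lambda>p\<in>S. Wp p \<omega>) * ln (g (\<lambda>p\<in>S. Wp p \<omega>))) - expectation (\<lambda>\<omega>. \<rho> \<omega> * ln (\<rho> \<omega>))\<bar> < d"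
proof -
  define r where "r k \<omega> = max (1 / real (Suc k)) (min (real (Suc k)) (\<rho> \<omega>))" for k \<omega>
  have rkm [measurable]: "r k \<in> borel_measurable M" for k unfolding r_def[abs_def] by measurable
  have rb: "1 / real (Suc k) \<le> r k \<omega>" "r k \<omega> \<le> real (Suc k)" for k \<omega>
  proof -
    have "1 / real (Suc k) \<le> 1" by simp
    also have "1 \<le> real (Suc k)" by simp
    finally show "1 / real (Suc k) \<le> r k \<omega>" "r k \<omega> \<le> real (Suc k)" by (auto simp: r_def)
  qed
  have rpos: "0 < r k \<omega>" for k \<omega> using rb(1)[of k \<omega>] by (smt (verit) of_nat_0_less_iff zero_less_Suc zero_less_divide_1_iff)
  have ev: "\<forall>\<^sub>F k in sequentially. r k \<omega> = \<rho> \<omega>" if "\<rho> \<omega> > 0" for \<omega>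
  proof -
    have "filterlim (\<lambda>n. real (Suc n)) at_top sequentially" by (rule filterlim_compose[OF filterlim_real_sequentially filterlim_Suc])
    then have "\<forall>\<^sub>F k in sequentially. max (\<rho> \<omega>) (1 / \<rho> \<omega>) \<le> real (Suc k)" unfolding filterlim_at_top by blast
    then show ?thesis
    proof eventually_elim
      case (elim k)
      then have 1: "\<rho> \<omega> \<le> real (Suc k)" "1 / \<rho> \<omega> \<le> real (Suc k)" by auto
      then have "1 / real (Suc k) \<le> \<rho> \<omega>" using that by (simp add: field_simps)
      then show ?case using 1 by (simp add: r_def del: of_nat_Suc)
    qed
  qed
  have r_zero: "r k \<omega> = 1 / real (Suc k)" if "\<rho> \<omega> = 0" for k \<omega> using that by (simp add: r_def)
  have rlim: "(\<lambda>k. r k \<omega>) \<longlonglongrightarrow> \<rho> \<omega>" for \<omega>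
  proof (cases "\<rho> \<omega> = 0")
    case True
    then show ?thesis using LIMSEQ_inverse_real_of_nat by (simp add: r_zero inverse_eq_divide)
  next
    case False
    then show ?thesis using r0[of \<omega>] ev[of \<omega>] by (intro tendsto_eventually) auto
  qed
  have elim: "(\<lambda>k. r k \<omega> * ln (r k \<omega>)) \<longlonglongrightarrow> \<rho> \<omega> * ln (\<rho> \<omega>)" for \<omega>
  proof (cases "\<rho> \<omega> = 0")
    case True
    then show ?thesis using lim_xlnx_inverse by (simp add: r_zero)
  next
    case False
    then have "\<forall>\<^sub>F k in sequentially. r k \<omega> * ln (r k \<omega>) = \<rho> \<omega> * ln (\<rho> \<omega>)"
      using r0[of \<omega>] ev[of \<omega>] by (auto elim: eventually_mono)
    then show ?thesis by (rule tendsto_eventually)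
  qed
  have l1: "(\<lambda>k. expectation (\<lambda>\<omega>. \<bar>\<rho> \<omega> - r k \<omega>\<bar>)) \<longlonglongrightarrow> expectation (\<lambda>\<omega>. 0 :: real)"
  proof (rule integral_dominated_convergence[where w="\<lambda>\<omega>. \<rho> \<omega> + 1"])
    show "AE \<omega> in M. (\<lambda>k. \<bar>\<rho> \<omega> - r k \<omega>\<bar>) \<longlonglongrightarrow> 0"
    proof (rule AE_I2)
      fix \<omega>
      have "(\<lambda>k. \<bar>\<rho> \<omega> - r k \<omega>\<bar>) \<longlonglongrightarrow> \<bar>\<rho> \<omega> - \<rho> \<omega>\<bar>" by (intro tendsto_intros rlim)
      then show "(\<lambda>k. \<bar>\<rho> \<omega> - r k \<omega>\<bar>) \<longlonglongrightarrow> 0" by simp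
    qed
    show "AE \<omega> in M. norm \<bar>\<rho> \<omega> - r k \<omega>\<bar> \<le> \<rho> \<omega> + 1" for k
    proof (rule AE_I2)
      fix \<omega>
      have "\<bar>a - max i (min K a)\<bar> \<le> a + 1" if "0 \<le> i" "i \<le> 1" "1 \<le> K" "0 \<le> a" for a i K :: real
        using that by (auto simp: max_def min_def)
      from this[of "1 / real (Suc k)" "real (Suc k)" "\<rho> \<omega>"] show "norm \<bar>\<rho> \<omega> - r k \<omega>\<bar> \<le> \<rho> \<omega> + 1"
        using r0[of \<omega>] by (simp add: r_def)
    qed
  qed (use ri in auto)
  have l2: "(\<lambda>k. expectation (\<lambda>\<omega>. r k \<omega> * ln (r k \<omega>))) \<longlonglongrightarrow> expectation (\<lambda>\<omega>. \<rho> \<omega> * ln (\<rho> \<omega>))"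
  proof (rule integral_dominated_convergence[where w="\<lambda>\<omega>. \<bar>\<rho> \<omega> * ln (\<rho> \<omega>)\<bar> + 1"])
    show "AE \<omega> in M. (\<lambda>k. r k \<omega> * ln (r k \<omega>)) \<longlonglongrightarrow> \<rho> \<omega> * ln (\<rho> \<omega>)" by (intro AE_I2 elim)
    show "AE \<omega> in M. norm (r k \<omega> * ln (r k \<omega>)) \<le> \<bar>\<rho> \<omega> * ln (\<rho> \<omega>)\<bar> + 1" for k
    proof (rule AE_I2)
      fix \<omega>
      let ?k = "real (Suc k)"
      have k1: "1 \<le> ?k" by simp
      consider "\<rho> \<omega> < 1 / ?k" | "1 / ?k \<le> \<rho> \<omega>" "\<rho> \<omega> \<le> ?k" | "?k < \<rho> \<omega>" by linarith
      then show "norm (r k \<omega> * ln (r k \<omega>)) \<le> \<bar>\<rho> \<omega> * ln (\<rho> \<omega>)\<bar> + 1"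
      proof cases
        case 1
        have "1 / ?k \<le> 1" by simp
        with 1 k1 have "r k \<omega> = 1 / ?k" unfolding r_def by linarith
        moreover have "\<bar>(1 / ?k) * ln (1 / ?k)\<bar> \<le> 1" by (rule xlnx_small) auto
        ultimately show ?thesis by (simp del: of_nat_Suc)
      next
        case 2
        then have "r k \<omega> = \<rho> \<omega>" unfolding r_def by linarith
        then show ?thesis by simp
      next
        case 3
        have "1 / ?k \<le> ?k" using rb[of k \<omega>] by linarith
        with 3 have "r k \<omega> = ?k" unfolding r_def by linarith
        moreover have "?k * ln ?k \<le> \<rho> \<omega> * ln (\<rho> \<omega>)" using 3 k1 by (intro mult_mono) auto
        moreover have "0 \<le> ?k * ln ?k" using k1 by simp
        ultimately show ?thesis by (simp del: of_nat_Suc)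
      qed
    qed
  qed (use ei in auto)
  have "\<forall>\<^sub>F k in sequentially. expectation (\<lambda>\<omega>. \<bar>\<rho> \<omega> - r k \<omega>\<bar>) < d / 2" using order_tendstoD(2)[OF l1, of "d/2"] d by simp
  moreover have "\<forall>\<^sub>F k in sequentially. dist (expectation (\<lambda>\<omega>. r k \<omega> * ln (r k \<omega>))) (expectation (\<lambda>\<omega>. \<rho> \<omega> * ln (\<rho> \<omega>))) < d / 2"
    using tendstoD[OF l2, of "d/2"] d by simp
  ultimately have "\<forall>\<^sub>F k in sequentially. expectation (\<lambda>\<omega>. \<bar>\<rho> \<omega> - r k \<omega>\<bar>) < d / 2 \<and> dist (expectation (\<lambda>\<omega>. r k \<omega> * ln (r k \<omega>))) (expectation (\<lambda>\<omega>. \<rho> \<omega> * ln (\<rho> \<omega>))) < d / 2"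
    by (rule eventually_conj)
  then obtain k where k1: "expectation (\<lambda>\<omega>. \<bar>\<rho> \<omega> - r k \<omega>\<bar>) < d / 2"
    and k2: "dist (expectation (\<lambda>\<omega>. r k \<omega> * ln (r k \<omega>))) (expectation (\<lambda>\<omega>. \<rho> \<omega> * ln (\<rho> \<omega>))) < d / 2"
    by (auto simp: eventually_sequentially)
  define k' where "k' = real (Suc k)"
  have kk: "1 \<le> k'" by (simp add: k'_def)
  \<comment> \<open>The Lipschitz constant of x ln x on the truncation interval: an L1 error below d
    / (2 L) costs less than d / 2 in entropy.\<close>
  define L where "L = 1 + ln k'"
  have L: "1 \<le> L" using kk by (simp add: L_def)
  have "d / (2 * L) > 0" using d L by simp
  have rb': "1 / k' \<le> r k \<omega>" "r k \<omega> \<le> k'" for \<omega> using rb[of k \<omega>] by (auto simp: k'_def)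
  from bounded_cyl_approx[OF rkm rb' \<open>d / (2 * L) > 0\<close>] obtain S g where S: "finite S" "S \<subseteq> I" and g [measurable]: "g \<in> borel_measurable (\<Pi>\<^sub>M p\<in>S. borel)"
    and gb: "\<And>x. 1 / k' \<le> g x" "\<And>x. g x \<le> k'" and gd: "expectation (\<lambda>\<omega>. \<bar>r k \<omega> - g (\<lambda>p\<in>S. Wp p \<omega>)\<bar>) < d / (2 * L)"
    by blast
  let ?g = "\<lambda>\<omega>. g (\<lambda>p\<in>S. Wp p \<omega>)"
  have gm [measurable]: "?g \<in> borel_measurable M" using S by (intro measurable_compose[OF _ g] measurable_restrict Wp_measurable) auto
  have k'0: "0 < 1 / k'" using kk by simp
  have ik: "integrable M h" "integrable M (\<lambda>\<omega>. h \<omega> * ln (h \<omega>))" if [measurable]: "h \<in> borel_measurable M" and hb: "\<And>\<omega>. 1 / k' \<le> h \<omega>" "\<And>\<omega>. h \<omega> \<le> k'" for h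
  proof -
    have hp: "\<bar>h \<omega>\<bar> \<le> k'" for \<omega> using hb(1)[of \<omega>] hb(2)[of \<omega>] k'0 by linarith
    then show "integrable M h" by (intro integrable_const_bound[where B=k']) auto
    show "integrable M (\<lambda>\<omega>. h \<omega> * ln (h \<omega>))"
      by (rule integrable_const_bound[where B="k' * (\<bar>ln (1 / k')\<bar> + \<bar>ln k'\<bar>)"]) (auto intro!: AE_I2 mult_ln_bound[OF k'0 hb])
  qed
  note irk = ik[OF rkm rb'] and ig = ik[OF gm gb]
  have small: "d / (2 * L) \<le> d / 2" using d L by (simp add: field_simps)
  have "expectation (\<lambda>\<omega>. \<bar>\<rho> \<omega> - ?g \<omega>\<bar>) \<le> expectation (\<lambda>\<omega>. \<bar>\<rho> \<omega> - r k \<omega>\<bar> + \<bar>r k \<omega> - ?g \<omega>\<bar>)"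
    using ri irk(1) ig(1) by (intro integral_mono) auto
  also have "\<dots> = expectation (\<lambda>\<omega>. \<bar>\<rho> \<omega> - r k \<omega>\<bar>) + expectation (\<lambda>\<omega>. \<bar>r k \<omega> - ?g \<omega>\<bar>)" using ri irk(1) ig(1) by simp
  finally have A: "expectation (\<lambda>\<omega>. \<bar>\<rho> \<omega> - ?g \<omega>\<bar>) < d" using k1 gd small by linarith
  have "\<bar>expectation (\<lambda>\<omega>. r k \<omega> * ln (r k \<omega>)) - expectation (\<lambda>\<omega>. ?g \<omega> * ln (?g \<omega>))\<bar> = \<bar>expectation (\<lambda>\<omega>. r k \<omega> * ln (r k \<omega>) - ?g \<omega> * ln (?g \<omega>))\<bar>"
    using irk(2) ig(2) by simp
  also have "\<dots> \<le> expectation (\<lambda>\<omega>. \<bar>r k \<omega> * ln (r k \<omega>) - ?g \<omega> * ln (?g \<omega>)\<bar>)" by (rule integral_abs_bound)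
  also have "\<dots> \<le> expectation (\<lambda>\<omega>. L * \<bar>r k \<omega> - ?g \<omega>\<bar>)"
    using irk ig xlnx_lipschitz[OF kk rb' gb] by (intro integral_mono) (auto simp: L_def)
  also have "\<dots> = L * expectation (\<lambda>\<omega>. \<bar>r k \<omega> - ?g \<omega>\<bar>)" by simp
  also have "\<dots> < L * (d / (2 * L))" using gd L by (intro mult_strict_left_mono) auto
  also have "\<dots> = d / 2" using L by simp
  finally have B: "\<bar>expectation (\<lambda>\<omega>. ?g \<omega> * ln (?g \<omega>)) - expectation (\<lambda>\<omega>. \<rho> \<omega> * ln (\<rho> \<omega>))\<bar> < d"
    using k2 unfolding dist_real_def by linarith
  show ?thesis using S g k'0 gb A B by blast
qed

text \<open>Normalisation: the means \<open>m n\<close> of the approximations tend to 1. Division by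
  \<open>m n\<close> turns the entropy \<open>E n\<close> into \<open>E n / m n - ln (m n)\<close>,
  which has the same limit as \<open>E n\<close>.\<close>

proposition density_approx:
  fixes \<rho> :: "'a \<Rightarrow> real"
  assumes rm [measurable]: "\<rho> \<in> borel_measurable M" and r0: "\<And>\<omega>. 0 \<le> \<rho> \<omega>" and ri: "integrable M \<rho>" and r1: "expectation \<rho> = 1"
    and ei: "integrable M (\<lambda>\<omega>. \<rho> \<omega> * ln (\<rho> \<omega>))" and e: "e > 0"
  shows "\<exists>S g c C. finite S \<and> S \<subseteq> I \<and> g \<in> borel_measurable (\<Pi>\<^sub>M p\<in>S. borel) \<and> 0 < c \<and> (\<forall>x. c \<le> g x) \<and> (\<forall>x. g x \<le> C) \<and>
    expectation (\<lambda>\<omega>. g (\<lambda>p\<in>S. Wp p \<omega>)) = 1 \<and>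
    expectation (\<lambda>\<omega>. \<bar>\<rho> \<omega> - g (\<lambda>p\<in>S. Wp p \<omega>)\<bar>) < e \<and>
    expectation (\<lambda>\<omega>. g (\<lambda>p\<in>S. Wp p \<omega>) * ln (g (\<lambda>p\<in>S. Wp p \<omega>))) < expectation (\<lambda>\<omega>. \<rho> \<omega> * ln (\<rho> \<omega>)) + e"
proof -
  let ?H = "expectation (\<lambda>\<omega>. \<rho> \<omega> * ln (\<rho> \<omega>))"
  have "\<forall>n::nat. \<exists>z. (case z of (S, g, c, C) \<Rightarrow> finite S \<and> S \<subseteq> I \<and> g \<in> borel_measurable (\<Pi>\<^sub>M p\<in>S. borel) \<and> 0 < c \<and> (\<forall>x. c \<le> g x) \<and> (\<forall>x. g x \<le> C) \<and>
    expectation (\<lambda>\<omega>. \<bar>\<rho> \<omega> - g (\<lambda>p\<in>S. Wp p \<omega>)\<bar>) < 1 / real (Suc n) \<and>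
    \<bar>expectation (\<lambda>\<omega>. g (\<lambda>p\<in>S. Wp p \<omega>) * ln (g (\<lambda>p\<in>S. Wp p \<omega>))) - ?H\<bar> < 1 / real (Suc n))"
  proof
    fix n :: nat
    have "1 / real (Suc n) > 0" by simp
    from density_approx_unnormalized[OF rm r0 ri ei this] show "\<exists>z. (case z of (S, g, c, C) \<Rightarrow> finite S \<and> S \<subseteq> I \<and> g \<in> borel_measurable (\<Pi>\<^sub>M p\<in>S. borel) \<and> 0 < c \<and> (\<forall>x. c \<le> g x) \<and> (\<forall>x. g x \<le> C) \<and>
    expectation (\<lambda>\<omega>. \<bar>\<rho> \<omega> - g (\<lambda>p\<in>S. Wp p \<omega>)\<bar>) < 1 / real (Suc n) \<and>
    \<bar>expectation (\<lambda>\<omega>. g (\<lambda>p\<in>S. Wp p \<omega>) * ln (g (\<lambda>p\<in>S. Wp p \<omega>))) - ?H\<bar> < 1 / real (Suc n))"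
      by (elim exE) (rule_tac x="(S, g, c, C)" in exI, simp)
  qed
  from choice[OF this] obtain z where z: "\<And>n. (case z n of (S, g, c, C) \<Rightarrow> finite S \<and> S \<subseteq> I \<and> g \<in> borel_measurable (\<Pi>\<^sub>M p\<in>S. borel) \<and> 0 < c \<and> (\<forall>x. c \<le> g x) \<and> (\<forall>x. g x \<le> C) \<and>
    expectation (\<lambda>\<omega>. \<bar>\<rho> \<omega> - g (\<lambda>p\<in>S. Wp p \<omega>)\<bar>) < 1 / real (Suc n) \<and>
    \<bar>expectation (\<lambda>\<omega>. g (\<lambda>p\<in>S. Wp p \<omega>) * ln (g (\<lambda>p\<in>S. Wp p \<omega>))) - ?H\<bar> < 1 / real (Suc n))" by blast
  define S g c C where "S n = fst (z n)" and "g n = fst (snd (z n))" and "c n = fst (snd (snd (z n)))" and "C n = snd (snd (snd (z n)))" for n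
  have zz: "finite (S n)" "S n \<subseteq> I" "g n \<in> borel_measurable (\<Pi>\<^sub>M p\<in>S n. borel)" "0 < c n" "\<forall>x. c n \<le> g n x" "\<forall>x. g n x \<le> C n"
    "expectation (\<lambda>\<omega>. \<bar>\<rho> \<omega> - g n (\<lambda>p\<in>S n. Wp p \<omega>)\<bar>) < 1 / real (Suc n)"
    "\<bar>expectation (\<lambda>\<omega>. g n (\<lambda>p\<in>S n. Wp p \<omega>) * ln (g n (\<lambda>p\<in>S n. Wp p \<omega>))) - ?H\<bar> < 1 / real (Suc n)" for n
    using z[of n] by (auto simp: S_def g_def c_def C_def case_prod_beta' simp del: of_nat_Suc)
  define F where "F n \<omega> = g n (\<lambda>p\<in>S n. Wp p \<omega>)" for n \<omega>
  have Fm [measurable]: "F n \<in> borel_measurable M" for n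
    unfolding F_def[abs_def] using zz(1,2)[of n] by (intro measurable_compose[OF _ zz(3)] measurable_restrict Wp_measurable) auto
  have Fb: "c n \<le> F n \<omega>" "F n \<omega> \<le> C n" for n \<omega> using zz(5,6) by (auto simp: F_def)
  have Fp: "0 < F n \<omega>" for n \<omega> using Fb(1)[of n \<omega>] zz(4)[of n] by linarith
  have Fi: "integrable M (F n)" for n
  proof -
    have "\<bar>F n \<omega>\<bar> \<le> C n" for \<omega> using Fb[of n \<omega>] Fp[of n \<omega>] by linarith
    then show ?thesis by (intro integrable_const_bound[where B="C n"]) auto
  qed
  have Fei: "integrable M (\<lambda>\<omega>. F n \<omega> * ln (F n \<omega>))" for n
    by (rule integrable_const_bound[where B="C n * (\<bar>ln (c n)\<bar> + \<bar>ln (C n)\<bar>)"]) (auto intro!: AE_I2 mult_ln_bound[OF zz(4) Fb])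
  define m where "m n = expectation (F n)" for n
  have mp: "0 < m n" for n
  proof -
    have "c n \<le> m n" unfolding m_def using Fb by (intro integral_ge_const Fi) auto
    then show ?thesis using zz(4)[of n] by linarith
  qed
  have md: "\<bar>m n - 1\<bar> \<le> 1 / real (Suc n)" for n
  proof -
    have "\<bar>m n - 1\<bar> = \<bar>expectation (\<lambda>\<omega>. \<rho> \<omega> - F n \<omega>)\<bar>" using ri Fi[of n] r1 by (simp add: m_def abs_minus_commute)
    also have "\<dots> \<le> expectation (\<lambda>\<omega>. \<bar>\<rho> \<omega> - F n \<omega>\<bar>)" by (rule integral_abs_bound)
    finally show ?thesis using zz(7)[of n] by (simp add: F_def del: of_nat_Suc)
  qed
  have inv0: "(\<lambda>n. 1 / real (Suc n)) \<longlonglongrightarrow> 0" using LIMSEQ_inverse_real_of_nat by (simp add: inverse_eq_divide)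
  have tend: "x \<longlonglongrightarrow> l" if x: "\<And>n. \<bar>x n - l\<bar> \<le> 1 / real (Suc n)" for x :: "nat \<Rightarrow> real" and l
  proof (rule LIM_zero_cancel)
    show "(\<lambda>n. x n - l) \<longlonglongrightarrow> 0"
      by (rule Lim_null_comparison[OF always_eventually inv0]) (simp only: real_norm_def x simp_thms)
  qed
  have ml: "m \<longlonglongrightarrow> 1" by (rule tend) (rule md)
  define E where "E n = expectation (\<lambda>\<omega>. F n \<omega> * ln (F n \<omega>))" for n
  have El: "E \<longlonglongrightarrow> ?H"
  proof (rule tend)
    fix n show "\<bar>E n - ?H\<bar> \<le> 1 / real (Suc n)" unfolding E_def F_def using zz(8)[of n] by linarith
  qed
  have "(\<lambda>n. E n / m n - ln (m n)) \<longlonglongrightarrow> ?H / 1 - ln 1" by (intro tendsto_intros El ml) auto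
  then have "\<forall>\<^sub>F n in sequentially. E n / m n - ln (m n) < ?H + e" using e by (intro order_tendstoD(2)) auto
  moreover have "(\<lambda>n. 1 / real (Suc n) + 1 / real (Suc n)) \<longlonglongrightarrow> 0 + 0" by (intro tendsto_add inv0)
  then have "\<forall>\<^sub>F n in sequentially. 1 / real (Suc n) + 1 / real (Suc n) < e" using e by (intro order_tendstoD(2)) auto
  ultimately have "\<forall>\<^sub>F n in sequentially. E n / m n - ln (m n) < ?H + e \<and> 1 / real (Suc n) + 1 / real (Suc n) < e" by (rule eventually_conj)
  then obtain n where n: "E n / m n - ln (m n) < ?H + e" "1 / real (Suc n) + 1 / real (Suc n) < e" unfolding eventually_sequentially by blast
  have G: "g n (\<lambda>p\<in>S n. Wp p \<omega>) / m n = F n \<omega> / m n" for \<omega> by (simp add: F_def)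
  have 1: "expectation (\<lambda>\<omega>. F n \<omega> / m n) = 1" using mp[of n] by (simp add: m_def)
  have 2: "expectation (\<lambda>\<omega>. \<bar>\<rho> \<omega> - F n \<omega> / m n\<bar>) < e"
  proof -
    have "expectation (\<lambda>\<omega>. \<bar>\<rho> \<omega> - F n \<omega> / m n\<bar>) \<le> expectation (\<lambda>\<omega>. \<bar>\<rho> \<omega> - F n \<omega>\<bar> + \<bar>1 - 1 / m n\<bar> * F n \<omega>)"
    proof (intro integral_mono)
      fix \<omega>
      have "F n \<omega> - F n \<omega> / m n = (1 - 1 / m n) * F n \<omega>" by (simp add: left_diff_distrib)
      then have "\<bar>F n \<omega> - F n \<omega> / m n\<bar> = \<bar>1 - 1 / m n\<bar> * F n \<omega>"
        using Fp[of n \<omega>] by (simp only: abs_mult abs_of_pos)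
      then show "\<bar>\<rho> \<omega> - F n \<omega> / m n\<bar> \<le> \<bar>\<rho> \<omega> - F n \<omega>\<bar> + \<bar>1 - 1 / m n\<bar> * F n \<omega>" by linarith
    qed (use ri Fi[of n] in auto)
    also have "\<dots> = expectation (\<lambda>\<omega>. \<bar>\<rho> \<omega> - F n \<omega>\<bar>) + \<bar>1 - 1 / m n\<bar> * m n" using ri Fi[of n] by (simp add: m_def)
    also have "\<bar>1 - 1 / m n\<bar> * m n = \<bar>m n - 1\<bar>"
    proof -
      have "\<bar>1 - 1 / m n\<bar> * m n = \<bar>(1 - 1 / m n) * m n\<bar>" using mp[of n] by (simp add: abs_mult)
      also have "(1 - 1 / m n) * m n = m n - 1" using mp[of n] by (simp add: left_diff_distrib)
      finally show ?thesis .
    qed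
    finally show ?thesis using n(2) md[of n] zz(7)[of n] by (simp add: F_def del: of_nat_Suc)
  qed
  have 3: "expectation (\<lambda>\<omega>. F n \<omega> / m n * ln (F n \<omega> / m n)) = E n / m n - ln (m n)"
  proof -
    have "expectation (\<lambda>\<omega>. F n \<omega> / m n * ln (F n \<omega> / m n)) = expectation (\<lambda>\<omega>. (F n \<omega> * ln (F n \<omega>)) / m n - (ln (m n) / m n) * F n \<omega>)"
      using Fp[of n] mp[of n] by (simp add: ln_div field_simps less_imp_neq[THEN not_sym])
    also have "\<dots> = E n / m n - (ln (m n) / m n) * m n" using Fi[of n] Fei[of n] by (simp add: E_def m_def)
    finally show ?thesis using mp[of n] by simp
  qed
  have gm: "(\<lambda>x. g n x / m n) \<in> borel_measurable (\<Pi>\<^sub>M p\<in>S n. borel)" using zz(3)[of n] by measurable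
  show ?thesis
  proof (intro exI conjI allI)
    show "0 < c n / m n" using zz(4)[of n] mp[of n] by simp
    show "c n / m n \<le> g n x / m n" "g n x / m n \<le> C n / m n" for x
      using zz(5,6)[of n] mp[of n] by (auto intro!: divide_right_mono)
    show "expectation (\<lambda>\<omega>. g n (\<lambda>p\<in>S n. Wp p \<omega>) / m n) = 1" unfolding G by (rule 1)
    show "expectation (\<lambda>\<omega>. \<bar>\<rho> \<omega> - g n (\<lambda>p\<in>S n. Wp p \<omega>) / m n\<bar>) < e" unfolding G by (rule 2)
    show "expectation (\<lambda>\<omega>. g n (\<lambda>p\<in>S n. Wp p \<omega>) / m n * ln (g n (\<lambda>p\<in>S n. Wp p \<omega>) / m n)) < ?H + e"
      unfolding G 3 by (rule n(1))
  qed (use zz(1,2)[of n] gm in auto)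
qed

end

section \<open>Pathwise stability of the mild equation\<close>

lemma Cauchy_Schwarz_lebesgue:
  fixes f g :: "'a \<Rightarrow> real"
  assumes [measurable]: "f \<in> borel_measurable M" "g \<in> borel_measurable M"
    and a: "(\<integral>\<^sup>+x. ennreal ((f x)\<^sup>2) \<partial>M) \<le> ennreal a" "0 \<le> a" and b: "(\<integral>\<^sup>+x. ennreal ((g x)\<^sup>2) \<partial>M) \<le> ennreal b" "0 \<le> b"
  shows "integrable M (\<lambda>x. f x * g x)" "\<bar>\<integral>x. f x * g x \<partial>M\<bar> \<le> sqrt (a * b)"
proof -
  let ?N = "\<integral>\<^sup>+x. ennreal \<bar>f x\<bar> * ennreal \<bar>g x\<bar> \<partial>M"
  have "?N\<^sup>2 \<le> (\<integral>\<^sup>+x. (ennreal \<bar>f x\<bar>)\<^sup>2 \<partial>M) * (\<integral>\<^sup>+x. (ennreal \<bar>g x\<bar>)\<^sup>2 \<partial>M)"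
    by (rule Cauchy_Schwarz_nn_integral) measurable
  also have "\<dots> \<le> ennreal a * ennreal b" using a b by (intro mult_mono) (auto simp: ennreal_power)
  finally have N2: "?N\<^sup>2 \<le> ennreal (a * b)" using a b by (simp add: ennreal_mult)
  have Nfin: "?N < \<infinity>"
  proof (rule ccontr)
    assume "\<not> ?N < \<infinity>"
    then have "?N = \<infinity>" by (simp add: not_less top_unique)
    with N2 show False by (simp add: power2_eq_square top_unique)
  qed
  have eq: "(\<integral>\<^sup>+x. ennreal (norm (f x * g x)) \<partial>M) = ?N" by (simp add: abs_mult ennreal_mult)
  show i: "integrable M (\<lambda>x. f x * g x)" using Nfin eq by (intro integrableI_bounded) auto
  obtain n where n: "?N = ennreal n" "0 \<le> n" using Nfin by (cases ?N) auto
  have "n\<^sup>2 \<le> a * b" using N2 n a b by (simp add: ennreal_power)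
  then have "n \<le> sqrt (a * b)" by (rule real_le_rsqrt)
  moreover have "ennreal \<bar>\<integral>x. f x * g x \<partial>M\<bar> \<le> ennreal n"
    using integral_norm_bound_ennreal[OF i] eq n by simp
  then have "\<bar>\<integral>x. f x * g x \<partial>M\<bar> \<le> n" using n by simp
  ultimately show "\<bar>\<integral>x. f x * g x \<partial>M\<bar> \<le> sqrt (a * b)" by linarith
qed

locale kernel_domain = Pa: path_domain T D + He: heat_kernel_setup bc D a b G
  for T D :: real and bc a b G +
  assumes energy: "kernel_energy T D G < \<infinity>"
begin

text \<open>The kernel of the mild equation at the point q = (t, x), in the integration variables
  and extended by zero, so that drift and noise terms are integrals over the whole plane.\<close>

definition Gk :: "real \<times> real \<Rightarrow> real \<times> real \<Rightarrow> real" where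
  "Gk q = (\<lambda>(s, y). indicator ({0<..<fst q} \<times> {0<..<D}) (s, y) * G (fst q - s) (snd q) y)"

lemma Gk_zero: "z \<notin> {0<..<fst q} \<times> {0<..<D} \<Longrightarrow> Gk q z = 0"
  by (cases z) (simp add: Gk_def)

lemma open_rect: "open ({0<..<t} \<times> {0<..<D :: real})" for t :: real by (intro open_Times) auto

lemma Gk_measurable [measurable]:
  assumes "snd q \<in> {0..D}" shows "Gk q \<in> borel_measurable borel"
proof -
  let ?S = "{0<..<fst q} \<times> {0<..<D}"
  have "continuous_on ?S (\<lambda>z. case (fst q - fst z, snd q, snd z) of (t, x, y) \<Rightarrow> G t x y)"
    by (intro continuous_on_compose2[OF He.G_cont] continuous_intros) (use assms in auto)
  then have "(\<lambda>z. indicator ?S z *\<^sub>R (case (fst q - fst z, snd q, snd z) of (t, x, y) \<Rightarrow> G t x y)) \<in> borel_measurable borel"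
    using open_rect by (intro borel_measurable_continuous_on_indicator borel_open)
  moreover have "(\<lambda>z. indicator ?S z *\<^sub>R (case (fst q - fst z, snd q, snd z) of (t, x, y) \<Rightarrow> G t x y)) = Gk q"
    by (auto simp: Gk_def fun_eq_iff)
  ultimately show ?thesis by simp
qed

lemma nn_integral_lborel_prod:
  assumes "f \<in> borel_measurable borel"
  shows "(\<integral>\<^sup>+z. f z \<partial>(lborel :: (real \<times> real) measure)) = (\<integral>\<^sup>+s. \<integral>\<^sup>+y. f (s, y) \<partial>lborel \<partial>lborel)"
proof -
  have "f \<in> borel_measurable (lborel \<Otimes>\<^sub>M lborel)" using assms by (simp add: lborel_prod)
  from lborel.nn_integral_fst[OF this] show ?thesis by (simp add: lborel_prod)
qed

text \<open>Time reversal turns the integral over (0, t) into a part of the one that defines the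
  energy.\<close>

lemma Gk_energy:
  assumes q: "0 < fst q" "fst q \<le> T" "snd q \<in> {0..D}"
  shows "(\<integral>\<^sup>+z. ennreal ((Gk q z)\<^sup>2) \<partial>lborel) \<le> kernel_energy T D G"
proof -
  obtain t x where tx: "q = (t, x)" by (cases q)
  have [measurable]: "Gk q \<in> borel_measurable borel" using q by (intro Gk_measurable) auto
  let ?k = "\<lambda>r. \<integral>\<^sup>+y\<in>{0..D}. ennreal ((G r x y)\<^sup>2) \<partial>lborel"
  have "(\<integral>\<^sup>+z. ennreal ((Gk q z)\<^sup>2) \<partial>lborel) = (\<integral>\<^sup>+s. \<integral>\<^sup>+y. ennreal ((Gk q (s, y))\<^sup>2) \<partial>lborel \<partial>lborel)"
    by (rule nn_integral_lborel_prod) measurable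
  also have "\<dots> = (\<integral>\<^sup>+r. \<integral>\<^sup>+y. ennreal ((Gk q (t - r, y))\<^sup>2) \<partial>lborel \<partial>lborel)"
  proof -
    have "(\<lambda>s. \<integral>\<^sup>+y. ennreal ((Gk q (s, y))\<^sup>2) \<partial>lborel) \<in> borel_measurable borel"
    proof (rule lborel.borel_measurable_nn_integral)
      have "(\<lambda>z. ennreal ((Gk q z)\<^sup>2)) \<in> borel_measurable (borel \<Otimes>\<^sub>M lborel)"
        by (subst measurable_cong_sets[OF sets_pair_measure_cong[OF refl sets_lborel] refl], subst borel_prod) measurable
      then show "(\<lambda>(s, y). ennreal ((Gk q (s, y))\<^sup>2)) \<in> borel_measurable (borel \<Otimes>\<^sub>M lborel)" by (simp add: case_prod_beta')
    qed
    from nn_integral_real_affine[OF this, of "-1" t] show ?thesis by simp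
  qed
  also have "\<dots> \<le> (\<integral>\<^sup>+r\<in>{0..T}. ?k r \<partial>lborel)"
  proof (rule nn_integral_mono)
    fix r :: real
    show "(\<integral>\<^sup>+y. ennreal ((Gk q (t - r, y))\<^sup>2) \<partial>lborel) \<le> ?k r * indicator {0..T} r"
    proof (cases "0 < r \<and> r < t")
      case True
      then have "(\<integral>\<^sup>+y. ennreal ((Gk q (t - r, y))\<^sup>2) \<partial>lborel) \<le> ?k r"
        by (intro nn_integral_mono) (auto simp: Gk_def tx split: split_indicator)
      then show ?thesis using True q tx by (auto split: split_indicator)
    next
      case False
      then have "(\<integral>\<^sup>+y. ennreal ((Gk q (t - r, y))\<^sup>2) \<partial>lborel) = (\<integral>\<^sup>+y. 0 \<partial>(lborel :: real measure))"
        by (intro nn_integral_cong) (auto simp: Gk_def tx split: split_indicator)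
      then show ?thesis by simp
    qed
  qed
  also have "\<dots> \<le> kernel_energy T D G"
    unfolding kernel_energy_def using q tx by (intro SUP_upper2[of x]) auto
  finally show ?thesis .
qed

text \<open>The bound on the total variation of the kernel removes the space variable, and the
  exponential weight makes the time integral explicit.\<close>

lemma Gk_abs_bound:
  assumes q: "0 < fst q" "snd q \<in> {0..D}" and l: "0 < l" and B: "0 \<le> B"
    and F: "\<And>s y. s \<in> {0<..<fst q} \<Longrightarrow> y \<in> {0<..<D} \<Longrightarrow> F (s, y) \<le> B * exp (l * s)"
  shows "(\<integral>\<^sup>+z. ennreal (\<bar>Gk q z\<bar> * F z) \<partial>lborel) \<le> ennreal (B * ((exp (l * fst q) - 1) / l))"
proof -
  obtain t x where tx: "q = (t, x)" by (cases q)
  have [measurable]: "Gk q \<in> borel_measurable borel" using q by (intro Gk_measurable) auto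
  have "(\<integral>\<^sup>+z. ennreal (\<bar>Gk q z\<bar> * F z) \<partial>lborel) \<le> (\<integral>\<^sup>+z. ennreal (\<bar>Gk q z\<bar> * (B * exp (l * fst z))) \<partial>lborel)"
  proof (intro nn_integral_mono ennreal_leI)
    fix z :: "real \<times> real"
    show "\<bar>Gk q z\<bar> * F z \<le> \<bar>Gk q z\<bar> * (B * exp (l * fst z))"
    proof (cases "z \<in> {0<..<fst q} \<times> {0<..<D}")
      case True
      then show ?thesis using F[of "fst z" "snd z"] by (intro mult_left_mono) auto
    qed (simp add: Gk_zero)
  qed
  also have "\<dots> = (\<integral>\<^sup>+s. \<integral>\<^sup>+y. ennreal (\<bar>Gk q (s, y)\<bar> * (B * exp (l * s))) \<partial>lborel \<partial>lborel)"
  proof -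
    have [measurable]: "(fst :: real \<times> real \<Rightarrow> real) \<in> borel_measurable borel"
      by (intro borel_measurable_continuous_onI continuous_intros)
    have "(\<lambda>z. ennreal (\<bar>Gk q z\<bar> * (B * exp (l * fst z)))) \<in> borel_measurable borel" by measurable
    from nn_integral_lborel_prod[OF this] show ?thesis by simp
  qed
  also have "\<dots> \<le> (\<integral>\<^sup>+s. ennreal (B * exp (l * s)) * indicator {0..t} s \<partial>lborel)"
  proof (rule nn_integral_mono)
    fix s :: real
    show "(\<integral>\<^sup>+y. ennreal (\<bar>Gk q (s, y)\<bar> * (B * exp (l * s))) \<partial>lborel) \<le> ennreal (B * exp (l * s)) * indicator {0..t} s"
    proof (cases "0 < s \<and> s < t")
      case True
      have i: "integrable lborel (\<lambda>y. indicator {0..D} y * \<bar>G (t - s) x y\<bar>)" "(\<integral>y. indicator {0..D} y * \<bar>G (t - s) x y\<bar> \<partial>lborel) \<le> 1"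
        using He.G_abs_integral_le[of "t - s" x] True q tx by auto
      have "(\<integral>\<^sup>+y. ennreal (\<bar>Gk q (s, y)\<bar> * (B * exp (l * s))) \<partial>lborel) \<le> (\<integral>\<^sup>+y. ennreal (B * exp (l * s)) * ennreal (indicator {0..D} y * \<bar>G (t - s) x y\<bar>) \<partial>lborel)"
        using B by (intro nn_integral_mono) (auto simp: Gk_def tx ennreal_mult[symmetric] mult_ac split: split_indicator)
      also have "\<dots> = ennreal (B * exp (l * s)) * (\<integral>\<^sup>+y. ennreal (indicator {0..D} y * \<bar>G (t - s) x y\<bar>) \<partial>lborel)"
        using borel_measurable_integrable[OF i(1)] by (intro nn_integral_cmult) auto
      also have "(\<integral>\<^sup>+y. ennreal (indicator {0..D} y * \<bar>G (t - s) x y\<bar>) \<partial>lborel) = ennreal (\<integral>y. indicator {0..D} y * \<bar>G (t - s) x y\<bar> \<partial>lborel)"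
        by (rule nn_integral_eq_integral[OF i(1)]) auto
      also have "ennreal (B * exp (l * s)) * \<dots> \<le> ennreal (B * exp (l * s)) * 1"
        using i(2) by (intro mult_left_mono) (auto simp: ennreal_le_1)
      finally show ?thesis using True by (auto split: split_indicator)
    next
      case False
      then have "(\<integral>\<^sup>+y. ennreal (\<bar>Gk q (s, y)\<bar> * (B * exp (l * s))) \<partial>lborel) = (\<integral>\<^sup>+y. 0 \<partial>(lborel :: real measure))"
        by (intro nn_integral_cong) (auto simp: Gk_def tx split: split_indicator)
      then show ?thesis by simp
    qed
  qed
  also have "\<dots> = ennreal (B * exp (l * t) / l - B * exp (l * 0) / l)"
  proof (rule nn_integral_FTC_Icc[where F="\<lambda>s. B * exp (l * s) / l" and f="\<lambda>s. B * exp (l * s)"])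
    show "((\<lambda>s. B * exp (l * s) / l) has_real_derivative B * exp (l * s)) (at s)" for s
      using l by (auto intro!: derivative_eq_intros)
  qed (use q tx B in auto)
  also have "B * exp (l * t) / l - B * exp (l * 0) / l = B * ((exp (l * fst q) - 1) / l)"
    using tx by (simp add: right_diff_distrib diff_divide_distrib)
  finally show ?thesis .
qed

text \<open>Gronwall's argument in a weighted supremum norm. With the weight exp (- l t), l > L, the
  explicit time integral bounds the weighted difference by a convex combination of the noise term
  \<open>c\<close> and L / l times its own maximum. Hence the maximum is at most \<open>c\<close>,
  with no extra factor, and letting \<open>l\<close> decrease to \<open>L\<close> gives the exponent
  L T.\<close>

lemma pathwise_stability:
  assumes p: "p \<in> mspace Pa.E" "p' \<in> mspace Pa.E" and L: "0 < L"
    and h [measurable]: "h \<in> borel_measurable borel" and h2: "(\<integral>\<^sup>+z. ennreal ((h z)\<^sup>2) \<partial>lborel) \<le> ennreal H" "0 \<le> H"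
    and lip: "\<And>s y v w. s \<in> {0..T} \<Longrightarrow> y \<in> {0..D} \<Longrightarrow> \<bar>g s y v - g s y w\<bar> \<le> L * \<bar>v - w\<bar>"
    and i: "\<And>q. q \<in> Pa.Q \<Longrightarrow> integrable lborel (\<lambda>z. Gk q z * g (fst z) (snd z) (p z))"
    and i': "\<And>q. q \<in> Pa.Q \<Longrightarrow> integrable lborel (\<lambda>z. Gk q z * g (fst z) (snd z) (p' z))"
    and eq: "\<And>q. q \<in> Pa.Q \<Longrightarrow> p' q - p q = (\<integral>z. Gk q z * g (fst z) (snd z) (p' z) \<partial>lborel) - (\<integral>z. Gk q z * g (fst z) (snd z) (p z) \<partial>lborel) + (\<integral>z. Gk q z * h z \<partial>lborel)"
  shows "mdist Pa.E p p' \<le> sqrt (enn2real (kernel_energy T D G) * H) * exp (L * T)"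
proof -
  define c where "c = sqrt (enn2real (kernel_energy T D G) * H)"
  have c0: "0 \<le> c" using h2 by (simp add: c_def)
  have gen: "mdist Pa.E p p' \<le> c * exp (l * T)" if l: "L < l" for l
  proof -
    have l0: "0 < l" using l L by linarith
    define w where "w z = exp (- (l * fst z)) * \<bar>p' z - p z\<bar>" for z
    have cw: "continuous_on Pa.R w"
      unfolding w_def by (intro continuous_intros Pa.mspace_cont p)
    obtain z0 where z0: "z0 \<in> Pa.R" "\<And>z. z \<in> Pa.R \<Longrightarrow> w z \<le> w z0"
      using continuous_attains_sup[OF Pa.compact_R Pa.R_nonempty cw] by blast
    define B where "B = w z0"
    have B0: "0 \<le> B" by (simp add: B_def w_def)
    have vB: "\<bar>p' z - p z\<bar> \<le> B * exp (l * fst z)" if "z \<in> Pa.R" for z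
    proof -
      have "w z * exp (l * fst z) \<le> B * exp (l * fst z)" using z0(2)[OF that] by (intro mult_right_mono) (auto simp: B_def)
      moreover have "w z * exp (l * fst z) = \<bar>p' z - p z\<bar>" by (simp add: w_def exp_minus)
      ultimately show ?thesis by simp
    qed
    have wq: "w q \<le> max c (L / l * B)" if q: "q \<in> Pa.Q" for q
    proof -
      have q': "0 < fst q" "fst q \<le> T" "snd q \<in> {0..D}" using q Pa.Q(2) by auto
      have [measurable]: "Gk q \<in> borel_measurable borel" using q' by (intro Gk_measurable) auto
      let ?A = "\<integral>z. Gk q z * (g (fst z) (snd z) (p' z) - g (fst z) (snd z) (p z)) \<partial>lborel"
      have id: "integrable lborel (\<lambda>z. Gk q z * (g (fst z) (snd z) (p' z) - g (fst z) (snd z) (p z)))"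
        using i[OF q] i'[OF q] by (simp add: right_diff_distrib)
      have "ennreal \<bar>?A\<bar> \<le> (\<integral>\<^sup>+z. ennreal (norm (Gk q z * (g (fst z) (snd z) (p' z) - g (fst z) (snd z) (p z)))) \<partial>lborel)"
        using integral_norm_bound_ennreal[OF id] by simp
      also have "\<dots> = (\<integral>\<^sup>+z. ennreal (\<bar>Gk q z\<bar> * \<bar>g (fst z) (snd z) (p' z) - g (fst z) (snd z) (p z)\<bar>) \<partial>lborel)"
        by (simp add: abs_mult)
      also have "\<dots> \<le> ennreal (L * B * ((exp (l * fst q) - 1) / l))"
      proof (rule Gk_abs_bound[OF q'(1,3) l0])
        fix s y assume sy: "s \<in> {0<..<fst q}" "y \<in> {0<..<D}"
        then have R: "(s, y) \<in> Pa.R" using q' by (auto simp: Pa.R_def)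
        have "\<bar>g s y (p' (s, y)) - g s y (p (s, y))\<bar> \<le> L * \<bar>p' (s, y) - p (s, y)\<bar>" using sy q' by (intro lip) auto
        also have "\<dots> \<le> L * (B * exp (l * s))" using vB[OF R] L by (intro mult_left_mono) auto
        finally show "\<bar>g (fst (s, y)) (snd (s, y)) (p' (s, y)) - g (fst (s, y)) (snd (s, y)) (p (s, y))\<bar> \<le> L * B * exp (l * s)" by (simp add: mult.assoc)
      qed (use L B0 in auto)
      finally have A: "\<bar>?A\<bar> \<le> L * B * ((exp (l * fst q) - 1) / l)"
        using L B0 l0 q' by (subst (asm) ennreal_le_iff) (auto intro!: mult_nonneg_nonneg divide_nonneg_nonneg)
      have "\<bar>\<integral>z. Gk q z * h z \<partial>lborel\<bar> \<le> c"
        unfolding c_def using Gk_energy[OF q'] h2 energy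
        by (intro Cauchy_Schwarz_lebesgue(2)) (auto simp: less_top[symmetric])
      moreover have "p' q - p q = ?A + (\<integral>z. Gk q z * h z \<partial>lborel)"
        using eq[OF q] i[OF q] i'[OF q] by (simp add: right_diff_distrib)
      ultimately have v: "\<bar>p' q - p q\<bar> \<le> c + L / l * B * (exp (l * fst q) - 1)" using A by simp
      define al where "al = exp (- (l * fst q))"
      have al: "0 < al" "al \<le> 1" using l0 q' by (auto simp: al_def)
      have "w q \<le> al * (c + L / l * B * (exp (l * fst q) - 1))"
        unfolding w_def al_def using v by (intro mult_left_mono) auto
      \<comment> \<open>The product of exp (- l t) and exp (l t) - 1 is 1 - al, so the two weights
        add up to one.\<close>
      also have "\<dots> = al * c + (1 - al) * (L / l * B)"
        by (simp add: algebra_simps al_def exp_minus)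
      also have "\<dots> \<le> al * max c (L / l * B) + (1 - al) * max c (L / l * B)"
        using al by (intro add_mono mult_left_mono) auto
      also have "\<dots> = max c (L / l * B)" by (simp add: algebra_simps)
      finally show ?thesis .
    qed
    \<comment> \<open>The equation is available on \<open>Q\<close> only; continuity of
      \<open>w\<close> carries the bound to the point where the maximum is attained.\<close>
    have "B \<le> max c (L / l * B)" unfolding B_def by (rule Pa.le_on_Q_imp[OF cw _ z0(1)]) (use wq B_def in auto)
    moreover have "L / l * B < B" if "0 < B" using that l l0 by (simp add: field_simps)
    ultimately have Bc: "B \<le> c" using c0 B0 by (cases "B = 0") (auto simp: max_def split: if_splits)
    show ?thesis unfolding Pa.mdist_le_iff[OF p]
    proof
      fix z assume z: "z \<in> Pa.R"
      have "\<bar>p z - p' z\<bar> \<le> B * exp (l * fst z)" using vB[OF z] by (simp add: abs_minus_commute)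
      also have "\<dots> \<le> c * exp (l * T)" using Bc c0 B0 l0 z by (intro mult_mono) (auto simp: Pa.R_def)
      finally show "\<bar>p z - p' z\<bar> \<le> c * exp (l * T)" .
    qed
  qed
  have "((\<lambda>l. c * exp (l * T)) \<longlongrightarrow> c * exp (L * T)) (at_right L)" by (intro tendsto_intros)
  then have "mdist Pa.E p p' \<le> c * exp (L * T)"
    by (rule tendsto_lowerbound) (auto simp: eventually_at_right_field intro!: exI[of _ "L + 1"] gen)
  then show ?thesis by (simp add: c_def)
qed

end

section \<open>The solution as a functional of the path of the sheet\<close>

locale spde = Sh: sheet_generated M T D W + Ke: kernel_domain T D bc a b G
  for M :: "'w measure" and T D :: real and W bc a b G +
  fixes u\<^sub>0 :: "real \<Rightarrow> real" and g :: "real \<Rightarrow> real \<Rightarrow> real \<Rightarrow> real" and L :: real and u :: "real \<Rightarrow> real \<Rightarrow> 'w \<Rightarrow> real"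
  assumes g_meas: "(\<lambda>(t, x, v). g t x v) \<in> borel_measurable (restrict_space borel ({0..T} \<times> {0..D} \<times> UNIV))"
    and L_pos: "0 < L"
    and lip: "\<And>t x v w. t \<in> {0..T} \<Longrightarrow> x \<in> {0..D} \<Longrightarrow> \<bar>g t x v - g t x w\<bar> \<le> L * \<bar>v - w\<bar>"
    and mild: "mild_solution M T D W G u\<^sub>0 g u"
    and traj: "continuous_trajectories M T D u"
begin

abbreviation "E \<equiv> path_space T D"
abbreviation "N \<equiv> metric_borel (path_space T D)"
abbreviation "Q \<equiv> Ke.Pa.Q"
abbreviation "R \<equiv> Ke.Pa.R"

lemma I_eq: "Sh.I = R" by (simp add: Sh.I_def Ke.Pa.R_def)

definition up :: "'w \<Rightarrow> real \<times> real \<Rightarrow> real" where "up \<omega> = (\<lambda>(t, x)\<in>{0..T} \<times> {0..D}. u t x \<omega>)"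

lemma path_law_eq: "path_law M T D u = distr M N up"
  unfolding path_law_def up_def[abs_def] ..

lemma up_mspace: "\<omega> \<in> space M \<Longrightarrow> up \<omega> \<in> mspace E"
proof -
  assume w: "\<omega> \<in> space M"
  have "continuous_on R (\<lambda>(t, x). u t x \<omega>)" using traj w by (auto simp: continuous_trajectories_def Ke.Pa.R_def)
  then have "continuous_on R (up \<omega>)" by (rule continuous_on_eq) (auto simp: up_def Ke.Pa.R_def)
  then show ?thesis by (simp add: Ke.Pa.mspace_E up_def Ke.Pa.R_def)
qed

text \<open>Fixing time and place maps the predictable algebra into the events: the section of a
  generator is empty or an event of the filtration.\<close>

lemma u_measurable:
  assumes "t \<in> {0..T}" "x \<in> {0..D}" shows "u t x \<in> borel_measurable M"
proof -
  let ?P = "predictable_algebra M T D (sheet_filtration M T D W)"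
  let ?g = "{{0} \<times> B \<times> A | B A. B \<in> sets borel \<and> B \<subseteq> {0..D} \<and> A \<in> sheet_filtration M T D W 0} \<union>
      {{s<..t} \<times> B \<times> A | s t B A. 0 \<le> s \<and> s \<le> t \<and> t \<le> T \<and> B \<in> sets borel \<and> B \<subseteq> {0..D} \<and> A \<in> sheet_filtration M T D W s}"
  have sub: "sheet_filtration M T D W s \<subseteq> sets M" if "s \<le> T" for s
  proof
    fix A assume "A \<in> sheet_filtration M T D W s"
    then have "A \<in> augmented_history M D W (min (T + 1) T)" unfolding sheet_filtration_def by (rule INT_D) (use that in auto)
    then show "A \<in> sets M" unfolding Sh.gen sheet_filtration_def by (auto simp: min_def)
  qed
  have sp: "sheet_filtration M T D W s \<subseteq> Pow (space M)" if "s \<le> T" for s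
    using sub[OF that] sets.sets_into_space by auto
  have gen: "\<exists>C B A s. Y = C \<times> B \<times> A \<and> C \<subseteq> {0..T} \<and> B \<subseteq> {0..D} \<and> A \<in> sheet_filtration M T D W s \<and> s \<le> T" if "Y \<in> ?g" for Y
  proof -
    from that have "(\<exists>B A. Y = {0} \<times> B \<times> A \<and> B \<in> sets borel \<and> B \<subseteq> {0..D} \<and> A \<in> sheet_filtration M T D W 0) \<or>
      (\<exists>s t B A. Y = {s<..t} \<times> B \<times> A \<and> 0 \<le> s \<and> s \<le> t \<and> t \<le> T \<and> B \<in> sets borel \<and> B \<subseteq> {0..D} \<and> A \<in> sheet_filtration M T D W s)"
      unfolding Un_iff mem_Collect_eq .
    then show ?thesis
    proof (elim disjE exE conjE)
      fix B A assume *: "Y = {0} \<times> B \<times> A" "B \<subseteq> {0..D}" "A \<in> sheet_filtration M T D W 0"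
      have "{0} \<subseteq> {0..T}" "0 \<le> T" using Sh.T_pos by simp_all
      with * show ?thesis by metis
    next
      fix s t B A assume *: "Y = {s<..t} \<times> B \<times> A" "0 \<le> s" "s \<le> t" "t \<le> T" "B \<subseteq> {0..D}" "A \<in> sheet_filtration M T D W s"
      have "{s<..t} \<subseteq> {0..T}" "s \<le> T" using * by auto
      with * show ?thesis by metis
    qed
  qed
  have gP: "?g \<subseteq> Pow ({0..T} \<times> {0..D} \<times> space M)"
  proof
    fix Y assume "Y \<in> ?g"
    from gen[OF this] obtain C B A s where Y: "Y = C \<times> B \<times> A" "C \<subseteq> {0..T}" "B \<subseteq> {0..D}" "A \<in> sheet_filtration M T D W s" "s \<le> T" by blast
    then have "A \<subseteq> space M" using sp by blast
    then show "Y \<in> Pow ({0..T} \<times> {0..D} \<times> space M)" using Y by blast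
  qed
  have "(\<lambda>\<omega>. (t, x, \<omega>)) \<in> measurable M ?P"
    unfolding predictable_algebra_def
  proof (rule measurable_measure_of[OF gP])
    show "(\<lambda>\<omega>. (t, x, \<omega>)) \<in> space M \<rightarrow> {0..T} \<times> {0..D} \<times> space M" using assms by auto
    fix Y assume "Y \<in> ?g"
    from gen[OF this] obtain C B A s where Y: "Y = C \<times> B \<times> A" "A \<in> sheet_filtration M T D W s" "s \<le> T" by blast
    then have "A \<in> sets M" using sub by auto
    moreover have "(\<lambda>\<omega>. (t, x, \<omega>)) -` Y \<inter> space M = (if t \<in> C \<and> x \<in> B then A \<inter> space M else {})" using Y by auto
    ultimately show "(\<lambda>\<omega>. (t, x, \<omega>)) -` Y \<inter> space M \<in> sets M" by auto
  qed
  moreover have "(\<lambda>(t, x, \<omega>). u t x \<omega>) \<in> borel_measurable ?P"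
    using mild by (auto simp: mild_solution_def predictable_field_def)
  ultimately have "(\<lambda>\<omega>. (\<lambda>(t, x, \<omega>). u t x \<omega>) (t, x, \<omega>)) \<in> borel_measurable M" by (rule measurable_compose)
  then show ?thesis by simp
qed

lemma up_measurable [measurable]: "up \<in> measurable M N"
proof (rule Ke.Pa.measurable_path_borelI[OF up_mspace])
  fix q assume "q \<in> Q"
  then have q: "fst q \<in> {0..T}" "snd q \<in> {0..D}" using Ke.Pa.Q(2) by (auto simp: less_imp_le)
  then have "(\<lambda>\<omega>. up \<omega> q) = u (fst q) (snd q)" by (cases q) (auto simp: up_def fun_eq_iff)
  then show "(\<lambda>\<omega>. up \<omega> q) \<in> borel_measurable M" using u_measurable[OF q] by simp
qed

text \<open>The values at the points of \<open>Q\<close> are factored one by one and the factors are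
  glued into a path. Two continuous paths that agree on \<open>Q\<close> are at distance zero, hence
  equal.\<close>

lemma factor_path: "\<exists>V\<in>measurable Sh.K N. AE \<omega> in M. V (Sh.w \<omega>) = up \<omega>"
proof -
  have "\<exists>U. U \<in> borel_measurable Sh.K \<and> (AE \<omega> in M. up \<omega> q = U (Sh.w \<omega>))" if q: "q \<in> Q" for q
  proof -
    have "(\<lambda>\<omega>. up \<omega> q) \<in> borel_measurable M"
      by (rule measurable_compose[OF up_measurable Ke.Pa.eval_measurable]) (use q Ke.Pa.Q_subset in auto)
    from Sh.factor_fun[OF this] show ?thesis by blast
  qed
  then have "\<forall>q. \<exists>U. q \<in> Q \<longrightarrow> U \<in> borel_measurable Sh.K \<and> (AE \<omega> in M. up \<omega> q = U (Sh.w \<omega>))" by blast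
  from choice[OF this] obtain U where U: "\<forall>q. q \<in> Q \<longrightarrow> U q \<in> borel_measurable Sh.K \<and> (AE \<omega> in M. up \<omega> q = U q (Sh.w \<omega>))" by (rule exE)
  from Ke.Pa.path_extension[of U Sh.K] U obtain V where V: "V \<in> measurable Sh.K N"
    and ext: "\<And>\<kappa>. \<kappa> \<in> space Sh.K \<Longrightarrow> (\<exists>p\<in>mspace E. \<forall>q\<in>Q. p q = U q \<kappa>) \<Longrightarrow> (\<forall>q\<in>Q. V \<kappa> q = U q \<kappa>)" by blast
  have "AE \<omega> in M. \<forall>q\<in>Q. up \<omega> q = U q (Sh.w \<omega>)" using U Ke.Pa.Q(1) by (subst AE_ball_countable) auto
  then have "AE \<omega> in M. V (Sh.w \<omega>) = up \<omega>"
    using AE_space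
  proof eventually_elim
    case (elim \<omega>)
    have k: "Sh.w \<omega> \<in> space Sh.K" using measurable_space[OF Sh.w_measurable elim(2)] .
    have Vm: "V (Sh.w \<omega>) \<in> mspace E" using measurable_space[OF V k] by (simp add: Ke.Pa.space_N)
    have um: "up \<omega> \<in> mspace E" using elim(2) by (rule up_mspace)
    have eqQ: "\<forall>q\<in>Q. V (Sh.w \<omega>) q = up \<omega> q" using ext[OF k] um elim(1) by metis
    have "mdist E (V (Sh.w \<omega>)) (up \<omega>) \<le> 0" unfolding Ke.Pa.mdist_le_iff_Q[OF Vm um] using eqQ by simp
    then show ?case using Vm um mdist_nonneg[of E] by (metis antisym mdist_zero)
  qed
  then show ?thesis using V by blast
qed

lemma drift_joint_measurable:
  assumes q: "q \<in> Q"
  shows "(\<lambda>(p, z). Ke.Gk q z * g (fst z) (snd z) (p z)) \<in> borel_measurable (N \<Otimes>\<^sub>M lborel)"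
proof -
  have q': "snd q \<in> {0..D}" "0 < fst q" "fst q < T" using q Ke.Pa.Q(2) by auto
  have [measurable]: "Ke.Gk q \<in> borel_measurable borel" using q' by (intro Ke.Gk_measurable) auto
  have Rb [measurable]: "R \<in> sets borel" using Ke.Pa.compact_R by (simp add: borel_compact)
  let ?L = "restrict_space borel R :: (real \<times> real) measure"
  have e: "(\<lambda>x. fst x (snd x)) \<in> borel_measurable (N \<Otimes>\<^sub>M ?L)"
    using measurable_compose[OF measurable_pair_swap' Ke.Pa.joint_eval_measurable] by (simp add: case_prod_beta')
  have z: "snd \<in> measurable (N \<Otimes>\<^sub>M ?L) borel"
    using measurable_compose[OF measurable_snd measurable_restrict_space1[OF measurable_ident]] by simp
  have "(\<lambda>x. (fst (snd x), snd (snd x), fst x (snd x))) \<in> measurable (N \<Otimes>\<^sub>M ?L) (restrict_space borel ({0..T} \<times> {0..D} \<times> UNIV))"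
  proof (rule measurable_restrict_space2)
    show "(\<lambda>x. (fst (snd x), snd (snd x), fst x (snd x))) \<in> space (N \<Otimes>\<^sub>M ?L) \<rightarrow> {0..T} \<times> {0..D} \<times> UNIV"
      by (auto simp: space_pair_measure space_restrict_space Ke.Pa.R_def)
    show "(\<lambda>x. (fst (snd x), snd (snd x), fst x (snd x))) \<in> borel_measurable (N \<Otimes>\<^sub>M ?L)"
      using e z by (intro borel_measurable_Pair measurable_compose[OF z borel_measurable_continuous_onI]) (auto intro: continuous_intros)
  qed
  from measurable_compose[OF this g_meas]
  have gm: "(\<lambda>x. g (fst (snd x)) (snd (snd x)) (fst x (snd x))) \<in> borel_measurable (N \<Otimes>\<^sub>M ?L)" by simp
  \<comment> \<open>A measurable retraction onto the rectangle, because measurability of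
    \<open>g\<close> and of the evaluation is known only there. The kernel vanishes off the
    rectangle, so the product is unchanged.\<close>
  define r :: "real \<times> real \<Rightarrow> real \<times> real" where "r z = (if z \<in> R then z else (0, 0))" for z
  have r: "r \<in> measurable borel ?L"
  proof (rule measurable_restrict_space2)
    show "r \<in> space borel \<rightarrow> R" using Sh.T_pos Sh.D_pos by (auto simp: r_def Ke.Pa.R_def)
    show "r \<in> borel_measurable borel" unfolding r_def[abs_def] by measurable
  qed
  have "(\<lambda>x. (fst x, r (snd x))) \<in> measurable (N \<Otimes>\<^sub>M borel) (N \<Otimes>\<^sub>M ?L)"
    using measurable_compose[OF measurable_snd r] by (intro measurable_Pair) auto
  from measurable_compose[OF this gm]
  have "(\<lambda>x. Ke.Gk q (snd x) * g (fst (r (snd x))) (snd (r (snd x))) (fst x (r (snd x)))) \<in> borel_measurable (N \<Otimes>\<^sub>M borel)"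
    by simp
  moreover have "Ke.Gk q z * g (fst (r z)) (snd (r z)) (p (r z)) = Ke.Gk q z * g (fst z) (snd z) (p z)" for z p
  proof (cases "z \<in> R")
    case False
    then have "Ke.Gk q z = 0" using q' by (intro Ke.Gk_zero) (auto simp: Ke.Pa.R_def)
    then show ?thesis by simp
  qed (simp add: r_def)
  ultimately have "(\<lambda>x. Ke.Gk q (snd x) * g (fst (snd x)) (snd (snd x)) (fst x (snd x))) \<in> borel_measurable (N \<Otimes>\<^sub>M borel)" by simp
  then have "(\<lambda>x. Ke.Gk q (snd x) * g (fst (snd x)) (snd (snd x)) (fst x (snd x))) \<in> borel_measurable (N \<Otimes>\<^sub>M lborel)"
    by (simp cong: measurable_cong_sets sets_pair_measure_cong)
  then show ?thesis by (simp add: case_prod_beta')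
qed

definition J0 :: "real \<times> real \<Rightarrow> real" where "J0 q = (LINT y:{0..D}|lebesgue. G (fst q) (snd q) y * u\<^sub>0 y)"

definition drift :: "real \<times> real \<Rightarrow> (real \<times> real \<Rightarrow> real) \<Rightarrow> real" where
  "drift q p = (\<integral>z. Ke.Gk q z * g (fst z) (snd z) (p z) \<partial>lborel)"

lemma mild_at:
  assumes q: "q \<in> Q"
  shows "\<exists>Z. walsh_integral M T D W (Ke.Gk q) Z \<and>
    (AE \<omega> in M. integrable lborel (\<lambda>z. Ke.Gk q z * g (fst z) (snd z) (up \<omega> z)) \<and> up \<omega> q = J0 q + drift q (up \<omega>) + Z \<omega>)"
proof -
  obtain t x where tx: "q = (t, x)" by (cases q)
  have t: "t \<in> {0<..T}" "x \<in> {0..D}" using q Ke.Pa.Q(2) tx by auto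
  then obtain Z where Z: "walsh_integral M T D W (\<lambda>(s, y). indicator ({0<..<t} \<times> {0<..<D}) (s, y) * G (t - s) x y) Z"
    and ae: "AE \<omega> in M. set_integrable lborel ({0<..<t} \<times> {0<..<D}) (\<lambda>(s, y). G (t - s) x y * g s y (u s y \<omega>)) \<and>
           u t x \<omega> = (LINT y:{0..D}|lebesgue. G t x y * u\<^sub>0 y) +
             (LINT z:{0<..<t} \<times> {0<..<D}|lborel. case z of (s, y) \<Rightarrow> G (t - s) x y * g s y (u s y \<omega>)) + Z \<omega>"
    using mild unfolding mild_solution_def by meson
  have e: "indicator ({0<..<t} \<times> {0<..<D}) z *\<^sub>R (case z of (s, y) \<Rightarrow> G (t - s) x y * g s y (u s y \<omega>)) = Ke.Gk q z * g (fst z) (snd z) (up \<omega> z)" for z \<omega>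
    using t by (cases z) (auto simp: Ke.Gk_def tx up_def split: split_indicator)
  have 1: "walsh_integral M T D W (Ke.Gk q) Z" using Z by (simp add: Ke.Gk_def tx)
  have "AE \<omega> in M. integrable lborel (\<lambda>z. Ke.Gk q z * g (fst z) (snd z) (up \<omega> z)) \<and> up \<omega> q = J0 q + drift q (up \<omega>) + Z \<omega>"
    using ae
  proof eventually_elim
    case (elim \<omega>)
    have "up \<omega> q = u t x \<omega>" using t by (simp add: up_def tx)
    then show ?case using elim unfolding set_integrable_def set_lebesgue_integral_def[of _ "{0<..<t} \<times> {0<..<D}"] e drift_def J0_def
      by (simp add: tx)
  qed
  with 1 show ?thesis by blast
qed

end

section \<open>The solution driven by shifted noise\<close>

text \<open>The sequences \<open>A n\<close> and \<open>B n\<close> converge in mean square, but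
  their difference \<open>d n\<close> only pointwise, since in the application it has random
  coefficients. Fatou's lemma reconciles the two modes of convergence.\<close>

lemma L2_limit_shift:
  fixes Z Y c :: "'a \<Rightarrow> real" and A B d :: "nat \<Rightarrow> 'a \<Rightarrow> real"
  assumes [measurable]: "Z \<in> borel_measurable M" "Y \<in> borel_measurable M" "c \<in> borel_measurable M"
    "\<And>n. A n \<in> borel_measurable M" "\<And>n. B n \<in> borel_measurable M" "\<And>n. d n \<in> borel_measurable M"
    and Zl: "(\<lambda>n. \<integral>\<^sup>+x. ennreal ((Z x - A n x)\<^sup>2) \<partial>M) \<longlonglongrightarrow> 0"
    and Yl: "(\<lambda>n. \<integral>\<^sup>+x. ennreal ((Y x - B n x)\<^sup>2) \<partial>M) \<longlonglongrightarrow> 0"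
    and B: "\<And>n x. x \<in> space M \<Longrightarrow> B n x = A n x + d n x" and dl: "\<And>x. x \<in> space M \<Longrightarrow> (\<lambda>n. d n x) \<longlonglongrightarrow> c x"
  shows "AE x in M. Y x = Z x + c x"
proof -
  have "(\<integral>\<^sup>+x. ennreal ((Y x - Z x - c x)\<^sup>2) \<partial>M) = (\<integral>\<^sup>+x. liminf (\<lambda>n. ennreal ((Y x - Z x - d n x)\<^sup>2)) \<partial>M)"
    by (intro nn_integral_cong lim_imp_Liminf[symmetric] tendsto_ennrealI tendsto_intros dl) auto
  also have "\<dots> \<le> liminf (\<lambda>n. \<integral>\<^sup>+x. ennreal ((Y x - Z x - d n x)\<^sup>2) \<partial>M)"
    by (intro nn_integral_liminf) measurable
  also have "\<dots> \<le> liminf (\<lambda>n. 2 * (\<integral>\<^sup>+x. ennreal ((Y x - B n x)\<^sup>2) \<partial>M) + 2 * (\<integral>\<^sup>+x. ennreal ((Z x - A n x)\<^sup>2) \<partial>M))"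
  proof (intro Liminf_mono always_eventually allI)
    fix n
    have "(\<integral>\<^sup>+x. ennreal ((Y x - Z x - d n x)\<^sup>2) \<partial>M) \<le> (\<integral>\<^sup>+x. 2 * ennreal ((Y x - B n x)\<^sup>2) + 2 * ennreal ((Z x - A n x)\<^sup>2) \<partial>M)"
    proof (intro nn_integral_mono)
      fix x assume "x \<in> space M"
      then have "Y x - Z x - d n x = (Y x - B n x) - (Z x - A n x)" using B by simp
      then have "(Y x - Z x - d n x)\<^sup>2 \<le> 2 * (Y x - B n x)\<^sup>2 + 2 * (Z x - A n x)\<^sup>2" by (simp only: power2_diff_le)
      then have "ennreal ((Y x - Z x - d n x)\<^sup>2) \<le> ennreal (2 * (Y x - B n x)\<^sup>2 + 2 * (Z x - A n x)\<^sup>2)" by (rule ennreal_leI)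
      also have "\<dots> = 2 * ennreal ((Y x - B n x)\<^sup>2) + 2 * ennreal ((Z x - A n x)\<^sup>2)" by (simp add: ennreal_mult)
      finally show "ennreal ((Y x - Z x - d n x)\<^sup>2) \<le> 2 * ennreal ((Y x - B n x)\<^sup>2) + 2 * ennreal ((Z x - A n x)\<^sup>2)" .
    qed
    also have "\<dots> = 2 * (\<integral>\<^sup>+x. ennreal ((Y x - B n x)\<^sup>2) \<partial>M) + 2 * (\<integral>\<^sup>+x. ennreal ((Z x - A n x)\<^sup>2) \<partial>M)"
      by (subst nn_integral_add) (auto simp: nn_integral_cmult)
    finally show "(\<integral>\<^sup>+x. ennreal ((Y x - Z x - d n x)\<^sup>2) \<partial>M) \<le> 2 * (\<integral>\<^sup>+x. ennreal ((Y x - B n x)\<^sup>2) \<partial>M) + 2 * (\<integral>\<^sup>+x. ennreal ((Z x - A n x)\<^sup>2) \<partial>M)" .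
  qed
  also have "\<dots> = 2 * 0 + 2 * 0"
    by (intro lim_imp_Liminf tendsto_add ennreal_tendsto_cmult Yl Zl) auto
  finally have "(\<integral>\<^sup>+x. ennreal ((Y x - Z x - c x)\<^sup>2) \<partial>M) = 0" by simp
  then have "AE x in M. ennreal ((Y x - Z x - c x)\<^sup>2) = 0" by (subst (asm) nn_integral_0_iff_AE) auto
  then show ?thesis by eventually_elim simp
qed

text \<open>The integral of a step function as a function of the path of the sheet, so that it can be evaluated at the
  shifted path as well.\<close>

definition step_eval :: "rect_step \<Rightarrow> (real \<times> real \<Rightarrow> real) \<Rightarrow> real" where
  "step_eval xs \<kappa> = (\<Sum>(k, (a, b), (c, d))\<leftarrow>xs. k * (\<kappa> (b, d) - \<kappa> (a, d) - \<kappa> (b, c) + \<kappa> (a, c)))"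

lemma step_eval_Nil [simp]: "step_eval [] \<kappa> = 0" by (simp add: step_eval_def)

lemma step_eval_Cons [simp]: "step_eval ((k, (a, b), (c, d)) # xs) \<kappa> = k * (\<kappa> (b, d) - \<kappa> (a, d) - \<kappa> (b, c) + \<kappa> (a, c)) + step_eval xs \<kappa>"
  by (simp add: step_eval_def)

lemma rect_step_fun_Cons [simp]: "rect_step_fun ((k, (a, b), (c, d)) # xs) z = k * indicator ({a<..b} \<times> {c<..d}) z + rect_step_fun xs z"
  by (simp add: rect_step_fun_def)

lemma rect_step_in_Cons [simp]: "rect_step_in T D ((k, (a, b), (c, d)) # xs) \<longleftrightarrow>
    0 \<le> a \<and> a \<le> b \<and> b \<le> T \<and> 0 \<le> c \<and> c \<le> d \<and> d \<le> D \<and> rect_step_in T D xs"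
  by (auto simp: rect_step_in_def)

lemma rect_step_fun_measurable [measurable]: "rect_step_fun xs \<in> borel_measurable borel"
proof (induction xs)
  case Nil
  have "rect_step_fun [] = (\<lambda>_. 0)" by (simp add: rect_step_fun_def fun_eq_iff)
  then show ?case by simp
next
  case (Cons y ys)
  obtain k a b c d where y: "y = (k, (a, b), (c, d))" by (cases y) auto
  have "{a<..b} \<times> {c<..d} \<in> sets (borel \<Otimes>\<^sub>M borel)" by measurable
  then have "{a<..b} \<times> {c<..d} \<in> sets borel" unfolding borel_prod .
  moreover have "rect_step_fun (y # ys) = (\<lambda>z. k * indicator ({a<..b} \<times> {c<..d}) z + rect_step_fun ys z)" by (simp add: y fun_eq_iff)
  ultimately show ?case using Cons by simp
qed

context spde begin

lemma step_eval_w: "rect_step_in T D xs \<Longrightarrow> rect_step_integral W xs \<omega> = step_eval xs (Sh.w \<omega>)"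
proof (induction xs)
  case Nil show ?case by (simp add: rect_step_integral_def)
next
  case (Cons y ys)
  obtain k a b c d where y: "y = (k, (a, b), (c, d))" by (cases y) auto
  have "rect_step_integral W (y # ys) \<omega> = k * (W b d \<omega> - W a d \<omega> - W b c \<omega> + W a c \<omega>) + rect_step_integral W ys \<omega>"
    by (simp add: rect_step_integral_def y)
  then show ?case using Cons by (simp add: y Sh.w_def Sh.I_def Sh.Wp_def)
qed

lemma step_eval_measurable: "rect_step_in T D xs \<Longrightarrow> step_eval xs \<in> borel_measurable Sh.K"
proof (induction xs)
  case Nil
  have "step_eval [] = (\<lambda>_. 0)" by (simp add: fun_eq_iff)
  then show ?case by simp
next
  case (Cons y ys)
  obtain k a b c d where y: "y = (k, (a, b), (c, d))" by (cases y) auto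
  have m: "(\<lambda>\<kappa>. \<kappa> q) \<in> borel_measurable Sh.K" if "q \<in> Sh.I" for q
    unfolding Sh.K_def using that by (rule measurable_component_singleton)
  have "(b, d) \<in> Sh.I" "(a, d) \<in> Sh.I" "(b, c) \<in> Sh.I" "(a, c) \<in> Sh.I" using Cons.prems by (auto simp: y Sh.I_def)
  note [measurable] = this[THEN m]
  have [measurable]: "step_eval ys \<in> borel_measurable Sh.K" using Cons by (simp add: y)
  have "step_eval (y # ys) = (\<lambda>\<kappa>. k * (\<kappa> (b, d) - \<kappa> (a, d) - \<kappa> (b, c) + \<kappa> (a, c)) + step_eval ys \<kappa>)" by (simp add: y fun_eq_iff)
  also have "\<dots> \<in> borel_measurable Sh.K" by measurable
  finally show ?case .
qed

lemma step_eval_restrict: "rect_step_in T D xs \<Longrightarrow> step_eval xs (restrict \<kappa> Sh.I) = step_eval xs \<kappa>"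
proof (induction xs)
  case (Cons y ys)
  obtain k a b c d where y: "y = (k, (a, b), (c, d))" by (cases y) auto
  have "(b, d) \<in> Sh.I" "(a, d) \<in> Sh.I" "(b, c) \<in> Sh.I" "(a, c) \<in> Sh.I" using Cons.prems by (auto simp: y Sh.I_def)
  then show ?case using Cons by (simp add: y)
qed simp

lemma step_eval_shift: "step_eval xs (\<lambda>q. f q + (\<Sum>i<n. d i * \<phi> i q)) = step_eval xs f + (\<Sum>i<n. d i * step_eval xs (\<phi> i))"
proof (induction xs)
  case (Cons y ys)
  obtain k a b c d' where y: "y = (k, (a, b), (c, d'))" by (cases y) auto
  show ?case by (simp add: y Cons sum_distrib_left sum.distrib sum_subtractf algebra_simps)
qed simp

lemma bounded_times_indicator_integrable:
  assumes [measurable]: "e \<in> borel_measurable borel" and "\<And>z. \<bar>e z\<bar> \<le> B" "\<And>z. z \<notin> Sh.I \<Longrightarrow> e z = 0" and [measurable]: "h \<in> borel_measurable borel" and "\<And>z. \<bar>h z\<bar> \<le> C"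
  shows "integrable lborel (\<lambda>z. e z * h z :: real)"
proof (rule Bochner_Integration.integrable_bound)
  have Ib: "Sh.I \<in> sets borel" using Ke.Pa.compact_R by (simp add: I_eq borel_compact)
  have "emeasure lborel Sh.I < \<infinity>" using emeasure_compact_finite[OF Ke.Pa.compact_R] by (simp add: I_eq)
  then show "integrable lborel (\<lambda>z. (B * C) * indicator Sh.I z :: real)" using Ib by (intro integrable_mult_right integrable_real_indicator) auto
  show "AE z in lborel. norm (e z * h z) \<le> norm ((B * C) * indicator Sh.I z :: real)"
  proof (rule AE_I2)
    fix z
    show "norm (e z * h z) \<le> norm ((B * C) * indicator Sh.I z :: real)"
    proof (cases "z \<in> Sh.I")
      case True
      have "\<bar>e z\<bar> * \<bar>h z\<bar> \<le> B * C" using assms(2,5)[of z] by (intro mult_mono) auto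
      also have "\<dots> \<le> \<bar>B * C\<bar>" by (rule abs_ge_self)
      finally show ?thesis using True by (simp add: abs_mult)
    qed (simp add: assms(3))
  qed
qed simp

text \<open>By inclusion and exclusion of rectangles at the origin, the increment of the primitive
  of \<open>e\<close> over a rectangle is the integral of \<open>e\<close> over it. So the step
  integral of the shift is the L2 product of \<open>e\<close> with the step function.\<close>

lemma step_eval_primitive:
  assumes e: "e \<in> borel_measurable borel" "\<And>z. \<bar>e z\<bar> \<le> B" "\<And>z. z \<notin> Sh.I \<Longrightarrow> e z = 0"
  shows "rect_step_in T D xs \<Longrightarrow> integrable lborel (\<lambda>z. e z * rect_step_fun xs z) \<and>
    step_eval xs (\<lambda>q. \<integral>z. e z * indicator (Sh.rect q) z \<partial>lborel) = (\<integral>z. e z * rect_step_fun xs z \<partial>lborel)"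
proof (induction xs)
  case Nil show ?case by (simp add: rect_step_fun_def)
next
  case (Cons y ys)
  obtain k a b c d where y: "y = (k, (a, b), (c, d))" by (cases y) auto
  have i: "integrable lborel (\<lambda>z. e z * indicator (Sh.rect q) z)" for q
    by (rule bounded_times_indicator_integrable[OF e, where C=1]) (auto split: split_indicator)
  have ind: "indicator ({a<..b} \<times> {c<..d}) z = (indicator (Sh.rect (b, d)) z - indicator (Sh.rect (a, d)) z - indicator (Sh.rect (b, c)) z + indicator (Sh.rect (a, c)) z :: real)" for z
    using Cons.prems by (cases z) (auto simp: y Sh.rect_def indicator_def)
  have IH: "integrable lborel (\<lambda>z. e z * rect_step_fun ys z)" "step_eval ys (\<lambda>q. \<integral>z. e z * indicator (Sh.rect q) z \<partial>lborel) = (\<integral>z. e z * rect_step_fun ys z \<partial>lborel)"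
    using Cons by (auto simp: y)
  have split: "(\<lambda>z. e z * rect_step_fun (y # ys) z) = (\<lambda>z. k * (e z * indicator (Sh.rect (b, d)) z - e z * indicator (Sh.rect (a, d)) z - e z * indicator (Sh.rect (b, c)) z + e z * indicator (Sh.rect (a, c)) z) + e z * rect_step_fun ys z)"
    by (simp add: y ind algebra_simps fun_eq_iff)
  show ?case unfolding split using i IH by (simp add: y)
qed

text \<open>The path functional \<open>V\<close> of the solution is evaluated at the shifted sheet,
  so no equation has to be solved anew: the mild equation is inherited. The two equations differ by
  the drift terms and by the integral of the kernel against \<open>h\<close>, which is the setting
  of the pathwise stability estimate.\<close>

theorem shifted_solution:
  assumes S: "finite S" "S \<subseteq> Sh.I" and Fm [measurable]: "F \<in> borel_measurable (\<Pi>\<^sub>M p\<in>S. borel)"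
    and c0: "0 < c0" and F: "\<And>x. c0 \<le> F x" "\<And>x. F x \<le> C0"
    and F1: "Sh.expectation (\<lambda>\<omega>. F (\<lambda>p\<in>S. Sh.Wp p \<omega>)) = 1"
  shows "\<exists>v\<in>measurable M N. distr M N v = distr (density M (\<lambda>\<omega>. ennreal (F (\<lambda>p\<in>S. Sh.Wp p \<omega>)))) N up \<and>
    (\<integral>\<^sup>+\<omega>. ennreal ((mdist E (up \<omega>) (v \<omega>))\<^sup>2) \<partial>M) \<le>
      ennreal (enn2real (kernel_energy T D G) * exp (2 * L * T)) * ennreal (2 * Sh.expectation (\<lambda>\<omega>. F (\<lambda>p\<in>S. Sh.Wp p \<omega>) * ln (F (\<lambda>p\<in>S. Sh.Wp p \<omega>))))"
proof -
  let ?F = "\<lambda>\<omega>. F (\<lambda>p\<in>S. Sh.Wp p \<omega>)"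
  let ?pr = "\<lambda>e q. \<integral>z. e z * indicator (Sh.rect q) z \<partial>lborel"
  have FWm [measurable]: "?F \<in> borel_measurable M"
    using S by (intro measurable_compose[OF _ Fm] measurable_restrict Sh.Wp_measurable) auto
  from Sh.cylinder_shift[OF S Fm c0 F F1] obtain n e d Be where
    em [measurable]: "\<And>i::nat. e i \<in> borel_measurable borel" and eb: "\<And>i z. i < n \<Longrightarrow> \<bar>e i z\<bar> \<le> Be" and ez: "\<And>i z. z \<notin> Sh.I \<Longrightarrow> e i z = 0"
    and eo: "\<And>i j. i < n \<Longrightarrow> j < n \<Longrightarrow> (\<integral>z. e i z * e j z \<partial>lborel) = (if i = j then 1 else 0)"
    and dm: "\<And>i. i < n \<Longrightarrow> d i \<in> borel_measurable M"
    and law: "distr M (\<Pi>\<^sub>M q\<in>Sh.I. borel) (\<lambda>\<omega>. \<lambda>q\<in>Sh.I. Sh.Wp q \<omega> + (\<Sum>i<n. d i \<omega> * ?pr (e i) q)) =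
      distr (density M (\<lambda>\<omega>. ennreal (?F \<omega>))) (\<Pi>\<^sub>M q\<in>Sh.I. borel) (\<lambda>\<omega>. \<lambda>q\<in>Sh.I. Sh.Wp q \<omega>)"
    and cost: "(\<integral>\<^sup>+\<omega>. (\<Sum>i<n. ennreal ((d i \<omega>)\<^sup>2)) \<partial>M) \<le> ennreal (2 * Sh.expectation (\<lambda>\<omega>. ?F \<omega> * ln (?F \<omega>)))"
    by blast
  define w' where "w' \<omega> = (\<lambda>q\<in>Sh.I. Sh.Wp q \<omega> + (\<Sum>i<n. d i \<omega> * ?pr (e i) q))" for \<omega>
  have w'm [measurable]: "w' \<in> measurable M Sh.K"
    unfolding w'_def[abs_def] Sh.K_def
    by (intro measurable_restrict borel_measurable_add borel_measurable_sum borel_measurable_times Sh.Wp_measurable dm) auto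
  have law': "distr M Sh.K w' = distr (density M (\<lambda>\<omega>. ennreal (?F \<omega>))) Sh.K Sh.w"
    using law unfolding w'_def[abs_def, symmetric] Sh.w_def[abs_def, symmetric] Sh.K_def[symmetric] .
  have tr_nn: "(\<integral>\<^sup>+\<omega>. f (w' \<omega>) \<partial>M) = (\<integral>\<^sup>+\<omega>. ennreal (?F \<omega>) * f (Sh.w \<omega>) \<partial>M)" if [measurable]: "f \<in> borel_measurable Sh.K" for f
  proof -
    have "(\<integral>\<^sup>+\<omega>. f (w' \<omega>) \<partial>M) = (\<integral>\<^sup>+\<kappa>. f \<kappa> \<partial>distr M Sh.K w')" by (subst nn_integral_distr) auto
    also have "\<dots> = (\<integral>\<^sup>+\<omega>. f (Sh.w \<omega>) \<partial>density M (\<lambda>\<omega>. ennreal (?F \<omega>)))" unfolding law' by (subst nn_integral_distr) auto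
    also have "\<dots> = (\<integral>\<^sup>+\<omega>. ennreal (?F \<omega>) * f (Sh.w \<omega>) \<partial>M)" by (subst nn_integral_density) auto
    finally show ?thesis .
  qed
  \<comment> \<open>The law of \<open>w'\<close> is that of \<open>w\<close> under a density, so
    almost sure properties pass from \<open>w\<close> to \<open>w'\<close>, provided that they are
    measurable in the path.\<close>
  have tr_AE: "AE \<omega> in M. P (w' \<omega>)" if ae: "AE \<omega> in M. P (Sh.w \<omega>)" and Pm: "{\<kappa> \<in> space Sh.K. P \<kappa>} \<in> sets Sh.K" for P
  proof -
    have "AE \<omega> in density M (\<lambda>\<omega>. ennreal (?F \<omega>)). P (Sh.w \<omega>)"
      using ae by (subst AE_density) (auto elim: eventually_mono)
    then have "AE \<kappa> in distr M Sh.K w'. P \<kappa>" unfolding law' using Pm by (subst AE_distr_iff) auto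
    then show ?thesis using Pm by (subst (asm) AE_distr_iff) auto
  qed
  obtain V where V [measurable]: "V \<in> measurable Sh.K N" and Vu: "AE \<omega> in M. V (Sh.w \<omega>) = up \<omega>" using factor_path by blast
  define v where "v \<omega> = V (w' \<omega>)" for \<omega>
  have vm [measurable]: "v \<in> measurable M N" unfolding v_def[abs_def] by measurable
  have lawv: "distr M N v = distr (density M (\<lambda>\<omega>. ennreal (?F \<omega>))) N up"
  proof -
    have "distr M N v = distr (distr M Sh.K w') N V" unfolding v_def[abs_def] by (subst distr_distr) (auto simp: comp_def)
    also have "\<dots> = distr (density M (\<lambda>\<omega>. ennreal (?F \<omega>))) N (\<lambda>\<omega>. V (Sh.w \<omega>))"
      unfolding law' by (subst distr_distr) (auto simp: comp_def)
    also have "\<dots> = distr (density M (\<lambda>\<omega>. ennreal (?F \<omega>))) N up"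
      by (rule distr_cong_AE) (use Vu in \<open>auto simp: AE_density elim: eventually_mono\<close>)
    finally show ?thesis .
  qed
  \<comment> \<open>The density of the Cameron-Martin shift; orthonormality of the
    \<open>e i\<close> makes its squared norm the sum of the squares of the coefficients.\<close>
  define h where "h \<omega> z = (\<Sum>i<n. d i \<omega> * e i z)" for \<omega> z
  have hm [measurable]: "h \<omega> \<in> borel_measurable borel" for \<omega> unfolding h_def[abs_def] by measurable
  have e2: "integrable lborel (\<lambda>z. e i z * e j z)" if "i < n" "j < n" for i j
    by (rule bounded_times_indicator_integrable[OF em eb[OF that(1)] ez em eb[OF that(2)]])
  have h2: "(\<integral>\<^sup>+z. ennreal ((h \<omega> z)\<^sup>2) \<partial>lborel) = ennreal (\<Sum>i<n. (d i \<omega>)\<^sup>2)" for \<omega>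
  proof -
    have sq: "(h \<omega> z)\<^sup>2 = (\<Sum>i<n. \<Sum>j<n. d i \<omega> * d j \<omega> * (e i z * e j z))" for z
      unfolding h_def power2_eq_square sum_product by (simp add: mult_ac)
    have "integrable lborel (\<lambda>z. (h \<omega> z)\<^sup>2)" unfolding sq using e2 by (intro Bochner_Integration.integrable_sum integrable_mult_right) auto
    then have "(\<integral>\<^sup>+z. ennreal ((h \<omega> z)\<^sup>2) \<partial>lborel) = ennreal (\<integral>z. (h \<omega> z)\<^sup>2 \<partial>lborel)" by (intro nn_integral_eq_integral) auto
    also have "(\<integral>z. (h \<omega> z)\<^sup>2 \<partial>lborel) = (\<Sum>i<n. \<Sum>j<n. d i \<omega> * d j \<omega> * (\<integral>z. e i z * e j z \<partial>lborel))"
      unfolding sq using e2 by (subst Bochner_Integration.integral_sum) (auto intro!: sum.cong Bochner_Integration.integrable_sum simp: Bochner_Integration.integral_sum)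
    also have "\<dots> = (\<Sum>i<n. \<Sum>j<n. if j = i then d i \<omega> * d i \<omega> else 0)" using eo by (intro sum.cong) auto
    also have "\<dots> = (\<Sum>i<n. (d i \<omega>)\<^sup>2)" by (simp add: power2_eq_square)
    finally show ?thesis .
  qed
  have key: "AE \<omega> in M. integrable lborel (\<lambda>z. Ke.Gk q z * g (fst z) (snd z) (up \<omega> z)) \<and> integrable lborel (\<lambda>z. Ke.Gk q z * g (fst z) (snd z) (v \<omega> z)) \<and>
     v \<omega> q - up \<omega> q = drift q (v \<omega>) - drift q (up \<omega>) + (\<integral>z. Ke.Gk q z * h \<omega> z \<partial>lborel)" if q: "q \<in> Q" for q
  proof -
    have q': "0 < fst q" "fst q \<le> T" "snd q \<in> {0..D}" using q Ke.Pa.Q(2) by auto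
    have Gm [measurable]: "Ke.Gk q \<in> borel_measurable borel" using q' by (intro Ke.Gk_measurable) auto
    obtain Z where Zw: "walsh_integral M T D W (Ke.Gk q) Z"
      and Zae: "AE \<omega> in M. integrable lborel (\<lambda>z. Ke.Gk q z * g (fst z) (snd z) (up \<omega> z)) \<and> up \<omega> q = J0 q + drift q (up \<omega>) + Z \<omega>"
      using mild_at[OF q] by blast
    from Zw have Zm [measurable]: "Z \<in> borel_measurable M" by (simp add: walsh_integral_def)
    from Zw obtain xs where xs: "\<And>k. rect_step_in T D (xs k)"
      and xl: "(\<lambda>k. \<integral>\<^sup>+z\<in>{0..T} \<times> {0..D}. ennreal ((Ke.Gk q z - rect_step_fun (xs k) z)\<^sup>2) \<partial>lborel) \<longlonglongrightarrow> 0"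
      and Zl: "(\<lambda>k. \<integral>\<^sup>+\<omega>. ennreal ((Z \<omega> - rect_step_integral W (xs k) \<omega>)\<^sup>2) \<partial>M) \<longlonglongrightarrow> 0"
      unfolding walsh_integral_def by blast
    \<comment> \<open>The stochastic convolution is also a functional of the path and can therefore
      be evaluated at the shifted sheet.\<close>
    obtain VZ where VZ [measurable]: "VZ \<in> borel_measurable Sh.K" and VZae: "AE \<omega> in M. Z \<omega> = VZ (Sh.w \<omega>)" using Sh.factor_fun[OF Zm] by blast
    note sm [measurable] = step_eval_measurable[OF xs]
    have Gei: "integrable lborel (\<lambda>z. e i z * Ke.Gk q z)" if i: "i < n" for i
    proof -
      have "(\<integral>\<^sup>+z. ennreal ((e i z)\<^sup>2) \<partial>lborel) = ennreal (\<integral>z. e i z * e i z \<partial>lborel)"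
        using e2[OF i i] by (subst nn_integral_eq_integral[symmetric]) (auto simp: power2_eq_square)
      then have 1: "(\<integral>\<^sup>+z. ennreal ((e i z)\<^sup>2) \<partial>lborel) \<le> ennreal 1" using eo[OF i i] by simp
      have 2: "(\<integral>\<^sup>+z. ennreal ((Ke.Gk q z)\<^sup>2) \<partial>lborel) \<le> ennreal (enn2real (kernel_energy T D G))"
        using Ke.Gk_energy[OF q'] Ke.energy by (simp add: less_top[symmetric])
      show ?thesis by (rule Cauchy_Schwarz_lebesgue(1)[OF _ _ 1 _ 2]) auto
    qed
    have ce: "(\<lambda>k. \<integral>z. e i z * rect_step_fun (xs k) z \<partial>lborel) \<longlonglongrightarrow> (\<integral>z. e i z * Ke.Gk q z \<partial>lborel)" if i: "i < n" for i
    proof -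
      let ?I = "{0..T} \<times> {0..D} :: (real \<times> real) set"
      define a where "a k = (\<integral>\<^sup>+z\<in>?I. ennreal ((Ke.Gk q z - rect_step_fun (xs k) z)\<^sup>2) \<partial>lborel)" for k
      have al: "a \<longlonglongrightarrow> 0" using xl by (simp add: a_def[abs_def])
      \<comment> \<open>Finitely many of the squared errors may be infinite, so the comparison with
        the real square root is made from some index on.\<close>
      then have fin: "\<forall>\<^sub>F k in sequentially. a k < 1" by (rule order_tendstoD) simp
      have "(\<lambda>k. enn2real (a k)) \<longlonglongrightarrow> 0" using tendsto_enn2real[of a 0 sequentially] al by simp
      then have "(\<lambda>k. sqrt (1 * enn2real (a k))) \<longlonglongrightarrow> sqrt (1 * 0)" by (intro tendsto_real_sqrt tendsto_mult_left)
      then have sl: "(\<lambda>k. sqrt (1 * enn2real (a k))) \<longlonglongrightarrow> 0" by simp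
      have "(\<lambda>k. (\<integral>z. e i z * rect_step_fun (xs k) z \<partial>lborel) - (\<integral>z. e i z * Ke.Gk q z \<partial>lborel)) \<longlonglongrightarrow> 0"
      proof (rule Lim_null_comparison[OF _ sl])
        show "\<forall>\<^sub>F k in sequentially. norm ((\<integral>z. e i z * rect_step_fun (xs k) z \<partial>lborel) - (\<integral>z. e i z * Ke.Gk q z \<partial>lborel)) \<le> sqrt (1 * enn2real (a k))"
          using fin
        proof eventually_elim
          case (elim k)
          have Ib [measurable]: "?I \<in> sets borel" using Ke.Pa.compact_R by (simp add: Ke.Pa.R_def borel_compact)
          let ?r = "\<lambda>z. indicator ?I z * (Ke.Gk q z - rect_step_fun (xs k) z)"
          have "(\<integral>\<^sup>+z. ennreal ((?r z)\<^sup>2) \<partial>lborel) = a k"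
            unfolding a_def by (intro nn_integral_cong) (auto split: split_indicator)
          then have r2: "(\<integral>\<^sup>+z. ennreal ((?r z)\<^sup>2) \<partial>lborel) \<le> ennreal (enn2real (a k))" using order.strict_trans[OF elim ennreal_one_less_top] by simp
          have "(\<integral>\<^sup>+z. ennreal ((e i z)\<^sup>2) \<partial>lborel) = ennreal (\<integral>z. e i z * e i z \<partial>lborel)"
            using e2[OF i i] by (subst nn_integral_eq_integral[symmetric]) (auto simp: power2_eq_square)
          then have e1: "(\<integral>\<^sup>+z. ennreal ((e i z)\<^sup>2) \<partial>lborel) \<le> ennreal 1" using eo[OF i i] by simp
          have rm: "?r \<in> borel_measurable lborel" by measurable
          have emi: "e i \<in> borel_measurable lborel" by simp
          have b: "\<bar>\<integral>z. e i z * ?r z \<partial>lborel\<bar> \<le> sqrt (1 * enn2real (a k))"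
            by (rule Cauchy_Schwarz_lebesgue(2)[OF emi rm e1 _ r2]) auto
          have er: "e i z * ?r z = e i z * Ke.Gk q z - e i z * rect_step_fun (xs k) z" for z
            using ez[of z i] by (cases "z \<in> Sh.I") (auto simp: Sh.I_def right_diff_distrib)
          have si: "integrable lborel (\<lambda>z. e i z * rect_step_fun (xs k) z)"
            using step_eval_primitive[OF em eb[OF i] ez xs] by blast
          show ?case using b unfolding er using Gei[OF i] si by (simp add: abs_minus_commute)
        qed
      qed
      then show ?thesis by (rule LIM_zero_cancel)
    qed
    have Y: "AE \<omega> in M. VZ (w' \<omega>) = Z \<omega> + (\<integral>z. Ke.Gk q z * h \<omega> z \<partial>lborel)"
    proof -
      let ?c = "\<lambda>\<omega>. \<Sum>i<n. d i \<omega> * (\<integral>z. e i z * Ke.Gk q z \<partial>lborel)"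
      let ?d = "\<lambda>k \<omega>. \<Sum>i<n. d i \<omega> * (\<integral>z. e i z * rect_step_fun (xs k) z \<partial>lborel)"
      have "AE \<omega> in M. VZ (w' \<omega>) = Z \<omega> + ?c \<omega>"
      proof (rule L2_limit_shift[where A="\<lambda>k \<omega>. step_eval (xs k) (Sh.w \<omega>)" and B="\<lambda>k \<omega>. step_eval (xs k) (w' \<omega>)" and d="?d"])
        show "?c \<in> borel_measurable M" "?d k \<in> borel_measurable M" for k
          using dm by (auto intro!: borel_measurable_sum borel_measurable_times)
        show "(\<lambda>k. \<integral>\<^sup>+\<omega>. ennreal ((Z \<omega> - step_eval (xs k) (Sh.w \<omega>))\<^sup>2) \<partial>M) \<longlonglongrightarrow> 0"
          using Zl by (simp add: step_eval_w[OF xs])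
        \<comment> \<open>The bound \<open>F \<le> C0\<close> carries the mean square convergence of
          the step integrals over to the shifted sheet.\<close>
        have le: "(\<integral>\<^sup>+\<omega>. ennreal ((VZ (w' \<omega>) - step_eval (xs k) (w' \<omega>))\<^sup>2) \<partial>M) \<le> ennreal C0 * (\<integral>\<^sup>+\<omega>. ennreal ((Z \<omega> - step_eval (xs k) (Sh.w \<omega>))\<^sup>2) \<partial>M)" for k
        proof -
          have "(\<integral>\<^sup>+\<omega>. ennreal ((VZ (w' \<omega>) - step_eval (xs k) (w' \<omega>))\<^sup>2) \<partial>M) = (\<integral>\<^sup>+\<omega>. ennreal (?F \<omega>) * ennreal ((VZ (Sh.w \<omega>) - step_eval (xs k) (Sh.w \<omega>))\<^sup>2) \<partial>M)"
            by (rule tr_nn) measurable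
          also have "\<dots> \<le> (\<integral>\<^sup>+\<omega>. ennreal C0 * ennreal ((Z \<omega> - step_eval (xs k) (Sh.w \<omega>))\<^sup>2) \<partial>M)"
            using VZae F(2) by (intro nn_integral_mono_AE) (auto elim!: eventually_mono intro!: mult_right_mono ennreal_leI)
          also have "\<dots> = ennreal C0 * (\<integral>\<^sup>+\<omega>. ennreal ((Z \<omega> - step_eval (xs k) (Sh.w \<omega>))\<^sup>2) \<partial>M)" by (rule nn_integral_cmult) measurable
          finally show ?thesis .
        qed
        have lim: "(\<lambda>k. ennreal C0 * (\<integral>\<^sup>+\<omega>. ennreal ((Z \<omega> - step_eval (xs k) (Sh.w \<omega>))\<^sup>2) \<partial>M)) \<longlonglongrightarrow> ennreal C0 * 0"
          using Zl by (intro ennreal_tendsto_cmult) (auto simp: step_eval_w[OF xs])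
        show "(\<lambda>k. \<integral>\<^sup>+\<omega>. ennreal ((VZ (w' \<omega>) - step_eval (xs k) (w' \<omega>))\<^sup>2) \<partial>M) \<longlonglongrightarrow> 0"
          by (rule tendsto_sandwich[OF always_eventually[OF allI] always_eventually[OF allI] tendsto_const lim[unfolded mult_zero_right]]) (rule zero_le, rule le)
        show "step_eval (xs k) (w' \<omega>) = step_eval (xs k) (Sh.w \<omega>) + ?d k \<omega>" for k \<omega>
        proof -
          have "step_eval (xs k) (w' \<omega>) = step_eval (xs k) (\<lambda>q. Sh.Wp q \<omega>) + (\<Sum>i<n. d i \<omega> * step_eval (xs k) (?pr (e i)))"
            unfolding w'_def step_eval_restrict[OF xs] by (rule step_eval_shift)
          also have "(\<Sum>i<n. d i \<omega> * step_eval (xs k) (?pr (e i))) = ?d k \<omega>"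
            using step_eval_primitive[OF em eb ez xs] by (intro sum.cong refl) auto
          finally show ?thesis unfolding Sh.w_def step_eval_restrict[OF xs] .
        qed
        show "(\<lambda>k. ?d k \<omega>) \<longlonglongrightarrow> ?c \<omega>" for \<omega> by (intro tendsto_sum tendsto_mult tendsto_const ce) auto
      qed auto
      moreover have "(\<integral>z. Ke.Gk q z * h \<omega> z \<partial>lborel) = ?c \<omega>" for \<omega>
      proof -
        have "(\<integral>z. Ke.Gk q z * h \<omega> z \<partial>lborel) = (\<integral>z. (\<Sum>i<n. d i \<omega> * (e i z * Ke.Gk q z)) \<partial>lborel)"
          unfolding h_def by (simp add: sum_distrib_left mult_ac)
        then show ?thesis using Gei by (subst (asm) Bochner_Integration.integral_sum) (auto intro!: integrable_mult_right)
      qed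
      ultimately show ?thesis by simp
    qed
    \<comment> \<open>The mild equation at \<open>q\<close> as a property of a path of the sheet.
      For measurability, integrability of the drift is rewritten as finiteness of a nonnegative
      integral.\<close>
    define P where "P \<kappa> \<longleftrightarrow> integrable lborel (\<lambda>z. Ke.Gk q z * g (fst z) (snd z) (V \<kappa> z)) \<and> V \<kappa> q = J0 q + drift q (V \<kappa>) + VZ \<kappa>" for \<kappa>
    have "AE \<omega> in M. P (w' \<omega>)"
    proof (rule tr_AE)
      show "AE \<omega> in M. P (Sh.w \<omega>)" using Vu VZae Zae by eventually_elim (simp add: P_def)
      have jm: "(\<lambda>(\<kappa>, z). Ke.Gk q z * g (fst z) (snd z) (V \<kappa> z)) \<in> borel_measurable (Sh.K \<Otimes>\<^sub>M lborel)"
      proof -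
        have "(\<lambda>x. (V (fst x), snd x)) \<in> measurable (Sh.K \<Otimes>\<^sub>M lborel) (N \<Otimes>\<^sub>M lborel)" by measurable
        from measurable_compose[OF this drift_joint_measurable[OF q]] show ?thesis by (simp add: case_prod_beta')
      qed
      have dV: "(\<lambda>\<kappa>. drift q (V \<kappa>)) \<in> borel_measurable Sh.K"
        unfolding drift_def by (rule lborel.borel_measurable_lebesgue_integral[OF jm])
      have Vq: "(\<lambda>\<kappa>. V \<kappa> q) \<in> borel_measurable Sh.K"
        using measurable_compose[OF V Ke.Pa.eval_measurable] q Ke.Pa.Q_subset by (cases q) auto
      have eq: "Measurable.pred Sh.K (\<lambda>\<kappa>. V \<kappa> q = J0 q + drift q (V \<kappa>) + VZ \<kappa>)"
        unfolding pred_def by (intro borel_measurable_eq borel_measurable_add borel_measurable_const Vq dV VZ)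
      have jn: "(\<lambda>\<kappa>. \<integral>\<^sup>+z. ennreal (norm (Ke.Gk q z * g (fst z) (snd z) (V \<kappa> z))) \<partial>lborel) \<in> borel_measurable Sh.K"
        by (rule lborel.borel_measurable_nn_integral) (use jm in \<open>simp add: case_prod_beta'\<close>)
      have "{\<kappa> \<in> space Sh.K. P \<kappa>} = {\<kappa> \<in> space Sh.K. (\<integral>\<^sup>+z. ennreal (norm (Ke.Gk q z * g (fst z) (snd z) (V \<kappa> z))) \<partial>lborel) < \<infinity> \<and> V \<kappa> q = J0 q + drift q (V \<kappa>) + VZ \<kappa>}"
      proof (intro Collect_cong conj_cong refl)
        fix \<kappa> assume \<kappa>: "\<kappa> \<in> space Sh.K"
        have "(\<lambda>z. Ke.Gk q z * g (fst z) (snd z) (V \<kappa> z)) \<in> borel_measurable lborel"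
          using measurable_compose[OF measurable_Pair1'[OF \<kappa>] jm] by simp
        then show "P \<kappa> \<longleftrightarrow> (\<integral>\<^sup>+z. ennreal (norm (Ke.Gk q z * g (fst z) (snd z) (V \<kappa> z))) \<partial>lborel) < \<infinity> \<and> V \<kappa> q = J0 q + drift q (V \<kappa>) + VZ \<kappa>"
          by (simp only: P_def integrable_iff_bounded simp_thms)
      qed
      also have "\<dots> \<in> sets Sh.K" using jn eq by measurable
      finally show "{\<kappa> \<in> space Sh.K. P \<kappa>} \<in> sets Sh.K" .
    qed
    then show ?thesis using Zae Y
      by eventually_elim (auto simp: P_def v_def)
  qed
  \<comment> \<open>Countably many null sets are united, and the stability estimate is applied at
    each remaining sample point.\<close>
  have "AE \<omega> in M. \<forall>q\<in>Q. integrable lborel (\<lambda>z. Ke.Gk q z * g (fst z) (snd z) (up \<omega> z)) \<and> integrable lborel (\<lambda>z. Ke.Gk q z * g (fst z) (snd z) (v \<omega> z)) \<and>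
     v \<omega> q - up \<omega> q = drift q (v \<omega>) - drift q (up \<omega>) + (\<integral>z. Ke.Gk q z * h \<omega> z \<partial>lborel)"
    using key Ke.Pa.Q(1) by (subst AE_ball_countable) auto
  then have "AE \<omega> in M. ennreal ((mdist E (up \<omega>) (v \<omega>))\<^sup>2) \<le> ennreal (enn2real (kernel_energy T D G) * exp (2 * L * T)) * (\<Sum>i<n. ennreal ((d i \<omega>)\<^sup>2))"
    using AE_space
  proof eventually_elim
    case (elim \<omega>)
    let ?H = "\<Sum>i<n. (d i \<omega>)\<^sup>2"
    have "mdist E (up \<omega>) (v \<omega>) \<le> sqrt (enn2real (kernel_energy T D G) * ?H) * exp (L * T)"
    proof (rule Ke.pathwise_stability[where h="h \<omega>" and g=g])
      show "up \<omega> \<in> mspace E" using elim(2) by (rule up_mspace)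
      show "v \<omega> \<in> mspace E" using measurable_space[OF vm elim(2)] by (simp add: Ke.Pa.space_N)
      show "(\<integral>\<^sup>+z. ennreal ((h \<omega> z)\<^sup>2) \<partial>lborel) \<le> ennreal ?H" using h2[of \<omega>] by simp
      show "0 \<le> ?H" by (intro sum_nonneg) auto
    qed (use elim(1) L_pos lip in \<open>auto simp: drift_def\<close>)
    then have "(mdist E (up \<omega>) (v \<omega>))\<^sup>2 \<le> (sqrt (enn2real (kernel_energy T D G) * ?H) * exp (L * T))\<^sup>2"
      by (intro power_mono) auto
    also have "\<dots> = enn2real (kernel_energy T D G) * exp (2 * L * T) * ?H"
    proof -
      have "(exp (L * T))\<^sup>2 = exp (2 * L * T)" by (simp add: power2_eq_square exp_add[symmetric])
      then show ?thesis by (simp add: power_mult_distrib sum_nonneg)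
    qed
    finally have "ennreal ((mdist E (up \<omega>) (v \<omega>))\<^sup>2) \<le> ennreal (enn2real (kernel_energy T D G) * exp (2 * L * T) * ?H)" by (rule ennreal_leI)
    also have "\<dots> = ennreal (enn2real (kernel_energy T D G) * exp (2 * L * T)) * (\<Sum>i<n. ennreal ((d i \<omega>)\<^sup>2))"
      by (subst ennreal_mult) (auto intro!: sum_nonneg simp: sum_ennreal)
    finally show ?case .
  qed
  then have "(\<integral>\<^sup>+\<omega>. ennreal ((mdist E (up \<omega>) (v \<omega>))\<^sup>2) \<partial>M) \<le> (\<integral>\<^sup>+\<omega>. ennreal (enn2real (kernel_energy T D G) * exp (2 * L * T)) * (\<Sum>i<n. ennreal ((d i \<omega>)\<^sup>2)) \<partial>M)"
    by (rule nn_integral_mono_AE)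
  also have "\<dots> = ennreal (enn2real (kernel_energy T D G) * exp (2 * L * T)) * (\<integral>\<^sup>+\<omega>. (\<Sum>i<n. ennreal ((d i \<omega>)\<^sup>2)) \<partial>M)"
    using dm by (intro nn_integral_cmult borel_measurable_sum measurable_compose[OF _ measurable_ennreal] borel_measurable_power) auto
  also have "\<dots> \<le> ennreal (enn2real (kernel_energy T D G) * exp (2 * L * T)) * ennreal (2 * Sh.expectation (\<lambda>\<omega>. ?F \<omega> * ln (?F \<omega>)))"
    by (intro mult_left_mono cost) auto
  finally show ?thesis using vm lawv by blast
qed

end

section \<open>Transport inequality for the law of the solution\<close>

text \<open>A bound uniform in the truncation level suffices. At each level, errors proportional to
  the level can be absorbed before the integral is known to be finite.\<close>

lemma nn_integral_le_of_truncations: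
  assumes [measurable]: "a \<in> borel_measurable M" and K: "\<And>n::nat. (\<integral>\<^sup>+x. min (a x) (of_nat n) \<partial>M) \<le> K"
  shows "(\<integral>\<^sup>+x. a x \<partial>M) \<le> K"
proof -
  have "(\<integral>\<^sup>+x. a x \<partial>M) = (\<integral>\<^sup>+x. liminf (\<lambda>n. min (a x) (of_nat n)) \<partial>M)"
  proof (rule nn_integral_cong)
    fix x
    have "(\<lambda>n. min (a x) (of_nat n)) \<longlonglongrightarrow> min (a x) top" by (intro tendsto_min tendsto_const of_nat_tendsto_top_ennreal)
    then show "a x = liminf (\<lambda>n. min (a x) (of_nat n))" by (intro lim_imp_Liminf[symmetric]) auto
  qed
  also have "\<dots> \<le> liminf (\<lambda>n. \<integral>\<^sup>+x. min (a x) (of_nat n) \<partial>M)" by (rule nn_integral_liminf) measurable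
  also have "\<dots> \<le> limsup (\<lambda>n. \<integral>\<^sup>+x. min (a x) (of_nat n) \<partial>M)" by (rule Liminf_le_Limsup) simp
  also have "\<dots> \<le> K" by (rule Limsup_bounded) (use K in simp)
  finally show ?thesis .
qed

lemma nn_integral_tail_tendsto_0:
  fixes a :: "'a \<Rightarrow> real"
  assumes [measurable]: "a \<in> borel_measurable M" and fin: "(\<integral>\<^sup>+x. ennreal (a x) \<partial>M) < \<infinity>"
  shows "(\<lambda>n. \<integral>\<^sup>+x. ennreal (a x) * indicator {x. of_nat n < ennreal (a x)} x \<partial>M) \<longlonglongrightarrow> 0"
proof -
  have "(\<lambda>n. \<integral>\<^sup>+x. ennreal (a x) * indicator {x. of_nat n < ennreal (a x)} x \<partial>M) \<longlonglongrightarrow> (\<integral>\<^sup>+x. 0 \<partial>M)"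
  proof (rule nn_integral_dominated_convergence[where w="\<lambda>x. ennreal (a x)"])
    show "AE x in M. (\<lambda>n. ennreal (a x) * indicator {x. of_nat n < ennreal (a x)} x) \<longlonglongrightarrow> 0"
    proof (rule AE_I2)
      fix x
      obtain m :: nat where m: "a x \<le> real m" using real_arch_simple by blast
      have "ennreal (a x) * indicator {x. of_nat n < ennreal (a x)} x = 0" if "m \<le> n" for n
      proof -
        have "a x \<le> real n" using m that by linarith
        then have "ennreal (a x) \<le> of_nat n" unfolding ennreal_of_nat_eq_real_of_nat by (rule ennreal_leI)
        then show ?thesis by (simp add: not_less)
      qed
      then show "(\<lambda>n. ennreal (a x) * indicator {x. of_nat n < ennreal (a x)} x) \<longlonglongrightarrow> 0"
        by (intro tendsto_eventually) (auto simp: eventually_sequentially)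
    qed
    show "AE x in M. ennreal (a x) * indicator {x. of_nat j < ennreal (a x)} x \<le> ennreal (a x)" for j
      by (auto split: split_indicator)
  qed (use fin in measurable)
  then show ?thesis by simp
qed

context spde begin

definition P :: "(real \<times> real \<Rightarrow> real) measure" where "P = distr M N up"

lemma prob_P: "prob_space P" unfolding P_def by (rule Sh.prob_space_distr[OF up_measurable])

lemma sets_P [measurable_cong, simp]: "sets P = sets N" by (simp add: P_def)

lemma space_P [simp]: "space P = space N" by (simp add: P_def)

text \<open>The factor between the squared norm of a shift and the squared distance of the
  solutions; the transport cost is then at most 2 \<kappa> times the entropy.\<close>

definition \<kappa> :: real where "\<kappa> = enn2real (kernel_energy T D G) * exp (2 * L * T)"

lemma kappa_nonneg: "0 \<le> \<kappa>" by (simp add: \<kappa>_def)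

text \<open>The cylindrical density is close to \<open>f (up \<omega>)\<close> but need not be a
  function of the solution. The law of \<open>v\<close> has as its density \<open>fn\<close> the
  conditional expectation of it given the solution, and conditioning does not increase the L1
  distance.\<close>

lemma nearby_density:
  assumes f [measurable]: "f \<in> borel_measurable N" and f0: "\<And>x. 0 \<le> f x" and fi: "integrable P f" and f1: "(\<integral>x. f x \<partial>P) = 1"
    and fl: "integrable P (\<lambda>x. f x * ln (f x))" and e: "0 < e"
  shows "\<exists>v\<in>measurable M N. \<exists>fn\<in>borel_measurable N. (\<forall>x. 0 \<le> fn x) \<and> distr M N v = density P (\<lambda>x. ennreal (fn x)) \<and>
    (\<integral>\<^sup>+x. ennreal \<bar>f x - fn x\<bar> \<partial>P) \<le> ennreal e \<and>
    (\<integral>\<^sup>+\<omega>. ennreal ((mdist E (up \<omega>) (v \<omega>))\<^sup>2) \<partial>M) \<le> ennreal (2 * \<kappa> * ((\<integral>x. f x * ln (f x) \<partial>P) + e))"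
proof -
  note [measurable] = up_measurable
  interpret P: prob_space P by (rule prob_P)
  have i1: "integrable M (\<lambda>\<omega>. f (up \<omega>))" "integrable M (\<lambda>\<omega>. f (up \<omega>) * ln (f (up \<omega>)))"
    using fi fl unfolding P_def by (auto simp: integrable_distr_eq)
  have i2: "Sh.expectation (\<lambda>\<omega>. f (up \<omega>)) = 1" "Sh.expectation (\<lambda>\<omega>. f (up \<omega>) * ln (f (up \<omega>))) = (\<integral>x. f x * ln (f x) \<partial>P)"
    using f1 unfolding P_def by (auto simp: integral_distr)
  obtain S F c C where S: "finite S" "S \<subseteq> Sh.I" and Fm: "F \<in> borel_measurable (\<Pi>\<^sub>M p\<in>S. borel)"
    and c: "0 < c" and Fc: "\<And>x. c \<le> F x" and FC: "\<And>x. F x \<le> C"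
    and F1: "Sh.expectation (\<lambda>\<omega>. F (\<lambda>p\<in>S. Sh.Wp p \<omega>)) = 1"
    and Fe: "Sh.expectation (\<lambda>\<omega>. \<bar>f (up \<omega>) - F (\<lambda>p\<in>S. Sh.Wp p \<omega>)\<bar>) < e"
    and Fl: "Sh.expectation (\<lambda>\<omega>. F (\<lambda>p\<in>S. Sh.Wp p \<omega>) * ln (F (\<lambda>p\<in>S. Sh.Wp p \<omega>))) < (\<integral>x. f x * ln (f x) \<partial>P) + e"
    using Sh.density_approx[of "\<lambda>\<omega>. f (up \<omega>)", OF _ f0 i1(1) i2(1) i1(2) e] unfolding i2(2) by (auto simp: f0)
  let ?F = "\<lambda>\<omega>. F (\<lambda>p\<in>S. Sh.Wp p \<omega>)"
  have FWm [measurable]: "?F \<in> borel_measurable M"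
    using S by (intro measurable_compose[OF _ Fm] measurable_restrict Sh.Wp_measurable) auto
  have F0: "0 \<le> ?F \<omega>" for \<omega> using c Fc[of "\<lambda>p\<in>S. Sh.Wp p \<omega>"] by linarith
  have Fi: "integrable M ?F" by (rule Sh.integrable_const_bound[where B=C]) (use F0 FC in auto)
  obtain v where v [measurable]: "v \<in> measurable M N" and lv: "distr M N v = distr (density M (\<lambda>\<omega>. ennreal (?F \<omega>))) N up"
    and cv: "(\<integral>\<^sup>+\<omega>. ennreal ((mdist E (up \<omega>) (v \<omega>))\<^sup>2) \<partial>M) \<le> ennreal (enn2real (kernel_energy T D G) * exp (2 * L * T)) * ennreal (2 * Sh.expectation (\<lambda>\<omega>. ?F \<omega> * ln (?F \<omega>)))"
    using shifted_solution[OF S Fm c Fc FC F1] by blast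
  have ac: "absolutely_continuous P (distr M N v)"
  proof (unfold absolutely_continuous_def, rule subsetI)
    fix A assume A: "A \<in> null_sets P"
    then have An: "A \<in> sets N" by (auto simp: null_sets_def)
    have "AE \<omega> in M. up \<omega> \<notin> A" using AE_not_in[OF A] unfolding P_def by (subst (asm) AE_distr_iff) (use An in auto)
    then have "AE \<omega> in density M (\<lambda>\<omega>. ennreal (?F \<omega>)). up \<omega> \<notin> A" by (subst AE_density) (auto elim: eventually_mono)
    then have "AE x in distr M N v. x \<notin> A" unfolding lv by (subst AE_distr_iff) (use An in auto)
    then show "A \<in> null_sets (distr M N v)" using An by (subst (asm) AE_iff_null_sets[symmetric]) auto
  qed
  interpret V: prob_space "distr M N v" by (rule Sh.prob_space_distr[OF v])
  obtain fn where fn: "fn \<in> borel_measurable P" "AE x in P. RN_deriv P (distr M N v) x = ennreal (fn x)" and fn0: "\<And>x. 0 \<le> fn x"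
    by (rule P.real_RN_deriv[OF V.finite_measure_axioms ac]) auto
  have fnm [measurable]: "fn \<in> borel_measurable N" using fn(1) by simp
  have lv': "distr M N v = density P (\<lambda>x. ennreal (fn x))"
  proof -
    have "distr M N v = density P (RN_deriv P (distr M N v))" using P.density_RN_deriv[OF ac] by simp
    also have "\<dots> = density P (\<lambda>x. ennreal (fn x))" using fn by (intro density_cong) auto
    finally show ?thesis .
  qed
  have fni: "integrable P fn"
  proof (rule integrableI_nonneg)
    have "(\<integral>\<^sup>+x. ennreal (fn x) \<partial>P) = emeasure (density P (\<lambda>x. ennreal (fn x))) (space P)" by (subst emeasure_density) (auto intro!: nn_integral_cong)
    also have "\<dots> < \<infinity>" using V.emeasure_finite[of "space P"] unfolding lv' by (simp add: less_top[symmetric])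
    finally show "(\<integral>\<^sup>+x. ennreal (fn x) \<partial>P) < \<infinity>" .
  qed (use fn0 in auto)
  \<comment> \<open>The sign of \<open>f - fn\<close>. Tested against a function of the path,
    \<open>fn\<close> and the cylindrical density have the same integral.\<close>
  define s :: "(real \<times> real \<Rightarrow> real) \<Rightarrow> real" where "s x = (if fn x \<le> f x then 1 else - 1)" for x
  have sm [measurable]: "s \<in> borel_measurable N" unfolding s_def by measurable
  have s1: "\<bar>s x\<bar> \<le> 1" for x by (simp add: s_def)
  have 1: "(\<integral>x. fn x * s x \<partial>P) = Sh.expectation (\<lambda>\<omega>. ?F \<omega> * s (up \<omega>))"
  proof -
    have "(\<integral>x. fn x * s x \<partial>P) = (\<integral>x. s x \<partial>density P (\<lambda>x. ennreal (fn x)))"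
      by (subst integral_real_density) (use fn0 in auto)
    also have "\<dots> = (\<integral>\<omega>. s (up \<omega>) \<partial>density M (\<lambda>\<omega>. ennreal (?F \<omega>)))" unfolding lv'[symmetric] lv by (subst integral_distr) auto
    also have "\<dots> = Sh.expectation (\<lambda>\<omega>. ?F \<omega> * s (up \<omega>))" by (subst integral_real_density) (use F0 in auto)
    finally show ?thesis .
  qed
  have 2: "(\<integral>x. f x * s x \<partial>P) = Sh.expectation (\<lambda>\<omega>. f (up \<omega>) * s (up \<omega>))" unfolding P_def by (subst integral_distr) auto
  have bs: "integrable K (\<lambda>x. h x * t x)" if "integrable K h" "t \<in> borel_measurable K" "\<And>x. \<bar>t x\<bar> \<le> 1" for K and h t :: "'z \<Rightarrow> real"
    by (rule Bochner_Integration.integrable_bound[OF that(1)]) (use that in \<open>auto simp: abs_mult intro!: mult_left_le\<close>)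
  have "(\<integral>x. \<bar>f x - fn x\<bar> \<partial>P) = (\<integral>x. f x * s x - fn x * s x \<partial>P)" by (intro Bochner_Integration.integral_cong) (auto simp: s_def)
  also have "\<dots> = (\<integral>x. f x * s x \<partial>P) - (\<integral>x. fn x * s x \<partial>P)"
    by (intro Bochner_Integration.integral_diff bs fi fni s1) simp_all
  also have "\<dots> = Sh.expectation (\<lambda>\<omega>. f (up \<omega>) * s (up \<omega>) - ?F \<omega> * s (up \<omega>))" unfolding 1 2
    by (intro Bochner_Integration.integral_diff[symmetric] bs i1 Fi s1) simp_all
  also have "\<dots> \<le> Sh.expectation (\<lambda>\<omega>. \<bar>f (up \<omega>) - ?F \<omega>\<bar>)"
  proof (rule integral_mono)
    show "integrable M (\<lambda>\<omega>. f (up \<omega>) * s (up \<omega>) - ?F \<omega> * s (up \<omega>))"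
      by (intro Bochner_Integration.integrable_diff bs i1 Fi s1) simp_all
    show "integrable M (\<lambda>\<omega>. \<bar>f (up \<omega>) - ?F \<omega>\<bar>)" using i1 Fi by simp
    show "f (up \<omega>) * s (up \<omega>) - ?F \<omega> * s (up \<omega>) \<le> \<bar>f (up \<omega>) - ?F \<omega>\<bar>" for \<omega> by (auto simp: s_def)
  qed
  finally have "(\<integral>x. \<bar>f x - fn x\<bar> \<partial>P) \<le> e" using Fe by simp
  then have L1: "(\<integral>\<^sup>+x. ennreal \<bar>f x - fn x\<bar> \<partial>P) \<le> ennreal e"
    by (subst nn_integral_eq_integral) (use fi fni in \<open>auto intro: ennreal_leI\<close>)
  note cv
  also have "ennreal (enn2real (kernel_energy T D G) * exp (2 * L * T)) * ennreal (2 * Sh.expectation (\<lambda>\<omega>. ?F \<omega> * ln (?F \<omega>))) \<le> ennreal \<kappa> * ennreal (2 * ((\<integral>x. f x * ln (f x) \<partial>P) + e))"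
    unfolding \<kappa>_def using Fl by (intro mult_left_mono ennreal_leI) auto
  also have "\<dots> = ennreal (2 * \<kappa> * ((\<integral>x. f x * ln (f x) \<partial>P) + e))"
    using kappa_nonneg by (simp add: ennreal_mult'[symmetric] algebra_simps)
  finally show ?thesis using v fnm fn0 lv' L1 by blast
qed

text \<open>The supremum norm, since \<open>p0\<close> is the zero path. Its square dominates the
  cost of redrawing in the correction of couplings.\<close>

definition \<alpha> :: "(real \<times> real \<Rightarrow> real) \<Rightarrow> real" where "\<alpha> x = mdist E Ke.Pa.p0 x"

lemma alpha_measurable [measurable]: "\<alpha> \<in> borel_measurable N"
proof -
  have "(\<lambda>x. (Ke.Pa.p0, x)) \<in> measurable N (N \<Otimes>\<^sub>M N)" using Ke.Pa.p0_mspace by (intro measurable_Pair) (auto simp: Ke.Pa.space_N)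
  from measurable_compose[OF this Ke.Pa.mdist_measurable] show ?thesis by (simp add: \<alpha>_def[abs_def])
qed

lemma alpha_triangle:
  assumes "x \<in> mspace E" "y \<in> mspace E"
  shows "\<alpha> x \<le> \<alpha> y + mdist E x y" "mdist E x y \<le> \<alpha> x + \<alpha> y"
  using Metric_space.triangle[OF Metric_space_mspace_mdist, of Ke.Pa.p0 E y x] Metric_space.triangle[OF Metric_space_mspace_mdist, of x E Ke.Pa.p0 y]
    Metric_space.commute[OF Metric_space_mspace_mdist, of E] assms Ke.Pa.p0_mspace by (auto simp: \<alpha>_def)

lemma alpha_nonneg: "0 \<le> \<alpha> x" by (simp add: \<alpha>_def)

lemma alpha_square:
  assumes "x \<in> mspace E" "y \<in> mspace E"
  shows "(\<alpha> x)\<^sup>2 \<le> 2 * (\<alpha> y)\<^sup>2 + 2 * (mdist E x y)\<^sup>2" "(mdist E x y)\<^sup>2 \<le> 2 * (\<alpha> x)\<^sup>2 + 2 * (\<alpha> y)\<^sup>2"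
proof -
  have "(\<alpha> x)\<^sup>2 \<le> (\<alpha> y - (- mdist E x y))\<^sup>2" using alpha_triangle[OF assms] alpha_nonneg by (intro power_mono) auto
  then show "(\<alpha> x)\<^sup>2 \<le> 2 * (\<alpha> y)\<^sup>2 + 2 * (mdist E x y)\<^sup>2" using power2_diff_le[of "\<alpha> y" "- mdist E x y"] by simp
  have "(mdist E x y)\<^sup>2 \<le> (\<alpha> x - (- \<alpha> y))\<^sup>2" using alpha_triangle[OF assms] by (intro power_mono) auto
  then show "(mdist E x y)\<^sup>2 \<le> 2 * (\<alpha> x)\<^sup>2 + 2 * (\<alpha> y)\<^sup>2" using power2_diff_le[of "\<alpha> x" "- \<alpha> y"] by simp
qed

lemma mdist_comp_measurable [measurable]:
  assumes "v \<in> measurable M N" shows "(\<lambda>\<omega>. mdist E (up \<omega>) (v \<omega>)) \<in> borel_measurable M"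
  using measurable_compose[OF measurable_Pair[OF up_measurable assms] Ke.Pa.mdist_measurable] by simp

lemma measurable_mspace: "v \<in> measurable M N \<Longrightarrow> \<omega> \<in> space M \<Longrightarrow> v \<omega> \<in> mspace E"
  using measurable_space[of v M N \<omega>] by (simp add: Ke.Pa.space_N)

text \<open>The law conditioned to a ball of positive probability has finite entropy, and the coupling with the
  conditioned law dominates the tail of the unconditioned one.\<close>

lemma second_moment_P: "(\<integral>\<^sup>+x. ennreal ((\<alpha> x)\<^sup>2) \<partial>P) < \<infinity>"
proof -
  interpret P: prob_space P by (rule prob_P)
  note [measurable] = up_measurable
  \<comment> \<open>Balls exhaust the path space, so one of integer radius has positive
    probability.\<close>
  have "\<exists>r::nat. \<not> (AE x in P. real r < \<alpha> x)"
  proof (rule ccontr)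
    assume "\<nexists>r::nat. \<not> (AE x in P. real r < \<alpha> x)"
    then have "AE x in P. \<forall>r::nat. real r < \<alpha> x" by (subst AE_all_countable) auto
    then have "AE x in P. False" by eventually_elim (meson not_less real_arch_simple)
    then show False by simp
  qed
  then obtain r :: nat where r: "\<not> (AE x in P. real r < \<alpha> x)" by blast
  define A where "A = {x \<in> space N. \<alpha> x \<le> real r}"
  have Am [measurable]: "A \<in> sets N" unfolding A_def by measurable
  define p where "p = measure P A"
  have "p \<noteq> 0"
  proof
    assume "p = 0"
    then have "AE x in P. x \<notin> A" unfolding p_def by (subst (asm) P.prob_eq_0) auto
    then have "AE x in P. real r < \<alpha> x" using AE_space by eventually_elim (auto simp: A_def)
    then show False using r by simp
  qed
  then have p: "0 < p" by (simp add: p_def less_le)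
  define f where "f x = indicator A x / p" for x
  have fm [measurable]: "f \<in> borel_measurable N" unfolding f_def[abs_def] by measurable
  have fi: "integrable P f" unfolding f_def by (intro integrable_divide_zero integrable_real_indicator) (auto simp: less_top[symmetric] P.emeasure_finite)
  have f1: "(\<integral>x. f x \<partial>P) = 1" using p by (simp add: f_def p_def)
  have f0: "0 \<le> f x" for x using p by (simp add: f_def)
  have fl: "integrable P (\<lambda>x. f x * ln (f x))"
    by (rule P.integrable_const_bound[where B="\<bar>1 / p * ln (1 / p)\<bar>"]) (auto simp: f_def split: split_indicator)
  define H where "H = (\<integral>x. f x * ln (f x) \<partial>P)"
  define K where "K = 2 * (real r)\<^sup>2 + 2 * \<bar>2 * \<kappa> * (H + 1)\<bar> + 1"
  have "(\<integral>\<^sup>+x. ennreal ((\<alpha> x)\<^sup>2) \<partial>P) \<le> ennreal K"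
  proof (rule nn_integral_le_of_truncations)
    fix n :: nat
    \<comment> \<open>The error is tied to the truncation level: where \<open>v\<close> leaves the
      ball the truncated square is at most \<open>n\<close>, and \<open>n\<close> times the
      probability of that event is at most 1.\<close>
    define e where "e = 1 / real (Suc n)"
    have e: "0 < e" "e \<le> 1" "real n * e \<le> 1" by (auto simp: e_def field_simps)
    obtain v fn where v [measurable]: "v \<in> measurable M N" and [measurable]: "fn \<in> borel_measurable N" and fn0: "\<And>x. 0 \<le> fn x"
      and lv: "distr M N v = density P (\<lambda>x. ennreal (fn x))" and fe: "(\<integral>\<^sup>+x. ennreal \<bar>f x - fn x\<bar> \<partial>P) \<le> ennreal e"
      and cv: "(\<integral>\<^sup>+\<omega>. ennreal ((mdist E (up \<omega>) (v \<omega>))\<^sup>2) \<partial>M) \<le> ennreal (2 * \<kappa> * (H + e))"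
      using nearby_density[OF fm f0 fi f1 fl e(1)] unfolding H_def by blast
    have vA: "(\<integral>\<^sup>+\<omega>. indicator (- A) (v \<omega>) \<partial>M) \<le> ennreal e"
    proof -
      have "(\<integral>\<^sup>+\<omega>. indicator (- A) (v \<omega>) \<partial>M) = (\<integral>\<^sup>+\<omega>. indicator (space N - A) (v \<omega>) \<partial>M)"
        using measurable_space[OF v] by (intro nn_integral_cong) (auto split: split_indicator)
      also have "\<dots> = (\<integral>\<^sup>+x. indicator (space N - A) x \<partial>distr M N v)" by (subst nn_integral_distr) auto
      also have "\<dots> = (\<integral>\<^sup>+x. ennreal (fn x) * indicator (space N - A) x \<partial>P)" unfolding lv by (subst nn_integral_density) auto
      \<comment> \<open>Off the ball \<open>f\<close> vanishes, so the mass of \<open>fn\<close>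
        there is part of the L1 distance.\<close>
      also have "\<dots> \<le> (\<integral>\<^sup>+x. ennreal \<bar>f x - fn x\<bar> \<partial>P)" by (intro nn_integral_mono) (auto simp: f_def split: split_indicator)
      finally show ?thesis using fe by (rule order_trans)
    qed
    have "(\<integral>\<^sup>+x. min (ennreal ((\<alpha> x)\<^sup>2)) (of_nat n) \<partial>P) = (\<integral>\<^sup>+\<omega>. min (ennreal ((\<alpha> (up \<omega>))\<^sup>2)) (of_nat n) \<partial>M)"
      unfolding P_def by (subst nn_integral_distr) auto
    also have "\<dots> \<le> (\<integral>\<^sup>+\<omega>. ennreal (2 * (real r)\<^sup>2) + (2 * ennreal ((mdist E (up \<omega>) (v \<omega>))\<^sup>2) + of_nat n * indicator (- A) (v \<omega>)) \<partial>M)"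
    proof (rule nn_integral_mono)
      fix \<omega> assume w: "\<omega> \<in> space M"
      show "min (ennreal ((\<alpha> (up \<omega>))\<^sup>2)) (of_nat n) \<le> ennreal (2 * (real r)\<^sup>2) + (2 * ennreal ((mdist E (up \<omega>) (v \<omega>))\<^sup>2) + of_nat n * indicator (- A) (v \<omega>))"
      proof (cases "v \<omega> \<in> A")
        case True
        have "(\<alpha> (up \<omega>))\<^sup>2 \<le> 2 * (\<alpha> (v \<omega>))\<^sup>2 + 2 * (mdist E (up \<omega>) (v \<omega>))\<^sup>2" by (rule alpha_square(1)[OF up_mspace[OF w] measurable_mspace[OF v w]])
        also have "(\<alpha> (v \<omega>))\<^sup>2 \<le> (real r)\<^sup>2" using True alpha_nonneg by (intro power_mono) (auto simp: A_def)
        finally have "ennreal ((\<alpha> (up \<omega>))\<^sup>2) \<le> ennreal (2 * (real r)\<^sup>2 + 2 * (mdist E (up \<omega>) (v \<omega>))\<^sup>2)" by (intro ennreal_leI) simp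
        then have "ennreal ((\<alpha> (up \<omega>))\<^sup>2) \<le> ennreal (2 * (real r)\<^sup>2) + 2 * ennreal ((mdist E (up \<omega>) (v \<omega>))\<^sup>2)" by (simp add: ennreal_mult)
        then show ?thesis using True by (simp add: min.coboundedI1)
      next
        case False
        have "of_nat n \<le> ennreal (2 * (real r)\<^sup>2) + (2 * ennreal ((mdist E (up \<omega>) (v \<omega>))\<^sup>2) + of_nat n)"
          by (intro add_increasing) auto
        then show ?thesis using False by (simp add: min.coboundedI2)
      qed
    qed
    also have "\<dots> = ennreal (2 * (real r)\<^sup>2) + (2 * (\<integral>\<^sup>+\<omega>. ennreal ((mdist E (up \<omega>) (v \<omega>))\<^sup>2) \<partial>M) + of_nat n * (\<integral>\<^sup>+\<omega>. indicator (- A) (v \<omega>) \<partial>M))"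
    proof -
      have "(\<lambda>\<omega>. indicator (- A) (v \<omega>) :: ennreal) \<in> borel_measurable M \<longleftrightarrow> (\<lambda>\<omega>. indicator (space N - A) (v \<omega>) :: ennreal) \<in> borel_measurable M"
        using measurable_space[OF v] by (intro measurable_cong) (auto split: split_indicator)
      then have [measurable]: "(\<lambda>\<omega>. indicator (- A) (v \<omega>) :: ennreal) \<in> borel_measurable M" by simp
      show ?thesis by (simp add: nn_integral_add nn_integral_cmult Sh.emeasure_space_1)
    qed
    also have "\<dots> \<le> ennreal (2 * (real r)\<^sup>2) + (2 * ennreal \<bar>2 * \<kappa> * (H + 1)\<bar> + of_nat n * ennreal e)"
    proof (intro add_left_mono add_mono mult_left_mono vA)
      have "2 * \<kappa> * (H + e) \<le> 2 * \<kappa> * (H + 1)" using e kappa_nonneg by (intro mult_left_mono) auto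
      then have "2 * \<kappa> * (H + e) \<le> \<bar>2 * \<kappa> * (H + 1)\<bar>" by linarith
      then show "(\<integral>\<^sup>+\<omega>. ennreal ((mdist E (up \<omega>) (v \<omega>))\<^sup>2) \<partial>M) \<le> ennreal \<bar>2 * \<kappa> * (H + 1)\<bar>" using cv by (meson ennreal_leI order_trans)
    qed auto
    also have "\<dots> = ennreal (2 * (real r)\<^sup>2 + 2 * \<bar>2 * \<kappa> * (H + 1)\<bar> + real n * e)"
      using e(1) by (simp add: ennreal_mult ennreal_of_nat_eq_real_of_nat add.assoc)
    also have "\<dots> \<le> ennreal K" unfolding K_def using e by (intro ennreal_leI) auto
    finally show "(\<integral>\<^sup>+x. min (ennreal ((\<alpha> x)\<^sup>2)) (of_nat n) \<partial>P) \<le> ennreal K" .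
  qed simp
  then show ?thesis by (rule order.strict_trans1) simp
qed

text \<open>The norm of \<open>v\<close> is controlled by the norm of the solution and the distance
  between them, which bounds the second moment under \<open>fn\<close>. Passing from
  \<open>fn\<close> to \<open>f\<close> costs the truncation level times the L1 error, at most
  1.\<close>

lemma second_moment_density:
  assumes f [measurable]: "f \<in> borel_measurable N" and f0: "\<And>x. 0 \<le> f x" and fi: "integrable P f" and f1: "(\<integral>x. f x \<partial>P) = 1"
    and fl: "integrable P (\<lambda>x. f x * ln (f x))"
  shows "(\<integral>\<^sup>+x. ennreal ((\<alpha> x)\<^sup>2) \<partial>density P (\<lambda>x. ennreal (f x))) < \<infinity>"
proof -
  note [measurable] = up_measurable
  define H where "H = (\<integral>x. f x * ln (f x) \<partial>P)"
  define K where "K = 2 * (\<integral>\<^sup>+x. ennreal ((\<alpha> x)\<^sup>2) \<partial>P) + 2 * ennreal (2 * \<kappa> * (H + 1)) + 1"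
  have "(\<integral>\<^sup>+x. ennreal ((\<alpha> x)\<^sup>2) \<partial>density P (\<lambda>x. ennreal (f x))) \<le> K"
  proof (rule nn_integral_le_of_truncations)
    fix n :: nat
    define e where "e = 1 / real (Suc n)"
    have e: "0 < e" "e \<le> 1" "real n * e \<le> 1" by (auto simp: e_def field_simps)
    obtain v fn where v [measurable]: "v \<in> measurable M N" and [measurable]: "fn \<in> borel_measurable N" and fn0: "\<And>x. 0 \<le> fn x"
      and lv: "distr M N v = density P (\<lambda>x. ennreal (fn x))" and fe: "(\<integral>\<^sup>+x. ennreal \<bar>f x - fn x\<bar> \<partial>P) \<le> ennreal e"
      and cv: "(\<integral>\<^sup>+\<omega>. ennreal ((mdist E (up \<omega>) (v \<omega>))\<^sup>2) \<partial>M) \<le> ennreal (2 * \<kappa> * (H + e))"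
      using nearby_density[OF f f0 fi f1 fl e(1)] unfolding H_def by blast
    have "(\<integral>\<^sup>+x. ennreal (fn x) * ennreal ((\<alpha> x)\<^sup>2) \<partial>P) = (\<integral>\<^sup>+x. ennreal ((\<alpha> x)\<^sup>2) \<partial>distr M N v)"
      unfolding lv by (subst nn_integral_density) auto
    also have "\<dots> = (\<integral>\<^sup>+\<omega>. ennreal ((\<alpha> (v \<omega>))\<^sup>2) \<partial>M)" by (subst nn_integral_distr) auto
    also have "\<dots> \<le> (\<integral>\<^sup>+\<omega>. 2 * ennreal ((\<alpha> (up \<omega>))\<^sup>2) + 2 * ennreal ((mdist E (up \<omega>) (v \<omega>))\<^sup>2) \<partial>M)"
    proof (rule nn_integral_mono)
      fix \<omega> assume w: "\<omega> \<in> space M"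
      have "(\<alpha> (v \<omega>))\<^sup>2 \<le> 2 * (\<alpha> (up \<omega>))\<^sup>2 + 2 * (mdist E (v \<omega>) (up \<omega>))\<^sup>2" by (rule alpha_square(1)[OF measurable_mspace[OF v w] up_mspace[OF w]])
      then have "ennreal ((\<alpha> (v \<omega>))\<^sup>2) \<le> ennreal (2 * (\<alpha> (up \<omega>))\<^sup>2 + 2 * (mdist E (up \<omega>) (v \<omega>))\<^sup>2)"
        unfolding Metric_space.commute[OF Metric_space_mspace_mdist, of E "v \<omega>" "up \<omega>"] by (rule ennreal_leI)
      then show "ennreal ((\<alpha> (v \<omega>))\<^sup>2) \<le> 2 * ennreal ((\<alpha> (up \<omega>))\<^sup>2) + 2 * ennreal ((mdist E (up \<omega>) (v \<omega>))\<^sup>2)" by (simp add: ennreal_mult)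
    qed
    also have "\<dots> = 2 * (\<integral>\<^sup>+x. ennreal ((\<alpha> x)\<^sup>2) \<partial>P) + 2 * (\<integral>\<^sup>+\<omega>. ennreal ((mdist E (up \<omega>) (v \<omega>))\<^sup>2) \<partial>M)"
      unfolding P_def by (simp add: nn_integral_add nn_integral_cmult nn_integral_distr)
    also have "\<dots> \<le> 2 * (\<integral>\<^sup>+x. ennreal ((\<alpha> x)\<^sup>2) \<partial>P) + 2 * ennreal (2 * \<kappa> * (H + 1))"
    proof (rule add_left_mono, rule mult_left_mono)
      have "2 * \<kappa> * (H + e) \<le> 2 * \<kappa> * (H + 1)" using e kappa_nonneg by (intro mult_left_mono) auto
      then show "(\<integral>\<^sup>+\<omega>. ennreal ((mdist E (up \<omega>) (v \<omega>))\<^sup>2) \<partial>M) \<le> ennreal (2 * \<kappa> * (H + 1))" using cv by (meson ennreal_leI order_trans)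
    qed simp
    finally have fn2: "(\<integral>\<^sup>+x. ennreal (fn x) * ennreal ((\<alpha> x)\<^sup>2) \<partial>P) \<le> 2 * (\<integral>\<^sup>+x. ennreal ((\<alpha> x)\<^sup>2) \<partial>P) + 2 * ennreal (2 * \<kappa> * (H + 1))" .
    have "(\<integral>\<^sup>+x. min (ennreal ((\<alpha> x)\<^sup>2)) (of_nat n) \<partial>density P (\<lambda>x. ennreal (f x))) = (\<integral>\<^sup>+x. ennreal (f x) * min (ennreal ((\<alpha> x)\<^sup>2)) (of_nat n) \<partial>P)"
      by (subst nn_integral_density) auto
    also have "\<dots> \<le> (\<integral>\<^sup>+x. ennreal (fn x) * ennreal ((\<alpha> x)\<^sup>2) + of_nat n * ennreal \<bar>f x - fn x\<bar> \<partial>P)"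
    proof (rule nn_integral_mono)
      fix x
      have "ennreal (f x) \<le> ennreal (fn x + \<bar>f x - fn x\<bar>)" by (intro ennreal_leI) auto
      also have "\<dots> = ennreal (fn x) + ennreal \<bar>f x - fn x\<bar>" using fn0 by simp
      finally have "ennreal (f x) * min (ennreal ((\<alpha> x)\<^sup>2)) (of_nat n) \<le> (ennreal (fn x) + ennreal \<bar>f x - fn x\<bar>) * min (ennreal ((\<alpha> x)\<^sup>2)) (of_nat n)"
        by (rule mult_right_mono) simp
      also have "\<dots> = ennreal (fn x) * min (ennreal ((\<alpha> x)\<^sup>2)) (of_nat n) + min (ennreal ((\<alpha> x)\<^sup>2)) (of_nat n) * ennreal \<bar>f x - fn x\<bar>" by (simp add: distrib_right mult.commute)
      also have "\<dots> \<le> ennreal (fn x) * ennreal ((\<alpha> x)\<^sup>2) + of_nat n * ennreal \<bar>f x - fn x\<bar>"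
        by (intro add_mono mult_left_mono mult_right_mono min.cobounded1 min.cobounded2) auto
      finally show "ennreal (f x) * min (ennreal ((\<alpha> x)\<^sup>2)) (of_nat n) \<le> ennreal (fn x) * ennreal ((\<alpha> x)\<^sup>2) + of_nat n * ennreal \<bar>f x - fn x\<bar>" .
    qed
    also have "\<dots> = (\<integral>\<^sup>+x. ennreal (fn x) * ennreal ((\<alpha> x)\<^sup>2) \<partial>P) + of_nat n * (\<integral>\<^sup>+x. ennreal \<bar>f x - fn x\<bar> \<partial>P)"
      by (simp add: nn_integral_add nn_integral_cmult)
    also have "\<dots> \<le> (2 * (\<integral>\<^sup>+x. ennreal ((\<alpha> x)\<^sup>2) \<partial>P) + 2 * ennreal (2 * \<kappa> * (H + 1))) + of_nat n * ennreal e"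
      by (intro add_mono fn2 mult_left_mono fe) auto
    also have "of_nat n * ennreal e = ennreal (real n * e)" using e by (simp add: ennreal_mult ennreal_of_nat_eq_real_of_nat)
    also have "\<dots> \<le> 1" using e by simp
    finally show "(\<integral>\<^sup>+x. min (ennreal ((\<alpha> x)\<^sup>2)) (of_nat n) \<partial>density P (\<lambda>x. ennreal (f x))) \<le> K" unfolding K_def by (simp add: add_left_mono)
  qed simp
  also have "K < \<infinity>" using second_moment_P by (simp add: K_def ennreal_mult_less_top)
  finally show ?thesis .
qed

text \<open>The solution and the shifted solution couple \<open>P\<close> with the law of density
  \<open>fn\<close>, and the marginal correction replaces \<open>fn\<close> by \<open>f\<close>. The
  truncation level \<open>n\<close> is fixed first, to make the tails small, and only then the L1
  error, because that error is multiplied by \<open>4 n\<close>.\<close>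

theorem transport_entropy_density:
  assumes f [measurable]: "f \<in> borel_measurable N" and f0: "\<And>x. 0 \<le> f x" and fi: "integrable P f" and f1: "(\<integral>x. f x \<partial>P) = 1"
    and fl: "integrable P (\<lambda>x. f x * ln (f x))" and eps: "0 < \<epsilon>"
  shows "\<exists>\<pi>\<in>couplings P (density P (\<lambda>x. ennreal (f x))). (\<integral>\<^sup>+z. ennreal ((mdist E (fst z) (snd z))\<^sup>2) \<partial>\<pi>) \<le> ennreal (2 * \<kappa> * (\<integral>x. f x * ln (f x) \<partial>P)) + ennreal \<epsilon>"
proof -
  let ?H = "\<integral>x. f x * ln (f x) \<partial>P" and ?Q = "density P (\<lambda>x. ennreal (f x))" and ?a = "\<lambda>x. ennreal ((\<alpha> x)\<^sup>2)"
  have Qp: "prob_space ?Q"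
  proof
    have "emeasure ?Q (space ?Q) = (\<integral>\<^sup>+x. ennreal (f x) \<partial>P)" by (subst emeasure_density) (auto intro!: nn_integral_cong)
    also have "\<dots> = ennreal 1" using fi f0 f1 by (subst nn_integral_eq_integral) auto
    finally show "emeasure ?Q (space ?Q) = 1" by simp
  qed
  let ?tail = "\<lambda>S n. \<integral>\<^sup>+x. ?a x * indicator {x. of_nat n < ?a x} x \<partial>S"
  have "(\<lambda>n. 2 * ?tail P n + 2 * ?tail ?Q n) \<longlonglongrightarrow> 2 * 0 + 2 * 0"
    by (intro tendsto_add ennreal_tendsto_cmult nn_integral_tail_tendsto_0 second_moment_P second_moment_density f f0 fi f1 fl) auto
  then have "\<forall>\<^sub>F n in sequentially. 2 * ?tail P n + 2 * ?tail ?Q n < ennreal (\<epsilon> / 2)"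
    by (rule order_tendstoD) (use eps in simp)
  then obtain n :: nat where n: "2 * ?tail P n + 2 * ?tail ?Q n < ennreal (\<epsilon> / 2)" by (auto simp: eventually_sequentially)
  \<comment> \<open>Chosen so that the entropy error 2 \<kappa> e and the correction 4 n e together
    stay below half of \<epsilon>; the summand 1 keeps the denominator positive.\<close>
  define e where "e = \<epsilon> / (2 * (2 * \<kappa> + 4 * real n + 1))"
  have den: "0 < 2 * \<kappa> + 4 * real n + 1" using kappa_nonneg by linarith
  have e: "0 < e" using eps den by (simp add: e_def)
  have "e * (2 * \<kappa> + 4 * real n + 1) = \<epsilon> / 2" using den by (subst nonzero_eq_divide_eq[symmetric]) (auto simp: e_def)
  then have e2: "2 * \<kappa> * e + 4 * real n * e \<le> \<epsilon> / 2" using e by (simp add: algebra_simps)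
  obtain v fn where v [measurable]: "v \<in> measurable M N" and fn [measurable]: "fn \<in> borel_measurable N" and fn0: "\<And>x. 0 \<le> fn x"
    and lv: "distr M N v = density P (\<lambda>x. ennreal (fn x))" and fe: "(\<integral>\<^sup>+x. ennreal \<bar>f x - fn x\<bar> \<partial>P) \<le> ennreal e"
    and cv: "(\<integral>\<^sup>+\<omega>. ennreal ((mdist E (up \<omega>) (v \<omega>))\<^sup>2) \<partial>M) \<le> ennreal (2 * \<kappa> * (?H + e))"
    using nearby_density[OF f f0 fi f1 fl e] by blast
  have cm: "(\<lambda>z. ennreal ((mdist E (fst z) (snd z))\<^sup>2)) \<in> borel_measurable (P \<Otimes>\<^sub>M P)"
  proof -
    have "(\<lambda>z. mdist E (fst z) (snd z)) \<in> borel_measurable (P \<Otimes>\<^sub>M P)"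
      using Ke.Pa.mdist_measurable by (simp add: case_prod_beta' cong: measurable_cong_sets sets_pair_measure_cong)
    then show ?thesis by measurable
  qed
  have "\<exists>\<pi>\<in>couplings P ?Q. (\<integral>\<^sup>+z. ennreal ((mdist E (fst z) (snd z))\<^sup>2) \<partial>\<pi>) \<le> (\<integral>\<^sup>+\<omega>. ennreal ((mdist E (fst (up \<omega>, v \<omega>)) (snd (up \<omega>, v \<omega>)))\<^sup>2) \<partial>M)
     + 4 * of_nat n * (\<integral>\<^sup>+x. ennreal \<bar>f x - fn x\<bar> \<partial>P) + 2 * ?tail P n + 2 * ?tail ?Q n"
  proof (rule coupling_correction[OF Sh.prob_space_axioms prob_P _ _ _ _ _ _ f0 fn0 Qp refl cm])
    show "distr M P up = P" "distr M P v = density P (\<lambda>x. ennreal (fn x))" using lv by (auto simp: P_def cong: distr_cong)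
    fix x y assume "x \<in> space P" "y \<in> space P"
    then have "(mdist E x y)\<^sup>2 \<le> 2 * (\<alpha> x)\<^sup>2 + 2 * (\<alpha> y)\<^sup>2" by (intro alpha_square(2)) (auto simp: Ke.Pa.space_N)
    then have "ennreal ((mdist E x y)\<^sup>2) \<le> ennreal (2 * (\<alpha> x)\<^sup>2 + 2 * (\<alpha> y)\<^sup>2)" by (rule ennreal_leI)
    then show "ennreal ((mdist E (fst (x, y)) (snd (x, y)))\<^sup>2) \<le> 2 * ?a x + 2 * ?a y" by (simp add: ennreal_mult)
  qed (use up_measurable in \<open>auto cong: measurable_cong_sets\<close>)
  then obtain \<pi> where \<pi>: "\<pi> \<in> couplings P ?Q" and le: "(\<integral>\<^sup>+z. ennreal ((mdist E (fst z) (snd z))\<^sup>2) \<partial>\<pi>) \<le> (\<integral>\<^sup>+\<omega>. ennreal ((mdist E (up \<omega>) (v \<omega>))\<^sup>2) \<partial>M)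
     + 4 * of_nat n * (\<integral>\<^sup>+x. ennreal \<bar>f x - fn x\<bar> \<partial>P) + 2 * ?tail P n + 2 * ?tail ?Q n" by auto
  note le
  also have "(\<integral>\<^sup>+\<omega>. ennreal ((mdist E (up \<omega>) (v \<omega>))\<^sup>2) \<partial>M) + 4 * of_nat n * (\<integral>\<^sup>+x. ennreal \<bar>f x - fn x\<bar> \<partial>P) + 2 * ?tail P n + 2 * ?tail ?Q n
    \<le> (ennreal (2 * \<kappa> * ?H) + ennreal (2 * \<kappa> * e)) + 4 * of_nat n * ennreal e + ennreal (\<epsilon> / 2)"
    unfolding add.assoc[of "_ + _" "2 * ?tail P n"]
  proof (intro add_mono mult_left_mono fe less_imp_le[OF n])
    show "(\<integral>\<^sup>+\<omega>. ennreal ((mdist E (up \<omega>) (v \<omega>))\<^sup>2) \<partial>M) \<le> ennreal (2 * \<kappa> * ?H) + ennreal (2 * \<kappa> * e)"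
    proof (rule order_trans[OF cv])
      have "0 \<le> 2 * \<kappa> * e" using e kappa_nonneg by simp
      then show "ennreal (2 * \<kappa> * (?H + e)) \<le> ennreal (2 * \<kappa> * ?H) + ennreal (2 * \<kappa> * e)"
        unfolding distrib_left by (cases "0 \<le> 2 * \<kappa> * ?H") (simp_all del: mult_nonneg_nonneg add: ennreal_neg ennreal_leI)
    qed
  qed auto
  also have "\<dots> \<le> ennreal (2 * \<kappa> * ?H) + ennreal \<epsilon>"
  proof -
    have "ennreal (2 * \<kappa> * e) + 4 * of_nat n * ennreal e + ennreal (\<epsilon> / 2) = ennreal (2 * \<kappa> * e + 4 * real n * e + \<epsilon> / 2)"
      using e kappa_nonneg eps by (simp add: ennreal_mult ennreal_of_nat_eq_real_of_nat)
    also have "\<dots> \<le> ennreal \<epsilon>" using e2 by (intro ennreal_leI) auto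
    finally show ?thesis by (simp add: add.assoc add_left_mono)
  qed
  finally show ?thesis using \<pi> by blast
qed

text \<open>For a real-valued version \<open>f\<close> of the density the divergence is the integral
  of f ln f, so the coupling bound applies, and its error 1/(n+1) tends to zero under the square
  root. Nonnegativity is kept because the entropy is converted to an extended nonnegative number in
  the final inequality.\<close>

theorem transport_entropy:
  assumes Q': "borel_prob E Q'" and ac: "absolutely_continuous P Q'" and ei: "integrable Q' (entropy_density (exp 1) P Q')"
  shows "0 \<le> KL_divergence (exp 1) P Q'" "wasserstein 2 E P Q' \<le> ennreal (sqrt (2 * \<kappa> * KL_divergence (exp 1) P Q'))"
proof -
  interpret P: prob_space P by (rule prob_P)
  interpret information_space P "exp 1" by unfold_locales simp
  interpret Q': prob_space Q' using Q' by (simp add: borel_prob_def)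
  have sQ: "sets Q' = sets P" using Q' by (simp add: borel_prob_def)
  obtain f where fm: "f \<in> borel_measurable P" and fR: "AE x in P. RN_deriv P Q' x = ennreal (f x)" and f0: "\<And>x. 0 \<le> f x"
    by (rule P.real_RN_deriv[OF Q'.finite_measure_axioms ac sQ]) auto
  have f [measurable]: "f \<in> borel_measurable N" using fm by simp
  have Qf: "Q' = density P (\<lambda>x. ennreal (f x))"
  proof -
    have "Q' = density P (RN_deriv P Q')" using P.density_RN_deriv[OF ac sQ] by simp
    also have "\<dots> = density P (\<lambda>x. ennreal (f x))" using fm fR by (intro density_cong) auto
    finally show ?thesis .
  qed
  have n1: "(\<integral>\<^sup>+x. ennreal (f x) \<partial>P) = 1"
  proof -
    have "(\<integral>\<^sup>+x. ennreal (f x) \<partial>P) = emeasure (density P (\<lambda>x. ennreal (f x))) (space P)" by (subst emeasure_density) (auto intro!: nn_integral_cong)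
    then show ?thesis using Q'.emeasure_space_1 unfolding Qf[symmetric] by (simp add: sets_eq_imp_space_eq[OF sQ])
  qed
  have fi: "integrable P f" by (rule integrableI_nonneg) (use n1 f0 fm in auto)
  have f1: "(\<integral>x. f x \<partial>P) = 1" using n1 f0 fi by (simp add: nn_integral_eq_integral)
  have "AE x in Q'. entropy_density (exp 1) P Q' x = ln (f x)"
  proof -
    have "AE x in P. entropy_density (exp 1) P Q' x = ln (f x)" using fR by eventually_elim (simp add: entropy_density_def log_def f0)
    then show ?thesis using ac sQ by (intro absolutely_continuous_AE[OF _ ac]) auto
  qed
  then have "integrable Q' (\<lambda>x. ln (f x))"
    using ei by (subst integrable_cong_AE[symmetric, where f="entropy_density (exp 1) P Q'"]) (auto simp: sQ cong: measurable_cong_sets)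
  then have "integrable (density P (\<lambda>x. ennreal (f x))) (\<lambda>x. ln (f x))" unfolding Qf[symmetric] .
  then have fl: "integrable P (\<lambda>x. f x * ln (f x))" by (subst (asm) integrable_real_density) (use f0 in auto)
  have KL: "KL_divergence (exp 1) P Q' = (\<integral>x. f x * ln (f x) \<partial>P)"
    unfolding Qf using f0 by (subst P.KL_density) (auto simp: log_def)
  show pos: "0 \<le> KL_divergence (exp 1) P Q'"
    unfolding Qf by (rule KL_nonneg) (use f0 fl Q'.prob_space_axioms in \<open>auto simp: Qf log_def\<close>)
  let ?B = "2 * \<kappa> * KL_divergence (exp 1) P Q'"
  have B0: "0 \<le> ?B" using pos kappa_nonneg by simp
  have le: "wasserstein 2 E P Q' \<le> ennreal (sqrt (?B + 1 / real (Suc n)))" for n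
  proof -
    have "0 < 1 / real (Suc n)" by simp
    from transport_entropy_density[OF f f0 fi f1 fl this] obtain \<pi> where \<pi>: "\<pi> \<in> couplings P Q'"
      and c: "(\<integral>\<^sup>+z. ennreal ((mdist E (fst z) (snd z))\<^sup>2) \<partial>\<pi>) \<le> ennreal ?B + ennreal (1 / real (Suc n))"
      unfolding Qf[symmetric] KL[symmetric] by blast
    let ?c = "\<integral>\<^sup>+(x, y). ennreal (mdist E x y powr 2) \<partial>\<pi>"
    have "?c = (\<integral>\<^sup>+z. ennreal ((mdist E (fst z) (snd z))\<^sup>2) \<partial>\<pi>)"
      by (intro nn_integral_cong) (auto simp: case_prod_beta' powr_numeral)
    then have cle: "?c \<le> ennreal (?B + 1 / real (Suc n))" using c B0 by simp
    then have "?c < \<infinity>" by (rule order.strict_trans1) simp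
    moreover have "enn2real ?c \<le> ?B + 1 / real (Suc n)" using cle B0 by (intro enn2real_leI) auto
    ultimately have "ennreal_powr ?c (1 / 2) \<le> ennreal (sqrt (?B + 1 / real (Suc n)))"
      by (auto simp: ennreal_powr_def powr_half_sqrt intro!: ennreal_leI)
    then show ?thesis unfolding wasserstein_def using \<pi> by (intro INF_lower2) auto
  qed
  have "(\<lambda>n. ennreal (sqrt (?B + 1 / real (Suc n)))) \<longlonglongrightarrow> ennreal (sqrt (?B + 0))"
    by (intro tendsto_ennrealI tendsto_real_sqrt tendsto_add tendsto_const lim_1_over_n[THEN LIMSEQ_Suc])
  then show "wasserstein 2 E P Q' \<le> ennreal (sqrt ?B)" using le by (intro LIMSEQ_le_const[of _ _ "wasserstein 2 E P Q'"]) auto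
qed

end

theorem theorem2p1:
  fixes M :: "'w measure"
    and W u :: "real \<Rightarrow> real \<Rightarrow> 'w \<Rightarrow> real"
    and D T L\<^sub>g :: real
    and u\<^sub>0 a b :: "real \<Rightarrow> real"
    and g G :: "real \<Rightarrow> real \<Rightarrow> real \<Rightarrow> real"
    and bc :: boundary_condition
  assumes "prob_space M"
    and "D > 0" and "T > 0"
    and "brownian_sheet M T D W"
    and "sets M = sheet_filtration M T D W T"
    and "essentially_bounded_on {0..D} u\<^sub>0"
    and "C_infinity_on {0..D} a" and "C_infinity_on {0..D} b"
    and "\<exists>c C. 0 < c \<and> (\<forall>x\<in>{0..D}. c \<le> \<bar>a x\<bar> \<and> \<bar>a x\<bar> \<le> C)"
    and "(\<lambda>(t, x, v). g t x v) \<in> borel_measurable (restrict_space borel ({0..T} \<times> {0..D} \<times> UNIV))"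
    and "L\<^sub>g > 0"
    and "\<And>t x v w. t \<in> {0..T} \<Longrightarrow> x \<in> {0..D} \<Longrightarrow> \<bar>g t x v - g t x w\<bar> \<le> L\<^sub>g * \<bar>v - w\<bar>"
    and "heat_kernel bc D a b G"
    and "kernel_energy T D G < \<infinity>"
    and "mild_solution M T D W G u\<^sub>0 g u"
    and "moments_bounded M T D u"
    and "continuous_trajectories M T D u"
  shows "path_law M T D u \<in>
    transport_ineq 2 (path_space T D) (2 * enn2real (kernel_energy T D G) * exp (2 * L\<^sub>g\<^sup>2 * T\<^sup>2))"
proof -
  interpret prob_space M by fact
  interpret spde M T D W bc a b G u\<^sub>0 g L\<^sub>g u
    by unfold_locales (use assms in auto)
  let ?e = "enn2real (kernel_energy T D G)"
  let ?C = "2 * ?e * exp (2 * L\<^sub>g\<^sup>2 * T\<^sup>2)"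
  have e: "0 < ?e" using Ke.He.G_energy_pos[OF \<open>T > 0\<close>] assms(14) by (simp add: enn2real_positive_iff)
  have kC: "\<kappa> \<le> ?C"
  proof -
    \<comment> \<open>Completing the square at 1/2. The constant 1/2 that is left over contributes
      the factor exp (1/2), which is at most 2.\<close>
    have "2 * (L\<^sub>g * T) \<le> 2 * (L\<^sub>g * T)\<^sup>2 + 1 / 2" using zero_le_power2[of "L\<^sub>g * T - 1 / 2"] unfolding power2_diff by (simp add: power2_eq_square)
    then have "2 * L\<^sub>g * T \<le> 1 / 2 + 2 * L\<^sub>g\<^sup>2 * T\<^sup>2" by (simp add: power_mult_distrib)
    then have "exp (2 * L\<^sub>g * T) \<le> exp (1 / 2) * exp (2 * L\<^sub>g\<^sup>2 * T\<^sup>2)" unfolding exp_add[symmetric] by simp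
    also have "\<dots> \<le> 2 * exp (2 * L\<^sub>g\<^sup>2 * T\<^sup>2)"
    proof (rule mult_right_mono)
      have "exp (1 / 2 :: real) \<le> 1 + 1 / 2 + (1 / 2)\<^sup>2" by (rule exp_bound) auto
      then show "exp (1 / 2 :: real) \<le> 2" by (simp add: power2_eq_square)
    qed simp
    finally show ?thesis using e by (simp add: \<kappa>_def mult_ac)
  qed
  show ?thesis unfolding transport_ineq_def path_law_eq P_def[symmetric]
  proof (intro CollectI conjI allI impI)
    show "borel_prob E P" using prob_P by (simp add: borel_prob_def)
    fix Q' assume Q': "borel_prob E Q'"
    let ?K = "KL_divergence (exp 1) P Q'"
    show "wasserstein 2 E P Q' \<le> ennreal_powr (ennreal (2 * ?C) * rel_entropy Q' P) (1 / 2)"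
    proof (cases "absolutely_continuous P Q' \<and> integrable Q' (entropy_density (exp 1) P Q')")
      case True
      note tr = transport_entropy[OF Q' conjunct1[OF True] conjunct2[OF True]]
      have "ennreal (2 * ?C) * rel_entropy Q' P = ennreal (2 * ?C * ?K)" using True e tr(1) by (simp add: rel_entropy_def ennreal_mult)
      then have "ennreal_powr (ennreal (2 * ?C) * rel_entropy Q' P) (1 / 2) = ennreal (sqrt (2 * ?C * ?K))"
        using e tr(1) by (simp add: ennreal_powr_def powr_half_sqrt)
      moreover have "sqrt (2 * \<kappa> * ?K) \<le> sqrt (2 * ?C * ?K)" using kC tr(1) by (intro real_sqrt_le_mono mult_right_mono) auto
      ultimately show ?thesis using order_trans[OF tr(2) ennreal_leI] by simp
    next
      case False
      then have "rel_entropy Q' P = \<infinity>" unfolding rel_entropy_def by (rule if_not_P)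
      \<comment> \<open>With infinite entropy the right-hand side is infinite because the constant
        is positive.\<close>
      then have "ennreal (2 * ?C) * rel_entropy Q' P = \<infinity>" using e by (simp add: ennreal_mult_top)
      then show ?thesis by (simp add: ennreal_powr_def)
    qed
  qed
qed
end
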